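(* Let $n\ge 2$, $0<s<1$, let $2<q<2^*_s:=\frac{2n}{n-2s}$ and let $b$ be defined by $\frac nq-b=\frac n2-s$. There exists $\lambda_0>0$ such that for every $\lambda>\lambda_0$ symmetry breaking occurs, that is, no extremal for $$S^\lambda_q=\inf_{u\in\mathcal D^s(\mathbb R^n),\ u\ne0}J_\lambda(u)$$ is radially symmetric about the origin.
   Context: All functions are real-valued. The operator $(-\Delta)^{s/2}$ is defined by $\mathcal F[(-\Delta)^{s/2}u]=|\xi|^{s}\mathcal F[u]$, with $\mathcal F$ the unitary Fourier transform, so that $\|(-\Delta)^{s/2}u\|_2^2=\int_{\mathbb R^n}|\xi|^{2s}|\mathcal F[u]|^2d\xi$. The space is $\mathcal D^s(\mathbb R^n)=\{u\in L^{2^*_s}(\mathbb R^n): (-\Delta)^{s/2}u\in L^2(\mathbb R^n)\}$. The functional is $$J_\lambda(u)=\frac{\|(-\Delta)^{s/2}u\|_2^2+\lambda\,\||x|^{-s}u\|_2^2}{\||x|^{-b}u\|_q^2}.$$ An extremal for $S^\lambda_q$ is a function $u\in\mathcal D^s(\mathbb R^n)\setminus\{0\}$ with $J_\lambda(u)=S^\lambda_q$. *)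

theory Defs
  imports "HOL-Analysis.Analysis"
begin

text \<open>Functions are considered up to equality almost everywhere for Lebesgue measure.\<close>

definition Lp :: "real \<Rightarrow> (real^'n \<Rightarrow> real) set" where
  "Lp p = {f \<in> borel_measurable lebesgue. integrable lebesgue (\<lambda>x. \<bar>f x\<bar> powr p)}"

definition Lp_norm :: "real \<Rightarrow> (real^'n \<Rightarrow> real) \<Rightarrow> real" where
  "Lp_norm p f = (\<integral>x. \<bar>f x\<bar> powr p \<partial>lebesgue) powr (1 / p)"

definition partial_deriv :: "'n \<Rightarrow> (real^'n \<Rightarrow> complex) \<Rightarrow> real^'n \<Rightarrow> complex" where
  "partial_deriv i f x = frechet_derivative f (at x) (axis i 1)"

text \<open>The list \<open>idx\<close> plays the role of a multi-index; the function \<open>foldr partial_deriv idx f\<close> is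
  the corresponding iterated partial derivative.\<close>

definition schwartz :: "(real^'n \<Rightarrow> complex) \<Rightarrow> bool" where
  "schwartz f \<longleftrightarrow> (\<forall>idx.
     (\<forall>x. foldr partial_deriv idx f differentiable (at x)) \<and>
     (\<forall>k::nat. bounded (range (\<lambda>x. norm x ^ k *\<^sub>R foldr partial_deriv idx f x))))"

definition fourier :: "(real^'n \<Rightarrow> complex) \<Rightarrow> real^'n \<Rightarrow> complex" where
  "fourier f \<xi> =
     of_real ((2 * pi) powr (- (real CARD('n) / 2))) * (\<integral>x. cis (- (x \<bullet> \<xi>)) * f x \<partial>lebesgue)"

text \<open>An element of \<open>Lp p\<close> with \<open>p > 2\<close> has a Fourier transform only as a tempered
  distribution. The following says that this distribution is given by the function \<open>v\<close>.\<close>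

definition has_fourier :: "(real^'n \<Rightarrow> complex) \<Rightarrow> (real^'n \<Rightarrow> complex) \<Rightarrow> bool" where
  "has_fourier f v \<longleftrightarrow>
     f \<in> borel_measurable lebesgue \<and> v \<in> borel_measurable lebesgue \<and>
     (\<forall>\<phi>. schwartz \<phi> \<longrightarrow>
        integrable lebesgue (\<lambda>x. f x * fourier \<phi> x) \<and>
        integrable lebesgue (\<lambda>\<xi>. v \<xi> * \<phi> \<xi>) \<and>
        (\<integral>x. f x * fourier \<phi> x \<partial>lebesgue) = (\<integral>\<xi>. v \<xi> * \<phi> \<xi> \<partial>lebesgue))"

text \<open>The equation \<open>g = (-\<Delta>)\<^bsup>s/2\<^esup> u\<close>, that is, \<open>\<F>[g] = |\<xi>|\<^bsup>s\<^esup> \<F>[u]\<close>. It determines \<open>g\<close> almost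
  everywhere. Asking for \<open>\<F>[u]\<close> to be a function gives a meaning to its product with the
  non-smooth function \<open>|\<xi>|\<^bsup>s\<^esup>\<close>; for \<open>u\<close> in \<open>Ds s\<close> below this costs nothing, since \<open>\<F>[u]\<close> is then
  the locally integrable function \<open>|\<xi>|\<^bsup>-s\<^esup> \<F>[g]\<close> with \<open>\<F>[g]\<close> in \<open>L\<^sup>2\<close>, because \<open>2s < n\<close>.\<close>

definition has_frac_laplacian :: "real \<Rightarrow> (real^'n \<Rightarrow> real) \<Rightarrow> (real^'n \<Rightarrow> real) \<Rightarrow> bool" where
  "has_frac_laplacian s u g \<longleftrightarrow>
     (\<exists>v. has_fourier (\<lambda>x. complex_of_real (u x)) v \<and>
          has_fourier (\<lambda>x. complex_of_real (g x)) (\<lambda>\<xi>. of_real (norm \<xi> powr s) * v \<xi>))"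

definition frac_laplacian :: "real \<Rightarrow> (real^'n \<Rightarrow> real) \<Rightarrow> real^'n \<Rightarrow> real" where
  "frac_laplacian s u = (SOME g. has_frac_laplacian s u g)"

definition Ds :: "real \<Rightarrow> (real^'n \<Rightarrow> real) set" where
  "Ds s = {u \<in> Lp (2 * real CARD('n) / (real CARD('n) - 2 * s)).
             \<exists>g \<in> Lp 2. has_frac_laplacian s u g}"

definition nonzero_ae :: "(real^'n \<Rightarrow> real) \<Rightarrow> bool" where
  "nonzero_ae u \<longleftrightarrow> \<not> (AE x in lebesgue. u x = 0)"

text \<open>All three norms are finite on \<open>Ds s\<close> in the range of parameters considered, by the
  fractional Hardy and Sobolev inequalities and interpolation.\<close>

definition J :: "real \<Rightarrow> real \<Rightarrow> real \<Rightarrow> real \<Rightarrow> (real^'n \<Rightarrow> real) \<Rightarrow> real" where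
  "J s b q lam u =
     ((Lp_norm 2 (frac_laplacian s u))\<^sup>2 + lam * (Lp_norm 2 (\<lambda>x. norm x powr (- s) * u x))\<^sup>2)
     / (Lp_norm q (\<lambda>x. norm x powr (- b) * u x))\<^sup>2"

definition best_const :: "'n::finite itself \<Rightarrow> real \<Rightarrow> real \<Rightarrow> real \<Rightarrow> real \<Rightarrow> real" where
  "best_const _ s b q lam = (INF u \<in> {u :: real^'n \<Rightarrow> real. u \<in> Ds s \<and> nonzero_ae u}. J s b q lam u)"

definition extremal :: "real \<Rightarrow> real \<Rightarrow> real \<Rightarrow> real \<Rightarrow> (real^'n \<Rightarrow> real) \<Rightarrow> bool" where
  "extremal s b q lam u \<longleftrightarrow>
     u \<in> Ds s \<and> nonzero_ae u \<and> J s b q lam u = best_const TYPE('n) s b q lam"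

definition radial :: "(real^'n \<Rightarrow> real) \<Rightarrow> bool" where
  "radial u \<longleftrightarrow> (\<exists>f :: real \<Rightarrow> real. AE x in lebesgue. u x = f (norm x))"

end

theory Submission
  imports Defs "HOL-Probability.Probability"
begin

text \<open>Write \<open>a = \<parallel>(-\<Delta>)\<^bsup>s/2\<^esup> u\<parallel>\<^sub>2\<close> and \<open>d = \<parallel>|x|\<^bsup>-s\<^esup> u\<parallel>\<^sub>2\<close>. A Gaussian of width \<open>\<lambda>\<^bsup>-1/(2s)\<^esup>\<close> centred
  at a unit vector shows that \<open>S\<^sub>\<lambda>\<close> is at most a multiple of \<open>\<lambda>\<^bsup>1 - (n/s)(1/2 - 1/q)\<^esup>\<close>. Radial functions
  cannot concentrate at a point and satisfy a better inequality. Indeed \<open>|u|\<close> is bounded by the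
  Riesz potential of \<open>g = |(-\<Delta>)\<^bsup>s/2\<^esup> u|\<close>; splitting its kernel at distance \<open>\<delta>|y|\<close> from \<open>y\<close> and
  averaging over rotations in a coordinate plane, which leaves \<open>u\<close> unchanged but smears out the
  singularity of the kernel in one direction, gives
  \<open>|y|\<^bsup>n/2-s\<^esup> |u(y)| \<le> B\<^sub>\<delta>(y) + C a \<delta>\<^bsup>-(n-1-s)/2\<^esup>\<close> with \<open>B\<^sub>\<delta>\<close> of size \<open>C a \<delta>\<^sup>s\<close> in
  \<open>L\<^sup>2(|y|\<^bsup>-n\<^esup> dy)\<close>. This is a weak-type bound with exponent \<open>r = 2 + 4s/(n-1-s)\<close>, and \<open>r\<close> exceeds the
  Sobolev exponent because \<open>s < 1\<close>. Interpolation with \<open>d\<close> yields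
  \<open>J\<^sub>\<lambda>(u) \<ge> c \<lambda>\<^bsup>1 - ((n-1+s)/s)(1/2 - 1/q)\<^esup>\<close> for radial \<open>u\<close>, which is the larger power of \<open>\<lambda>\<close>.

  The Plancherel theorem is avoided: testing with Gaussians turns the Fourier identities into identities
  between heat averages, and the powers of \<open>|\<xi>|\<close> are written as integrals of \<open>exp (-\<tau>|\<xi>|\<^sup>2)\<close>.\<close>

section \<open>Power integrals by dyadic decomposition\<close>

text \<open>Why averaging helps: beyond distance \<delta>|y| the Riesz kernel alone is controlled by
  Cauchy-Schwarz with the factor \<delta>^(-(n-2s)/2), and balancing this against \<delta>^s
  reproduces exactly the Sobolev exponent 2 + 4s/(n-2s). Averaging over an arc lowers the pointwise
  size of the kernel from \<delta>^(s-n) to \<delta>^(s+1-n), while its integral stays bounded in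
  \<delta>; the geometric mean of the two controls the L^2 norm and replaces n-2s by n-1-s. The
  motion along the arc must be quantitatively fast, hence the plane always contains the coordinate
  direction in which y is largest. The conventions shape the rest. \<open>Lp_norm\<close> is 0 for a
  divergent integral and division by 0 gives 0, so a lower bound for \<open>J\<close> requires
  finiteness and positivity of the norms involved, while a divergent denominator is harmless in an
  upper bound. The potentials of the positive and negative part of (-\<Delta>)^(s/2) u may be
  infinite, so the representation of u is an identity between sums in \<open>ennreal\<close>. For
  the Gaussian, the L^2 norm of its fractional Laplacian comes from a sup bound times an L^1
  bound.\<close>

lemma ex_dyadic_below:
  fixes h r :: real
  assumes "0 < h" "h < r"
  shows "\<exists>k::nat. r * (1/2) ^ Suc k \<le> h \<and> h < r * (1/2) ^ k"
proof -
  have "\<exists>k::nat. r * (1/2) ^ Suc k \<le> h"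
  proof -
    obtain k where "(1/2::real) ^ k < h / r"
      using real_arch_pow_inv[of "h / r" "1/2"] assms by auto
    moreover have "(1/2::real) ^ Suc k \<le> (1/2) ^ k" by simp
    ultimately show ?thesis using assms by (intro exI[of _ k]) (simp add: field_simps)
  qed
  then obtain k where k: "r * (1/2) ^ Suc k \<le> h" "\<And>j. j < k \<Longrightarrow> \<not> r * (1/2) ^ Suc j \<le> h"
    using exists_least_iff[of "\<lambda>k. r * (1/2) ^ Suc k \<le> h"] by auto
  have "h < r * (1/2) ^ k"
    using k(2)[of "k - 1"] assms by (cases k) auto
  with k(1) show ?thesis by blast
qed

lemma ex_dyadic_above:
  fixes h r :: real
  assumes "0 < r" "r \<le> h"
  shows "\<exists>k::nat. r * 2 ^ k \<le> h \<and> h < r * 2 ^ Suc k"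
proof -
  have "\<exists>k::nat. h < r * 2 ^ Suc k"
  proof -
    obtain k where "h / r < (2::real) ^ k"
      using real_arch_pow[of 2 "h / r"] by auto
    moreover have "(2::real) ^ k \<le> 2 ^ Suc k" by simp
    ultimately show ?thesis using assms by (intro exI[of _ k]) (simp add: field_simps)
  qed
  then obtain k where k: "h < r * 2 ^ Suc k" "\<And>j. j < k \<Longrightarrow> \<not> h < r * 2 ^ Suc j"
    using exists_least_iff[of "\<lambda>k. h < r * 2 ^ Suc k"] by auto
  have "r * 2 ^ k \<le> h"
    using k(2)[of "k - 1"] assms by (cases k) auto
  with k(1) show ?thesis by blast
qed

text \<open>A substitute for polar coordinates: every value of \<open>f\<close> is dominated by one
  term of the series, and each term sees only the measure of a sublevel set of \<open>h\<close>.
  Keeping \<open>h\<close> abstract allows both the norm on R^n, with m = n, and the distance of a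
  rotated point from a target as a function of the angle, with m = 1.\<close>

lemma nn_integral_le_suminf_sublevels:
  fixes h f :: "'b \<Rightarrow> real" and c R :: "nat \<Rightarrow> real"
  assumes [measurable]: "h \<in> borel_measurable M"
    and meas: "\<And>\<rho>. \<rho> > 0 \<Longrightarrow> emeasure M {x \<in> space M. h x < \<rho>} \<le> ennreal (A * \<rho> powr m)"
    and c: "\<And>k. 0 \<le> c k" and R: "\<And>k. 0 < R k" and "0 \<le> A"
    and f: "\<And>x. x \<in> space M \<Longrightarrow> f x = 0 \<or> (\<exists>k. f x \<le> c k \<and> h x < R k)"
    and sums: "(\<lambda>k. c k * (A * R k powr m)) sums S"
  shows "(\<integral>\<^sup>+x. ennreal (f x) \<partial>M) \<le> ennreal S"
proof -
  have "(\<integral>\<^sup>+x. ennreal (f x) \<partial>M)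
      \<le> (\<integral>\<^sup>+x. (\<Sum>k. ennreal (c k) * indicator {x \<in> space M. h x < R k} x) \<partial>M)"
  proof (rule nn_integral_mono)
    fix x assume x: "x \<in> space M"
    show "ennreal (f x) \<le> (\<Sum>k. ennreal (c k) * indicator {x \<in> space M. h x < R k} x)"
    proof (cases "f x = 0")
      case False
      then obtain k where k: "f x \<le> c k" "h x < R k" using f[OF x] by blast
      define F where "F k = ennreal (c k) * indicator {x \<in> space M. h x < R k} x" for k
      have "ennreal (f x) \<le> F k"
        using k x by (simp add: ennreal_leI F_def)
      also have "\<dots> = sum F {k}" by simp
      also have "\<dots> \<le> suminf F"
        by (rule sum_le_suminf) auto
      finally show ?thesis unfolding F_def[abs_def] .
    qed simp
  qed
  also have "\<dots> = (\<Sum>k. ennreal (c k) * emeasure M {x \<in> space M. h x < R k})"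
    by (simp add: nn_integral_suminf nn_integral_cmult)
  also have "\<dots> \<le> (\<Sum>k. ennreal (c k * (A * R k powr m)))"
    using meas[OF R] c by (intro suminf_le) (auto simp: ennreal_mult' intro!: mult_left_mono)
  also have "\<dots> = ennreal S"
    using sums c \<open>0 \<le> A\<close> by (intro suminf_ennreal_eq) auto
  finally show ?thesis .
qed

text \<open>On the shell r/2^(k+1) <= h < r/2^k the integrand is at most (r/2^(k+1))^(-\<alpha>), so
  the shells form a geometric series with ratio 2^(\<alpha>-m) < 1. The zero set of \<open>h\<close>
  contributes nothing, because \<open>0 powr a = 0\<close>.\<close>

lemma nn_integral_powr_sublevel:
  fixes h :: "'b \<Rightarrow> real"
  assumes [measurable]: "h \<in> borel_measurable M" and h: "\<And>x. x \<in> space M \<Longrightarrow> 0 \<le> h x"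
    and meas: "\<And>\<rho>. \<rho> > 0 \<Longrightarrow> emeasure M {x \<in> space M. h x < \<rho>} \<le> ennreal (A * \<rho> powr m)"
    and "0 \<le> A" "0 \<le> \<alpha>" "\<alpha> < m" "0 < r"
  shows "(\<integral>\<^sup>+x. ennreal (h x powr (- \<alpha>) * indicator {..<r} (h x)) \<partial>M)
      \<le> ennreal (2 powr \<alpha> / (1 - 2 powr (\<alpha> - m)) * A * r powr (m - \<alpha>))"
proof (rule nn_integral_le_suminf_sublevels[where h = h and A = A and m = m
      and c = "\<lambda>k. (r * (1/2) ^ Suc k) powr (- \<alpha>)" and R = "\<lambda>k. r * (1/2) ^ k"])
  fix x assume x: "x \<in> space M"
  show "h x powr (- \<alpha>) * indicator {..<r} (h x) = 0
    \<or> (\<exists>k. h x powr (- \<alpha>) * indicator {..<r} (h x) \<le> (r * (1/2) ^ Suc k) powr (- \<alpha>) \<and> h x < r * (1/2) ^ k)"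
  proof (cases "0 < h x \<and> h x < r")
    case True
    then obtain k where k: "r * (1/2) ^ Suc k \<le> h x" "h x < r * (1/2) ^ k"
      using ex_dyadic_below[of "h x" r] by blast
    have "h x powr (- \<alpha>) \<le> (r * (1/2) ^ Suc k) powr (- \<alpha>)"
      using k assms True by (intro powr_mono2') auto
    then show ?thesis using k True by auto
  next
    case False
    then show ?thesis using h[OF x] by (auto simp: indicator_def)
  qed
next
  let ?x = "2 powr (\<alpha> - m) :: real"
  have lt1: "?x < 1" using assms by (simp add: powr_less_one)
  have "(\<lambda>k. (2 powr \<alpha> * A * r powr (m - \<alpha>)) * ?x ^ k) sums ((2 powr \<alpha> * A * r powr (m - \<alpha>)) * (1 / (1 -
      ?x)))"
    by (intro sums_mult geometric_sums) (use lt1 in auto)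
  moreover have te: "(r * (1/2) ^ Suc k) powr (- \<alpha>) * (A * (r * (1/2) ^ k) powr m)
     = (2 powr \<alpha> * A * r powr (m - \<alpha>)) * ?x ^ k" for k
  proof -
    have e: "r * (1/2) ^ Suc k = r * 2 powr (- real k - 1)" "r * (1/2) ^ k = r * 2 powr (- real k)"
      by (simp_all add: powr_minus powr_diff powr_realpow field_simps power_one_over)
    have "?x ^ k = 2 powr ((\<alpha> - m) * real k)" by (simp add: powr_powr flip: powr_realpow)
    then show ?thesis unfolding e using \<open>0 < r\<close>
      by (simp add: powr_mult powr_powr algebra_simps flip: powr_add)
  qed
  ultimately show "(\<lambda>k. (r * (1/2) ^ Suc k) powr (- \<alpha>) * (A * (r * (1/2) ^ k) powr m)) sums
      (2 powr \<alpha> / (1 - 2 powr (\<alpha> - m)) * A * r powr (m - \<alpha>))"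
    unfolding te by (simp add: mult_ac)
qed (use assms in auto)

text \<open>The shells now grow outwards from r, and the ratio becomes 2^(m-\<alpha>), which is
  below 1 for the opposite order of \<alpha> and m.\<close>

lemma nn_integral_powr_superlevel:
  fixes h :: "'b \<Rightarrow> real"
  assumes [measurable]: "h \<in> borel_measurable M"
    and meas: "\<And>\<rho>. \<rho> > 0 \<Longrightarrow> emeasure M {x \<in> space M. h x < \<rho>} \<le> ennreal (A * \<rho> powr m)"
    and "0 \<le> A" "0 \<le> m" "m < \<alpha>" "0 < r"
  shows "(\<integral>\<^sup>+x. ennreal (h x powr (- \<alpha>) * indicator {r..} (h x)) \<partial>M)
      \<le> ennreal (2 powr m / (1 - 2 powr (m - \<alpha>)) * A * r powr (m - \<alpha>))"
proof (rule nn_integral_le_suminf_sublevels[where h = h and A = A and m = m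
      and c = "\<lambda>k. (r * 2 ^ k) powr (- \<alpha>)" and R = "\<lambda>k. r * 2 ^ Suc k"])
  fix x assume x: "x \<in> space M"
  show "h x powr (- \<alpha>) * indicator {r..} (h x) = 0
    \<or> (\<exists>k. h x powr (- \<alpha>) * indicator {r..} (h x) \<le> (r * 2 ^ k) powr (- \<alpha>) \<and> h x < r * 2 ^ Suc k)"
  proof (cases "r \<le> h x")
    case True
    then obtain k where k: "r * 2 ^ k \<le> h x" "h x < r * 2 ^ Suc k"
      using ex_dyadic_above[of r "h x"] assms by blast
    have "h x powr (- \<alpha>) \<le> (r * 2 ^ k) powr (- \<alpha>)"
      using k assms True by (intro powr_mono2') auto
    then show ?thesis using k True by auto
  qed auto
next
  let ?x = "2 powr (m - \<alpha>) :: real"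
  have lt1: "?x < 1" using assms by (simp add: powr_less_one)
  have "(\<lambda>k. (2 powr m * A * r powr (m - \<alpha>)) * ?x ^ k) sums ((2 powr m * A * r powr (m - \<alpha>)) * (1 / (1 -
      ?x)))"
    by (intro sums_mult geometric_sums) (use lt1 in auto)
  moreover have te: "(r * 2 ^ k) powr (- \<alpha>) * (A * (r * 2 ^ Suc k) powr m)
     = (2 powr m * A * r powr (m - \<alpha>)) * ?x ^ k" for k
  proof -
    have e: "r * 2 ^ Suc k = r * 2 powr (real k + 1)" "r * 2 ^ k = r * 2 powr (real k)"
      by (simp_all add: powr_add powr_realpow field_simps)
    have "?x ^ k = 2 powr ((m - \<alpha>) * real k)" by (simp add: powr_powr flip: powr_realpow)
    then show ?thesis unfolding e using \<open>0 < r\<close>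
      by (simp add: powr_mult powr_powr algebra_simps flip: powr_add)
  qed
  ultimately show "(\<lambda>k. (r * 2 ^ k) powr (- \<alpha>) * (A * (r * 2 ^ Suc k) powr m)) sums
      (2 powr m / (1 - 2 powr (m - \<alpha>)) * A * r powr (m - \<alpha>))"
    unfolding te by (simp add: mult_ac)
qed (use assms in auto)

section \<open>Power weights on Euclidean space\<close>

lemma nn_integral_lborel_translate:
  fixes f :: "'a::euclidean_space \<Rightarrow> ennreal"
  assumes [measurable]: "f \<in> borel_measurable borel"
  shows "(\<integral>\<^sup>+x. f (x - a) \<partial>lborel) = (\<integral>\<^sup>+x. f x \<partial>lborel)"
    and "(\<integral>\<^sup>+x. f (a - x) \<partial>lborel) = (\<integral>\<^sup>+x. f x \<partial>lborel)"
proof -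
  have "(\<integral>\<^sup>+x. f x \<partial>lborel) = (\<integral>\<^sup>+x. f x \<partial>distr lborel borel ((+) (-a)))"
    by (simp add: lborel_distr_plus)
  then show "(\<integral>\<^sup>+x. f (x - a) \<partial>lborel) = (\<integral>\<^sup>+x. f x \<partial>lborel)"
    by (simp add: nn_integral_distr)
  have "lborel = distr lborel borel (\<lambda>x. a - x)"
    using lborel_affine[of "-1" a] by (simp add: density_1)
  then have "(\<integral>\<^sup>+x. f x \<partial>lborel) = (\<integral>\<^sup>+x. f x \<partial>distr lborel borel (\<lambda>x. a - x))"
    by simp
  then show "(\<integral>\<^sup>+x. f (a - x) \<partial>lborel) = (\<integral>\<^sup>+x. f x \<partial>lborel)"
    by (simp add: nn_integral_distr)
qed

lemma emeasure_norm_less: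
  assumes "\<rho> > 0"
  shows "emeasure lborel {x \<in> space lborel. norm (x::'a::euclidean_space) < \<rho>}
    \<le> ennreal (unit_ball_vol (real DIM('a)) * \<rho> powr real DIM('a))"
proof -
  have "{x \<in> space lborel. norm (x::'a) < \<rho>} = ball 0 \<rho>" by auto
  then show ?thesis using assms by (simp add: emeasure_ball powr_realpow)
qed

lemma nn_integral_norm_powr_ball:
  assumes "0 \<le> \<alpha>" "\<alpha> < real DIM('a::euclidean_space)"
  shows "\<exists>C>0. \<forall>r>0. (\<integral>\<^sup>+x. ennreal (norm (x::'a) powr (- \<alpha>) * indicator {..<r} (norm x)) \<partial>lborel)
    \<le> ennreal (C * r powr (real DIM('a) - \<alpha>))"
proof (intro exI conjI allI impI)
  let ?n = "real DIM('a)" let ?C = "2 powr \<alpha> / (1 - 2 powr (\<alpha> - ?n)) * unit_ball_vol ?n"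
  show "?C > 0" using assms by (auto intro!: divide_pos_pos mult_pos_pos simp: powr_less_one)
  show "(\<integral>\<^sup>+x. ennreal (norm (x::'a) powr (- \<alpha>) * indicator {..<r} (norm x)) \<partial>lborel)
    \<le> ennreal (?C * r powr (?n - \<alpha>))" if "r > 0" for r
    using nn_integral_powr_sublevel[OF _ _ emeasure_norm_less, where \<alpha> = \<alpha> and r = r] assms that
    by simp
qed

lemma nn_integral_norm_powr_outside:
  assumes "real DIM('a::euclidean_space) < \<alpha>"
  shows "\<exists>C>0. \<forall>r>0. (\<integral>\<^sup>+x. ennreal (norm (x::'a) powr (- \<alpha>) * indicator {r..} (norm x)) \<partial>lborel)
    \<le> ennreal (C * r powr (real DIM('a) - \<alpha>))"
proof (intro exI conjI allI impI)
  let ?n = "real DIM('a)" let ?C = "2 powr ?n / (1 - 2 powr (?n - \<alpha>)) * unit_ball_vol ?n"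
  show "?C > 0" using assms by (auto intro!: divide_pos_pos mult_pos_pos simp: powr_less_one)
  show "(\<integral>\<^sup>+x. ennreal (norm (x::'a) powr (- \<alpha>) * indicator {r..} (norm x)) \<partial>lborel)
    \<le> ennreal (?C * r powr (?n - \<alpha>))" if "r > 0" for r
    using nn_integral_powr_superlevel[OF _ emeasure_norm_less, where \<alpha> = \<alpha> and r = r] assms that
    by simp
qed

section \<open>Schur's test and the weighted bound for Riesz potentials\<close>

lemma AE_lborel_neq: "AE z in lborel. z \<noteq> (a::'a::euclidean_space)"
  by (rule AE_I[where N = "{a}"]) auto

text \<open>Cauchy-Schwarz is applied to K|g| = sqrt(K P) * sqrt(K Q)|g|. The first square
  integrates to at most \<open>A\<close>; after Tonelli the second hypothesis returns
  \<open>B * P z\<close>, and \<open>P\<close> cancels against \<open>Q\<close>. The reciprocal is a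
  separate function because for powers of the norm P Q = 1 fails at the origin.\<close>

lemma schur_test:
  fixes K :: "'a::euclidean_space \<Rightarrow> 'a \<Rightarrow> real" and g P Q A W :: "'a \<Rightarrow> real"
  assumes [measurable]: "case_prod K \<in> borel_measurable (lborel \<Otimes>\<^sub>M lborel)"
      "g \<in> borel_measurable borel" "P \<in> borel_measurable borel" "Q \<in> borel_measurable borel"
      "A \<in> borel_measurable borel" "W \<in> borel_measurable borel"
    and nn: "\<And>y z. 0 \<le> K y z" "\<And>z. 0 \<le> P z" "\<And>z. 0 \<le> Q z" "\<And>y. 0 \<le> A y" "\<And>y. 0 \<le> W y" "0 \<le> B"
    and PQ: "\<And>z. z \<noteq> 0 \<Longrightarrow> P z * Q z = 1"
    and 1: "\<And>y. y \<noteq> 0 \<Longrightarrow> (\<integral>\<^sup>+z. ennreal (K y z * P z) \<partial>lborel) \<le> ennreal (A y)"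
    and 2: "\<And>z. z \<noteq> 0 \<Longrightarrow> (\<integral>\<^sup>+y. ennreal (A y * W y * K y z) \<partial>lborel) \<le> ennreal (B * P z)"
  shows "(\<integral>\<^sup>+y. ennreal (W y) * (\<integral>\<^sup>+z. ennreal (K y z * \<bar>g z\<bar>) \<partial>lborel)\<^sup>2 \<partial>lborel)
    \<le> ennreal B * (\<integral>\<^sup>+z. ennreal ((g z)\<^sup>2) \<partial>lborel)"
proof -
  have inner: "(\<integral>\<^sup>+z. ennreal (K y z * \<bar>g z\<bar>) \<partial>lborel)\<^sup>2
      \<le> ennreal (A y) * (\<integral>\<^sup>+z. ennreal (K y z * Q z * (g z)\<^sup>2) \<partial>lborel)" if "y \<noteq> 0" for y
  proof -
    have "(\<integral>\<^sup>+z. ennreal (K y z * \<bar>g z\<bar>) \<partial>lborel)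
      = (\<integral>\<^sup>+z. ennreal (sqrt (K y z * P z)) * ennreal (sqrt (K y z * Q z) * \<bar>g z\<bar>) \<partial>lborel)"
    proof (intro nn_integral_cong_AE)
      show "AE z in lborel. ennreal (K y z * \<bar>g z\<bar>)
          = ennreal (sqrt (K y z * P z)) * ennreal (sqrt (K y z * Q z) * \<bar>g z\<bar>)"
        using AE_lborel_neq[of 0]
      proof eventually_elim
        case (elim z)
        have "sqrt (K y z * P z) * sqrt (K y z * Q z) = sqrt ((K y z)\<^sup>2 * (P z * Q z))"
          by (simp add: real_sqrt_mult[symmetric] power2_eq_square algebra_simps)
        also have "\<dots> = K y z" using PQ[OF elim] nn by simp
        finally show ?case using nn by (simp add: ennreal_mult[symmetric] mult.assoc[symmetric])
      qed
    qed
    also have "\<dots>\<^sup>2 \<le> (\<integral>\<^sup>+z. ennreal (sqrt (K y z * P z)) ^ 2 \<partial>lborel)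
        * (\<integral>\<^sup>+z. ennreal (sqrt (K y z * Q z) * \<bar>g z\<bar>) ^ 2 \<partial>lborel)"
      by (rule Cauchy_Schwarz_nn_integral) measurable
    also have "\<dots> = (\<integral>\<^sup>+z. ennreal (K y z * P z) \<partial>lborel) * (\<integral>\<^sup>+z. ennreal (K y z * Q z * (g z)\<^sup>2) \<partial>lborel)"
      using nn by (simp add: ennreal_power power_mult_distrib)
    also have "\<dots> \<le> ennreal (A y) * (\<integral>\<^sup>+z. ennreal (K y z * Q z * (g z)\<^sup>2) \<partial>lborel)"
      using 1[OF that] by (rule mult_right_mono) simp
    finally show ?thesis .
  qed
  have "(\<integral>\<^sup>+y. ennreal (W y) * (\<integral>\<^sup>+z. ennreal (K y z * \<bar>g z\<bar>) \<partial>lborel)\<^sup>2 \<partial>lborel)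
     \<le> (\<integral>\<^sup>+y. (\<integral>\<^sup>+z. ennreal (A y * W y * K y z) * ennreal (Q z * (g z)\<^sup>2) \<partial>lborel) \<partial>lborel)"
  proof (intro nn_integral_mono_AE)
    show "AE y in lborel. ennreal (W y) * (\<integral>\<^sup>+z. ennreal (K y z * \<bar>g z\<bar>) \<partial>lborel)\<^sup>2
        \<le> (\<integral>\<^sup>+z. ennreal (A y * W y * K y z) * ennreal (Q z * (g z)\<^sup>2) \<partial>lborel)"
      using AE_lborel_neq[of 0]
    proof eventually_elim
      case (elim y)
      have "ennreal (W y) * (\<integral>\<^sup>+z. ennreal (K y z * \<bar>g z\<bar>) \<partial>lborel)\<^sup>2
        \<le> ennreal (W y) * (ennreal (A y) * (\<integral>\<^sup>+z. ennreal (K y z * Q z * (g z)\<^sup>2) \<partial>lborel))"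
        using inner[OF elim] by (rule mult_left_mono) simp
      also have "\<dots> = (\<integral>\<^sup>+z. ennreal (W y * A y) * ennreal (K y z * Q z * (g z)\<^sup>2) \<partial>lborel)"
        using nn by (simp add: nn_integral_cmult ennreal_mult mult.assoc)
      also have "\<dots> = (\<integral>\<^sup>+z. ennreal (A y * W y * K y z) * ennreal (Q z * (g z)\<^sup>2) \<partial>lborel)"
        using nn by (intro nn_integral_cong) (simp add: ennreal_mult[symmetric] algebra_simps)
      finally show ?case .
    qed
  qed
  also have "\<dots> = (\<integral>\<^sup>+z. (\<integral>\<^sup>+y. ennreal (A y * W y * K y z) * ennreal (Q z * (g z)\<^sup>2) \<partial>lborel) \<partial>lborel)"
    by (rule lborel_pair.Fubini') measurable
  also have "\<dots> = (\<integral>\<^sup>+z. (\<integral>\<^sup>+y. ennreal (A y * W y * K y z) \<partial>lborel) * ennreal (Q z * (g z)\<^sup>2) \<partial>lborel)"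
    by (simp add: nn_integral_multc)
  also have "\<dots> \<le> (\<integral>\<^sup>+z. ennreal B * ennreal ((g z)\<^sup>2) \<partial>lborel)"
  proof (intro nn_integral_mono_AE)
    show "AE z in lborel. (\<integral>\<^sup>+y. ennreal (A y * W y * K y z) \<partial>lborel) * ennreal (Q z * (g z)\<^sup>2)
        \<le> ennreal B * ennreal ((g z)\<^sup>2)"
      using AE_lborel_neq[of 0]
    proof eventually_elim
      case (elim z)
      have "(\<integral>\<^sup>+y. ennreal (A y * W y * K y z) \<partial>lborel) * ennreal (Q z * (g z)\<^sup>2)
        \<le> ennreal (B * P z) * ennreal (Q z * (g z)\<^sup>2)"
        using 2[OF elim] by (rule mult_right_mono) simp
      also have "\<dots> = ennreal (B * (P z * Q z) * (g z)\<^sup>2)"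
        using nn by (simp add: ennreal_mult[symmetric] algebra_simps)
      finally show ?case using PQ[OF elim] nn by (simp add: ennreal_mult)
    qed
  qed
  also have "\<dots> = ennreal B * (\<integral>\<^sup>+z. ennreal ((g z)\<^sup>2) \<partial>lborel)"
    by (simp add: nn_integral_cmult)
  finally show ?thesis .
qed

lemma riesz_near:
  assumes "0 < s" "s \<le> real DIM('a::euclidean_space)"
  shows "\<exists>C>0. \<forall>r>0. \<forall>y::'a. (\<integral>\<^sup>+z. ennreal (norm (y - z) powr (s - real DIM('a)) * indicator {..<r} (norm (y
      - z))) \<partial>lborel)
    \<le> ennreal (C * r powr s)"
proof -
  obtain C where C: "C > 0" "\<And>r. r > 0 \<Longrightarrow>
      (\<integral>\<^sup>+x. ennreal (norm (x::'a) powr (s - real DIM('a)) * indicator {..<r} (norm x)) \<partial>lborel)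
          \<le> ennreal (C * r powr s)"
    using nn_integral_norm_powr_ball[where 'a = 'a, of "real DIM('a) - s"] assms by auto
  show ?thesis
  proof (intro exI conjI allI impI)
    fix r :: real and y :: 'a assume "r > 0"
    then show "(\<integral>\<^sup>+z. ennreal (norm (y - z) powr (s - real DIM('a)) * indicator {..<r} (norm (y - z)))
        \<partial>lborel)
      \<le> ennreal (C * r powr s)"
      using C(2)[of r] nn_integral_lborel_translate(2)[of "\<lambda>x. ennreal (norm x powr (s - real DIM('a)) *
          indicator {..<r} (norm x))" y]
      by simp
  qed fact
qed

text \<open>The power of |y| is dictated by scaling. The three inequalities on the exponents are the
  convergence conditions: \<alpha> < n at the origin, 0 < s at z = y, and s < \<alpha> at
  infinity.\<close>

lemma riesz_of_power:
  assumes s: "0 < s" "s < \<alpha>" "\<alpha> < real DIM('a::euclidean_space)"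
  shows "\<exists>C>0. \<forall>y::'a. y \<noteq> 0 \<longrightarrow>
    (\<integral>\<^sup>+z. ennreal (norm (y - z) powr (s - real DIM('a)) * norm z powr (- \<alpha>)) \<partial>lborel)
        \<le> ennreal (C * norm y powr (s - \<alpha>))"
proof -
  let ?n = "real DIM('a)"
  obtain C1 where C1: "C1 > 0" "\<And>r. r > 0 \<Longrightarrow>
      (\<integral>\<^sup>+x. ennreal (norm (x::'a) powr (- \<alpha>) * indicator {..<r} (norm x)) \<partial>lborel)
          \<le> ennreal (C1 * r powr (?n - \<alpha>))"
    using nn_integral_norm_powr_ball[where 'a = 'a, of \<alpha>] assms by auto
  obtain C2 where C2: "C2 > 0" "\<And>r y. r > 0 \<Longrightarrow>
      (\<integral>\<^sup>+z. ennreal (norm (y - z :: 'a) powr (s - ?n) * indicator {..<r} (norm (y - z))) \<partial>lborel)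
          \<le> ennreal (C2 * r powr s)"
    using riesz_near[where 'a = 'a, of s] assms by auto
  obtain C3 where C3: "C3 > 0" "\<And>r. r > 0 \<Longrightarrow>
      (\<integral>\<^sup>+x. ennreal (norm (x::'a) powr (s - ?n - \<alpha>) * indicator {r..} (norm x)) \<partial>lborel)
          \<le> ennreal (C3 * r powr (s - \<alpha>))"
    using nn_integral_norm_powr_outside[where 'a = 'a, of "?n + \<alpha> - s"] assms by (auto simp: algebra_simps)
  let ?C = "(1/2) powr (s - \<alpha>) * C1 + (1/2) powr (- \<alpha>) * (C2 * 3 powr s) + (1/2) powr (s - ?n) * (C3 * 2 powr
      (s - \<alpha>))"
  have "(\<integral>\<^sup>+z. ennreal (norm (y - z) powr (s - ?n) * norm z powr (- \<alpha>)) \<partial>lborel)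
      \<le> ennreal (?C * norm y powr (s - \<alpha>))"
    if "y \<noteq> 0" for y :: 'a
  proof -
    define \<rho> where "\<rho> = norm y"
    have \<rho>: "\<rho> > 0" using that by (simp add: \<rho>_def)
    define F where "F z = (\<rho>/2) powr (s - ?n) * (norm z powr (- \<alpha>) * indicator {..<\<rho>/2} (norm z))" for z :: 'a
    define G where "G z = (\<rho>/2) powr (- \<alpha>) * (norm (y - z) powr (s - ?n) * indicator {..<3*\<rho>} (norm (y - z)))"
        for z :: 'a
    define H where "H z = (1/2) powr (s - ?n) * (norm z powr (s - ?n - \<alpha>) * indicator {2*\<rho>..} (norm z))" for z
        :: 'a
    have nn: "0 \<le> F z" "0 \<le> G z" "0 \<le> H z" for z by (auto simp: F_def G_def H_def)
    have [measurable]: "F \<in> borel_measurable borel" "G \<in> borel_measurable borel" "H \<in> borel_measurable borel"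
      unfolding F_def[abs_def] G_def[abs_def] H_def[abs_def] by measurable
    have le: "norm (y - z) powr (s - ?n) * norm z powr (- \<alpha>) \<le> F z + G z + H z" for z
    proof -
      have tri: "\<rho> \<le> norm z + norm (y - z)" "norm (y - z) \<le> \<rho> + norm z" "norm z \<le> \<rho> + norm (y - z)"
        unfolding \<rho>_def by norm+
      \<comment> \<open>In the first zone |y - z| >= \<rho>/2 freezes the kernel; in the second |z|
        >= \<rho>/2 freezes the power; in the third |z| >= 2\<rho>, so |y - z| >= |z|/2 and the two
        powers merge.\<close>
      consider "norm z < \<rho>/2" | "norm z \<ge> \<rho>/2" "norm (y - z) < 3 * \<rho>" | "norm (y - z) \<ge> 3 * \<rho>"
        by linarith
      then show ?thesis
      proof cases
        case 1
        then have "norm (y - z) powr (s - ?n) \<le> (\<rho>/2) powr (s - ?n)"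
          using tri \<rho> s by (intro powr_mono2') auto
        then have "norm (y - z) powr (s - ?n) * norm z powr (- \<alpha>) \<le> F z"
          using 1 by (auto simp: F_def intro!: mult_right_mono)
        with nn[of z] show ?thesis by linarith
      next
        case 2
        then have "norm z powr (- \<alpha>) \<le> (\<rho>/2) powr (- \<alpha>)"
          using tri \<rho> s by (intro powr_mono2') auto
        then have "norm (y - z) powr (s - ?n) * norm z powr (- \<alpha>) \<le> G z"
          using 2 by (simp add: G_def mult.commute mult_right_mono)
        with nn[of z] show ?thesis by linarith
      next
        case 3
        then have "norm (y - z) powr (s - ?n) \<le> (1/2 * norm z) powr (s - ?n)"
          using tri \<rho> s by (intro powr_mono2') auto
        then have "norm (y - z) powr (s - ?n) * norm z powr (- \<alpha>) \<le> (1/2) powr (s - ?n) * (norm z powr (s -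
            ?n) * norm z powr (- \<alpha>))"
          unfolding powr_mult mult.assoc[symmetric] by (rule mult_right_mono) simp
        also have "\<dots> = H z"
          using 3 tri by (simp add: H_def flip: powr_add)
        finally show ?thesis using nn[of z] by linarith
      qed
    qed
    have iF: "(\<integral>\<^sup>+z. ennreal (F z) \<partial>lborel) \<le> ennreal ((\<rho>/2) powr (s - ?n) * (C1 * (\<rho>/2) powr (?n - \<alpha>)))"
      unfolding F_def using C1(2)[of "\<rho>/2"] \<rho> C1(1)
      by (simp add: ennreal_mult nn_integral_cmult mult_left_mono del: times_divide_eq_right)
    have iG: "(\<integral>\<^sup>+z. ennreal (G z) \<partial>lborel) \<le> ennreal ((\<rho>/2) powr (- \<alpha>) * (C2 * (3*\<rho>) powr s))"
      unfolding G_def using C2(2)[of "3*\<rho>" y] \<rho> C2(1)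
      by (simp add: ennreal_mult nn_integral_cmult mult_left_mono del: times_divide_eq_right)
    have iH: "(\<integral>\<^sup>+z. ennreal (H z) \<partial>lborel) \<le> ennreal ((1/2) powr (s - ?n) * (C3 * (2*\<rho>) powr (s - \<alpha>)))"
      unfolding H_def using C3(2)[of "2*\<rho>"] \<rho> C3(1)
      by (simp add: ennreal_mult nn_integral_cmult mult_left_mono del: times_divide_eq_right)
    have "(\<integral>\<^sup>+z. ennreal (norm (y - z) powr (s - ?n) * norm z powr (- \<alpha>)) \<partial>lborel)
      \<le> (\<integral>\<^sup>+z. ennreal (F z) + ennreal (G z) + ennreal (H z) \<partial>lborel)"
      using le nn by (intro nn_integral_mono) (simp add: ennreal_leI flip: ennreal_plus)
    also have "\<dots> = (\<integral>\<^sup>+z. ennreal (F z) \<partial>lborel) + (\<integral>\<^sup>+z. ennreal (G z) \<partial>lborel)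
        + (\<integral>\<^sup>+z. ennreal (H z) \<partial>lborel)"
      by (simp add: nn_integral_add)
    also have "\<dots> \<le> ennreal ((\<rho>/2) powr (s - ?n) * (C1 * (\<rho>/2) powr (?n - \<alpha>)))
        + ennreal ((\<rho>/2) powr (- \<alpha>) * (C2 * (3*\<rho>) powr s))
       + ennreal ((1/2) powr (s - ?n) * (C3 * (2*\<rho>) powr (s - \<alpha>)))"
      by (intro add_mono iF iG iH)
    also have "\<dots> = ennreal ((\<rho>/2) powr (s - ?n) * (C1 * (\<rho>/2) powr (?n - \<alpha>))
        + (\<rho>/2) powr (- \<alpha>) * (C2 * (3*\<rho>) powr s)
       + (1/2) powr (s - ?n) * (C3 * (2*\<rho>) powr (s - \<alpha>)))"
      using C1(1) C2(1) C3(1) by (simp add: ennreal_plus)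
    also have "(\<rho>/2) powr (s - ?n) * (C1 * (\<rho>/2) powr (?n - \<alpha>)) + (\<rho>/2) powr (- \<alpha>) * (C2 * (3*\<rho>) powr s)
       + (1/2) powr (s - ?n) * (C3 * (2*\<rho>) powr (s - \<alpha>)) = ?C * \<rho> powr (s - \<alpha>)"
    proof -
      have "(\<rho>/2) powr (s - ?n) * (C1 * (\<rho>/2) powr (?n - \<alpha>)) = C1 * ((1/2 * \<rho>) powr (s - ?n) * (1/2 * \<rho>) powr
          (?n - \<alpha>))"
        by simp
      also have "\<dots> = C1 * ((1/2) powr (s - \<alpha>) * \<rho> powr (s - \<alpha>))"
        by (subst powr_add[symmetric]) (simp add: powr_mult[symmetric])
      finally have 1: "(\<rho>/2) powr (s - ?n) * (C1 * (\<rho>/2) powr (?n - \<alpha>)) = C1 * ((1/2) powr (s - \<alpha>) * \<rho> powr (s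
          - \<alpha>))" .
      have "(\<rho>/2) powr (- \<alpha>) * (C2 * (3*\<rho>) powr s) = (1/2 * \<rho>) powr (- \<alpha>) * (C2 * (3*\<rho>) powr s)"
        by simp
      also have "\<dots> = (1/2) powr (- \<alpha>) * (C2 * 3 powr s) * (\<rho> powr (- \<alpha>) * \<rho> powr s)"
        unfolding powr_mult by simp
      also have "\<rho> powr (- \<alpha>) * \<rho> powr s = \<rho> powr (s - \<alpha>)" by (simp flip: powr_add)
      finally have 2: "(\<rho>/2) powr (- \<alpha>) * (C2 * (3*\<rho>) powr s) = (1/2) powr (- \<alpha>) * (C2 * 3 powr s) * \<rho> powr (s
          - \<alpha>)" .
      show ?thesis unfolding 1 2 unfolding powr_mult by (simp add: algebra_simps)
    qed
    finally show ?thesis by (simp only: \<rho>_def)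
  qed
  moreover have "?C > 0" using C1(1) C2(1) C3(1) by (intro add_pos_pos mult_pos_pos) auto
  ultimately show ?thesis by blast
qed

text \<open>A Stein-Weiss inequality by Schur's test with the scale-invariant weight |z|^(-n/2). The
  two integrals are instances of \<open>riesz_of_power\<close> with exponents n/2 and n/2 + s, both
  admissible because s < n/2. Later it supplies finiteness of the Hardy term of the
  quotient.\<close>

lemma hardy_riesz:
  assumes s: "0 < s" "2 * s < real DIM('a::euclidean_space)"
  shows "\<exists>C>0. \<forall>g\<in>borel_measurable (borel :: 'a measure).
    (\<integral>\<^sup>+y. ennreal (norm y powr (- 2 * s)) *
        (\<integral>\<^sup>+z. ennreal (norm (y - z) powr (s - real DIM('a)) * \<bar>g z\<bar>) \<partial>lborel)\<^sup>2 \<partial>lborel)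
    \<le> ennreal C * (\<integral>\<^sup>+z. ennreal ((g z)\<^sup>2) \<partial>lborel)"
proof -
  let ?n = "real DIM('a)"
  obtain C where C: "C > 0" "\<And>y::'a. y \<noteq> 0 \<Longrightarrow>
    (\<integral>\<^sup>+z. ennreal (norm (y - z) powr (s - ?n) * norm z powr (- (?n/2))) \<partial>lborel)
        \<le> ennreal (C * norm y powr (s - ?n/2))"
    using riesz_of_power[where 'a = 'a, of s "?n/2"] s by auto
  obtain D where D: "D > 0" "\<And>y::'a. y \<noteq> 0 \<Longrightarrow>
    (\<integral>\<^sup>+z. ennreal (norm (y - z) powr (s - ?n) * norm z powr (- (?n/2 + s))) \<partial>lborel)
        \<le> ennreal (D * norm y powr (s - (?n/2 + s)))"
    using riesz_of_power[where 'a = 'a, of s "?n/2 + s"] s by auto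
  show ?thesis
  proof (intro exI conjI ballI)
    fix g :: "'a \<Rightarrow> real" assume [measurable]: "g \<in> borel_measurable borel"
    show "(\<integral>\<^sup>+y. ennreal (norm y powr (- 2 * s)) *
        (\<integral>\<^sup>+z. ennreal (norm (y - z) powr (s - real DIM('a)) * \<bar>g z\<bar>) \<partial>lborel)\<^sup>2 \<partial>lborel)
      \<le> ennreal (C * D) * (\<integral>\<^sup>+z. ennreal ((g z)\<^sup>2) \<partial>lborel)"
    proof (rule schur_test[where P = "\<lambda>z. norm z powr (- (?n/2))" and Q = "\<lambda>z. norm z powr (?n/2)"
          and A = "\<lambda>y. C * norm y powr (s - ?n/2)"])
      fix z :: 'a assume "z \<noteq> 0"
      have "(\<integral>\<^sup>+y. ennreal (C * norm y powr (s - ?n/2) * norm y powr (- 2 * s) * norm (y - z) powr (s - ?n))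
          \<partial>lborel)
        = (\<integral>\<^sup>+y. ennreal C * ennreal (norm (z - y) powr (s - ?n) * norm y powr (- (?n/2 + s))) \<partial>lborel)"
        using C(1) by (intro nn_integral_cong)
          (simp add: norm_minus_commute algebra_simps ennreal_mult[symmetric] flip: powr_add)
      also have "\<dots> \<le> ennreal C * ennreal (D * norm z powr (s - (?n/2 + s)))"
        using D(2)[OF \<open>z \<noteq> 0\<close>] by (subst nn_integral_cmult) (auto intro: mult_left_mono)
      also have "\<dots> = ennreal (C * D * norm z powr (- (?n/2)))"
        using C D by (simp add: ennreal_mult[symmetric])
      finally show "(\<integral>\<^sup>+y. ennreal (C * norm y powr (s - ?n/2) * norm y powr (- 2 * s) * norm (y - z) powr (s
          - ?n)) \<partial>lborel)
        \<le> ennreal (C * D * norm z powr (- (?n/2)))" .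
    qed (use C D in \<open>auto simp flip: powr_add\<close>)
  qed (use C D in simp)
qed

text \<open>Constant Schur weights suffice here: |y - z| < \<delta>|y| with \<delta> <= 1/2 makes
  |y| and |z| comparable up to a factor 2, so the weight can be moved from y to z at bounded cost.
  Each of the two Schur integrals contributes one factor \<delta>^s.\<close>

lemma riesz_near_schur:
  assumes s: "0 < s" "s \<le> real DIM('a::euclidean_space)"
  shows "\<exists>C>0. \<forall>\<delta>\<in>{0<..1/2}. \<forall>g\<in>borel_measurable (borel :: 'a measure).
    (\<integral>\<^sup>+y. ennreal (norm y powr (- 2 * s)) *
        (\<integral>\<^sup>+z. ennreal (norm (y - z) powr (s - real DIM('a)) * indicator {..<\<delta> * norm y} (norm (y - z)) * \<bar>g
            z\<bar>) \<partial>lborel)\<^sup>2 \<partial>lborel)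
    \<le> ennreal (C * \<delta> powr (2 * s)) * (\<integral>\<^sup>+z. ennreal ((g z)\<^sup>2) \<partial>lborel)"
proof -
  let ?n = "real DIM('a)"
  obtain C where C: "C > 0" "\<And>r y. r > 0 \<Longrightarrow>
      (\<integral>\<^sup>+z. ennreal (norm (y - z :: 'a) powr (s - ?n) * indicator {..<r} (norm (y - z))) \<partial>lborel)
          \<le> ennreal (C * r powr s)"
    using riesz_near[where 'a = 'a, of s] assms by auto
  show ?thesis
  proof (intro exI conjI ballI)
    fix g :: "'a \<Rightarrow> real" and \<delta> :: real
    assume [measurable]: "g \<in> borel_measurable borel" and \<delta>: "\<delta> \<in> {0<..1/2}"
    let ?K = "\<lambda>(y::'a) z. norm (y - z) powr (s - ?n) * indicator {..<\<delta> * norm y} (norm (y - z)) :: real"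
    show "(\<integral>\<^sup>+y. ennreal (norm y powr (- 2 * s)) * (\<integral>\<^sup>+z. ennreal (?K y z * \<bar>g z\<bar>) \<partial>lborel)\<^sup>2 \<partial>lborel)
      \<le> ennreal (C * C * 4 powr s * \<delta> powr (2 * s)) * (\<integral>\<^sup>+z. ennreal ((g z)\<^sup>2) \<partial>lborel)"
    proof (rule schur_test[where P = "\<lambda>z. 1" and Q = "\<lambda>z. 1" and A = "\<lambda>y. C * (\<delta> * norm y) powr s"])
      fix z :: 'a assume "z \<noteq> 0"
      have "(\<integral>\<^sup>+y. ennreal (C * (\<delta> * norm y) powr s * norm y powr (- 2 * s) * ?K y z) \<partial>lborel)
        \<le> (\<integral>\<^sup>+y. ennreal (C * \<delta> powr s * 2 powr s * norm z powr (- s)) * ennreal (norm (z - y) powr (s - ?n) *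
            indicator {..<2*\<delta>*norm z} (norm (z - y))) \<partial>lborel)"
      proof (intro nn_integral_mono)
        fix y :: 'a
        show "ennreal (C * (\<delta> * norm y) powr s * norm y powr (- 2 * s) * ?K y z)
          \<le> ennreal (C * \<delta> powr s * 2 powr s * norm z powr (- s)) * ennreal (norm (z - y) powr (s - ?n) *
              indicator {..<2*\<delta>*norm z} (norm (z - y)))"
        proof (cases "norm (y - z) < \<delta> * norm y")
          case True
          then have y: "y \<noteq> 0" by auto
          have "\<delta> * norm y \<le> 1/2 * norm y" using \<delta> by (intro mult_right_mono) auto
          moreover have "norm y \<le> norm z + norm (y - z)" "norm z \<le> norm y + norm (y - z)" by norm+
          ultimately have yz: "norm y \<le> 2 * norm z" "norm z \<le> 2 * norm y" using True by auto
          have zy: "norm (z - y) < 2 * \<delta> * norm z"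
          proof -
            have "\<delta> * norm y \<le> \<delta> * (2 * norm z)" using yz \<delta> by (intro mult_left_mono) auto
            with True show ?thesis by (simp add: norm_minus_commute)
          qed
          have "(\<delta> * norm y) powr s * norm y powr (- 2 * s) = \<delta> powr s * norm y powr (- s)"
            by (simp add: powr_mult mult.assoc flip: powr_add)
          also have "\<dots> \<le> \<delta> powr s * (1/2 * norm z) powr (- s)"
            using yz y \<open>z \<noteq> 0\<close> s by (intro mult_left_mono powr_mono2') auto
          also have "\<dots> = \<delta> powr s * 2 powr s * norm z powr (- s)"
            unfolding powr_mult by (simp add: powr_minus powr_divide)
          finally have "C * ((\<delta> * norm y) powr s * norm y powr (- 2 * s)) * norm (y - z) powr (s - ?n)
            \<le> C * (\<delta> powr s * 2 powr s * norm z powr (- s)) * norm (y - z) powr (s - ?n)"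
            using C by (intro mult_right_mono mult_left_mono) auto
          then show ?thesis using True zy C
            by (simp add: ennreal_mult[symmetric] norm_minus_commute ennreal_leI mult.assoc)
        qed simp
      qed
      also have "\<dots> \<le> ennreal (C * \<delta> powr s * 2 powr s * norm z powr (- s)) * ennreal (C * (2*\<delta>*norm z) powr
          s)"
        using C(2)[of "2 * \<delta> * norm z" z] \<delta> \<open>z \<noteq> 0\<close> by (subst nn_integral_cmult) (auto intro: mult_left_mono)
      also have "\<dots> = ennreal (C * C * 4 powr s * \<delta> powr (2 * s) * 1)"
      proof -
        have "norm z powr (- s) * norm z powr s = 1" using \<open>z \<noteq> 0\<close> by (simp flip: powr_add)
        moreover have "2 powr s * 2 powr s = (4::real) powr s" by (simp flip: powr_mult)
        moreover have "\<delta> powr s * \<delta> powr s = \<delta> powr (2 * s)" by (simp flip: powr_add)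
        moreover have "C * \<delta> powr s * 2 powr s * norm z powr (- s) * (C * (2*\<delta>*norm z) powr s)
          = C * C * (2 powr s * 2 powr s) * (\<delta> powr s * \<delta> powr s) * (norm z powr (- s) * norm z powr s)"
          unfolding powr_mult by (simp only: mult_ac)
        ultimately have "C * \<delta> powr s * 2 powr s * norm z powr (- s) * (C * (2*\<delta>*norm z) powr s)
            = C * C * 4 powr s * \<delta> powr (2 * s) * 1"
          by (simp only:)
        then show ?thesis using C by (simp add: ennreal_mult[symmetric])
      qed
      finally show "(\<integral>\<^sup>+y. ennreal (C * (\<delta> * norm y) powr s * norm y powr (- 2 * s) * ?K y z) \<partial>lborel)
         \<le> ennreal (C * C * 4 powr s * \<delta> powr (2 * s) * 1)" .
    next
      fix y :: 'a assume "y \<noteq> 0"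
      then show "(\<integral>\<^sup>+z. ennreal (?K y z * 1) \<partial>lborel) \<le> ennreal (C * (\<delta> * norm y) powr s)"
        using C(2)[of "\<delta> * norm y" y] \<delta> by simp
    next
      show "case_prod ?K \<in> borel_measurable (lborel \<Otimes>\<^sub>M lborel)"
        unfolding indicator_def of_bool_def lessThan_iff by measurable
    qed (use C in auto)
  qed (use C in simp)
qed

section \<open>Rotations in a coordinate plane\<close>

text \<open>Fubini isolates the coordinate in direction \<open>i\<close>; with the other coordinates
  frozen the shear is a translation of the line. Shears are what is required because a plane
  rotation factors into three of them.\<close>

lemma nn_integral_lborel_shear:
  fixes f :: "'a::euclidean_space \<Rightarrow> ennreal"
  assumes [measurable]: "f \<in> borel_measurable borel" and ij: "i \<in> Basis" "j \<in> Basis" "i \<noteq> j"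
  shows "(\<integral>\<^sup>+x. f (x + (a * (x \<bullet> j)) *\<^sub>R i) \<partial>lborel) = (\<integral>\<^sup>+x. f x \<partial>lborel)"
proof -
  interpret product_sigma_finite "\<lambda>_::'a. lborel :: real measure" ..
  let ?S = "\<lambda>x. \<Sum>b\<in>Basis. x b *\<^sub>R b :: 'a"
  let ?B = "Basis - {i} :: 'a set"
  have B: "Basis = insert i ?B" "i \<notin> ?B" "finite ?B" using ij by auto
  have split: "integral\<^sup>N lborel h = (\<integral>\<^sup>+x. (\<integral>\<^sup>+y. h (?S (x(i := y))) \<partial>lborel) \<partial>Pi\<^sub>M ?B (\<lambda>_. lborel))"
    if [measurable]: "h \<in> borel_measurable borel" for h :: "'a \<Rightarrow> ennreal"
  proof -
    have "integral\<^sup>N lborel h = (\<integral>\<^sup>+x. h (?S x) \<partial>Pi\<^sub>M Basis (\<lambda>_. lborel))"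
      by (subst lborel_eq) (simp add: nn_integral_distr)
    also have "\<dots> = (\<integral>\<^sup>+x. h (?S x) \<partial>Pi\<^sub>M (insert i ?B) (\<lambda>_. lborel))"
      using B(1) by simp
    also have "\<dots> = (\<integral>\<^sup>+x. (\<integral>\<^sup>+y. h (?S (x(i := y))) \<partial>lborel) \<partial>Pi\<^sub>M ?B (\<lambda>_. lborel))"
      using B by (subst product_nn_integral_insert) auto
    finally show ?thesis .
  qed
  have upd: "?S (x(i := y)) + (a * (?S (x(i := y)) \<bullet> j)) *\<^sub>R i = ?S (x(i := y + a * x j))" for x y
  proof (rule euclidean_eqI)
    fix b :: 'a assume b: "b \<in> Basis"
    show "(?S (x(i := y)) + (a * (?S (x(i := y)) \<bullet> j)) *\<^sub>R i) \<bullet> b = ?S (x(i := y + a * x j)) \<bullet> b"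
      using b ij by (simp add: inner_simps inner_Basis)
  qed
  have "(\<integral>\<^sup>+x. f (x + (a * (x \<bullet> j)) *\<^sub>R i) \<partial>lborel)
     = (\<integral>\<^sup>+x. (\<integral>\<^sup>+y. f (?S (x(i := y + a * x j))) \<partial>lborel) \<partial>Pi\<^sub>M ?B (\<lambda>_. lborel))"
    by (subst split) (simp_all only: upd, measurable)
  also have "\<dots> = (\<integral>\<^sup>+x. (\<integral>\<^sup>+y. f (?S (x(i := y))) \<partial>lborel) \<partial>Pi\<^sub>M ?B (\<lambda>_. lborel))"
  proof (rule nn_integral_cong)
    fix x :: "'a \<Rightarrow> real"
    have e: "?S (x(i := y)) = (\<Sum>b\<in>?B. x b *\<^sub>R b) + y *\<^sub>R i" for y
    proof -
      have "?S (x(i := y)) = (\<Sum>b\<in>insert i ?B. (x(i := y)) b *\<^sub>R b)" using B(1) by simp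
      also have "\<dots> = y *\<^sub>R i + (\<Sum>b\<in>?B. (x(i := y)) b *\<^sub>R b)"
        using B(2,3) by (subst sum.insert) auto
      also have "(\<Sum>b\<in>?B. (x(i := y)) b *\<^sub>R b) = (\<Sum>b\<in>?B. x b *\<^sub>R b)" by (intro sum.cong) auto
      finally show ?thesis by (simp add: add.commute)
    qed
    show "(\<integral>\<^sup>+y. f (?S (x(i := y + a * x j))) \<partial>lborel) = (\<integral>\<^sup>+y. f (?S (x(i := y))) \<partial>lborel)"
      unfolding e using nn_integral_lborel_translate(1)[of "\<lambda>y. f ((\<Sum>b\<in>?B. x b *\<^sub>R b) + y *\<^sub>R i)" "- a * x j"]
      by simp
  qed
  also have "\<dots> = (\<integral>\<^sup>+x. f x \<partial>lborel)" by (subst split) simp_all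
  finally show ?thesis .
qed

text \<open>The rotation by \<theta> in the plane spanned by \<open>i\<close> and \<open>j\<close>,
  fixing the orthogonal complement. It is written as the identity plus a correction, so that it
  makes sense in any Euclidean space without matrices.\<close>

definition plane_rot :: "'a::euclidean_space \<Rightarrow> 'a \<Rightarrow> real \<Rightarrow> 'a \<Rightarrow> 'a" where
  "plane_rot i j \<theta> y = y + ((cos \<theta> - 1) * (y \<bullet> i) - sin \<theta> * (y \<bullet> j)) *\<^sub>R i
     + (sin \<theta> * (y \<bullet> i) + (cos \<theta> - 1) * (y \<bullet> j)) *\<^sub>R j"

lemma measurable_plane_rot [measurable (raw)]:
  assumes [measurable]: "f \<in> borel_measurable M" "g \<in> borel_measurable M"
  shows "(\<lambda>x. plane_rot i j (f x) (g x)) \<in> borel_measurable M"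
  unfolding plane_rot_def by measurable

lemma plane_rot_inner:
  assumes "i \<in> Basis" "j \<in> Basis" "i \<noteq> j"
  shows "plane_rot i j \<theta> y \<bullet> j = sin \<theta> * (y \<bullet> i) + cos \<theta> * (y \<bullet> j)"
  using assms by (simp add: plane_rot_def inner_simps inner_Basis algebra_simps)

lemma norm_plane_rot:
  assumes "i \<in> Basis" "j \<in> Basis" "i \<noteq> j"
  shows "norm (plane_rot i j \<theta> y) = norm y"
proof -
  define A B where "A = (cos \<theta> - 1) * (y \<bullet> i) - sin \<theta> * (y \<bullet> j)"
    and "B = sin \<theta> * (y \<bullet> i) + (cos \<theta> - 1) * (y \<bullet> j)"
  have ij: "i \<bullet> i = 1" "j \<bullet> j = 1" "i \<bullet> j = 0" "j \<bullet> i = 0" using assms by (auto simp: inner_Basis)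
  have "plane_rot i j \<theta> y \<bullet> plane_rot i j \<theta> y
      = y \<bullet> y + (A * A + B * B + 2 * A * (y \<bullet> i) + 2 * B * (y \<bullet> j))"
    unfolding plane_rot_def A_def[symmetric] B_def[symmetric]
    by (simp add: inner_simps ij inner_commute[of i y] inner_commute[of j y]) (simp add: algebra_simps)
  also have "A * A + B * B + 2 * A * (y \<bullet> i) + 2 * B * (y \<bullet> j)
     = ((cos \<theta>)\<^sup>2 + (sin \<theta>)\<^sup>2 - 1) * ((y \<bullet> i)\<^sup>2 + (y \<bullet> j)\<^sup>2)"
    unfolding A_def B_def power2_eq_square by algebra
  finally have "plane_rot i j \<theta> y \<bullet> plane_rot i j \<theta> y = y \<bullet> y" by simp
  then show ?thesis by (simp add: norm_eq_sqrt_inner)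
qed

text \<open>A rotation is the product of shears with parameters -tan(\<theta>/2), sin \<theta> and
  -tan(\<theta>/2), each of which preserves Lebesgue measure. The small range of angles keeps
  cos(\<theta>/2) away from zero, so that the tangent makes sense.\<close>

lemma nn_integral_lborel_plane_rot:
  fixes f :: "'a::euclidean_space \<Rightarrow> ennreal"
  assumes [measurable]: "f \<in> borel_measurable borel" and ij: "i \<in> Basis" "j \<in> Basis" "i \<noteq> j"
    and \<theta>: "0 \<le> \<theta>" "\<theta> \<le> 1/2"
  shows "(\<integral>\<^sup>+x. f (plane_rot i j \<theta> x) \<partial>lborel) = (\<integral>\<^sup>+x. f x \<partial>lborel)"
proof -
  define t where "t = tan (\<theta>/2)"
  have c: "cos (\<theta>/2) \<noteq> 0" using cos_gt_zero_pi[of "\<theta>/2"] \<theta> pi_gt3 by simp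
  have sc: "sin \<theta> = 2 * sin (\<theta>/2) * cos (\<theta>/2)" "cos \<theta> = 1 - 2 * (sin (\<theta>/2))\<^sup>2" "cos \<theta> = 2 * (cos (\<theta>/2))\<^sup>2 - 1"
    using sin_double[of "\<theta>/2"] cos_double_sin[of "\<theta>/2"] cos_double_cos[of "\<theta>/2"] by auto
  have t1: "sin \<theta> * t = 1 - cos \<theta>"
    unfolding t_def tan_def using c by (simp add: sc(1) sc(2) power2_eq_square)
  have t2: "t * (1 + cos \<theta>) = sin \<theta>"
    unfolding t_def tan_def using c by (simp add: sc(1) sc(3) power2_eq_square)
  let ?A = "\<lambda>x::'a. x + (- t * (x \<bullet> j)) *\<^sub>R i" and ?B = "\<lambda>x::'a. x + (sin \<theta> * (x \<bullet> i)) *\<^sub>R j"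
  have rot: "plane_rot i j \<theta> x = ?A (?B (?A x))" for x
  proof (rule euclidean_eqI)
    fix b :: 'a assume b: "b \<in> Basis"
    have co: "cos \<theta> = 1 - sin \<theta> * t" using t1 by simp
    have si: "sin \<theta> = t * (2 - sin \<theta> * t)" using t2 co by (simp add: algebra_simps)
    show "plane_rot i j \<theta> x \<bullet> b = ?A (?B (?A x)) \<bullet> b"
    proof (cases "b = i \<or> b = j")
      case True
      have "(cos \<theta> - 1) * (x \<bullet> i) - sin \<theta> * (x \<bullet> j) =
        - t * (x \<bullet> j) - t * (x \<bullet> j + sin \<theta> * (x \<bullet> i - t * (x \<bullet> j)))"
        using co si by algebra
      moreover have "sin \<theta> * (x \<bullet> i) + (cos \<theta> - 1) * (x \<bullet> j) = sin \<theta> * (x \<bullet> i - t * (x \<bullet> j))"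
        using co by algebra
      ultimately show ?thesis using True b ij by (auto simp: plane_rot_def inner_simps inner_Basis)
    qed (use b ij in \<open>auto simp: plane_rot_def inner_simps inner_Basis\<close>)
  qed
  show ?thesis unfolding rot
    using nn_integral_lborel_shear[of "\<lambda>x. f (?A (?B x))" i j "- t"] nn_integral_lborel_shear[of
        "\<lambda>x. f (?A x)" j i "sin \<theta>"]
      nn_integral_lborel_shear[of f i j "- t"] ij by simp
qed

text \<open>The \<open>j\<close>-coordinate of the rotated point has angular speed cos \<theta>
  times \<open>y \<bullet> i\<close> minus sin \<theta> times \<open>y \<bullet> j\<close>. For
  angles up to 1/2 one has cos >= 7/8 and sin <= 1/2; since \<open>i\<close> dominates
  \<open>j\<close>, at least 3/8 of \<open>\<bar>y \<bullet> i\<bar>\<close> remains.\<close>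

lemma plane_rot_inner_expanding:
  assumes ij: "i \<in> Basis" "j \<in> Basis" "i \<noteq> j" and y: "\<bar>y \<bullet> j\<bar> \<le> \<bar>y \<bullet> i\<bar>"
    and \<theta>: "\<theta> \<in> {0..1/2}" "\<theta>' \<in> {0..1/2}"
  shows "3/8 * \<bar>y \<bullet> i\<bar> * \<bar>\<theta> - \<theta>'\<bar> \<le> \<bar>plane_rot i j \<theta> y \<bullet> j - plane_rot i j \<theta>' y \<bullet> j\<bar>"
proof -
  have wlog: "3/8 * \<bar>y \<bullet> i\<bar> * \<bar>\<theta> - \<theta>'\<bar> \<le> \<bar>plane_rot i j \<theta> y \<bullet> j - plane_rot i j \<theta>' y \<bullet> j\<bar>"
    if "\<theta> < \<theta>'" "\<theta> \<in> {0..1/2}" "\<theta>' \<in> {0..1/2}" for \<theta> \<theta>'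
  proof -
    let ?h = "\<lambda>\<theta>. sin \<theta> * (y \<bullet> i) + cos \<theta> * (y \<bullet> j)"
    have "\<exists>z. \<theta> < z \<and> z < \<theta>' \<and> ?h \<theta>' - ?h \<theta> = (\<theta>' - \<theta>) * (cos z * (y \<bullet> i) - sin z * (y \<bullet> j))"
      using that(1) by (intro MVT2) (auto intro!: derivative_eq_intros)
    then obtain z where z: "\<theta> < z" "z < \<theta>'" "?h \<theta>' - ?h \<theta> = (\<theta>' - \<theta>) * (cos z * (y \<bullet> i) - sin z * (y \<bullet> j))"
      by blast
    have z': "0 \<le> z" "z \<le> 1/2" using z that by auto
    have "sin z \<le> 1/2" "0 \<le> sin z" using z' sin_x_le_x[of z] sin_ge_zero[of z] pi_gt3 by auto
    moreover have "cos z \<ge> 7/8"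
    proof -
      have "sin (z/2) \<le> 1/4" "0 \<le> sin (z/2)" using z' sin_x_le_x[of "z/2"] sin_ge_zero[of "z/2"] pi_gt3
          by auto
      then have "(sin (z/2))\<^sup>2 \<le> (1/4)\<^sup>2" by (intro power_mono)
      then show ?thesis using cos_double_sin[of "z/2"] by (simp add: power2_eq_square)
    qed
    ultimately have "3/8 * \<bar>y \<bullet> i\<bar> \<le> \<bar>cos z\<bar> * \<bar>y \<bullet> i\<bar> - \<bar>sin z\<bar> * \<bar>y \<bullet> i\<bar>"
      using mult_right_mono[of "3/8" "cos z - sin z" "\<bar>y \<bullet> i\<bar>"] by (simp add: algebra_simps)
    also have "\<dots> \<le> \<bar>cos z\<bar> * \<bar>y \<bullet> i\<bar> - \<bar>sin z\<bar> * \<bar>y \<bullet> j\<bar>"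
      using y by (intro diff_mono mult_left_mono) auto
    also have "\<dots> \<le> \<bar>cos z * (y \<bullet> i) - sin z * (y \<bullet> j)\<bar>"
      by (simp flip: abs_mult)
    finally have "3/8 * \<bar>y \<bullet> i\<bar> * (\<theta>' - \<theta>) \<le> \<bar>cos z * (y \<bullet> i) - sin z * (y \<bullet> j)\<bar> * (\<theta>' - \<theta>)"
      using that by (intro mult_right_mono) auto
    also have "\<dots> = \<bar>?h \<theta>' - ?h \<theta>\<bar>" unfolding z(3) using that by (simp add: abs_mult)
    finally show ?thesis using that by (simp add: plane_rot_inner[OF ij] abs_minus_commute)
  qed
  show ?thesis using wlog[of \<theta> \<theta>'] wlog[of \<theta>' \<theta>] \<theta>
    by (cases \<theta> \<theta>' rule: linorder_cases) (auto simp: abs_minus_commute)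
qed

text \<open>If two rotated points both lie within \<rho> of z, their \<open>j\<close>-coordinates
  differ by at most 2\<rho>, so by the expansion factor 3/8 \<open>\<bar>y \<bullet> i\<bar>\<close>
  the angles differ by at most \<open>L\<close>. All such angles lie in an interval of length
  2\<open>L\<close> around any one of them.\<close>

lemma emeasure_plane_rot_near:
  fixes y z :: "'a::euclidean_space"
  assumes ij: "i \<in> Basis" "j \<in> Basis" "i \<noteq> j" and y: "\<bar>y \<bullet> j\<bar> \<le> \<bar>y \<bullet> i\<bar>" "y \<bullet> i \<noteq> 0" and "0 < \<rho>"
  shows "emeasure (restrict_space lborel {0..1/2}) {\<theta> \<in> space (restrict_space lborel {0..1/2}). norm
      (plane_rot i j \<theta> y - z) < \<rho>}
    \<le> ennreal (32 / (3 * \<bar>y \<bullet> i\<bar>) * \<rho> powr 1)"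
proof -
  let ?E = "{\<theta> \<in> {0..1/2}. norm (plane_rot i j \<theta> y - z) < \<rho>}"
  define L where "L = 16 * \<rho> / (3 * \<bar>y \<bullet> i\<bar>)"
  have L: "0 \<le> L" using assms by (simp add: L_def)
  have "emeasure lborel ?E \<le> ennreal (2 * L)"
  proof (cases "?E = {}")
    case False
    then obtain \<theta>0 where \<theta>0: "\<theta>0 \<in> ?E" by blast
    have "?E \<subseteq> {\<theta>0 - L..\<theta>0 + L}"
    proof
      fix \<theta> assume \<theta>: "\<theta> \<in> ?E"
      have "\<bar>plane_rot i j \<theta> y \<bullet> j - plane_rot i j \<theta>0 y \<bullet> j\<bar> \<le> \<bar>(plane_rot i j \<theta> y - z) \<bullet> j\<bar>
          + \<bar>(plane_rot i j \<theta>0 y - z) \<bullet> j\<bar>"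
        by (simp add: inner_simps)
      also have "\<dots> \<le> norm (plane_rot i j \<theta> y - z) + norm (plane_rot i j \<theta>0 y - z)"
        using ij by (intro add_mono Basis_le_norm)
      also have "\<dots> \<le> 2 * \<rho>" using \<theta> \<theta>0 by auto
      finally have "3/8 * \<bar>y \<bullet> i\<bar> * \<bar>\<theta> - \<theta>0\<bar> \<le> 2 * \<rho>"
        using plane_rot_inner_expanding[OF ij y(1), of \<theta> \<theta>0] \<theta> \<theta>0 by auto
      then have "\<bar>\<theta> - \<theta>0\<bar> \<le> L" unfolding L_def using y by (simp add: field_simps)
      then show "\<theta> \<in> {\<theta>0 - L..\<theta>0 + L}" by auto
    qed
    then have "emeasure lborel ?E \<le> emeasure lborel {\<theta>0 - L..\<theta>0 + L}" by (intro emeasure_mono) auto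
    also have "\<dots> = ennreal (2 * L)" using L by simp
    finally show ?thesis .
  qed (use L in \<open>simp only: emeasure_empty zero_le\<close>)
  also have "2 * L = 32 / (3 * \<bar>y \<bullet> i\<bar>) * \<rho> powr 1" using \<open>0 < \<rho>\<close> by (simp add: L_def)
  finally show ?thesis by (subst emeasure_restrict_space) (auto simp: space_restrict_space)
qed

text \<open>As a function of the angle, the distance from z has one-dimensional sublevel growth, so
  the singularity of order p is paid for in dimension 1 and not in dimension n. Taking
  \<open>i\<close> as a coordinate of maximal size allows 1/\<open>\<bar>y \<bullet> i\<bar>\<close>
  to be replaced by \<open>DIM('a)\<close>/|y|.\<close>

lemma plane_rot_average_riesz:
  assumes "1 < p"
  shows "\<exists>C>0. \<forall>(i::'a::euclidean_space)\<in>Basis. \<forall>j\<in>Basis. \<forall>y z r. i \<noteq> j \<longrightarrow> y \<noteq> 0 \<longrightarrow> 0 < r \<longrightarrow> (\<forall>k\<in>Basis. \<bar>y \<bullet> k\<bar>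
      \<le> \<bar>y \<bullet> i\<bar>) \<longrightarrow>
    (\<integral>\<^sup>+\<theta>\<in>{0..1/2}. ennreal (norm (plane_rot i j \<theta> y - z) powr (- p) * indicator {r..} (norm (plane_rot i j \<theta>
        y - z))) \<partial>lborel)
    \<le> ennreal (C / norm y * r powr (1 - p))"
proof (intro exI conjI ballI allI impI)
  let ?c = "2 / (1 - 2 powr (1 - p)) :: real"
  let ?C = "?c * (32 / 3 * real DIM('a))"
  have c: "?c > 0" using assms by (simp add: powr_less_one)
  then show "?C > 0" by simp
  fix i j y z :: 'a and r :: real
  assume ij: "i \<in> Basis" "j \<in> Basis" "i \<noteq> j" and y: "y \<noteq> 0" and r: "0 < r" and m: "\<forall>k\<in>Basis. \<bar>y \<bullet> k\<bar>
      \<le> \<bar>y \<bullet> i\<bar>"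
  have ny: "norm y \<le> real DIM('a) * \<bar>y \<bullet> i\<bar>"
  proof -
    have "norm y \<le> (\<Sum>k\<in>Basis. \<bar>y \<bullet> k\<bar>)" by (rule norm_le_l1)
    also have "\<dots> \<le> (\<Sum>k\<in>(Basis::'a set). \<bar>y \<bullet> i\<bar>)" using m by (intro sum_mono) auto
    finally show ?thesis by simp
  qed
  then have yi: "y \<bullet> i \<noteq> 0" using y by auto
  have "(\<integral>\<^sup>+\<theta>\<in>{0..1/2}. ennreal (norm (plane_rot i j \<theta> y - z) powr (- p) * indicator {r..} (norm (plane_rot i
      j \<theta> y - z))) \<partial>lborel)
    = (\<integral>\<^sup>+\<theta>. ennreal (norm (plane_rot i j \<theta> y - z) powr (- p) * indicator {r..} (norm (plane_rot i j \<theta> y -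
        z))) \<partial>restrict_space lborel {0..1/2})"
    by (subst nn_integral_restrict_space) auto
  also have "\<dots> \<le> ennreal (2 powr 1 / (1 - 2 powr (1 - p)) * (32 / (3 * \<bar>y \<bullet> i\<bar>)) * r powr (1 - p))"
  proof (rule nn_integral_powr_superlevel)
    show "(\<lambda>\<theta>. norm (plane_rot i j \<theta> y - z)) \<in> borel_measurable (restrict_space lborel {0..1/2})"
      by (rule measurable_restrict_space1) measurable
    show "emeasure (restrict_space lborel {0..1/2}) {\<theta> \<in> space (restrict_space lborel {0..1/2}). norm
        (plane_rot i j \<theta> y - z) < \<rho>}
      \<le> ennreal (32 / (3 * \<bar>y \<bullet> i\<bar>) * \<rho> powr 1)" if "\<rho> > 0" for \<rho>
      using emeasure_plane_rot_near[OF ij _ yi that, of z] m ij by auto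
  qed (use assms r in auto)
  also have "\<dots> \<le> ennreal (?C / norm y * r powr (1 - p))"
  proof (intro ennreal_leI mult_right_mono)
    have "1 / \<bar>y \<bullet> i\<bar> \<le> real DIM('a) / norm y"
      using ny y yi by (simp add: field_simps)
    then have "?c * (32/3) * (1 / \<bar>y \<bullet> i\<bar>) \<le> ?c * (32/3) * (real DIM('a) / norm y)"
      using c by (intro mult_left_mono) auto
    moreover have "a * (32 / (3 * t)) = a * (32/3) * (1 / t)" "a * (32/3 * d) / t = a * (32/3) * (d / t)"
      for a t d :: real by simp_all
    ultimately show "2 powr 1 / (1 - 2 powr (1 - p)) * (32 / (3 * \<bar>y \<bullet> i\<bar>)) \<le> ?C / norm y"
      by (simp only: powr_one)
  qed simp
  finally show "(\<integral>\<^sup>+\<theta>\<in>{0..1/2}. ennreal (norm (plane_rot i j \<theta> y - z) powr (- p) * indicator {r..} (norm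
      (plane_rot i j \<theta> y - z))) \<partial>lborel)
    \<le> ennreal (?C / norm y * r powr (1 - p))" .
qed

section \<open>Riesz potentials split by distance: near, annular and far parts\<close>

lemma powr_square: "(x powr a)\<^sup>2 = x powr (2 * a)" for x a :: real
  by (simp add: power2_eq_square flip: powr_add)

lemma ennreal_le_of_power2_le:
  assumes "(x::ennreal)\<^sup>2 \<le> y\<^sup>2" shows "x \<le> y"
proof (rule ccontr)
  assume "\<not> x \<le> y"
  then have "y < x" by simp
  then have "y\<^sup>2 < x\<^sup>2"
  proof (cases x y rule: ennreal2_cases)
    case (real_real r q)
    then show ?thesis using \<open>y < x\<close> by (simp add: ennreal_power ennreal_less_iff power_strict_mono)
  next
    case (top_real q)
    then show ?thesis by (simp add: ennreal_power power2_eq_square ennreal_mult_less_top)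
  qed (use \<open>y < x\<close> in auto)
  with assms show False by simp
qed

lemma Cauchy_Schwarz_nn_integral_bound:
  fixes f g :: "'b \<Rightarrow> real"
  assumes [measurable]: "f \<in> borel_measurable M" "g \<in> borel_measurable M"
    and nn: "\<And>x. 0 \<le> f x" "0 \<le> a" "0 \<le> b"
    and g: "(\<integral>\<^sup>+x. ennreal ((g x)\<^sup>2) \<partial>M) \<le> ennreal (a\<^sup>2)"
    and f: "(\<integral>\<^sup>+x. ennreal ((f x)\<^sup>2) \<partial>M) \<le> ennreal (b\<^sup>2)"
  shows "(\<integral>\<^sup>+x. ennreal (f x * \<bar>g x\<bar>) \<partial>M) \<le> ennreal (b * a)"
proof (rule ennreal_le_of_power2_le)
  have "(\<integral>\<^sup>+x. ennreal (f x * \<bar>g x\<bar>) \<partial>M)\<^sup>2 = (\<integral>\<^sup>+x. ennreal (f x) * ennreal \<bar>g x\<bar> \<partial>M)\<^sup>2"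
    using nn by (simp add: ennreal_mult)
  also have "\<dots> \<le> (\<integral>\<^sup>+x. ennreal (f x) ^ 2 \<partial>M) * (\<integral>\<^sup>+x. ennreal \<bar>g x\<bar> ^ 2 \<partial>M)"
    by (rule Cauchy_Schwarz_nn_integral) measurable
  also have "\<dots> \<le> ennreal (b\<^sup>2) * ennreal (a\<^sup>2)"
    using f g nn by (intro mult_mono) (auto simp: ennreal_power)
  also have "\<dots> = (ennreal (b * a))\<^sup>2"
    using nn by (simp add: ennreal_power power_mult_distrib flip: ennreal_mult)
  finally show "(\<integral>\<^sup>+x. ennreal (f x * \<bar>g x\<bar>) \<partial>M)\<^sup>2 \<le> (ennreal (b * a))\<^sup>2" .
qed

text \<open>Outside a ball the kernel is square integrable because 2(n - s) > n, so Cauchy-Schwarz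
  gives a pointwise bound.\<close>

lemma riesz_far:
  assumes s: "2 * s < real DIM('a::euclidean_space)"
  shows "\<exists>C>0. \<forall>g\<in>borel_measurable (borel :: 'a measure). \<forall>a\<ge>0. \<forall>y. \<forall>r>0.
    (\<integral>\<^sup>+z. ennreal ((g z)\<^sup>2) \<partial>lborel) \<le> ennreal (a\<^sup>2) \<longrightarrow>
    (\<integral>\<^sup>+z. ennreal (norm (y - z) powr (s - real DIM('a)) * indicator {r..} (norm (y - z)) * \<bar>g z\<bar>) \<partial>lborel)
      \<le> ennreal (C * r powr (s - real DIM('a)/2) * a)"
proof -
  let ?n = "real DIM('a)"
  obtain C where C: "C > 0" "\<And>r. r > 0 \<Longrightarrow>
      (\<integral>\<^sup>+x. ennreal (norm (x::'a) powr (2 * s - 2 * ?n) * indicator {r..} (norm x)) \<partial>lborel)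
          \<le> ennreal (C * r powr (2 * s - ?n))"
    using nn_integral_norm_powr_outside[where 'a = 'a, of "2 * ?n - 2 * s"] s by (auto simp: algebra_simps)
  show ?thesis
  proof (intro exI conjI ballI allI impI)
    fix g :: "'a \<Rightarrow> real" and a r :: real and y :: 'a
    assume [measurable]: "g \<in> borel_measurable borel" and ar: "0 \<le> a" "0 < r"
      and g: "(\<integral>\<^sup>+z. ennreal ((g z)\<^sup>2) \<partial>lborel) \<le> ennreal (a\<^sup>2)"
    show "(\<integral>\<^sup>+z. ennreal (norm (y - z) powr (s - ?n) * indicator {r..} (norm (y - z)) * \<bar>g z\<bar>) \<partial>lborel)
      \<le> ennreal (sqrt C * r powr (s - ?n/2) * a)"
    proof (rule Cauchy_Schwarz_nn_integral_bound[OF _ _ _ _ _ g])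
      have "(\<integral>\<^sup>+z. ennreal ((norm (y - z) powr (s - ?n) * indicator {r..} (norm (y - z)))\<^sup>2) \<partial>lborel)
        = (\<integral>\<^sup>+z. ennreal (norm (y - z) powr (2 * s - 2 * ?n) * indicator {r..} (norm (y - z))) \<partial>lborel)"
        by (intro nn_integral_cong) (auto simp: power2_eq_square indicator_def algebra_simps simp flip:
            powr_add)
      also have "\<dots> = (\<integral>\<^sup>+x. ennreal (norm (x::'a) powr (2 * s - 2 * ?n) * indicator {r..} (norm x)) \<partial>lborel)"
        using nn_integral_lborel_translate(2)[of "\<lambda>x. ennreal (norm x powr (2 * s - 2 * ?n) * indicator {r..}
            (norm x))" y] by simp
      also have "\<dots> \<le> ennreal (C * r powr (2 * s - ?n))" using C ar by blast
      also have "C * r powr (2 * s - ?n) = (sqrt C * r powr (s - ?n/2))\<^sup>2"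
        using C by (simp add: power_mult_distrib powr_square algebra_simps)
      finally show "(\<integral>\<^sup>+z. ennreal ((norm (y - z) powr (s - ?n) * indicator {r..} (norm (y - z)))\<^sup>2) \<partial>lborel)
        \<le> ennreal ((sqrt C * r powr (s - ?n/2))\<^sup>2)" .
    qed (use ar C in auto)
  qed (use C in simp)
qed

definition riesz_annulus :: "real \<Rightarrow> real \<Rightarrow> real \<Rightarrow> 'a::euclidean_space \<Rightarrow> real" where
  "riesz_annulus s r R x = norm x powr (s - real DIM('a)) * indicator {r..<R} (norm x)"

lemma measurable_riesz_annulus [measurable]: "riesz_annulus s r R \<in> borel_measurable borel"
  unfolding riesz_annulus_def by measurable

lemma riesz_annulus_nonneg [simp]: "0 \<le> riesz_annulus s r R x"
  by (simp add: riesz_annulus_def)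

text \<open>Tonelli moves the angular average onto the kernel. The averaged kernel
  \<open>\<kappa>\<close> is bounded by \<open>K\<close>, where only one dimension of singularity is
  left, and its integral over z is at most a multiple of |y|^s whatever \<delta> is. Interpolating
  these two bounds gives its L^2 norm, and Cauchy-Schwarz against \<open>g\<close> finishes.\<close>

lemma riesz_middle_average:
  assumes s: "0 < s" "s + 1 < real DIM('a::euclidean_space)"
  shows "\<exists>C>0. \<forall>\<delta>>0. \<forall>g\<in>borel_measurable (borel :: 'a measure). \<forall>a\<ge>0. \<forall>i\<in>Basis. \<forall>j\<in>Basis. \<forall>y. i \<noteq> j \<longrightarrow> y \<noteq> 0 \<longrightarrow>
    (\<forall>k\<in>Basis. \<bar>y \<bullet> k\<bar> \<le> \<bar>y \<bullet> i\<bar>) \<longrightarrow>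
    (\<integral>\<^sup>+z. ennreal ((g z)\<^sup>2) \<partial>lborel) \<le> ennreal (a\<^sup>2) \<longrightarrow>
    (\<integral>\<^sup>+\<theta>\<in>{0..1/2}. (\<integral>\<^sup>+z. ennreal (riesz_annulus s (\<delta> * norm y) (norm y) (plane_rot i j \<theta> y - z) * \<bar>g z\<bar>)
        \<partial>lborel) \<partial>lborel)
      \<le> ennreal (C * norm y powr (s - real DIM('a)/2) * \<delta> powr ((s + 1 - real DIM('a)) / 2) * a)"
proof -
  let ?n = "real DIM('a)"
  obtain C where C: "C > 0" "\<And>(i::'a) j y z r. i \<in> Basis \<Longrightarrow> j \<in> Basis \<Longrightarrow> i \<noteq> j \<Longrightarrow> y \<noteq> 0 \<Longrightarrow> 0 < r \<Longrightarrow>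
      \<forall>k\<in>Basis. \<bar>y \<bullet> k\<bar> \<le> \<bar>y \<bullet> i\<bar> \<Longrightarrow>
    (\<integral>\<^sup>+\<theta>\<in>{0..1/2}. ennreal (norm (plane_rot i j \<theta> y - z) powr (- (?n - s)) * indicator {r..} (norm (plane_rot
        i j \<theta> y - z))) \<partial>lborel)
    \<le> ennreal (C / norm y * r powr (1 - (?n - s)))"
    using plane_rot_average_riesz[where 'a = 'a, of "?n - s"] s by auto
  obtain D where D: "D > 0" "\<And>r y. r > 0 \<Longrightarrow>
      (\<integral>\<^sup>+z. ennreal (norm (y - z :: 'a) powr (s - ?n) * indicator {..<r} (norm (y - z))) \<partial>lborel)
          \<le> ennreal (D * r powr s)"
    using riesz_near[where 'a = 'a, of s] assms by auto
  show ?thesis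
  proof (intro exI conjI ballI allI impI)
    fix g :: "'a \<Rightarrow> real" and a \<delta> :: real and i j y :: 'a
    assume [measurable]: "g \<in> borel_measurable borel" and a: "0 \<le> a" and \<delta>: "\<delta> > 0" and ij: "i \<in> Basis"
        "j \<in> Basis" "i \<noteq> j"
      and y: "y \<noteq> 0" and m: "\<forall>k\<in>Basis. \<bar>y \<bullet> k\<bar> \<le> \<bar>y \<bullet> i\<bar>"
      and g: "(\<integral>\<^sup>+z. ennreal ((g z)\<^sup>2) \<partial>lborel) \<le> ennreal (a\<^sup>2)"
    define k where "k \<theta> z = riesz_annulus s (\<delta> * norm y) (norm y) (plane_rot i j \<theta> y - z)" for \<theta> z
    have k0: "0 \<le> k \<theta> z" for \<theta> z by (simp add: k_def)
    have [measurable (raw)]: "(\<lambda>x. k (p x) (q x)) \<in> borel_measurable M"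
      if [measurable]: "p \<in> borel_measurable M" "q \<in> borel_measurable M" for p q and M :: "'b measure"
      unfolding k_def by measurable
    define \<kappa> where "\<kappa> z = (\<integral>\<^sup>+\<theta>\<in>{0..1/2}. ennreal (k \<theta> z) \<partial>lborel)" for z
    have [measurable]: "\<kappa> \<in> borel_measurable borel"
      unfolding \<kappa>_def by measurable
    define K where "K = C / norm y * (\<delta> * norm y) powr (1 - (?n - s))"
    have K0: "0 \<le> K" using C by (simp add: K_def)
    have \<kappa>K: "\<kappa> z \<le> ennreal K" for z
    proof -
      have "\<kappa> z \<le> (\<integral>\<^sup>+\<theta>\<in>{0..1/2}. ennreal (norm (plane_rot i j \<theta> y - z) powr (- (?n - s)) * indicator {\<delta> *
          norm y..} (norm (plane_rot i j \<theta> y - z))) \<partial>lborel)"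
        unfolding \<kappa>_def by (intro nn_integral_mono mult_right_mono ennreal_leI)
           (auto simp: k_def riesz_annulus_def indicator_def)
      also have "\<dots> \<le> ennreal K" unfolding K_def using C(2)[OF ij y _ m] \<delta> y by simp
      finally show ?thesis .
    qed
    have "(\<integral>\<^sup>+z. \<kappa> z \<partial>lborel) = (\<integral>\<^sup>+\<theta>. (\<integral>\<^sup>+z. ennreal (k \<theta> z) * indicator {0..1/2} \<theta> \<partial>lborel) \<partial>lborel)"
      unfolding \<kappa>_def by (rule lborel_pair.Fubini') measurable
    also have "\<dots> = (\<integral>\<^sup>+\<theta>\<in>{0..1/2}. (\<integral>\<^sup>+z. ennreal (k \<theta> z) \<partial>lborel) \<partial>lborel)"
      by (simp add: nn_integral_multc)
    also have "\<dots> \<le> (\<integral>\<^sup>+\<theta>\<in>{0..1/2}. ennreal (D * norm y powr s) \<partial>(lborel :: real measure))"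
    proof (intro nn_integral_mono mult_right_mono)
      fix \<theta>
      have "(\<integral>\<^sup>+z. ennreal (k \<theta> z) \<partial>lborel) \<le> (\<integral>\<^sup>+z. ennreal (norm (plane_rot i j \<theta> y - z) powr (s - ?n) *
          indicator {..<norm y} (norm (plane_rot i j \<theta> y - z))) \<partial>lborel)"
        by (intro nn_integral_mono ennreal_leI) (auto simp: k_def riesz_annulus_def indicator_def)
      also have "\<dots> \<le> ennreal (D * norm y powr s)" using D y by simp
      finally show "(\<integral>\<^sup>+z. ennreal (k \<theta> z) \<partial>lborel) \<le> ennreal (D * norm y powr s)" .
    qed simp
    also have "\<dots> = ennreal (D * norm y powr s / 2)"
    proof -
      have "emeasure lborel {0..1/2::real} = ennreal (1/2)" by (subst emeasure_lborel_Icc) simp_all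
      then have "(\<integral>\<^sup>+\<theta>\<in>{0..1/2}. ennreal (D * norm y powr s) \<partial>(lborel :: real measure))
          = ennreal (D * norm y powr s) * ennreal (1/2)"
        by (simp only: nn_integral_cmult_indicator[of "{0..1/2::real}" lborel] sets_lborel borel_closed
            closed_atLeastAtMost)
      also have "\<dots> = ennreal (D * norm y powr s / 2)"
        using D by (subst ennreal_mult[symmetric]) auto
      finally show ?thesis .
    qed
    finally have \<kappa>1: "(\<integral>\<^sup>+z. \<kappa> z \<partial>lborel) \<le> ennreal (D * norm y powr s / 2)" .
    \<comment> \<open>A real-valued copy of \<open>\<kappa>\<close>, faithful because
      \<open>\<kappa>\<close> is bounded by the finite number \<open>K\<close>.\<close>
    define f where "f z = enn2real (\<kappa> z)" for z
    have f: "\<kappa> z = ennreal (f z)" for z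
      unfolding f_def using \<kappa>K[of z] by (intro ennreal_enn2real[symmetric]) (auto simp: less_top[symmetric]
          top_unique)
    have f0: "0 \<le> f z" for z by (simp add: f_def)
    have [measurable]: "f \<in> borel_measurable borel" unfolding f_def by measurable
    have fK: "f z \<le> K" for z using \<kappa>K[of z] unfolding f using K0 by simp
    \<comment> \<open>The geometric mean of the sup bound and the L^1 bound, from f^2 <= K
      f.\<close>
    define b where "b = sqrt (K * (D * norm y powr s / 2))"
    have b0: "0 \<le> b" using K0 D by (simp add: b_def)
    have fb: "(\<integral>\<^sup>+z. ennreal ((f z)\<^sup>2) \<partial>lborel) \<le> ennreal (b\<^sup>2)"
    proof -
      have "(\<integral>\<^sup>+z. ennreal ((f z)\<^sup>2) \<partial>lborel) \<le> (\<integral>\<^sup>+z. ennreal K * ennreal (f z) \<partial>lborel)"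
        using f0 fK K0 by (intro nn_integral_mono) (simp add: ennreal_mult[symmetric] power2_eq_square
            mult_right_mono ennreal_leI)
      also have "\<dots> = ennreal K * (\<integral>\<^sup>+z. \<kappa> z \<partial>lborel)" unfolding f by (simp add: nn_integral_cmult)
      also have "\<dots> \<le> ennreal K * ennreal (D * norm y powr s / 2)" using \<kappa>1 by (rule mult_left_mono) simp
      also have "\<dots> = ennreal (b\<^sup>2)" using K0 D by (simp add: b_def ennreal_mult[symmetric])
      finally show ?thesis .
    qed
    have "(\<integral>\<^sup>+\<theta>\<in>{0..1/2}. (\<integral>\<^sup>+z. ennreal (k \<theta> z * \<bar>g z\<bar>) \<partial>lborel) \<partial>lborel)
      = (\<integral>\<^sup>+\<theta>. (\<integral>\<^sup>+z. ennreal (k \<theta> z) * indicator {0..1/2} \<theta> * ennreal \<bar>g z\<bar> \<partial>lborel) \<partial>lborel)"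
    proof (rule nn_integral_cong)
      fix \<theta>
      have "(\<integral>\<^sup>+z. ennreal (k \<theta> z * \<bar>g z\<bar>) \<partial>lborel) * indicator {0..1/2} \<theta>
        = (\<integral>\<^sup>+z. ennreal (k \<theta> z * \<bar>g z\<bar>) * indicator {0..1/2} \<theta> \<partial>lborel)"
        by (simp add: nn_integral_multc)
      then show "(\<integral>\<^sup>+z. ennreal (k \<theta> z * \<bar>g z\<bar>) \<partial>lborel) * indicator {0..1/2} \<theta>
        = (\<integral>\<^sup>+z. ennreal (k \<theta> z) * indicator {0..1/2} \<theta> * ennreal \<bar>g z\<bar> \<partial>lborel)"
        using k0 by (simp add: ennreal_mult mult_ac)
    qed
    also have "\<dots> = (\<integral>\<^sup>+z. (\<integral>\<^sup>+\<theta>. ennreal (k \<theta> z) * indicator {0..1/2} \<theta> * ennreal \<bar>g z\<bar> \<partial>lborel) \<partial>lborel)"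
      by (rule lborel_pair.Fubini') measurable
    also have "\<dots> = (\<integral>\<^sup>+z. \<kappa> z * ennreal \<bar>g z\<bar> \<partial>lborel)"
      by (simp add: nn_integral_multc \<kappa>_def)
    also have "\<dots> = (\<integral>\<^sup>+z. ennreal (f z * \<bar>g z\<bar>) \<partial>lborel)"
      unfolding f using f0 by (simp add: ennreal_mult)
    also have "\<dots> \<le> ennreal (b * a)"
      by (rule Cauchy_Schwarz_nn_integral_bound[OF _ _ _ _ _ g fb]) (use f0 a b0 in auto)
    also have "b = sqrt (C * D / 2) * norm y powr (s - ?n/2) * \<delta> powr ((s + 1 - ?n) / 2)"
    proof -
      have "K * (D * norm y powr s / 2) = C * D / 2 * (norm y powr (-1) * norm y powr (1 - (?n - s)) * norm y
          powr s) * \<delta> powr (1 - (?n - s))"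
        unfolding K_def powr_mult using y by (simp add: powr_minus field_simps)
      also have "norm y powr (-1) * norm y powr (1 - (?n - s)) * norm y powr s = (norm y powr (s - ?n/2))\<^sup>2"
        unfolding powr_square powr_add[symmetric]
          by (intro arg_cong[where f = "\<lambda>t. norm y powr t"]) simp
      also have "\<delta> powr (1 - (?n - s)) = (\<delta> powr ((s + 1 - ?n) / 2))\<^sup>2"
        unfolding powr_square
          by (intro arg_cong[where f = "\<lambda>t. \<delta> powr t"]) simp
      also have "C * D / 2 * (norm y powr (s - ?n/2))\<^sup>2 * (\<delta> powr ((s + 1 - ?n) / 2))\<^sup>2
          = (sqrt (C * D / 2) * norm y powr (s - ?n/2) * \<delta> powr ((s + 1 - ?n) / 2))\<^sup>2"
        unfolding power_mult_distrib using C D by (subst real_sqrt_pow2) auto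
      finally show ?thesis unfolding b_def using C D by (simp only:) (rule real_sqrt_unique, auto)
    qed
    finally show "(\<integral>\<^sup>+\<theta>\<in>{0..1/2}. (\<integral>\<^sup>+z. ennreal (riesz_annulus s (\<delta> * norm y) (norm y) (plane_rot i j \<theta> y -
        z) * \<bar>g z\<bar>) \<partial>lborel) \<partial>lborel)
      \<le> ennreal (sqrt (C * D / 2) * norm y powr (s - ?n/2) * \<delta> powr ((s + 1 - ?n) / 2) * a)"
      by (simp only: k_def)
  qed (use C D in simp)
qed

definition riesz_pot :: "real \<Rightarrow> ('a::euclidean_space \<Rightarrow> real) \<Rightarrow> 'a \<Rightarrow> ennreal" where
  "riesz_pot s g y = (\<integral>\<^sup>+z. ennreal (norm (y - z) powr (s - real DIM('a)) * \<bar>g z\<bar>) \<partial>lborel)"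

definition riesz_near_pot :: "real \<Rightarrow> real \<Rightarrow> ('a::euclidean_space \<Rightarrow> real) \<Rightarrow> 'a \<Rightarrow> ennreal" where
  "riesz_near_pot s \<delta> g y = (\<integral>\<^sup>+z. ennreal (norm (y - z) powr (s - real DIM('a)) *
     indicator {..<\<delta> * norm y} (norm (y - z)) * \<bar>g z\<bar>) \<partial>lborel)"

lemma measurable_riesz_pot [measurable]:
  assumes [measurable]: "g \<in> borel_measurable borel"
  shows "riesz_pot s g \<in> borel_measurable borel"
  unfolding riesz_pot_def by measurable

lemma measurable_riesz_near_pot [measurable]:
  assumes [measurable]: "g \<in> borel_measurable borel"
  shows "riesz_near_pot s \<delta> g \<in> borel_measurable borel"
  unfolding riesz_near_pot_def indicator_def of_bool_def lessThan_iff by measurable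

text \<open>An inequality rather than an equality: \<delta> is unrestricted, so the three ranges of
  |y - z| always cover everything but may overlap.\<close>

lemma riesz_pot_split:
  fixes y :: "'a::euclidean_space"
  assumes [measurable]: "g \<in> borel_measurable borel"
  shows "riesz_pot s g y \<le> riesz_near_pot s \<delta> g y
    + (\<integral>\<^sup>+z. ennreal (riesz_annulus s (\<delta> * norm y) (norm y) (y - z) * \<bar>g z\<bar>) \<partial>lborel)
    + (\<integral>\<^sup>+z. ennreal (norm (y - z) powr (s - real DIM('a)) * indicator {norm y..} (norm (y - z)) * \<bar>g z\<bar>)
        \<partial>lborel)"
proof -
  have "riesz_pot s g y \<le> (\<integral>\<^sup>+z. ennreal (norm (y - z) powr (s - real DIM('a)) * indicator {..<\<delta> * norm y}
      (norm (y - z)) * \<bar>g z\<bar>)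
     + ennreal (riesz_annulus s (\<delta> * norm y) (norm y) (y - z) * \<bar>g z\<bar>)
     + ennreal (norm (y - z) powr (s - real DIM('a)) * indicator {norm y..} (norm (y - z)) * \<bar>g z\<bar>) \<partial>lborel)"
    unfolding riesz_pot_def
    by (intro nn_integral_mono) (auto simp: riesz_annulus_def indicator_def ennreal_leI simp flip:
        ennreal_plus)
  also have "\<dots> = riesz_near_pot s \<delta> g y
    + (\<integral>\<^sup>+z. ennreal (riesz_annulus s (\<delta> * norm y) (norm y) (y - z) * \<bar>g z\<bar>) \<partial>lborel)
    + (\<integral>\<^sup>+z. ennreal (norm (y - z) powr (s - real DIM('a)) * indicator {norm y..} (norm (y - z)) * \<bar>g z\<bar>)
        \<partial>lborel)"
    unfolding riesz_near_pot_def by (simp add: nn_integral_add)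
  finally show ?thesis .
qed

text \<open>Rotations preserve the norm, so the radii of the split are the same for all angles. The
  far part is bounded pointwise without any \<delta>; it is absorbed into the annular bound because
  a negative power of \<delta> <= 1 is at least 1.\<close>

lemma riesz_pot_rot_average:
  assumes s: "0 < s" "s < 1" "2 \<le> DIM('a::euclidean_space)"
  shows "\<exists>C>0. \<forall>\<delta>\<in>{0<..1}. \<forall>g\<in>borel_measurable (borel :: 'a measure). \<forall>a\<ge>0. \<forall>i\<in>Basis. \<forall>j\<in>Basis. \<forall>y. i \<noteq> j \<longrightarrow>
      y \<noteq> 0 \<longrightarrow>
    (\<forall>k\<in>Basis. \<bar>y \<bullet> k\<bar> \<le> \<bar>y \<bullet> i\<bar>) \<longrightarrow>
    (\<integral>\<^sup>+z. ennreal ((g z)\<^sup>2) \<partial>lborel) \<le> ennreal (a\<^sup>2) \<longrightarrow>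
    (\<integral>\<^sup>+\<theta>\<in>{0..1/2}. riesz_pot s g (plane_rot i j \<theta> y) \<partial>lborel)
      \<le> (\<integral>\<^sup>+\<theta>\<in>{0..1/2}. riesz_near_pot s \<delta> g (plane_rot i j \<theta> y) \<partial>lborel)
        + ennreal (C * norm y powr (s - real DIM('a)/2) * \<delta> powr ((s + 1 - real DIM('a)) / 2) * a)"
proof -
  let ?n = "real DIM('a)"
  have n: "s + 1 < ?n" "2 * s < ?n" using s by auto
  obtain C where C: "C > 0" "\<And>\<delta> g a (i::'a) j y. \<delta> > 0 \<Longrightarrow> g \<in> borel_measurable borel \<Longrightarrow> 0 \<le> a \<Longrightarrow> i \<in> Basis \<Longrightarrow>
      j \<in> Basis \<Longrightarrow> i \<noteq> j \<Longrightarrow>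
    y \<noteq> 0 \<Longrightarrow> \<forall>k\<in>Basis. \<bar>y \<bullet> k\<bar> \<le> \<bar>y \<bullet> i\<bar> \<Longrightarrow> (\<integral>\<^sup>+z. ennreal ((g z)\<^sup>2) \<partial>lborel) \<le> ennreal (a\<^sup>2) \<Longrightarrow>
    (\<integral>\<^sup>+\<theta>\<in>{0..1/2}. (\<integral>\<^sup>+z. ennreal (riesz_annulus s (\<delta> * norm y) (norm y) (plane_rot i j \<theta> y - z) * \<bar>g z\<bar>)
        \<partial>lborel) \<partial>lborel)
      \<le> ennreal (C * norm y powr (s - ?n/2) * \<delta> powr ((s + 1 - ?n) / 2) * a)"
    using riesz_middle_average[where 'a = 'a, OF s(1) n(1)] by auto
  obtain D where D: "D > 0" "\<And>g a y r. g \<in> borel_measurable borel \<Longrightarrow> 0 \<le> a \<Longrightarrow> 0 < r \<Longrightarrow>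
    (\<integral>\<^sup>+z. ennreal ((g z)\<^sup>2) \<partial>lborel) \<le> ennreal (a\<^sup>2) \<Longrightarrow>
    (\<integral>\<^sup>+z. ennreal (norm (y - z :: 'a) powr (s - ?n) * indicator {r..} (norm (y - z)) * \<bar>g z\<bar>) \<partial>lborel)
      \<le> ennreal (D * r powr (s - ?n/2) * a)"
    using riesz_far[where 'a = 'a, OF n(2)] by auto
  show ?thesis
  proof (intro exI conjI ballI allI impI)
    fix g :: "'a \<Rightarrow> real" and a \<delta> :: real and i j y :: 'a
    assume [measurable]: "g \<in> borel_measurable borel" and a: "0 \<le> a" and \<delta>: "\<delta> \<in> {0<..1}" and ij: "i \<in> Basis"
        "j \<in> Basis" "i \<noteq> j"
      and y: "y \<noteq> 0" and m: "\<forall>k\<in>Basis. \<bar>y \<bullet> k\<bar> \<le> \<bar>y \<bullet> i\<bar>"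
      and g: "(\<integral>\<^sup>+z. ennreal ((g z)\<^sup>2) \<partial>lborel) \<le> ennreal (a\<^sup>2)"
    let ?R = "\<lambda>\<theta>. plane_rot i j \<theta> y" and ?I = "\<lambda>\<theta>. indicator {0..1/2} (\<theta>::real) :: ennreal"
    let ?p = "norm y powr (s - ?n/2)" and ?d = "\<delta> powr ((s + 1 - ?n) / 2)"
    let ?N = "\<lambda>\<theta>. riesz_near_pot s \<delta> g (?R \<theta>)"
    let ?M = "\<lambda>\<theta>. (\<integral>\<^sup>+z. ennreal (riesz_annulus s (\<delta> * norm y) (norm y) (?R \<theta> - z) * \<bar>g z\<bar>) \<partial>lborel)"
    have [measurable]: "?M \<in> borel_measurable borel" unfolding riesz_annulus_def by measurable
    have d1: "1 \<le> ?d"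
    proof -
      have "1 powr ((s + 1 - ?n) / 2) \<le> ?d" using \<delta> n by (intro powr_mono2') auto
      then show ?thesis by simp
    qed
    have "(\<integral>\<^sup>+\<theta>\<in>{0..1/2}. riesz_pot s g (?R \<theta>) \<partial>lborel)
      \<le> (\<integral>\<^sup>+\<theta>. ?N \<theta> * ?I \<theta> + ?M \<theta> * ?I \<theta> + ennreal (D * ?p * a) * ?I \<theta> \<partial>lborel)"
    proof (intro nn_integral_mono)
      fix \<theta>
      have "riesz_pot s g (?R \<theta>) \<le> ?N \<theta> + ?M \<theta> + ennreal (D * ?p * a)"
      proof -
        have "(\<integral>\<^sup>+z. ennreal (norm (?R \<theta> - z) powr (s - ?n) * indicator {norm y..} (norm (?R \<theta> - z)) * \<bar>g z\<bar>)
            \<partial>lborel)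
          \<le> ennreal (D * ?p * a)"
          using D(2)[of g a "norm y" "?R \<theta>"] a g y by simp
        from order_trans[OF riesz_pot_split[of g s "?R \<theta>" \<delta>, unfolded norm_plane_rot[OF ij]] add_left_mono[OF
            this]]
        show ?thesis by simp
      qed
      then show "riesz_pot s g (?R \<theta>) * ?I \<theta> \<le> ?N \<theta> * ?I \<theta> + ?M \<theta> * ?I \<theta> + ennreal (D * ?p * a) * ?I \<theta>"
        unfolding distrib_right[symmetric] by (rule mult_right_mono) simp
    qed
    also have "\<dots> = (\<integral>\<^sup>+\<theta>. ?N \<theta> * ?I \<theta> \<partial>lborel) + (\<integral>\<^sup>+\<theta>. ?M \<theta> * ?I \<theta> \<partial>lborel)
        + (\<integral>\<^sup>+\<theta>. ennreal (D * ?p * a) * ?I \<theta> \<partial>lborel)"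
      by (simp add: nn_integral_add)
    also have "\<dots> \<le> (\<integral>\<^sup>+\<theta>. ?N \<theta> * ?I \<theta> \<partial>lborel) + ennreal (C * ?p * ?d * a) + ennreal (D * ?p * ?d * a)"
    proof (intro add_mono order_refl)
      show "(\<integral>\<^sup>+\<theta>. ?M \<theta> * ?I \<theta> \<partial>lborel) \<le> ennreal (C * ?p * ?d * a)"
        using C(2)[of \<delta> g a i j y] \<delta> a ij y m g by simp
      have "(\<integral>\<^sup>+\<theta>. ennreal (D * ?p * a) * ?I \<theta> \<partial>lborel) = ennreal (D * ?p * a) * emeasure lborel
          {0..1/2::real}"
        by (rule nn_integral_cmult_indicator) simp
      also have "\<dots> \<le> ennreal (D * ?p * a) * ennreal ?d"
        using d1 by (intro mult_left_mono) (auto simp: ennreal_leI simp del: ennreal_half)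
      also have "\<dots> = ennreal (D * ?p * ?d * a)"
        using D a by (simp add: ennreal_mult[symmetric] mult_ac)
      finally show "(\<integral>\<^sup>+\<theta>. ennreal (D * ?p * a) * ?I \<theta> \<partial>lborel) \<le> ennreal (D * ?p * ?d * a)" .
    qed
    also have "\<dots> = (\<integral>\<^sup>+\<theta>. ?N \<theta> * ?I \<theta> \<partial>lborel) + ennreal ((C + D) * ?p * ?d * a)"
      using C D a by (simp add: add.assoc distrib_right flip: ennreal_plus)
    finally show "(\<integral>\<^sup>+\<theta>\<in>{0..1/2}. riesz_pot s g (?R \<theta>) \<partial>lborel) \<le> (\<integral>\<^sup>+\<theta>\<in>{0..1/2}. ?N \<theta> \<partial>lborel) + ennreal ((C
        + D) * ?p * ?d * a)" .
  qed (use C D in simp)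
qed

text \<open>The arc traced by one point y is a null set in dimension at least 2, so an
  almost-everywhere property gives no information along a given arc. Fubini in angle and point, with
  the invariance of Lebesgue measure, shows that for almost every y almost every rotated point
  avoids the exceptional set. The 1/2 on the left is the length of the angle interval.\<close>

lemma radial_le_rot_average:
  fixes u :: "'a::euclidean_space \<Rightarrow> real" and Q :: "'a \<Rightarrow> ennreal"
  assumes [measurable]: "Q \<in> borel_measurable borel"
    and rad: "AE y in lborel. u y = f (norm y)" and le: "AE y in lborel. ennreal \<bar>u y\<bar> \<le> Q y"
    and ij: "i \<in> Basis" "j \<in> Basis" "i \<noteq> j"
  shows "AE y in lborel. ennreal (\<bar>u y\<bar> / 2) \<le> (\<integral>\<^sup>+\<theta>\<in>{0..1/2}. Q (plane_rot i j \<theta> y) \<partial>lborel)"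
proof -
  have "AE y in lborel. u y = f (norm y) \<and> ennreal \<bar>u y\<bar> \<le> Q y" using rad le by auto
  then obtain N where N: "{y \<in> space lborel. \<not> (u y = f (norm y) \<and> ennreal \<bar>u y\<bar> \<le> Q y)} \<subseteq> N"
      "N \<in> null_sets lborel"
    by (elim AE_E) (auto simp: null_sets_def)
  have N': "u x = f (norm x) \<and> ennreal \<bar>u x\<bar> \<le> Q x" if "x \<notin> N" for x
    using contra_subsetD[OF N(1) that] unfolding mem_Collect_eq space_lborel space_borel by blast
  have [measurable]: "N \<in> sets borel" using N(2) by (auto simp: null_sets_def)
  have N0: "(\<integral>\<^sup>+y. indicator N y \<partial>lborel) = 0" using N(2) by (simp add: null_sets_def)
  have "(\<integral>\<^sup>+y. (\<integral>\<^sup>+\<theta>. indicator N (plane_rot i j \<theta> y) * indicator {0..1/2} \<theta> \<partial>lborel) \<partial>lborel)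
    = (\<integral>\<^sup>+\<theta>. (\<integral>\<^sup>+y. indicator N (plane_rot i j \<theta> y) * indicator {0..1/2} \<theta> \<partial>lborel) \<partial>lborel)"
    by (rule lborel_pair.Fubini') measurable
  also have "\<dots> = (\<integral>\<^sup>+\<theta>. 0 \<partial>(lborel :: real measure))"
  proof (rule nn_integral_cong)
    fix \<theta> :: real
    show "(\<integral>\<^sup>+y. indicator N (plane_rot i j \<theta> y) * indicator {0..1/2} \<theta> \<partial>lborel) = 0"
      using nn_integral_lborel_plane_rot[of "indicator N" i j \<theta>] ij N0
      by (auto simp: indicator_def[of "{0..1/2}"] nn_integral_multc)
  qed
  also have "\<dots> = 0" by simp
  finally have "AE y in lborel. (\<integral>\<^sup>+\<theta>. indicator N (plane_rot i j \<theta> y) * indicator {0..1/2} \<theta> \<partial>lborel) = 0"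
    by (rule nn_integral_0_iff_AE[THEN iffD1, rotated]) measurable
  moreover have "AE y in lborel. y \<notin> N" using N(2) by (rule AE_not_in)
  ultimately show ?thesis
  proof eventually_elim
    case (elim y)
    have ae: "AE \<theta> in lborel. indicator N (plane_rot i j \<theta> y) * indicator {0..1/2} \<theta> = (0::ennreal)"
      using elim(1) by (rule nn_integral_0_iff_AE[THEN iffD1, rotated]) measurable
    have "ennreal (\<bar>u y\<bar> / 2) = (\<integral>\<^sup>+\<theta>. ennreal \<bar>u y\<bar> * indicator {0..1/2} (\<theta>::real) \<partial>lborel)"
    proof -
      have "emeasure lborel {0..1/2::real} = ennreal (1/2)" by (subst emeasure_lborel_Icc) simp_all
      moreover have "(\<integral>\<^sup>+\<theta>. ennreal \<bar>u y\<bar> * indicator {0..1/2} (\<theta>::real) \<partial>lborel)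
          = ennreal \<bar>u y\<bar> * emeasure lborel {0..1/2::real}"
        by (rule nn_integral_cmult_indicator) simp
      moreover have "ennreal (\<bar>u y\<bar> / 2) = ennreal \<bar>u y\<bar> * ennreal (1/2)"
        by (subst ennreal_mult[symmetric]) auto
      ultimately show ?thesis by simp
    qed
    also have "\<dots> \<le> (\<integral>\<^sup>+\<theta>\<in>{0..1/2}. Q (plane_rot i j \<theta> y) \<partial>lborel)"
    proof (rule nn_integral_mono_AE)
      show "AE \<theta> in lborel. ennreal \<bar>u y\<bar> * indicator {0..1/2} \<theta> \<le> Q (plane_rot i j \<theta> y) * indicator {0..1/2}
          \<theta>"
        using ae
      proof eventually_elim
        case (elim \<theta>)
        show ?case
        proof (cases "\<theta> \<in> {0..1/2}")
          case True
          with elim have "plane_rot i j \<theta> y \<notin> N" by (auto simp: indicator_def split: if_splits)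
          then have "u (plane_rot i j \<theta> y) = f (norm y)" "ennreal \<bar>u (plane_rot i j \<theta> y)\<bar>
              \<le> Q (plane_rot i j \<theta> y)"
            using N' [of "plane_rot i j \<theta> y"] norm_plane_rot[OF ij] by auto
          moreover have "u y = f (norm y)" using N' \<open>y \<notin> N\<close> by auto
          ultimately show ?thesis using True by simp
        qed simp
      qed
    qed
    finally show ?case .
  qed
qed

text \<open>Averaging does not worsen the near estimate: Cauchy-Schwarz in \<theta> moves the square
  under the average, and for every angle both the weight and Lebesgue measure are rotation
  invariant.\<close>

lemma riesz_near_pot_average_bound:
  assumes s: "0 < s" "s \<le> real DIM('a::euclidean_space)"
  shows "\<exists>C>0. \<forall>\<delta>\<in>{0<..1/2}. \<forall>g\<in>borel_measurable (borel :: 'a measure). \<forall>i\<in>Basis. \<forall>j\<in>Basis. i \<noteq> j \<longrightarrow>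
    (\<integral>\<^sup>+y. ennreal (norm y powr (- 2 * s)) * (\<integral>\<^sup>+\<theta>\<in>{0..1/2}. riesz_near_pot s \<delta> g (plane_rot i j \<theta> y)
        \<partial>lborel)\<^sup>2 \<partial>lborel)
    \<le> ennreal (C * \<delta> powr (2 * s)) * (\<integral>\<^sup>+z. ennreal ((g z)\<^sup>2) \<partial>lborel)"
proof -
  obtain C where C: "C > 0" "\<And>\<delta> g. \<delta> \<in> {0<..1/2} \<Longrightarrow> g \<in> borel_measurable (borel :: 'a measure) \<Longrightarrow>
    (\<integral>\<^sup>+y. ennreal (norm y powr (- 2 * s)) * (riesz_near_pot s \<delta> g y)\<^sup>2 \<partial>lborel)
    \<le> ennreal (C * \<delta> powr (2 * s)) * (\<integral>\<^sup>+z. ennreal ((g z)\<^sup>2) \<partial>lborel)"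
    unfolding riesz_near_pot_def using riesz_near_schur[where 'a = 'a, of s] s by blast
  show ?thesis
  proof (intro exI conjI ballI impI)
    fix g :: "'a \<Rightarrow> real" and \<delta> :: real and i j :: 'a
    assume [measurable]: "g \<in> borel_measurable borel" and \<delta>: "\<delta> \<in> {0<..1/2}" and ij: "i \<in> Basis" "j \<in> Basis"
        "i \<noteq> j"
    define F where "F \<theta> y = riesz_near_pot s \<delta> g (plane_rot i j \<theta> y)" for \<theta> y
    let ?I = "\<lambda>\<theta>. indicator {0..1/2} (\<theta>::real) :: ennreal"
    have [measurable]: "(\<lambda>\<theta>. F \<theta> y) \<in> borel_measurable borel" for y unfolding F_def by measurable
    have [measurable]: "(\<lambda>p. F (snd p) (fst p)) \<in> borel_measurable (borel \<Otimes>\<^sub>M borel)"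
      "(\<lambda>p. F (fst p) (snd p)) \<in> borel_measurable (borel \<Otimes>\<^sub>M borel)"
      unfolding F_def by measurable
    have half: "emeasure lborel {0..1/2::real} \<le> 1"
      using ennreal_leI[of "1/2" 1] by (subst emeasure_lborel_Icc) (simp_all del: ennreal_half)
    have sq: "(\<integral>\<^sup>+\<theta>\<in>{0..1/2}. F \<theta> y \<partial>lborel)\<^sup>2 \<le> (\<integral>\<^sup>+\<theta>\<in>{0..1/2}. (F \<theta> y)\<^sup>2 \<partial>lborel)" for y
    proof -
      have "(\<integral>\<^sup>+\<theta>\<in>{0..1/2}. F \<theta> y \<partial>lborel)\<^sup>2 = (\<integral>\<^sup>+\<theta>. F \<theta> y * ?I \<theta> * ?I \<theta> \<partial>lborel)\<^sup>2"
        by (intro arg_cong[where f = "\<lambda>x. x\<^sup>2"] nn_integral_cong) (auto simp: indicator_def)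
      also have "\<dots> \<le> (\<integral>\<^sup>+\<theta>. (F \<theta> y * ?I \<theta>)\<^sup>2 \<partial>lborel) * (\<integral>\<^sup>+\<theta>. (?I \<theta>)\<^sup>2 \<partial>lborel)"
        by (rule Cauchy_Schwarz_nn_integral) measurable
      also have "(\<integral>\<^sup>+\<theta>. (?I \<theta>)\<^sup>2 \<partial>lborel) = (\<integral>\<^sup>+\<theta>. ?I \<theta> \<partial>lborel)"
        by (intro nn_integral_cong) (auto simp: indicator_def)
      also have "(\<integral>\<^sup>+\<theta>. (F \<theta> y * ?I \<theta>)\<^sup>2 \<partial>lborel) = (\<integral>\<^sup>+\<theta>\<in>{0..1/2}. (F \<theta> y)\<^sup>2 \<partial>lborel)"
        by (intro nn_integral_cong) (auto simp: indicator_def)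
      also have "(\<integral>\<^sup>+\<theta>\<in>{0..1/2}. (F \<theta> y)\<^sup>2 \<partial>lborel) * (\<integral>\<^sup>+\<theta>. ?I \<theta> \<partial>lborel)
          \<le> (\<integral>\<^sup>+\<theta>\<in>{0..1/2}. (F \<theta> y)\<^sup>2 \<partial>lborel) * 1"
        using half by (intro mult_left_mono) auto
      finally show ?thesis by simp
    qed
    have "(\<integral>\<^sup>+y. ennreal (norm y powr (- 2 * s)) * (\<integral>\<^sup>+\<theta>\<in>{0..1/2}. F \<theta> y \<partial>lborel)\<^sup>2 \<partial>lborel)
      \<le> (\<integral>\<^sup>+y. ennreal (norm y powr (- 2 * s)) * (\<integral>\<^sup>+\<theta>\<in>{0..1/2}. (F \<theta> y)\<^sup>2 \<partial>lborel) \<partial>lborel)"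
      by (intro nn_integral_mono mult_left_mono sq) simp
    also have "\<dots> = (\<integral>\<^sup>+y. (\<integral>\<^sup>+\<theta>. ennreal (norm y powr (- 2 * s)) * ((F \<theta> y)\<^sup>2 * ?I \<theta>) \<partial>lborel) \<partial>lborel)"
      by (simp add: nn_integral_cmult)
    also have "\<dots> = (\<integral>\<^sup>+\<theta>. (\<integral>\<^sup>+y. ennreal (norm y powr (- 2 * s)) * ((F \<theta> y)\<^sup>2 * ?I \<theta>) \<partial>lborel) \<partial>lborel)"
      by (rule lborel_pair.Fubini') measurable
    also have "\<dots> \<le> (\<integral>\<^sup>+\<theta>. ennreal (C * \<delta> powr (2 * s)) * (\<integral>\<^sup>+z. ennreal ((g z)\<^sup>2) \<partial>lborel) * ?I \<theta> \<partial>lborel)"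
    proof (rule nn_integral_mono)
      fix \<theta> :: real
      let ?G = "\<lambda>y. ennreal (norm y powr (- 2 * s)) * (riesz_near_pot s \<delta> g y)\<^sup>2"
      show "(\<integral>\<^sup>+y. ennreal (norm y powr (- 2 * s)) * ((F \<theta> y)\<^sup>2 * ?I \<theta>) \<partial>lborel)
        \<le> ennreal (C * \<delta> powr (2 * s)) * (\<integral>\<^sup>+z. ennreal ((g z)\<^sup>2) \<partial>lborel) * ?I \<theta>"
      proof (cases "\<theta> \<in> {0..1/2}")
        case True
        have "(\<integral>\<^sup>+y. ennreal (norm y powr (- 2 * s)) * ((F \<theta> y)\<^sup>2 * ?I \<theta>) \<partial>lborel)
            = (\<integral>\<^sup>+y. ?G (plane_rot i j \<theta> y) \<partial>lborel)"
          using True by (simp add: F_def norm_plane_rot[OF ij])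
        also have "\<dots> = (\<integral>\<^sup>+y. ?G y \<partial>lborel)"
          using True ij by (intro nn_integral_lborel_plane_rot) auto
        finally show ?thesis using C(2)[OF \<delta>, of g] True by simp
      qed simp
    qed
    also have "\<dots> = ennreal (C * \<delta> powr (2 * s)) * (\<integral>\<^sup>+z. ennreal ((g z)\<^sup>2) \<partial>lborel) * emeasure lborel
        {0..1/2::real}"
      by (rule nn_integral_cmult_indicator) simp
    also have "\<dots> \<le> ennreal (C * \<delta> powr (2 * s)) * (\<integral>\<^sup>+z. ennreal ((g z)\<^sup>2) \<partial>lborel) * 1"
      using half by (rule mult_left_mono) simp
    finally show "(\<integral>\<^sup>+y. ennreal (norm y powr (- 2 * s)) * (\<integral>\<^sup>+\<theta>\<in>{0..1/2}. riesz_near_pot s \<delta> g (plane_rot i j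
        \<theta> y) \<partial>lborel)\<^sup>2 \<partial>lborel)
      \<le> ennreal (C * \<delta> powr (2 * s)) * (\<integral>\<^sup>+z. ennreal ((g z)\<^sup>2) \<partial>lborel)"
      by (simp add: F_def)
  qed (use C in simp)
qed

section \<open>Weak-type estimate for radial functions\<close>

lemma ex_max_coordinate:
  fixes y :: "'a::euclidean_space"
  shows "\<exists>i\<in>Basis. \<forall>k\<in>Basis. \<bar>y \<bullet> k\<bar> \<le> \<bar>y \<bullet> i\<bar>"
proof -
  have "finite ((\<lambda>k. \<bar>y \<bullet> k\<bar>) ` (Basis::'a set))" "(\<lambda>k. \<bar>y \<bullet> k\<bar>) ` (Basis::'a set) \<noteq> {}" by auto
  from Max_in[OF this] Max_ge[OF this(1)] show ?thesis by fastforce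
qed

lemma ex_other_Basis:
  assumes "2 \<le> DIM('a::euclidean_space)" "i \<in> (Basis :: 'a set)"
  shows "\<exists>j\<in>Basis. i \<noteq> j"
proof (rule ccontr)
  assume "\<not> ?thesis"
  then have "(Basis :: 'a set) \<subseteq> {i}" by auto
  then have "DIM('a) \<le> card {i}" by (intro card_mono) auto
  with assms show False by simp
qed

text \<open>Obtained by solving a \<delta>^(-(n-1-s)/2) ~ \<beta> for \<delta> and inserting the
  result into the Chebyshev bound (a \<delta>^s/\<beta>)^2: the 2 comes from L^2, the fraction from
  \<delta>^(2s).\<close>

definition weak_exponent :: "real \<Rightarrow> real \<Rightarrow> real" where
  "weak_exponent n s = 2 + 4 * s / (n - 1 - s)"

text \<open>Chebyshev's inequality for the near part, at the scale \<delta> at which the remaining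
  part uses up half of the available level. Levels below a multiple of \<open>a\<close> are excluded
  because the near estimate is available only for \<delta> <= 1/2.\<close>

lemma radial_weak_type:
  assumes s: "0 < s" "s < 1" "2 \<le> DIM('a::euclidean_space)" and c: "0 < c"
  shows "\<exists>C>0. \<forall>g\<in>borel_measurable (borel :: 'a measure). \<forall>u\<in>borel_measurable borel. \<forall>a>0. \<forall>\<beta>\<ge>C*a.
    (\<integral>\<^sup>+z. ennreal ((g z)\<^sup>2) \<partial>lborel) \<le> ennreal (a\<^sup>2) \<longrightarrow>
    (\<exists>f. AE y in lborel. u y = f (norm y)) \<longrightarrow>
    (AE y in lborel. ennreal \<bar>u y\<bar> \<le> ennreal c * riesz_pot s g y) \<longrightarrow>
    (\<integral>\<^sup>+y. ennreal (norm y powr (- real DIM('a))) * indicator {y. \<beta> < norm y powr (real DIM('a) / 2 - s) * \<bar>u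
        y\<bar>} y \<partial>lborel)
      \<le> ennreal (C * (a / \<beta>) powr weak_exponent (real DIM('a)) s)"
proof -
  let ?n = "real DIM('a)"
  define m where "m = ?n - 1 - s"
  have m: "m > 0" using s by (simp add: m_def)
  obtain C where C: "C > 0" "\<And>\<delta> g a (i::'a) j y. \<delta> \<in> {0<..1} \<Longrightarrow> g \<in> borel_measurable borel \<Longrightarrow> 0 \<le> a \<Longrightarrow>
      i \<in> Basis \<Longrightarrow> j \<in> Basis \<Longrightarrow> i \<noteq> j \<Longrightarrow>
    y \<noteq> 0 \<Longrightarrow> \<forall>k\<in>Basis. \<bar>y \<bullet> k\<bar> \<le> \<bar>y \<bullet> i\<bar> \<Longrightarrow> (\<integral>\<^sup>+z. ennreal ((g z)\<^sup>2) \<partial>lborel) \<le> ennreal (a\<^sup>2) \<Longrightarrow>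
    (\<integral>\<^sup>+\<theta>\<in>{0..1/2}. riesz_pot s g (plane_rot i j \<theta> y) \<partial>lborel)
      \<le> (\<integral>\<^sup>+\<theta>\<in>{0..1/2}. riesz_near_pot s \<delta> g (plane_rot i j \<theta> y) \<partial>lborel)
        + ennreal (C * norm y powr (s - ?n/2) * \<delta> powr ((s + 1 - ?n) / 2) * a)"
    using riesz_pot_rot_average[OF s] by auto
  obtain D where D: "D > 0" "\<And>\<delta> g (i::'a) j. \<delta> \<in> {0<..1/2} \<Longrightarrow> g \<in> borel_measurable borel \<Longrightarrow> i \<in> Basis \<Longrightarrow>
      j \<in> Basis \<Longrightarrow> i \<noteq> j \<Longrightarrow>
    (\<integral>\<^sup>+y. ennreal (norm y powr (- 2 * s)) * (\<integral>\<^sup>+\<theta>\<in>{0..1/2}. riesz_near_pot s \<delta> g (plane_rot i j \<theta> y)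
        \<partial>lborel)\<^sup>2 \<partial>lborel)
    \<le> ennreal (D * \<delta> powr (2 * s)) * (\<integral>\<^sup>+z. ennreal ((g z)\<^sup>2) \<partial>lborel)"
    using riesz_near_pot_average_bound[where 'a = 'a, of s] s by auto
  \<comment> \<open>\<open>K1\<close> forces t <= 2^(-m/2), hence \<delta> = t^(2/m) <= 1/2.
    \<open>K2\<close> collects the Chebyshev factor 16 c^2, the constant in \<delta>^(2s), and a
    factor n from the sum over coordinate directions.\<close>
  define K1 where "K1 = 4 * c * C * 2 powr (m/2)"
  define K2 where "K2 = ?n * (16 * c\<^sup>2 * D * (4 * c * C) powr (4 * s / m))"
  have K: "K1 > 0" "K2 > 0" using C D c by (auto simp: K1_def K2_def)
  have main: "(\<integral>\<^sup>+y. ennreal (norm y powr (- ?n)) * indicator {y. \<beta> < norm y powr (?n / 2 - s) * \<bar>u y\<bar>} y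
      \<partial>lborel)
      \<le> ennreal (K2 * (a / \<beta>) powr weak_exponent ?n s)"
    if [measurable]: "g \<in> borel_measurable borel" "u \<in> borel_measurable borel" and a: "a > 0" and \<beta>:
        "\<beta> \<ge> K1 * a"
      and g: "(\<integral>\<^sup>+z. ennreal ((g z)\<^sup>2) \<partial>lborel) \<le> ennreal (a\<^sup>2)"
      and rad: "AE y in lborel. u y = f (norm y)"
      and le: "AE y in lborel. ennreal \<bar>u y\<bar> \<le> ennreal c * riesz_pot s g y" for g u :: "'a \<Rightarrow> real" and a \<beta> f
  proof -
    have \<beta>0: "\<beta> > 0" using \<beta> a K by (meson less_le_trans mult_pos_pos)
    \<comment> \<open>The scale is to satisfy c C \<delta>^(-m/2) a = \<beta>/4, that is
      \<delta>^(m/2) = t.\<close>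
    define t where "t = 4 * c * C * a / \<beta>"
    have t0: "0 < t" using c C a \<beta>0 by (simp add: t_def)
    have t1: "t \<le> 2 powr (- m/2)"
    proof -
      have "4 * c * C * a * 2 powr (m/2) \<le> \<beta>" using \<beta> by (simp add: K1_def mult_ac)
      then have "t * 2 powr (m/2) \<le> 1" using \<beta>0 by (simp add: t_def field_simps)
      then show ?thesis by (simp add: powr_minus field_simps)
    qed
    define \<delta> where "\<delta> = t powr (2 / m)"
    have \<delta>0: "\<delta> > 0" using t0 by (simp add: \<delta>_def)
    have "\<delta> \<le> (2 powr (- m/2)) powr (2/m)" unfolding \<delta>_def using t0 t1 m by (intro powr_mono2) auto
    also have "\<dots> = 2 powr (- 1)" unfolding powr_powr using m by simp
    also have "\<dots> = 1/2" by (simp add: powr_minus)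
    finally have \<delta>: "\<delta> \<in> {0<..1/2}" using \<delta>0 by simp
    have \<delta>m: "c * (C * \<delta> powr ((s + 1 - ?n) / 2) * a) = \<beta>/4"
    proof -
      have "\<delta> powr ((s + 1 - ?n) / 2) = t powr (- 1)"
        unfolding \<delta>_def powr_powr using m by (intro arg_cong2[where f =
            "(powr)"]) (auto simp: m_def field_simps)
      then show ?thesis using t0 \<beta>0 c C a by (simp add: powr_minus t_def field_simps)
    qed
    define E where "E = {y. \<beta> < norm y powr (?n / 2 - s) * \<bar>u y\<bar>}"
    have [measurable]: "E \<in> sets borel" unfolding E_def by measurable
    define j where "j i = (SOME j. j \<in> Basis \<and> i \<noteq> j)" for i :: 'a
    have j: "j i \<in> Basis" "i \<noteq> j i" if "i \<in> Basis" for i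
    proof -
      have "\<exists>j. j \<in> Basis \<and> i \<noteq> j" using ex_other_Basis[OF s(3) that] by blast
      from someI_ex[OF this] show "j i \<in> Basis" "i \<noteq> j i" by (auto simp: j_def)
    qed
    define NA where "NA i y = (\<integral>\<^sup>+\<theta>\<in>{0..1/2}. riesz_near_pot s \<delta> g (plane_rot i (j i) \<theta> y) \<partial>lborel)" for i y
    have [measurable]: "NA i \<in> borel_measurable borel" for i unfolding NA_def by measurable
    \<comment> \<open>All directions are treated at once, since the coordinate of maximal size
      depends on y. Summing over them below replaces a measurable selection.\<close>
    have pt: "AE y in lborel. \<forall>i\<in>Basis. ennreal (\<bar>u y\<bar> / 2) \<le> (\<integral>\<^sup>+\<theta>\<in>{0..1/2}. ennreal c * riesz_pot s g
        (plane_rot i (j i) \<theta> y) \<partial>lborel)"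
      by (intro AE_finite_allI radial_le_rot_average[OF _ rad le]) (use j in auto)
    have "(\<integral>\<^sup>+y. ennreal (norm y powr (- ?n)) * indicator E y \<partial>lborel)
      \<le> (\<integral>\<^sup>+y. (\<Sum>i\<in>Basis. ennreal (16 * c\<^sup>2 / \<beta>\<^sup>2) * (ennreal (norm y powr (- 2 * s)) * (NA i y)\<^sup>2)) \<partial>lborel)"
    proof (rule nn_integral_mono_AE)
      show "AE y in lborel. ennreal (norm y powr (- ?n)) * indicator E y
        \<le> (\<Sum>i\<in>Basis. ennreal (16 * c\<^sup>2 / \<beta>\<^sup>2) * (ennreal (norm y powr (- 2 * s)) * (NA i y)\<^sup>2))"
        using pt AE_lborel_neq[of 0]
      proof eventually_elim
        case (elim y)
        show ?case
        proof (cases "y \<in> E")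
          case True
          obtain i where i: "i \<in> Basis" "\<forall>k\<in>Basis. \<bar>y \<bullet> k\<bar> \<le> \<bar>y \<bullet> i\<bar>" using ex_max_coordinate[of y] by blast
          define w where "w = norm y powr (s - ?n/2)"
          have w: "w > 0" using elim(2) by (simp add: w_def)
          have "\<beta> * w < norm y powr (?n / 2 - s) * \<bar>u y\<bar> * w"
            using True w by (intro mult_strict_right_mono) (auto simp: E_def)
          also have "\<dots> = \<bar>u y\<bar>" using elim(2) by (simp add: w_def mult_ac flip: powr_add)
          finally have u: "\<beta> * w < \<bar>u y\<bar>" .
          have "ennreal (\<beta>/2 * w) \<le> ennreal (\<bar>u y\<bar> / 2)" using u by (intro ennreal_leI) simp
          also have "\<dots> \<le> (\<integral>\<^sup>+\<theta>\<in>{0..1/2}. ennreal c * riesz_pot s g (plane_rot i (j i) \<theta> y) \<partial>lborel)"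
            using elim(1) i by blast
          also have "\<dots> = ennreal c * (\<integral>\<^sup>+\<theta>\<in>{0..1/2}. riesz_pot s g (plane_rot i (j i) \<theta> y) \<partial>lborel)"
            by (simp add: nn_integral_cmult mult.assoc)
          also have "\<dots> \<le> ennreal c * (NA i y + ennreal (C * w * \<delta> powr ((s + 1 - ?n) / 2) * a))"
            unfolding NA_def w_def using C(2)[of \<delta> g a i "j i" y] \<delta> i j[OF i(1)] elim(2) g a
            by (intro mult_left_mono) auto
          also have "\<dots> = ennreal c * NA i y + ennreal (\<beta>/4 * w)"
            unfolding distrib_left using c C a w by (simp add: ennreal_mult[symmetric] \<delta>m[symmetric] mult_ac)
          finally have "ennreal (\<beta>/4 * w) + ennreal (\<beta>/4 * w) \<le> ennreal c * NA i y + ennreal (\<beta>/4 * w)"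
            using \<beta>0 w by (simp flip: ennreal_plus)
          then have "ennreal (\<beta>/4 * w) \<le> ennreal c * NA i y"
            by (simp add: ennreal_add_left_cancel_le)
          then have "(ennreal (\<beta>/4 * w))\<^sup>2 \<le> (ennreal c * NA i y)\<^sup>2" by (rule power_mono) simp
          then have sq: "ennreal (\<beta>\<^sup>2/16 * w\<^sup>2) \<le> ennreal (c\<^sup>2) * (NA i y)\<^sup>2"
            using \<beta>0 w c by (simp add: power_mult_distrib ennreal_power power_divide)
          \<comment> \<open>The scale-invariant weight |y|^(-n) is |y|^(-2s) w^2, which brings in
            exactly the weight of the near estimate.\<close>
          have "norm y powr (- ?n) = 16 / \<beta>\<^sup>2 * norm y powr (- 2 * s) * (\<beta>\<^sup>2/16 * w\<^sup>2)"
            using \<beta>0 by (simp add: w_def powr_square flip: powr_add)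
          then have "ennreal (norm y powr (- ?n)) = ennreal (16 / \<beta>\<^sup>2 * norm y powr (- 2 * s)) * ennreal
              (\<beta>\<^sup>2/16 * w\<^sup>2)"
            by (simp add: ennreal_mult[symmetric])
          also have "\<dots> \<le> ennreal (16 / \<beta>\<^sup>2 * norm y powr (- 2 * s)) * (ennreal (c\<^sup>2) * (NA i y)\<^sup>2)"
            using sq by (rule mult_left_mono) simp
          also have "\<dots> = ennreal (16 * c\<^sup>2 / \<beta>\<^sup>2) * (ennreal (norm y powr (- 2 * s)) * (NA i y)\<^sup>2)"
          proof -
            have "ennreal (16 / \<beta>\<^sup>2 * norm y powr (- 2 * s)) * ennreal (c\<^sup>2)
                = ennreal (16 * c\<^sup>2 / \<beta>\<^sup>2) * ennreal (norm y powr (- 2 * s))"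
              by (simp add: ennreal_mult[symmetric] mult_ac)
            then show ?thesis by (simp only: mult.assoc[symmetric])
          qed
          also have "\<dots> \<le> (\<Sum>i\<in>Basis. ennreal (16 * c\<^sup>2 / \<beta>\<^sup>2) * (ennreal (norm y powr (- 2 * s)) * (NA i
              y)\<^sup>2))"
            using i(1) by (intro member_le_sum) auto
          finally show ?thesis using True by simp
        qed simp
      qed
    qed
    also have "\<dots> = (\<Sum>i\<in>Basis. ennreal (16 * c\<^sup>2 / \<beta>\<^sup>2) * (\<integral>\<^sup>+y. ennreal (norm y powr (- 2 * s)) * (NA i y)\<^sup>2
        \<partial>lborel))"
      by (simp add: nn_integral_sum nn_integral_cmult)
    also have "\<dots> \<le> (\<Sum>i\<in>(Basis::'a set). ennreal (16 * c\<^sup>2 / \<beta>\<^sup>2) * ennreal (D * \<delta> powr (2 * s) * a\<^sup>2))"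
    proof (intro sum_mono mult_left_mono)
      fix i :: 'a assume i: "i \<in> Basis"
      have "(\<integral>\<^sup>+y. ennreal (norm y powr (- 2 * s)) * (NA i y)\<^sup>2 \<partial>lborel)
          \<le> ennreal (D * \<delta> powr (2 * s)) * (\<integral>\<^sup>+z. ennreal ((g z)\<^sup>2) \<partial>lborel)"
        unfolding NA_def using D(2)[OF \<delta>, of g i "j i"] i j[OF i] by simp
      also have "\<dots> \<le> ennreal (D * \<delta> powr (2 * s)) * ennreal (a\<^sup>2)" using g by (rule mult_left_mono) simp
      also have "\<dots> = ennreal (D * \<delta> powr (2 * s) * a\<^sup>2)" using D by (simp add: ennreal_mult)
      finally show "(\<integral>\<^sup>+y. ennreal (norm y powr (- 2 * s)) * (NA i y)\<^sup>2 \<partial>lborel)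
          \<le> ennreal (D * \<delta> powr (2 * s) * a\<^sup>2)" .
    qed simp
    also have "\<dots> = ennreal (?n * (16 * c\<^sup>2 / \<beta>\<^sup>2 * (D * \<delta> powr (2 * s) * a\<^sup>2)))"
      using D by (simp add: ennreal_mult[symmetric] ennreal_of_nat_eq_real_of_nat)
    also have "?n * (16 * c\<^sup>2 / \<beta>\<^sup>2 * (D * \<delta> powr (2 * s) * a\<^sup>2)) = K2 * (a / \<beta>) powr weak_exponent ?n s"
    proof -
      have "\<delta> powr (2 * s) = ((4 * c * C) * (a / \<beta>)) powr (4 * s / m)"
        unfolding \<delta>_def powr_powr t_def by (simp add: mult_ac)
      also have "\<dots> = (4 * c * C) powr (4 * s / m) * (a / \<beta>) powr (4 * s / m)"
        by (rule powr_mult)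
      finally have 1: "\<delta> powr (2 * s) = (4 * c * C) powr (4 * s / m) * (a / \<beta>) powr (4 * s / m)" .
      have "(a / \<beta>) powr weak_exponent ?n s = (a / \<beta>)\<^sup>2 * (a / \<beta>) powr (4 * s / m)"
        using a \<beta>0 by (simp add: weak_exponent_def m_def powr_add powr_numeral)
      then show ?thesis unfolding 1 K2_def by (simp add: power_divide)
    qed
    finally show ?thesis by (simp only: E_def)
  qed
  show ?thesis
  proof (intro exI conjI ballI allI impI)
    show "0 < max K1 K2" using K by simp
    fix g u :: "'a \<Rightarrow> real" and a \<beta> :: real
    assume meas: "g \<in> borel_measurable borel" "u \<in> borel_measurable borel" and a: "0 < a" and \<beta>:
        "max K1 K2 * a \<le> \<beta>"
      and g: "(\<integral>\<^sup>+z. ennreal ((g z)\<^sup>2) \<partial>lborel) \<le> ennreal (a\<^sup>2)"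
      and rad: "\<exists>f. AE y in lborel. u y = f (norm y)"
      and le: "AE y in lborel. ennreal \<bar>u y\<bar> \<le> ennreal c * riesz_pot s g y"
    have "K1 * a \<le> max K1 K2 * a" using a by (intro mult_right_mono) auto
    then have "K1 * a \<le> \<beta>" using \<beta> by linarith
    from rad obtain f where "AE y in lborel. u y = f (norm y)" by blast
    from main[OF meas a \<open>K1 * a \<le> \<beta>\<close> g this le]
    have "(\<integral>\<^sup>+y. ennreal (norm y powr (- ?n)) * indicator {y. \<beta> < norm y powr (?n / 2 - s) * \<bar>u y\<bar>} y \<partial>lborel)
      \<le> ennreal (K2 * (a / \<beta>) powr weak_exponent ?n s)" .
    also have "\<dots> \<le> ennreal (max K1 K2 * (a / \<beta>) powr weak_exponent ?n s)"
      by (intro ennreal_leI mult_right_mono) auto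
    finally show "(\<integral>\<^sup>+y. ennreal (norm y powr (- ?n)) * indicator {y. \<beta> < norm y powr (?n / 2 - s) * \<bar>u y\<bar>} y
        \<partial>lborel)
      \<le> ennreal (max K1 K2 * (a / \<beta>) powr weak_exponent ?n s)" .
  qed
qed

text \<open>Below \<beta> the L^2 bound enters through U^q <= \<beta>^(q-2) U^2; above it, dyadic
  shells and the weak bound form a geometric series with ratio 2^(q-r) < 1. The weak bound concerns
  strict superlevel sets, so the shell starting at \<beta> 2^k is enclosed in the set above \<beta>
  2^k / 2; hence the requirement 2B <= \<beta>.\<close>

lemma nn_integral_powr_interpolation:
  fixes U :: "'b \<Rightarrow> real"
  assumes [measurable]: "U \<in> borel_measurable M" and U0: "\<And>x. 0 \<le> U x"
    and q: "2 < q" "q < r" and pos: "0 < B" "0 \<le> C" "0 \<le> a" "0 \<le> d" "2 * B \<le> \<beta>"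
    and weak: "\<And>t. B \<le> t \<Longrightarrow> emeasure M {x \<in> space M. t < U x} \<le> ennreal (C * (a / t) powr r)"
    and L2: "(\<integral>\<^sup>+x. ennreal ((U x)\<^sup>2) \<partial>M) \<le> ennreal (d\<^sup>2)"
  shows "(\<integral>\<^sup>+x. ennreal (U x powr q) \<partial>M)
    \<le> ennreal (\<beta> powr (q - 2) * d\<^sup>2 + C * 2 powr (q + r) / (1 - 2 powr (q - r)) * a powr r * \<beta> powr (q - r))"
proof -
  have \<beta>: "\<beta> > 0" using pos by linarith
  define F where "F k x = ennreal ((\<beta> * 2 ^ Suc k) powr q) * indicator {x \<in> space M. \<beta> / 2 * 2 ^ k < U x} x"
      for k x
  have [measurable]: "F k \<in> borel_measurable M" for k unfolding F_def by measurable
  let ?x = "2 powr (q - r) :: real"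
  have lt1: "?x < 1" using q by (simp add: powr_less_one)
  define S where "S = C * 2 powr (q + r) * a powr r * \<beta> powr (q - r)"
  have S: "0 \<le> S" using pos by (simp add: S_def)
  have term_le: "(\<integral>\<^sup>+x. F k x \<partial>M) \<le> ennreal (S * ?x ^ k)" for k
  proof -
    have "B * 1 \<le> \<beta> / 2 * 2 ^ k" using pos \<beta> by (intro mult_mono) auto
    then have "emeasure M {x \<in> space M. \<beta> / 2 * 2 ^ k < U x} \<le> ennreal (C * (a / (\<beta> / 2 * 2 ^ k)) powr r)"
      by (intro weak) simp
    then have "(\<integral>\<^sup>+x. F k x \<partial>M) \<le> ennreal ((\<beta> * 2 ^ Suc k) powr q) * ennreal (C * (a / (\<beta> / 2 * 2 ^ k)) powr
        r)"
      unfolding F_def by (subst nn_integral_cmult_indicator) (auto intro: mult_left_mono)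
    also have "\<dots> = ennreal ((\<beta> * 2 ^ Suc k) powr q * (C * (a / (\<beta> / 2 * 2 ^ k)) powr r))"
      using pos by (simp add: ennreal_mult)
    also have "(\<beta> * 2 ^ Suc k) powr q * (C * (a / (\<beta> / 2 * 2 ^ k)) powr r) = S * ?x ^ k"
    proof -
      have e: "\<beta> * 2 ^ Suc k = \<beta> * 2 powr (real k + 1)" "a / (\<beta> / 2 * 2 ^ k)
          = a * (\<beta> powr (- 1) * 2 powr (1 - real k))"
        using \<beta> by (simp_all add: powr_add powr_diff powr_minus powr_realpow field_simps)
      have x: "?x ^ k = 2 powr ((q - r) * real k)" by (simp add: powr_powr flip: powr_realpow)
      have "(\<beta> * 2 powr (real k + 1)) powr q * (C * (a * (\<beta> powr (- 1) * 2 powr (1 - real k))) powr r)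
        = C * a powr r * (\<beta> powr q * \<beta> powr (- r)) * (2 powr ((real k + 1) * q) * 2 powr ((1 - real k) * r))"
        unfolding powr_mult powr_powr by simp
      also have "\<dots> = S * ?x ^ k"
        unfolding x S_def powr_add[symmetric] by (simp add: algebra_simps flip: powr_add)
      finally show ?thesis unfolding e .
    qed
    finally show ?thesis .
  qed
  have "(\<integral>\<^sup>+x. ennreal (U x powr q) \<partial>M) \<le> (\<integral>\<^sup>+x. ennreal (\<beta> powr (q - 2)) * ennreal ((U x)\<^sup>2)
      + (\<Sum>k. F k x) \<partial>M)"
  proof (rule nn_integral_mono)
    fix x assume x: "x \<in> space M"
    show "ennreal (U x powr q) \<le> ennreal (\<beta> powr (q - 2)) * ennreal ((U x)\<^sup>2) + (\<Sum>k. F k x)"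
    proof (cases "U x < \<beta>")
      case True
      have "U x powr q \<le> \<beta> powr (q - 2) * (U x)\<^sup>2"
      proof (cases "U x = 0")
        case False
        then have "U x powr q = U x powr (q - 2) * (U x)\<^sup>2"
          using U0[of x] by (simp add: powr_diff powr_numeral)
        also have "\<dots> \<le> \<beta> powr (q - 2) * (U x)\<^sup>2"
          using True U0[of x] q by (intro mult_right_mono powr_mono2) auto
        finally show ?thesis .
      qed simp
      then have "ennreal (U x powr q) \<le> ennreal (\<beta> powr (q - 2)) * ennreal ((U x)\<^sup>2)"
        by (simp add: ennreal_leI flip: ennreal_mult)
      then show ?thesis by (rule order_trans) simp
    next
      case False
      then obtain k where k: "\<beta> * 2 ^ k \<le> U x" "U x < \<beta> * 2 ^ Suc k"
        using ex_dyadic_above[of \<beta> "U x"] \<beta> by auto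
      have "\<beta> / 2 * 2 ^ k < \<beta> * 2 ^ k" using \<beta> by simp
      then have "\<beta> / 2 * 2 ^ k < U x" using k by linarith
      moreover have "U x powr q \<le> (\<beta> * 2 ^ Suc k) powr q" using k U0 q by (intro powr_mono2) auto
      ultimately have "ennreal (U x powr q) \<le> F k x" using x by (simp add: F_def ennreal_leI)
      also have "\<dots> = (\<Sum>k\<in>{k}. F k x)" by simp
      also have "\<dots> \<le> (\<Sum>k. F k x)" by (rule sum_le_suminf) auto
      finally show ?thesis by (rule order_trans) simp
    qed
  qed
  also have "\<dots> = ennreal (\<beta> powr (q - 2)) * (\<integral>\<^sup>+x. ennreal ((U x)\<^sup>2) \<partial>M) + (\<Sum>k. (\<integral>\<^sup>+x. F k x \<partial>M))"
    by (simp add: nn_integral_add nn_integral_cmult nn_integral_suminf)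
  also have "\<dots> \<le> ennreal (\<beta> powr (q - 2)) * ennreal (d\<^sup>2) + (\<Sum>k. ennreal (S * ?x ^ k))"
    by (intro add_mono mult_left_mono L2 suminf_le term_le) auto
  also have "(\<Sum>k. ennreal (S * ?x ^ k)) = ennreal (S * (1 / (1 - ?x)))"
    using lt1 S by (intro suminf_ennreal_eq sums_mult geometric_sums) auto
  also have "ennreal (\<beta> powr (q - 2)) * ennreal (d\<^sup>2) + ennreal (S * (1 / (1 - ?x)))
      = ennreal (\<beta> powr (q - 2) * d\<^sup>2 + S * (1 / (1 - ?x)))"
    using lt1 S by (simp add: ennreal_mult ennreal_plus)
  finally show ?thesis by (simp add: S_def mult_ac)
qed

text \<open>With respect to |y|^(-n) dy and for U = |y|^(n/2-s)|u|, the L^2 bound, the weak bound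
  and the conclusion all become unweighted, so \<open>nn_integral_powr_interpolation\<close>
  applies. What remains is the choice of the threshold.\<close>

lemma radial_interpolation:
  assumes s: "0 < s" "s < 1" "2 \<le> DIM('a::euclidean_space)" and c: "0 < c"
    and r: "r = weak_exponent (real DIM('a)) s" and q: "2 < q" "q < r"
  shows "\<exists>K>0. \<forall>g\<in>borel_measurable (borel :: 'a measure). \<forall>u\<in>borel_measurable borel. \<forall>a>0. \<forall>d\<ge>0. \<forall>\<Lambda>\<ge>1.
    (\<integral>\<^sup>+z. ennreal ((g z)\<^sup>2) \<partial>lborel) \<le> ennreal (a\<^sup>2) \<longrightarrow>
    (\<integral>\<^sup>+y. ennreal ((norm y powr (- s) * u y)\<^sup>2) \<partial>lborel) \<le> ennreal (d\<^sup>2) \<longrightarrow>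
    (\<exists>f. AE y in lborel. u y = f (norm y)) \<longrightarrow>
    (AE y in lborel. ennreal \<bar>u y\<bar> \<le> ennreal c * riesz_pot s g y) \<longrightarrow>
    (\<integral>\<^sup>+y. ennreal (norm y powr ((real DIM('a) / 2 - s) * q - real DIM('a)) * \<bar>u y\<bar> powr q) \<partial>lborel)
      \<le> ennreal (K * (a\<^sup>2 + \<Lambda> * d\<^sup>2) powr (q / 2) * \<Lambda> powr (- ((r - q) / (r - 2))))"
proof -
  let ?n = "real DIM('a)"
  obtain C where C: "C > 0" "\<forall>g\<in>borel_measurable (borel :: 'a measure). \<forall>u\<in>borel_measurable borel. \<forall>a>0.
      \<forall>\<beta>\<ge>C*a.
    (\<integral>\<^sup>+z. ennreal ((g z)\<^sup>2) \<partial>lborel) \<le> ennreal (a\<^sup>2) \<longrightarrow>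
    (\<exists>f. AE y in lborel. u y = f (norm y)) \<longrightarrow>
    (AE y in lborel. ennreal \<bar>u y\<bar> \<le> ennreal c * riesz_pot s g y) \<longrightarrow>
    (\<integral>\<^sup>+y. ennreal (norm y powr (- ?n)) * indicator {y. \<beta> < norm y powr (?n / 2 - s) * \<bar>u y\<bar>} y \<partial>lborel)
      \<le> ennreal (C * (a / \<beta>) powr r)"
    using radial_weak_type[OF s c, folded r] by (elim exE conjE) (rule that, assumption+)
  define C1 where "C1 = C * 2 powr (q + r) / (1 - 2 powr (q - r))"
  have lt1: "2 powr (q - r) < (1::real)" using q by (simp add: powr_less_one)
  have C1: "C1 > 0" using C lt1 by (simp add: C1_def)
  define K where "K = (2 * C) powr (q - 2) + C1 * (2 * C) powr (q - r)"
  have K: "K > 0" using C C1 by (simp add: K_def add_pos_pos)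
  have main: "(\<integral>\<^sup>+y. ennreal (norm y powr ((?n / 2 - s) * q - ?n) * \<bar>u y\<bar> powr q) \<partial>lborel)
      \<le> ennreal (K * (a\<^sup>2 + \<Lambda> * d\<^sup>2) powr (q / 2) * \<Lambda> powr (- ((r - q) / (r - 2))))"
    if [measurable]: "g \<in> borel_measurable borel" "u \<in> borel_measurable borel" and a: "a > 0" and d:
        "d \<ge> 0" and \<Lambda>: "\<Lambda> \<ge> 1"
      and g: "(\<integral>\<^sup>+z. ennreal ((g z)\<^sup>2) \<partial>lborel) \<le> ennreal (a\<^sup>2)"
      and L2: "(\<integral>\<^sup>+y. ennreal ((norm y powr (- s) * u y)\<^sup>2) \<partial>lborel) \<le> ennreal (d\<^sup>2)"
      and rad: "AE y in lborel. u y = f (norm y)"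
      and le: "AE y in lborel. ennreal \<bar>u y\<bar> \<le> ennreal c * riesz_pot s g y" for g u :: "'a \<Rightarrow> real" and a d \<Lambda> f
  proof -
    define M where "M = density lborel (\<lambda>y::'a. ennreal (norm y powr (- ?n)))"
    define U where "U y = norm y powr (?n / 2 - s) * \<bar>u y\<bar>" for y
    have [measurable]: "U \<in> borel_measurable borel" unfolding U_def by measurable
    have [measurable_cong]: "sets M = sets borel" by (simp add: M_def)
    define D where "D = sqrt (a\<^sup>2 + \<Lambda> * d\<^sup>2)"
    have D2: "D\<^sup>2 = a\<^sup>2 + \<Lambda> * d\<^sup>2" using \<Lambda> by (simp add: D_def)
    have aD: "a \<le> D" unfolding D_def using \<Lambda> by (intro real_le_rsqrt) auto
    have D0: "D > 0" using a aD by linarith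
    define \<kappa> where "\<kappa> = 1 / (r - 2)"
    \<comment> \<open>By d^2 <= D^2/\<Lambda> and a <= D the two contributions carry the powers
      \<kappa>(q-2) - 1 and \<kappa>(q-r) of \<Lambda>, which coincide exactly for \<kappa> =
      1/(r-2). The assumption \<Lambda> >= 1 keeps the threshold in the admissible range of the weak
      bound.\<close>
    define \<beta> where "\<beta> = 2 * C * D * \<Lambda> powr \<kappa>"
    have \<Lambda>\<kappa>: "1 \<le> \<Lambda> powr \<kappa>" using \<Lambda> q by (intro ge_one_powr_ge_zero) (auto simp: \<kappa>_def)
    have \<beta>: "2 * (C * a) \<le> \<beta>"
    proof -
      have "2 * C * a * 1 \<le> 2 * C * D * \<Lambda> powr \<kappa>"
        using C a aD \<Lambda>\<kappa> by (intro mult_mono) auto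
      then show ?thesis by (simp add: \<beta>_def)
    qed
    have "(\<integral>\<^sup>+y. ennreal (U y powr q) \<partial>M)
      \<le> ennreal (\<beta> powr (q - 2) * d\<^sup>2 + C * 2 powr (q + r) / (1 - 2 powr (q - r)) * a powr r * \<beta> powr (q -
          r))"
    proof (rule nn_integral_powr_interpolation[where B = "C * a"])
      fix t assume t: "C * a \<le> t"
      have "emeasure M {x \<in> space M. t < U x} = (\<integral>\<^sup>+y. ennreal (norm y powr (- ?n)) * indicator {y. t < U y} y
          \<partial>lborel)"
        unfolding M_def by (subst emeasure_density) auto
      then show "emeasure M {x \<in> space M. t < U x} \<le> ennreal (C * (a / t) powr r)"
        using C(2)[rule_format, OF _ _ a t g exI[of _ f] le] rad by (simp add: U_def)
    next
      have "(\<integral>\<^sup>+y. ennreal ((U y)\<^sup>2) \<partial>M) = (\<integral>\<^sup>+y. ennreal ((norm y powr (- s) * u y)\<^sup>2) \<partial>lborel)"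
      proof -
        have "norm y powr (- ?n) * (U y)\<^sup>2 = (norm y powr (- s) * u y)\<^sup>2" for y :: 'a
        proof -
          have "norm y powr (2 * - s) = norm y powr (- ?n) * norm y powr (2 * (?n / 2 - s))"
            by (subst powr_add[symmetric]) (simp add: algebra_simps)
          then show ?thesis unfolding U_def power_mult_distrib powr_square
              by (simp only: mult.assoc power2_abs)
        qed
        then show ?thesis unfolding M_def by (simp add: nn_integral_density ennreal_mult[symmetric])
      qed
      then show "(\<integral>\<^sup>+y. ennreal ((U y)\<^sup>2) \<partial>M) \<le> ennreal (d\<^sup>2)" using L2 by simp
    qed (use C a d q \<beta> in \<open>auto simp: U_def\<close>)
    also have "(\<integral>\<^sup>+y. ennreal (U y powr q) \<partial>M) = (\<integral>\<^sup>+y. ennreal (norm y powr ((?n / 2 - s) * q - ?n) * \<bar>u y\<bar>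
        powr q) \<partial>lborel)"
    proof -
      have "norm y powr (- ?n) * U y powr q = norm y powr ((?n / 2 - s) * q - ?n) * \<bar>u y\<bar> powr q" for y :: 'a
      proof -
        have "norm y powr ((?n / 2 - s) * q - ?n) = norm y powr (- ?n) * norm y powr ((?n / 2 - s) * q)"
          by (subst powr_add[symmetric]) (simp add: algebra_simps)
        then show ?thesis unfolding U_def powr_mult powr_powr by (simp only: mult.assoc)
      qed
      then show ?thesis unfolding M_def by (simp add: nn_integral_density ennreal_mult[symmetric])
    qed
    also have "ennreal (\<beta> powr (q - 2) * d\<^sup>2 + C * 2 powr (q + r) / (1 - 2 powr (q - r)) * a powr r * \<beta> powr
        (q - r))
      \<le> ennreal (K * (a\<^sup>2 + \<Lambda> * d\<^sup>2) powr (q / 2) * \<Lambda> powr (- ((r - q) / (r - 2))))"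
    proof (rule ennreal_leI)
      define e where "e = - ((r - q) / (r - 2))"
      have Dq: "(a\<^sup>2 + \<Lambda> * d\<^sup>2) powr (q / 2) = D powr q"
      proof -
        have "(a\<^sup>2 + \<Lambda> * d\<^sup>2) powr (q / 2) = (D powr 2) powr (q / 2)" using D2 D0 by (simp add: powr_numeral)
        then show ?thesis unfolding powr_powr by simp
      qed
      have "\<Lambda> * d\<^sup>2 \<le> D\<^sup>2" using D2 a by simp
      then have d2: "d\<^sup>2 \<le> D\<^sup>2 * \<Lambda> powr (- 1)" using \<Lambda> by (simp add: powr_minus field_simps)
      have "\<beta> powr (q - 2) * d\<^sup>2 \<le> \<beta> powr (q - 2) * (D\<^sup>2 * \<Lambda> powr (- 1))"
        using d2 by (rule mult_left_mono) simp
      also have "\<dots> = (2 * C) powr (q - 2) * (D powr (q - 2) * D powr 2) * (\<Lambda> powr (\<kappa> * (q - 2)) * \<Lambda> powr (-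
          1))"
        unfolding \<beta>_def powr_mult powr_powr using D0 by (simp add: powr_numeral)
      also have "\<dots> = (2 * C) powr (q - 2) * D powr q * \<Lambda> powr e"
      proof -
        have "\<kappa> * (q - 2) + - 1 = e" using q by (simp add: \<kappa>_def e_def field_simps)
        then show ?thesis unfolding powr_add[symmetric] by (simp only: diff_add_cancel)
      qed
      finally have 1: "\<beta> powr (q - 2) * d\<^sup>2 \<le> (2 * C) powr (q - 2) * D powr q * \<Lambda> powr e" .
      have "C1 * a powr r * \<beta> powr (q - r) \<le> C1 * D powr r * \<beta> powr (q - r)"
        using C1 a aD q by (intro mult_right_mono mult_left_mono powr_mono2) auto
      also have "\<dots> = C1 * (2 * C) powr (q - r) * (D powr r * D powr (q - r)) * \<Lambda> powr (\<kappa> * (q - r))"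
        unfolding \<beta>_def powr_mult powr_powr by simp
      also have "\<dots> = C1 * (2 * C) powr (q - r) * D powr q * \<Lambda> powr e"
      proof -
        have "\<kappa> * (q - r) = e" using q by (simp add: \<kappa>_def e_def field_simps)
        then show ?thesis by (simp flip: powr_add)
      qed
      finally have 2: "C1 * a powr r * \<beta> powr (q - r) \<le> C1 * (2 * C) powr (q - r) * D powr q * \<Lambda> powr e" .
      have "\<beta> powr (q - 2) * d\<^sup>2 + C1 * a powr r * \<beta> powr (q - r) \<le> K * D powr q * \<Lambda> powr e"
        using add_mono[OF 1 2] by (simp add: K_def algebra_simps)
      then show "\<beta> powr (q - 2) * d\<^sup>2 + C * 2 powr (q + r) / (1 - 2 powr (q - r)) * a powr r * \<beta> powr (q - r)
         \<le> K * (a\<^sup>2 + \<Lambda> * d\<^sup>2) powr (q / 2) * \<Lambda> powr (- ((r - q) / (r - 2)))"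
        by (simp only: Dq C1_def e_def)
    qed
    finally show ?thesis .
  qed
  show ?thesis
    by (intro exI[of _ K] conjI ballI allI impI K; elim exE; rule main; assumption)
qed

section \<open>The heat kernel\<close>

text \<open>The Gauss-Weierstrass kernel of the semigroup generated by the Laplacian: a centred
  Gaussian with variance 2t in every coordinate.\<close>

definition heat :: "real \<Rightarrow> 'a::euclidean_space \<Rightarrow> real" where
  "heat t x = (4 * pi * t) powr (- real DIM('a) / 2) * exp (- (norm x)\<^sup>2 / (4 * t))"

lemma measurable_heat [measurable (raw)]:
  assumes [measurable]: "f \<in> borel_measurable M" "g \<in> borel_measurable M"
  shows "(\<lambda>x. heat (f x) (g x)) \<in> borel_measurable M"
  unfolding heat_def by measurable

lemma heat_nonneg [simp]: "0 \<le> heat t x"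
  by (simp add: heat_def)

lemma heat_eq_prod:
  assumes "t > 0"
  shows "heat t (x::'a::euclidean_space) = (\<Prod>b\<in>Basis. normal_density 0 (sqrt (2 * t)) (x \<bullet> b))"
proof -
  have "(\<Prod>b\<in>(Basis::'a set). normal_density 0 (sqrt (2 * t)) (x \<bullet> b))
    = (\<Prod>b\<in>(Basis::'a set). (4 * pi * t) powr (- 1 / 2) * exp (- (x \<bullet> b)\<^sup>2 / (4 * t)))"
    using assms by (intro prod.cong refl)
      (simp add: normal_density_def powr_minus powr_half_sqrt field_simps)
  also have "\<dots> = (4 * pi * t) powr (- real DIM('a) / 2) * exp (\<Sum>b\<in>(Basis::'a set). - (x \<bullet> b)\<^sup>2 / (4 * t))"
    using assms by (simp add: prod.distrib exp_sum powr_power)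
  also have "(\<Sum>b\<in>(Basis::'a set). - (x \<bullet> b)\<^sup>2 / (4 * t)) = - (norm x)\<^sup>2 / (4 * t)"
    unfolding power2_norm_eq_inner euclidean_inner[of x x]
    by (simp add: sum_divide_distrib sum_negf power2_eq_square)
  finally show ?thesis by (simp add: heat_def)
qed

lemma nn_integral_heat_conv:
  fixes x z :: "'a::euclidean_space"
  assumes t: "0 < t" "0 < \<tau>"
  shows "(\<integral>\<^sup>+y. ennreal (heat t (x - y) * heat \<tau> (y - z)) \<partial>lborel) = ennreal (heat (t + \<tau>) (x - z))"
proof -
  have 1: "(\<integral>\<^sup>+y. ennreal (heat t (x - y) * heat \<tau> y) \<partial>lborel) = ennreal (heat (t + \<tau>) x)" for x :: 'a
  proof -
    have "(\<integral>\<^sup>+y. ennreal (heat t (x - y) * heat \<tau> y) \<partial>lborel)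
      = (\<integral>\<^sup>+y. (\<Prod>b\<in>(Basis::'a set). ennreal (normal_density 0 (sqrt (2 * t)) (x \<bullet> b - y \<bullet> b) * normal_density
          0 (sqrt (2 * \<tau>)) (y \<bullet> b))) \<partial>lborel)"
      using t by (intro nn_integral_cong) (simp add: heat_eq_prod prod_ennreal inner_diff_left flip:
          prod.distrib)
    also have "\<dots> = (\<Prod>b\<in>(Basis::'a set). (\<integral>\<^sup>+y. ennreal (normal_density 0 (sqrt (2 * t)) (x \<bullet> b - y) *
        normal_density 0 (sqrt (2 * \<tau>)) y) \<partial>lborel))"
      by (rule nn_integral_lborel_prod) auto
    also have "\<dots> = (\<Prod>b\<in>(Basis::'a set). ennreal (normal_density 0 (sqrt (2 * (t + \<tau>))) (x \<bullet> b)))"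
    proof (rule prod.cong)
      fix b
      show "(\<integral>\<^sup>+y. ennreal (normal_density 0 (sqrt (2 * t)) (x \<bullet> b - y) * normal_density 0 (sqrt (2 * \<tau>)) y)
          \<partial>lborel)
        = ennreal (normal_density 0 (sqrt (2 * (t + \<tau>))) (x \<bullet> b))"
        using fun_cong[OF conv_normal_density_zero_mean[of "sqrt (2 * t)" "sqrt (2 * \<tau>)"], of "x \<bullet> b"] t
        by (simp add: distrib_left)
    qed simp
    also have "\<dots> = ennreal (heat (t + \<tau>) x)"
      using t by (simp add: heat_eq_prod prod_ennreal)
    finally show ?thesis .
  qed
  have "(\<integral>\<^sup>+y. ennreal (heat t (x - y) * heat \<tau> (y - z)) \<partial>lborel)
    = (\<integral>\<^sup>+y. ennreal (heat t ((x - z) - (y - z)) * heat \<tau> (y - z)) \<partial>lborel)" by simp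
  also have "\<dots> = (\<integral>\<^sup>+y. ennreal (heat t ((x - z) - y) * heat \<tau> y) \<partial>lborel)"
    using nn_integral_lborel_translate(1)[of "\<lambda>y. ennreal (heat t ((x - z) - y) * heat \<tau> y)" z] by simp
  finally show ?thesis by (simp only: 1)
qed

lemma nn_integral_heat:
  assumes t: "0 < t"
  shows "(\<integral>\<^sup>+y. ennreal (heat t (y::'a::euclidean_space)) \<partial>lborel) = 1"
    and "(\<integral>\<^sup>+y. ennreal (heat t (y - x::'a)) \<partial>lborel) = 1"
    and "(\<integral>\<^sup>+y. ennreal (heat t (x - y::'a)) \<partial>lborel) = 1"
proof -
  have "(\<integral>\<^sup>+y. ennreal (heat t (y::'a)) \<partial>lborel)
     = (\<integral>\<^sup>+y. (\<Prod>b\<in>(Basis::'a set). ennreal (normal_density 0 (sqrt (2 * t)) (y \<bullet> b))) \<partial>lborel)"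
    using t by (intro nn_integral_cong) (simp add: heat_eq_prod prod_ennreal)
  also have "\<dots> = (\<Prod>b\<in>(Basis::'a set). (\<integral>\<^sup>+y. ennreal (normal_density 0 (sqrt (2 * t)) y) \<partial>lborel))"
    by (rule nn_integral_lborel_prod) auto
  also have "\<dots> = 1"
    using t by (simp add: nn_integral_eq_integral)
  finally show 1: "(\<integral>\<^sup>+y. ennreal (heat t (y::'a)) \<partial>lborel) = 1" .
  show "(\<integral>\<^sup>+y. ennreal (heat t (y - x::'a)) \<partial>lborel) = 1" "(\<integral>\<^sup>+y. ennreal (heat t (x - y::'a)) \<partial>lborel) = 1"
    using 1 nn_integral_lborel_translate[of "\<lambda>y. ennreal (heat t y)" x] by simp_all
qed

text \<open>Half of the Gaussian exponent is estimated at the distance e, the other half is kept as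
  a Gaussian of doubled time; adjusting the normalisation costs 2^(n/2).\<close>

lemma heat_le_double:
  assumes t: "0 < t" and e: "0 \<le> e" "e \<le> norm x"
  shows "heat t (x::'a::euclidean_space) \<le> 2 powr (real DIM('a) / 2) * exp (- e\<^sup>2 / (8 * t)) * heat (2 * t) x"
proof -
  have "heat t x = (4 * pi * t) powr (- real DIM('a) / 2) * (exp (- (norm x)\<^sup>2 / (8 * t)) * exp (- (norm x)\<^sup>2
      / (8 * t)))"
    unfolding heat_def exp_add[symmetric] by (simp add: field_simps)
  also have "\<dots> \<le> (4 * pi * t) powr (- real DIM('a) / 2) * (exp (- e\<^sup>2 / (8 * t)) * exp (- (norm x)\<^sup>2 / (8 *
      t)))"
    using t e by (intro mult_left_mono mult_right_mono) (auto intro!: divide_right_mono power_mono)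
  also have "(4 * pi * t) powr (- real DIM('a) / 2) = 2 powr (real DIM('a) / 2) * (4 * pi * (2 * t)) powr (-
      real DIM('a) / 2)"
  proof -
    have "(4 * pi * (2 * t)) powr (- real DIM('a) / 2) = 2 powr (- real DIM('a) / 2) * (4 * pi * t) powr (-
        real DIM('a) / 2)"
      by (subst powr_mult[symmetric]) (simp add: mult_ac)
    then show ?thesis by (simp add: mult.assoc[symmetric] flip: powr_add)
  qed
  finally show ?thesis by (simp add: heat_def mult_ac)
qed

lemma heat_tail:
  assumes t: "0 < t" and e: "0 \<le> e"
  shows "(\<integral>\<^sup>+y. ennreal (heat t (y - x::'a::euclidean_space)) * indicator {y. e \<le> norm (y - x)} y \<partial>lborel)
    \<le> ennreal (2 powr (real DIM('a) / 2) * exp (- e\<^sup>2 / (8 * t)))"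
proof -
  have "(\<integral>\<^sup>+y. ennreal (heat t (y - x)) * indicator {y. e \<le> norm (y - x)} y \<partial>lborel)
    \<le> (\<integral>\<^sup>+y. ennreal (2 powr (real DIM('a) / 2) * exp (- e\<^sup>2 / (8 * t))) * ennreal (heat (2 * t) (y - x))
        \<partial>lborel)"
    using heat_le_double[OF t e] by (intro nn_integral_mono) (auto simp: indicator_def ennreal_mult[symmetric]
        ennreal_leI)
  also have "\<dots> = ennreal (2 powr (real DIM('a) / 2) * exp (- e\<^sup>2 / (8 * t)))"
    using t by (simp add: nn_integral_cmult nn_integral_heat)
  finally show ?thesis .
qed

lemma heat_tail_tendsto_0:
  assumes e: "0 < e"
  shows "(\<lambda>k. C * exp (- e\<^sup>2 / (8 * (1 / real (Suc k))))) \<longlonglongrightarrow> 0"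
proof -
  have "((\<lambda>x. C * exp (- (e\<^sup>2 / 8) * x)) \<longlongrightarrow> C * 0) at_top"
  proof (intro tendsto_intros)
    have "filterlim (\<lambda>x. - (e\<^sup>2 / 8) * x) at_bot at_top"
      using e by (intro filterlim_tendsto_neg_mult_at_bot[OF tendsto_const] filterlim_ident) auto
    then show "((\<lambda>x. exp (- (e\<^sup>2 / 8) * x)) \<longlongrightarrow> 0) at_top"
      by (rule filterlim_compose[OF exp_at_bot])
  qed
  from filterlim_compose[OF this filterlim_compose[OF filterlim_real_sequentially filterlim_Suc]]
  show ?thesis by simp
qed

section \<open>Uniqueness from heat averages\<close>

definition heat_box :: "'a::euclidean_space set \<Rightarrow> real \<Rightarrow> 'a \<Rightarrow> ennreal" where
  "heat_box Q t x = (\<integral>\<^sup>+y. ennreal (heat t (y - x)) * indicator Q y \<partial>lborel)"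

lemma heat_box_tendsto:
  assumes Q: "open Q" and x: "x \<notin> frontier Q"
  shows "(\<lambda>k. heat_box Q (1 / real (Suc k)) x) \<longlonglongrightarrow> indicator Q (x::'a::euclidean_space)"
proof -
  let ?t = "\<lambda>k. 1 / real (Suc k)"
  have [measurable]: "Q \<in> sets borel" using Q by simp
  have le1: "heat_box Q (?t k) x \<le> 1" for k
  proof -
    have "heat_box Q (?t k) x \<le> (\<integral>\<^sup>+y. ennreal (heat (?t k) (y - x)) \<partial>lborel)"
      unfolding heat_box_def by (intro nn_integral_mono) (auto simp: indicator_def)
    then show ?thesis by (simp add: nn_integral_heat)
  qed
  let ?C = "2 powr (real DIM('a) / 2) :: real"
  show ?thesis
  proof (cases "x \<in> Q")
    case True
    then obtain e where e: "e > 0" "ball x e \<subseteq> Q" using Q open_contains_ball by blast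
    have lower: "1 - ennreal (?C * exp (- e\<^sup>2 / (8 * ?t k))) \<le> heat_box Q (?t k) x" for k
    proof -
      let ?T = "\<integral>\<^sup>+y. ennreal (heat (?t k) (y - x)) * indicator {y. e \<le> norm (y - x)} y \<partial>lborel"
      have "1 = (\<integral>\<^sup>+y. ennreal (heat (?t k) (y - x)) \<partial>lborel)" by (simp add: nn_integral_heat)
      also have "\<dots> \<le> (\<integral>\<^sup>+y. ennreal (heat (?t k) (y - x)) * indicator Q y
          + ennreal (heat (?t k) (y - x)) * indicator {y. e \<le> norm (y - x)} y \<partial>lborel)"
      proof (rule nn_integral_mono)
        fix y
        have "y \<in> Q \<or> e \<le> norm (y - x)" using e(2) by (auto simp: ball_def dist_norm norm_minus_commute not_le
            subset_eq)
        then show "ennreal (heat (?t k) (y - x)) \<le> ennreal (heat (?t k) (y - x)) * indicator Q y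
            + ennreal (heat (?t k) (y - x)) * indicator {y. e \<le> norm (y - x)} y"
          by (auto simp: indicator_def)
      qed
      also have "\<dots> = heat_box Q (?t k) x + ?T" unfolding heat_box_def by (rule nn_integral_add) auto
      also have "\<dots> \<le> heat_box Q (?t k) x + ennreal (?C * exp (- e\<^sup>2 / (8 * ?t k)))"
        using e by (intro add_left_mono heat_tail) auto
      finally show ?thesis by (simp add: ennreal_minus_le_iff add.commute)
    qed
    have "(\<lambda>k. 1 - ennreal (?C * exp (- e\<^sup>2 / (8 * ?t k)))) \<longlonglongrightarrow> 1 - ennreal 0"
      by (rule tendsto_diff_ennreal[OF tendsto_const tendsto_ennrealI[OF heat_tail_tendsto_0[OF e(1)]]])
          simp_all
    then have "(\<lambda>k. 1 - ennreal (?C * exp (- e\<^sup>2 / (8 * ?t k)))) \<longlonglongrightarrow> 1" by simp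
    then have "(\<lambda>k. heat_box Q (?t k) x) \<longlonglongrightarrow> 1"
      by (rule tendsto_sandwich[OF always_eventually[OF allI[OF lower]] always_eventually[OF allI[OF le1]] _
          tendsto_const])
    then show ?thesis using True by simp
  next
    case False
    then have "x \<notin> closure Q" using x Q by (auto simp: frontier_def interior_open)
    then obtain e where e: "e > 0" "ball x e \<subseteq> - closure Q" using open_contains_ball[of "- closure Q"] by auto
    have upper: "heat_box Q (?t k) x \<le> ennreal (?C * exp (- e\<^sup>2 / (8 * ?t k)))" for k
    proof -
      have "heat_box Q (?t k) x \<le> (\<integral>\<^sup>+y. ennreal (heat (?t k) (y - x)) * indicator {y. e
          \<le> norm (y - x)} y \<partial>lborel)"
        unfolding heat_box_def
      proof (rule nn_integral_mono)
        fix y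
        have "y \<notin> Q \<or> e \<le> norm (y - x)"
        proof (rule ccontr)
          assume "\<not> ?thesis"
          then have "y \<in> ball x e" "y \<in> closure Q"
            using closure_subset[of Q] by (auto simp: dist_norm norm_minus_commute)
          then show False using e(2) by auto
        qed
        then show "ennreal (heat (?t k) (y - x)) * indicator Q y \<le> ennreal (heat (?t k) (y - x)) * indicator
            {y. e \<le> norm (y - x)} y"
          by (auto simp: indicator_def)
      qed
      also have "\<dots> \<le> ennreal (?C * exp (- e\<^sup>2 / (8 * ?t k)))" using e by (intro heat_tail) auto
      finally show ?thesis .
    qed
    have "(\<lambda>k. ennreal (?C * exp (- e\<^sup>2 / (8 * ?t k)))) \<longlonglongrightarrow> ennreal 0"
      by (intro tendsto_ennrealI heat_tail_tendsto_0 e)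
    then have "(\<lambda>k. heat_box Q (?t k) x) \<longlonglongrightarrow> 0"
      by (intro tendsto_sandwich[OF always_eventually always_eventually[OF allI[OF upper]] tendsto_const])
          auto
    then show ?thesis using False by simp
  qed
qed

text \<open>A majorant uniform in t <= 1, for dominated convergence as t tends to 0. From |y0 - x|^2
  <= 2|y - x|^2 + 2R^2 one passes from exp(-|y - x|^2/8) to exp(-|y0 - x|^2/16), the Gaussian of
  time 4; the remaining kernel of time 2t has mass one.\<close>

lemma heat_box_le:
  assumes Q: "Q \<subseteq> cball y0 R" and R: "0 \<le> R" and t: "0 < t" "t \<le> 1"
  shows "heat_box Q t (x::'a::euclidean_space) \<le> ennreal (2 powr (real DIM('a) / 2) * exp (R\<^sup>2 / 8) * (16 *
      pi) powr (real DIM('a) / 2)) * ennreal (heat 4 (y0 - x))"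
proof -
  let ?C = "2 powr (real DIM('a) / 2) * exp (R\<^sup>2 / 8) * (16 * pi) powr (real DIM('a) / 2)"
  have "heat_box Q t x \<le> (\<integral>\<^sup>+y. ennreal (?C * heat 4 (y0 - x)) * ennreal (heat (2 * t) (y - x)) \<partial>lborel)"
    unfolding heat_box_def
  proof (rule nn_integral_mono)
    fix y
    show "ennreal (heat t (y - x)) * indicator Q y \<le> ennreal (?C * heat 4 (y0 - x)) * ennreal (heat (2 * t) (y
        - x))"
    proof (cases "y \<in> Q")
      case True
      then have yR: "norm (y - y0) \<le> R" using Q by (auto simp: dist_norm norm_minus_commute)
      have "norm (y0 - x) \<le> norm (y - x) + norm (y - y0)" by norm
      then have "(norm (y0 - x))\<^sup>2 \<le> (norm (y - x) + R)\<^sup>2" using yR by (intro power_mono) auto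
      also have "\<dots> \<le> 2 * (norm (y - x))\<^sup>2 + 2 * R\<^sup>2"
        using zero_le_power2[of "norm (y - x) - R"] by (simp add: power2_eq_square algebra_simps)
      finally have "- (norm (y - x))\<^sup>2 \<le> R\<^sup>2 - (norm (y0 - x))\<^sup>2 / 2" by simp
      then have le: "- (norm (y - x))\<^sup>2 / 8 \<le> R\<^sup>2 / 8 + - (norm (y0 - x))\<^sup>2 / 16" by simp
      have "(norm (y - x))\<^sup>2 / 8 \<le> (norm (y - x))\<^sup>2 / (8 * t)"
        using t by (intro divide_left_mono) auto
      then have "exp (- (norm (y - x))\<^sup>2 / (8 * t)) \<le> exp (- (norm (y - x))\<^sup>2 / 8)" by simp
      also have "\<dots> \<le> exp (R\<^sup>2 / 8) * exp (- (norm (y0 - x))\<^sup>2 / 16)"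
        unfolding exp_add[symmetric] using le by simp
      also have "exp (- (norm (y0 - x))\<^sup>2 / 16) = (16 * pi) powr (real DIM('a) / 2) * heat 4 (y0 - x)"
        unfolding heat_def by (simp add: mult.assoc[symmetric] mult.commute[of pi 16] flip: powr_add)
      finally have "heat t (y - x) \<le> 2 powr (real DIM('a) / 2) * (exp (R\<^sup>2 / 8) * ((16 * pi) powr (real
          DIM('a) / 2) * heat 4 (y0 - x))) * heat (2 * t) (y - x)"
        using heat_le_double[OF t(1), of "norm (y - x)" "y - x"]
        by (meson mult_left_mono mult_right_mono order_trans heat_nonneg powr_ge_zero norm_ge_zero order_refl)
      then show ?thesis using True by (simp add: ennreal_mult[symmetric] ennreal_leI mult.assoc)
    qed simp
  qed
  also have "\<dots> = ennreal (?C * heat 4 (y0 - x))" using t by (simp add: nn_integral_cmult nn_integral_heat)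
  finally show ?thesis by (simp add: ennreal_mult)
qed

text \<open>Integrating the hypothesis over y in a box and letting t tend to 0 recovers the
  integrals of \<open>f\<close> and \<open>g\<close> over all boxes, and boxes generate the Borel
  sets. The \<open>ennreal\<close> formulation allows sums involving possibly infinite potentials to
  be compared without subtraction.\<close>

lemma heat_unique:
  fixes f g :: "'a::euclidean_space \<Rightarrow> ennreal"
  assumes [measurable]: "f \<in> borel_measurable borel" "g \<in> borel_measurable borel"
    and eq: "\<And>t y. t > 0 \<Longrightarrow> (\<integral>\<^sup>+x. f x * ennreal (heat t (y - x)) \<partial>lborel) = (\<integral>\<^sup>+x. g x * ennreal (heat t (y -
        x)) \<partial>lborel)"
    and fin: "\<And>t y. t > 0 \<Longrightarrow> (\<integral>\<^sup>+x. f x * ennreal (heat t (y - x)) \<partial>lborel) < \<infinity>"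
  shows "AE x in lborel. f x = g x"
proof -
  have lim: "(\<lambda>k. \<integral>\<^sup>+x. f x * heat_box (box a b) (1 / real (Suc k)) x \<partial>lborel) \<longlonglongrightarrow> (\<integral>\<^sup>+x. f x * indicator (box a
      b) x \<partial>lborel)"
    and fin_box: "(\<integral>\<^sup>+x. f x * indicator (box a b) x \<partial>lborel) < \<infinity>"
    if [measurable]: "f \<in> borel_measurable borel" and fin: "\<And>t y. t > 0 \<Longrightarrow>
        (\<integral>\<^sup>+x. f x * ennreal (heat t (y - x)) \<partial>lborel) < \<infinity>"
    for f :: "'a \<Rightarrow> ennreal" and a b :: 'a
  proof -
    obtain R where R: "R > 0" "box a b \<subseteq> cball 0 R"
    proof -
      obtain R where "R > 0" "box a b \<subseteq> ball 0 R" using bounded_subset_ballD[OF bounded_box[of a b], of 0]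
          by auto
      then show ?thesis using that[of R] ball_subset_cball[of 0 R] by (meson subset_trans)
    qed
    define C where "C = 2 powr (real DIM('a) / 2) * exp (R\<^sup>2 / 8) * (16 * pi) powr (real DIM('a) / 2)"
    have dom: "heat_box (box a b) (1 / real (Suc k)) x \<le> ennreal C * ennreal (heat 4 (0 - x))" for k x
      unfolding C_def using R by (intro heat_box_le) auto
    have frontier: "AE x in lborel. x \<notin> frontier (box a b)"
    proof -
      have "frontier (box a b) \<subseteq> cbox a b - box a b" by (auto simp: frontier_box)
      then have "negligible (frontier (box a b))" using negligible_frontier_interval negligible_subset
          by blast
      then have "frontier (box a b) \<in> null_sets lebesgue" by (simp add: negligible_iff_null_sets)
      then have "AE x in lebesgue. x \<notin> frontier (box a b)" by (rule AE_not_in)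
      then show ?thesis by (simp add: AE_completion_iff)
    qed
    have int: "(\<integral>\<^sup>+x. f x * (ennreal C * ennreal (heat 4 (0 - x))) \<partial>lborel) < \<infinity>"
    proof -
      have "(\<integral>\<^sup>+x. f x * (ennreal C * ennreal (heat 4 (0 - x))) \<partial>lborel) = ennreal C * (\<integral>\<^sup>+x. f x * ennreal
          (heat 4 (0 - x)) \<partial>lborel)"
        by (simp add: nn_integral_cmult[symmetric] mult_ac)
      also have "\<dots> < \<infinity>" using fin[of 4 0] by (simp add: ennreal_mult_less_top)
      finally show ?thesis .
    qed
    \<comment> \<open>Multiplication by a constant in \<open>ennreal\<close> is continuous only for
      finite constants, so the pointwise limit below requires this.\<close>
    have fcont: "AE x in lborel. f x < \<infinity>"
    proof -
      have "AE x in lborel. f x * (ennreal C * ennreal (heat 4 (0 - x))) \<noteq> \<infinity>"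
        by (rule nn_integral_noteq_infinite) (use int in auto)
      then show ?thesis
      proof eventually_elim
        case (elim x)
        have "heat 4 (0 - x) > 0" "C > 0" by (simp_all add: heat_def C_def)
        then show ?case using elim by (auto simp: ennreal_mult_eq_top_iff less_top)
      qed
    qed
    have [measurable]: "heat_box (box a b) t \<in> borel_measurable borel" for t
      unfolding heat_box_def by measurable
    show l: "(\<lambda>k. \<integral>\<^sup>+x. f x * heat_box (box a b) (1 / real (Suc k)) x \<partial>lborel) \<longlonglongrightarrow> (\<integral>\<^sup>+x. f x * indicator (box a
        b) x \<partial>lborel)"
    proof (rule nn_integral_dominated_convergence[OF _ _ _ _ int])
      show "AE x in lborel. f x * heat_box (box a b) (1 / real (Suc j)) x \<le> f x * (ennreal C * ennreal (heat 4
          (0 - x)))" for j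
        by (intro AE_I2 mult_left_mono dom) simp
      show "AE x in lborel. (\<lambda>k. f x * heat_box (box a b) (1 / real (Suc k)) x) \<longlonglongrightarrow> f x * indicator (box a b) x"
        using frontier fcont
      proof eventually_elim
        case (elim x)
        show ?case by (intro ennreal_tendsto_cmult heat_box_tendsto elim open_box) (use elim in auto)
      qed
    qed auto
    have "(\<integral>\<^sup>+x. f x * indicator (box a b) x \<partial>lborel) \<le> (\<integral>\<^sup>+x. f x * (ennreal C * ennreal (heat 4 (0 - x)))
        \<partial>lborel)"
    proof (rule LIMSEQ_le_const2[OF l], intro exI allI impI nn_integral_mono mult_left_mono dom)
    qed simp
    then show "(\<integral>\<^sup>+x. f x * indicator (box a b) x \<partial>lborel) < \<infinity>" using int by simp
  qed
  have fub: "(\<integral>\<^sup>+x. f x * heat_box (box a b) t x \<partial>lborel) = (\<integral>\<^sup>+y. (\<integral>\<^sup>+x. f x * ennreal (heat t (y - x))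
      \<partial>lborel) * indicator (box a b) y \<partial>lborel)"
    if [measurable]: "f \<in> borel_measurable borel" for f :: "'a \<Rightarrow> ennreal" and a b t
  proof -
    have "(\<integral>\<^sup>+x. f x * heat_box (box a b) t x \<partial>lborel) = (\<integral>\<^sup>+x. (\<integral>\<^sup>+y. f x * (ennreal (heat t (y - x)) *
        indicator (box a b) y) \<partial>lborel) \<partial>lborel)"
      unfolding heat_box_def by (simp add: nn_integral_cmult)
    also have "\<dots> = (\<integral>\<^sup>+y. (\<integral>\<^sup>+x. f x * (ennreal (heat t (y - x)) * indicator (box a b) y) \<partial>lborel) \<partial>lborel)"
      by (rule lborel_pair.Fubini') measurable
    also have "\<dots> = (\<integral>\<^sup>+y. (\<integral>\<^sup>+x. f x * ennreal (heat t (y - x)) \<partial>lborel) * indicator (box a b) y \<partial>lborel)"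
      by (subst nn_integral_multc[symmetric]) (simp_all add: mult.assoc)
    finally show ?thesis .
  qed
  have fin_g: "\<And>t y. t > 0 \<Longrightarrow> (\<integral>\<^sup>+x. g x * ennreal (heat t (y - x)) \<partial>lborel) < \<infinity>"
    using eq fin by metis
  have box_eq: "(\<integral>\<^sup>+x. f x * indicator (box a b) x \<partial>lborel) = (\<integral>\<^sup>+x. g x * indicator (box a b) x \<partial>lborel)" for
      a b
  proof (rule LIMSEQ_unique[OF lim[OF _ fin]])
    have "(\<integral>\<^sup>+x. f x * heat_box (box a b) (1 / real (Suc k)) x \<partial>lborel) = (\<integral>\<^sup>+x. g x * heat_box (box a b) (1 /
        real (Suc k)) x \<partial>lborel)" for k
      by (simp add: fub eq)
    then show "(\<lambda>k. \<integral>\<^sup>+x. f x * heat_box (box a b) (1 / real (Suc k)) x \<partial>lborel) \<longlonglongrightarrow> (\<integral>\<^sup>+x. g x * indicator (box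
        a b) x \<partial>lborel)"
      using lim[OF _ fin_g, of a b] by simp
  qed auto
  have "density lborel f = density lborel g"
  proof (rule measure_eqI_generator_eq)
    let ?E = "range (\<lambda>(a, b). box a b::'a set)"
    show "Int_stable ?E" by (auto simp: Int_stable_def box_Int_box)
    show "?E \<subseteq> Pow UNIV" "sets (density lborel f) = sigma_sets UNIV ?E" "sets (density lborel g)
        = sigma_sets UNIV ?E"
      by (simp_all add: borel_eq_box)
    let ?A = "\<lambda>n::nat. box (- (real n *\<^sub>R One)) (real n *\<^sub>R One) :: 'a set"
    show "range ?A \<subseteq> ?E" "(\<Union>i. ?A i) = UNIV"
      unfolding UN_box_eq_UNIV by auto
    show "emeasure (density lborel f) (?A i) \<noteq> \<infinity>" for i
      using fin_box[OF _ fin, of "- (real i *\<^sub>R One)" "real i *\<^sub>R One"] by (simp add: emeasure_density)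
    show "emeasure (density lborel f) X = emeasure (density lborel g) X" if "X \<in> ?E" for X
      using that box_eq by (auto simp: emeasure_density)
  qed
  then show ?thesis by (intro sigma_finite_measure.density_unique[OF lborel.sigma_finite_measure_axioms]) auto
qed

section \<open>Gaussians as Schwartz functions\<close>

lemma
  fixes f :: "'a::euclidean_space \<Rightarrow> real \<Rightarrow> 'b::{real_normed_field, banach, second_countable_topology}"
  assumes int: "\<And>b. b \<in> Basis \<Longrightarrow> integrable lborel (f b)"
  shows integrable_lborel_prod: "integrable lborel (\<lambda>x. \<Prod>b\<in>Basis. f b (x \<bullet> b))"
    and integral_lborel_prod: "(\<integral>x. (\<Prod>b\<in>Basis. f b (x \<bullet> b)) \<partial>lborel) = (\<Prod>b\<in>Basis. \<integral>x. f b x \<partial>lborel)"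
proof -
  interpret product_sigma_finite "\<lambda>_::'a. lborel :: real measure" ..
  have [measurable]: "f b \<in> borel_measurable borel" if "b \<in> Basis" for b using int[OF that] by auto
  have [measurable]: "(\<lambda>x. \<Prod>b\<in>Basis. f b (x \<bullet> b)) \<in> borel_measurable borel" by measurable
  have T: "(\<lambda>f. \<Sum>b\<in>Basis. f b *\<^sub>R b) \<in> (\<Pi>\<^sub>M b\<in>Basis. lborel) \<rightarrow>\<^sub>M (borel :: 'a measure)" by measurable
  have eq: "(\<Prod>b\<in>Basis. f b ((\<Sum>b\<in>Basis. x b *\<^sub>R b) \<bullet> b)) = (\<Prod>b\<in>Basis. f b (x b))" for x
    by (intro prod.cong) auto
  show "integrable lborel (\<lambda>x. \<Prod>b\<in>Basis. f b (x \<bullet> b))"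
    unfolding lborel_eq[where 'a = 'a] using product_integrable_prod[OF finite_Basis int]
    by (subst integrable_distr_eq[OF T]) (simp_all add: eq)
  show "(\<integral>x. (\<Prod>b\<in>Basis. f b (x \<bullet> b)) \<partial>lborel) = (\<Prod>b\<in>Basis. \<integral>x. f b x \<partial>lborel)"
    unfolding lborel_eq[where 'a = 'a] using product_integral_prod[OF finite_Basis int]
    by (subst integral_distr[OF T]) (simp_all add: eq)
qed

text \<open>Rescaling by c = 1/sqrt(2t) turns the Gaussian into the standard normal density, whose
  characteristic function is known.\<close>

lemma
  fixes y t :: real
  assumes t: "t > 0"
  shows integrable_gaussian_cis_real: "integrable lborel (\<lambda>x. complex_of_real (exp (- t * x\<^sup>2)) * cis (y *
      x))"
    and integral_gaussian_cis_real: "(\<integral>x. complex_of_real (exp (- t * x\<^sup>2)) * cis (y * x) \<partial>lborel)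
      = of_real (sqrt (pi / t) * exp (- y\<^sup>2 / (4 * t)))"
proof -
  let ?F = "\<lambda>x. complex_of_real (exp (- t * x\<^sup>2)) * cis (y * x)"
  define c where "c = 1 / sqrt (2 * t)"
  have c: "c > 0" using t by (simp add: c_def)
  have c2: "t * c\<^sup>2 = 1 / 2" using t by (simp add: c_def power_divide)
  have F: "?F (0 + c * x) = of_real (sqrt (2 * pi)) * (std_normal_density x *\<^sub>R iexp (y * c * x))" for x
  proof -
    have "- t * (c * x)\<^sup>2 = - x\<^sup>2 / 2" using c2 by (simp add: power_mult_distrib flip: mult.assoc)
    then show ?thesis
      by (simp add: std_normal_density_def cis_conv_exp scaleR_conv_of_real mult.assoc)
  qed
  have int: "integrable lborel (\<lambda>x. std_normal_density x *\<^sub>R iexp (y * c * x))"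
    by (rule Bochner_Integration.integrable_bound[OF integrable_normal_density[where \<mu> = 0 and \<sigma>
        = 1]]) (simp_all add: norm_exp_i_times)
  have "char std_normal_distribution (y * c) = (\<integral>x. std_normal_density x *\<^sub>R iexp (y * c * x) \<partial>lborel)"
    unfolding char_def by (subst integral_density) (auto simp: normal_density_nonneg)
  then have val: "(\<integral>x. std_normal_density x *\<^sub>R iexp (y * c * x) \<partial>lborel) = of_real (exp (- (y * c)\<^sup>2 / 2))"
    by (simp add: char_std_normal_distribution)
  show "integrable lborel ?F"
  proof -
    have "integrable lborel (\<lambda>x. ?F (0 + c * x))" unfolding F using int by (rule integrable_mult_right)
    then show ?thesis using lborel_integrable_real_affine_iff[of c ?F 0] c by blast
  qed
  have "(\<integral>x. ?F x \<partial>lborel) = \<bar>c\<bar> *\<^sub>R (\<integral>x. ?F (0 + c * x) \<partial>lborel)"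
    using c by (intro lborel_integral_real_affine) auto
  also have "\<dots> = of_real (c * sqrt (2 * pi) * exp (- (y * c)\<^sup>2 / 2))"
    unfolding F integral_mult_right_zero val using c by (simp add: scaleR_conv_of_real)
  also have "c * sqrt (2 * pi) = sqrt (pi / t)" using t by (simp add: c_def real_sqrt_divide real_sqrt_mult)
  also have "- (y * c)\<^sup>2 / 2 = - y\<^sup>2 / (4 * t)" using t by (simp add: c_def power_divide power_mult_distrib)
  finally show "(\<integral>x. ?F x \<partial>lborel) = of_real (sqrt (pi / t) * exp (- y\<^sup>2 / (4 * t)))" .
qed

lemma norm_power2_eq_sum: "(norm (x::'a::euclidean_space))\<^sup>2 = (\<Sum>b\<in>Basis. (x \<bullet> b)\<^sup>2)"
  unfolding power2_norm_eq_inner euclidean_inner[of x x] by (simp add: power2_eq_square)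

lemma cis_sum: "finite A \<Longrightarrow> cis (\<Sum>b\<in>A. f b) = (\<Prod>b\<in>A. cis (f b))"
  by (induction rule: finite_induct) (simp_all add: cis_mult[symmetric])

text \<open>The value is recorded as a multiple of the heat kernel in the modulation vector y: this
  form turns pairings with modulated Gaussians into convolutions with \<open>heat t\<close>.\<close>

lemma
  fixes y :: "'a::euclidean_space"
  assumes t: "t > 0"
  shows integrable_gaussian_cis: "integrable lborel (\<lambda>x. complex_of_real (exp (- t * (norm x)\<^sup>2)) * cis (y \<bullet>
      x))"
    and integral_gaussian_cis: "(\<integral>x. complex_of_real (exp (- t * (norm x)\<^sup>2)) * cis (y \<bullet> x) \<partial>lborel)
      = of_real ((2 * pi) powr real DIM('a) * heat t y)"
proof -
  let ?f = "\<lambda>b x. complex_of_real (exp (- t * x\<^sup>2)) * cis ((y \<bullet> b) * x)"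
  have eq: "complex_of_real (exp (- t * (norm x)\<^sup>2)) * cis (y \<bullet> x) = (\<Prod>b\<in>Basis. ?f b (x \<bullet> b))" for x :: 'a
  proof -
    have "exp (- t * (norm x)\<^sup>2) = (\<Prod>b\<in>(Basis::'a set). exp (- t * (x \<bullet> b)\<^sup>2))"
      unfolding norm_power2_eq_sum sum_distrib_left by (rule exp_sum) simp
    moreover have "cis (y \<bullet> x) = (\<Prod>b\<in>(Basis::'a set). cis ((y \<bullet> b) * (x \<bullet> b)))"
      unfolding euclidean_inner[of y x] by (rule cis_sum) simp
    ultimately show ?thesis by (simp add: prod.distrib)
  qed
  show "integrable lborel (\<lambda>x. complex_of_real (exp (- t * (norm x)\<^sup>2)) * cis (y \<bullet> x))"
    unfolding eq by (intro integrable_lborel_prod integrable_gaussian_cis_real t)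
  have "(\<integral>x. complex_of_real (exp (- t * (norm x)\<^sup>2)) * cis (y \<bullet> x) \<partial>lborel)
    = (\<Prod>b\<in>(Basis::'a set). complex_of_real (sqrt (pi / t) * exp (- (y \<bullet> b)\<^sup>2 / (4 * t))))"
    unfolding eq by (subst integral_lborel_prod) (simp_all only: integral_gaussian_cis_real[OF t]
        integrable_gaussian_cis_real[OF t])
  also have "\<dots> = of_real (\<Prod>b\<in>(Basis::'a set). sqrt (pi / t) * exp (- (y \<bullet> b)\<^sup>2 / (4 * t)))"
    by (simp only: of_real_prod)
  also have "(\<Prod>b\<in>(Basis::'a set). sqrt (pi / t) * exp (- (y \<bullet> b)\<^sup>2 / (4 * t)))
      = (2 * pi) powr real DIM('a) * heat t y"
  proof -
    have "(\<Prod>b\<in>(Basis::'a set). sqrt (pi / t) * exp (- (y \<bullet> b)\<^sup>2 / (4 * t)))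
        = sqrt (pi / t) ^ DIM('a) * exp (\<Sum>b\<in>(Basis::'a set). - (y \<bullet> b)\<^sup>2 / (4 * t))"
      by (simp add: prod.distrib exp_sum)
    also have "(\<Sum>b\<in>(Basis::'a set). - (y \<bullet> b)\<^sup>2 / (4 * t)) = - (norm y)\<^sup>2 / (4 * t)"
      unfolding norm_power2_eq_sum by (simp add: sum_divide_distrib sum_negf)
    also have "sqrt (pi / t) ^ DIM('a) = (2 * pi) powr real DIM('a) * (4 * pi * t) powr (- real DIM('a) / 2)"
    proof -
      have "(2 * pi) powr real DIM('a) * (4 * pi * t) powr (- real DIM('a) / 2)
         = ((2 * pi) powr 2) powr (real DIM('a) / 2) * ((4 * pi * t) powr (-1)) powr (real DIM('a) / 2)"
        unfolding powr_powr by simp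
      also have "\<dots> = ((2 * pi) powr 2 * (4 * pi * t) powr (-1)) powr (real DIM('a) / 2)"
        by (rule powr_mult[symmetric])
      also have "(2 * pi) powr 2 * (4 * pi * t) powr (-1) = pi / t"
        using t by (simp add: powr_minus powr_numeral power2_eq_square field_simps)
      also have "(pi / t) powr (real DIM('a) / 2) = ((pi / t) powr (1/2)) powr real DIM('a)"
        unfolding powr_powr by simp
      also have "\<dots> = sqrt (pi / t) ^ DIM('a)"
        using t by (subst powr_realpow[symmetric]) (auto simp: powr_half_sqrt)
      finally show ?thesis by simp
    qed
    finally show ?thesis by (simp add: heat_def)
  qed
  finally show "(\<integral>x. complex_of_real (exp (- t * (norm x)\<^sup>2)) * cis (y \<bullet> x) \<partial>lborel)
      = of_real ((2 * pi) powr real DIM('a) * heat t y)" .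
qed

text \<open>Obtained from the preceding integral at the dual time 1/(4t), after translating
  \<open>x0\<close> to the origin. The normalising constants cancel because (4 pi t)(4 pi/(4t)) = (2
  pi)^2.\<close>

lemma
  fixes x0 \<xi> :: "'a::euclidean_space"
  assumes t: "t > 0"
  shows integrable_cis_heat: "integrable lborel (\<lambda>x. cis (- (x \<bullet> \<xi>)) * complex_of_real (heat t (x - x0)))"
    and integral_cis_heat: "(\<integral>x. cis (- (x \<bullet> \<xi>)) * complex_of_real (heat t (x - x0)) \<partial>lborel)
      = of_real (exp (- t * (norm \<xi>)\<^sup>2)) * cis (- (x0 \<bullet> \<xi>))"
proof -
  let ?t = "1 / (4 * t)"
  have t': "?t > 0" using t by simp
  have eq: "cis (- ((x0 + x) \<bullet> \<xi>)) * complex_of_real (heat t (x0 + x - x0))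
      = (of_real ((4 * pi * t) powr (- real DIM('a) / 2)) * cis (- (x0 \<bullet> \<xi>))) * (of_real (exp (- ?t * (norm
          x)\<^sup>2)) * cis ((- \<xi>) \<bullet> x))" for x
  proof -
    have "cis (- ((x0 + x) \<bullet> \<xi>)) = cis (- (x0 \<bullet> \<xi>)) * cis ((- \<xi>) \<bullet> x)"
      by (simp add: cis_mult inner_simps inner_commute)
    then show ?thesis by (simp add: heat_def)
  qed
  have "integrable lborel (\<lambda>x. cis (- ((x0 + x) \<bullet> \<xi>)) * complex_of_real (heat t (x0 + x - x0)))"
    unfolding eq by (intro integrable_mult_right integrable_gaussian_cis t')
  then have "integrable (distr lborel borel ((+) x0)) (\<lambda>x. cis (- (x \<bullet> \<xi>)) * complex_of_real (heat t (x -
      x0)))"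
    by (subst integrable_distr_eq) (auto simp: cis_conv_exp)
  then show "integrable lborel (\<lambda>x. cis (- (x \<bullet> \<xi>)) * complex_of_real (heat t (x - x0)))"
    by (simp add: lborel_distr_plus)
  have "(\<integral>x. cis (- (x \<bullet> \<xi>)) * complex_of_real (heat t (x - x0)) \<partial>lborel)
    = (\<integral>x. cis (- (x \<bullet> \<xi>)) * complex_of_real (heat t (x - x0)) \<partial>distr lborel borel ((+) x0))"
    by (simp add: lborel_distr_plus)
  also have "\<dots> = (\<integral>x. cis (- ((x0 + x) \<bullet> \<xi>)) * complex_of_real (heat t (x0 + x - x0)) \<partial>lborel)"
    by (subst integral_distr) (auto simp: cis_conv_exp)
  also have "\<dots> = (of_real ((4 * pi * t) powr (- real DIM('a) / 2)) * cis (- (x0 \<bullet> \<xi>))) * of_real ((2 * pi)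
      powr real DIM('a) * heat ?t (- \<xi>))"
    unfolding eq by (simp only: integral_mult_right_zero integral_gaussian_cis[OF t'])
  also have "\<dots> = of_real ((4 * pi * t) powr (- real DIM('a) / 2) * ((2 * pi) powr real DIM('a) * heat ?t (-
      \<xi>))) * cis (- (x0 \<bullet> \<xi>))"
    by simp
  also have "(4 * pi * t) powr (- real DIM('a) / 2) * ((2 * pi) powr real DIM('a) * heat ?t (- \<xi>))
      = exp (- t * (norm \<xi>)\<^sup>2)"
  proof -
    define A B where "A = (4 * pi * t) powr (real DIM('a) / 2)" and "B = (4 * pi * ?t) powr (real DIM('a) /
        2)"
    have "A * B = ((4 * pi * t) * (4 * pi * ?t)) powr (real DIM('a) / 2)"
      unfolding A_def B_def by (rule powr_mult[symmetric])
    also have "(4 * pi * t) * (4 * pi * ?t) = (2 * pi) powr 2"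
      using t by (simp add: powr_numeral power2_eq_square)
    finally have "A * B = (2 * pi) powr real DIM('a)" unfolding powr_powr by simp
    note AB = this
    have AX: "A * (4 * pi * t) powr (- real DIM('a) / 2) = 1" and BY: "B * (4 * pi * ?t) powr (- real DIM('a)
        / 2) = 1"
      unfolding A_def B_def powr_add[symmetric] using t by auto
    have X: "X * (A * B * (Y * E)) = (A * X) * (B * Y) * E" for X Y E by (simp only: mult_ac)
    have "(4 * pi * t) powr (- real DIM('a) / 2) * ((2 * pi) powr real DIM('a) * ((4 * pi * ?t) powr (- real
        DIM('a) / 2) * E)) = E" for E
      unfolding AB[symmetric] X AX BY by simp
    from this[of "exp (- (norm (- \<xi>))\<^sup>2 / (4 * ?t))"] show ?thesis unfolding heat_def
      by (simp add: mult.commute)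
  qed
  finally show "(\<integral>x. cis (- (x \<bullet> \<xi>)) * complex_of_real (heat t (x - x0)) \<partial>lborel)
      = of_real (exp (- t * (norm \<xi>)\<^sup>2)) * cis (- (x0 \<bullet> \<xi>))" .
qed

text \<open>Complex polynomials in the coordinates, generated inductively: growth bounds and
  stability under partial derivatives follow by rule induction, without multi-index
  bookkeeping.\<close>

inductive cpoly :: "(real^'n \<Rightarrow> complex) \<Rightarrow> bool" where
  const: "cpoly (\<lambda>x. c)"
| coord: "cpoly (\<lambda>x. of_real (x $ i))"
| add: "cpoly p \<Longrightarrow> cpoly q \<Longrightarrow> cpoly (\<lambda>x. p x + q x)"
| mult: "cpoly p \<Longrightarrow> cpoly q \<Longrightarrow> cpoly (\<lambda>x. p x * q x)"

lemma cpoly_derivative: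
  "cpoly p \<Longrightarrow> \<exists>D. (\<forall>x. (p has_derivative D x) (at x)) \<and> (\<forall>i. cpoly (\<lambda>x. D x (axis i 1)))"
proof (induction rule: cpoly.induct)
  case (const c)
  show ?case by (intro exI[of _ "\<lambda>x h. 0"]) (auto intro: cpoly.const)
next
  case (coord i)
  show ?case
  proof (intro exI conjI allI)
    show "((\<lambda>x. complex_of_real (x $ i)) has_derivative (\<lambda>h. of_real (h $ i))) (at x)" for x
      by (intro has_derivative_of_real bounded_linear_imp_has_derivative bounded_linear_vec_nth)
  qed (rule cpoly.const)
next
  case (add p q)
  then obtain D E where *: "\<forall>x. (p has_derivative D x) (at x)" "\<forall>i. cpoly (\<lambda>x. D x (axis i 1))"
    "\<forall>x. (q has_derivative E x) (at x)" "\<forall>i. cpoly (\<lambda>x. E x (axis i 1))" by blast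
  show ?case
    by (intro exI[of _ "\<lambda>x h. D x h + E x h"]) (use * in \<open>auto intro!: has_derivative_add cpoly.add\<close>)
next
  case (mult p q)
  then obtain D E where *: "\<forall>x. (p has_derivative D x) (at x)" "\<forall>i. cpoly (\<lambda>x. D x (axis i 1))"
    "\<forall>x. (q has_derivative E x) (at x)" "\<forall>i. cpoly (\<lambda>x. E x (axis i 1))" by blast
  show ?case
    by (intro exI[of _ "\<lambda>x h. p x * E x h + D x h * q x"])
      (use * mult.hyps in \<open>auto intro!: has_derivative_mult cpoly.add cpoly.mult\<close>)
qed

lemma cpoly_bound:
  fixes p :: "real^'n \<Rightarrow> complex"
  shows "cpoly p \<Longrightarrow> \<exists>C\<ge>0. \<exists>k. \<forall>x. cmod (p x) \<le> C * (1 + norm x) ^ k"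
proof (induction rule: cpoly.induct)
  case (const c)
  show ?case by (intro exI[of _ "cmod c"] conjI exI[of _ 0]) auto
next
  case (coord i)
  have "cmod (complex_of_real (x $ i)) \<le> 1 * (1 + norm x) ^ 1" for x :: "real^'n"
    using component_le_norm_cart[of x i] by simp
  then show ?case by (intro exI[of _ 1] conjI) auto
next
  case (add p q)
  then obtain C D k l where *: "C \<ge> 0" "D \<ge> 0" "\<And>x. cmod (p x) \<le> C * (1 + norm x) ^ k" "\<And>x. cmod (q x)
      \<le> D * (1 + norm x) ^ l"
    by metis
  have "cmod (p x + q x) \<le> (C + D) * (1 + norm x) ^ (k + l)" for x
  proof -
    have "cmod (p x + q x) \<le> C * (1 + norm x) ^ k + D * (1 + norm x) ^ l"
      using norm_triangle_ineq[of "p x" "q x"] *(3,4)[of x] by linarith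
    also have "\<dots> \<le> C * (1 + norm x) ^ (k + l) + D * (1 + norm x) ^ (k + l)"
      using * by (intro add_mono mult_left_mono power_increasing) auto
    finally show ?thesis by (simp add: distrib_right)
  qed
  then show ?case using * by (intro exI[of _ "C + D"] conjI exI[of _ "k + l"]) auto
next
  case (mult p q)
  then obtain C D k l where *: "C \<ge> 0" "D \<ge> 0" "\<And>x. cmod (p x) \<le> C * (1 + norm x) ^ k" "\<And>x. cmod (q x)
      \<le> D * (1 + norm x) ^ l"
    by metis
  have "cmod (p x * q x) \<le> (C * D) * (1 + norm x) ^ (k + l)" for x
  proof -
    have "cmod (p x * q x) \<le> (C * (1 + norm x) ^ k) * (D * (1 + norm x) ^ l)"
      unfolding norm_mult using * by (intro mult_mono) auto
    then show ?thesis by (simp add: power_add mult_ac)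
  qed
  then show ?case using * by (intro exI[of _ "C * D"] conjI exI[of _ "k + l"]) auto
qed

text \<open>One family for both kinds of test function: a = 0 gives a modulated Gaussian, whose
  Fourier transform is a translated heat kernel, and b = 0 gives translated heat kernels themselves
  up to a constant.\<close>

definition gaussian :: "real \<Rightarrow> real^'n \<Rightarrow> real^'n \<Rightarrow> real^'n \<Rightarrow> complex" where
  "gaussian t a b x = exp (of_real (- t * (x \<bullet> x) + a \<bullet> x) + \<i> * of_real (b \<bullet> x))"

lemma gaussian_alt: "gaussian t a b x = of_real (exp (- t * (norm x)\<^sup>2 + a \<bullet> x)) * cis (b \<bullet> x)"
  unfolding gaussian_def exp_add[of "complex_of_real r" for r] exp_of_real cis_conv_exp power2_norm_eq_inner
      ..

text \<open>The logarithmic derivative of the Gaussian is affine in x, so products of a polynomial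
  and the Gaussian are stable under every partial derivative.\<close>

lemma cpoly_gaussian_derivative:
  assumes "cpoly p"
  shows "\<exists>D. (\<forall>x. ((\<lambda>x. p x * gaussian t a b x) has_derivative D x) (at x)) \<and>
    (\<forall>i. \<exists>q. cpoly q \<and> (\<forall>x. D x (axis i 1) = q x * gaussian t a b x))"
proof -
  obtain E where E: "\<And>x. (p has_derivative E x) (at x)" "\<And>i. cpoly (\<lambda>x. E x (axis i 1))"
    using cpoly_derivative[OF assms] by blast
  define L where "L x h = complex_of_real (- t * (x \<bullet> h + h \<bullet> x) + a \<bullet> h) + \<i> * of_real (b \<bullet> h)" for x h
  have g: "(gaussian t a b has_derivative (\<lambda>h. gaussian t a b x * L x h)) (at x)" for x
  proof -
    have "((\<lambda>x. of_real (- t * (x \<bullet> x) + a \<bullet> x) + \<i> * of_real (b \<bullet> x)) has_derivative L x) (at x)"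
      unfolding L_def[abs_def] by (auto intro!: derivative_eq_intros)
    from has_derivative_compose[OF this DERIV_exp[unfolded has_field_derivative_def]]
    show ?thesis unfolding gaussian_def[abs_def] by simp
  qed
  define D where "D x h = p x * (gaussian t a b x * L x h) + E x h * gaussian t a b x" for x h
  show ?thesis
  proof (intro exI[of _ D] conjI allI)
    show "((\<lambda>x. p x * gaussian t a b x) has_derivative D x) (at x)" for x
      unfolding D_def by (rule has_derivative_mult[OF E(1) g])
    fix i
    have Leq: "L x (axis i 1) = of_real (-2 * t) * of_real (x $ i) + (of_real (a $ i)
        + \<i> * of_real (b $ i))" for x
      by (simp add: L_def inner_axis inner_axis')
    have "cpoly (\<lambda>x. L x (axis i 1))" unfolding Leq
      by (intro cpoly.add cpoly.mult cpoly.const cpoly.coord)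
    then have "cpoly (\<lambda>x. p x * L x (axis i 1) + E x (axis i 1))"
      using assms E(2) by (intro cpoly.add cpoly.mult)
    moreover have "D x (axis i 1) = (p x * L x (axis i 1) + E x (axis i 1)) * gaussian t a b x" for x
      by (simp add: D_def algebra_simps)
    ultimately show "\<exists>q. cpoly q \<and> (\<forall>x. D x (axis i 1) = q x * gaussian t a b x)" by blast
  qed
qed

lemma iterated_partial_deriv_gaussian:
  "\<exists>p. cpoly p \<and> foldr partial_deriv idx (gaussian t a b) = (\<lambda>x. p x * gaussian t a b x)"
proof (induction idx)
  case Nil
  show ?case by (intro exI[of _ "\<lambda>x. 1"]) (auto intro: cpoly.const)
next
  case (Cons i idx)
  then obtain p where p: "cpoly p" "foldr partial_deriv idx (gaussian t a b) = (\<lambda>x. p x * gaussian t a b x)"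
      by blast
  obtain D where D: "\<And>x. ((\<lambda>x. p x * gaussian t a b x) has_derivative D x) (at x)"
    "\<And>i. \<exists>q. cpoly q \<and> (\<forall>x. D x (axis i 1) = q x * gaussian t a b x)"
    using cpoly_gaussian_derivative[OF p(1), of t a b] by blast
  obtain q where q: "cpoly q" "\<And>x. D x (axis i 1) = q x * gaussian t a b x" using D(2) by blast
  have "foldr partial_deriv (i # idx) (gaussian t a b) = (\<lambda>x. q x * gaussian t a b x)"
    unfolding foldr.simps o_def p(2) partial_deriv_def frechet_derivative_at[OF D(1), symmetric] q(2) ..
  with q(1) show ?case by blast
qed

text \<open>All polynomial factors are swallowed by exp(M|x|), using 1 + |x| <= exp |x|, and M|x| -
  t|x|^2 never exceeds M^2/(4t).\<close>

lemma schwartz_gaussian: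
  assumes t: "t > 0"
  shows "schwartz (gaussian t a b)"
  unfolding schwartz_def
proof (intro allI conjI)
  fix idx
  obtain p where p: "cpoly p" "foldr partial_deriv idx (gaussian t a b) = (\<lambda>x. p x * gaussian t a b x)"
    using iterated_partial_deriv_gaussian by blast
  show "foldr partial_deriv idx (gaussian t a b) differentiable at x" for x
    unfolding p(2) using cpoly_gaussian_derivative[OF p(1), of t a b] by (auto simp: differentiable_def)
  fix k :: nat
  obtain C m where C: "C \<ge> 0" "\<And>x. cmod (p x) \<le> C * (1 + norm x) ^ m" using cpoly_bound[OF p(1)] by blast
  define M where "M = real (k + m) + norm a"
  have "norm (norm x ^ k *\<^sub>R foldr partial_deriv idx (gaussian t a b) x) \<le> C * exp (M\<^sup>2 / (4 * t))" for x
  proof -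
    have "norm (norm x ^ k *\<^sub>R foldr partial_deriv idx (gaussian t a b) x) = norm x ^ k * cmod (p x) * exp (-
        t * (norm x)\<^sup>2 + a \<bullet> x)"
      unfolding p(2) gaussian_alt by (simp add: norm_mult)
    also have "\<dots> \<le> (1 + norm x) ^ k * (C * (1 + norm x) ^ m) * exp (- t * (norm x)\<^sup>2 + norm a * norm x)"
      using C Cauchy_Schwarz_ineq2[of a x] by (intro mult_mono power_mono) auto
    also have "\<dots> = C * ((1 + norm x) ^ (k + m) * exp (- t * (norm x)\<^sup>2 + norm a * norm x))"
      by (simp add: power_add mult_ac)
    also have "\<dots> \<le> C * (exp (norm x) ^ (k + m) * exp (- t * (norm x)\<^sup>2 + norm a * norm x))"
      using C(1) exp_ge_add_one_self[of "norm x"] by (intro mult_left_mono mult_right_mono power_mono) auto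
    also have "exp (norm x) ^ (k + m) * exp (- t * (norm x)\<^sup>2 + norm a * norm x)
        = exp (M * norm x - t * (norm x)\<^sup>2)"
      unfolding exp_of_nat_mult[symmetric] exp_add[symmetric] by (simp add: M_def algebra_simps)
    also have "C * exp (M * norm x - t * (norm x)\<^sup>2) \<le> C * exp (M\<^sup>2 / (4 * t))"
    proof -
      have "0 \<le> (M - 2 * t * norm x)\<^sup>2" by simp
      then have "4 * t * (M * norm x - t * (norm x)\<^sup>2) \<le> M\<^sup>2" by (simp add: power2_eq_square algebra_simps)
      then have "M * norm x - t * (norm x)\<^sup>2 \<le> M\<^sup>2 / (4 * t)" using t by (simp add: field_simps)
      then show ?thesis using C(1) by (intro mult_left_mono) auto
    qed
    finally show ?thesis .
  qed
  then show "bounded (range (\<lambda>x. norm x ^ k *\<^sub>R foldr partial_deriv idx (gaussian t a b) x))"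
    by (auto intro!: boundedI)
qed

section \<open>Subordination\<close>

text \<open>The weight of the Gamma integral. Its Laplace transform at |\<xi>|^2 is a multiple of
  |\<xi>|^(-s), so mixing heat kernels over time with this weight inverts the fractional
  Laplacian.\<close>

definition subord :: "real \<Rightarrow> real \<Rightarrow> real" where
  "subord s \<tau> = indicator {0..} \<tau> * \<tau> powr (s / 2 - 1)"

lemma measurable_subord [measurable]: "subord s \<in> borel_measurable borel"
  unfolding subord_def by measurable

lemma subord_nonneg [simp]: "0 \<le> subord s \<tau>"
  by (simp add: subord_def)

lemma nn_integral_subord_exp:
  assumes "0 < s" "0 < a"
  shows "(\<integral>\<^sup>+\<tau>. ennreal (subord s \<tau> * exp (- a * \<tau>)) \<partial>lborel) = ennreal (Gamma (s / 2) * a powr (- (s / 2)))"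
proof -
  let ?F = "\<lambda>t. ennreal (indicator {0..} t * t powr (s / 2 - 1) / exp t)"
  have "ennreal (Gamma (s / 2)) = ennreal a * (\<integral>\<^sup>+\<tau>. ?F (0 + a * \<tau>) \<partial>lborel)"
    using Gamma_conv_nn_integral_real[of "s / 2"] nn_integral_real_affine[of ?F a 0] assms by simp
  also have "(\<integral>\<^sup>+\<tau>. ?F (0 + a * \<tau>) \<partial>lborel) = (\<integral>\<^sup>+\<tau>. ennreal (a powr (s / 2 - 1)) * ennreal (subord s \<tau> * exp
      (- a * \<tau>)) \<partial>lborel)"
    using assms by (intro nn_integral_cong) (auto simp: subord_def indicator_def zero_le_mult_iff powr_mult
        exp_minus field_simps ennreal_mult[symmetric])
  also have "ennreal a * (\<integral>\<^sup>+\<tau>. ennreal (a powr (s / 2 - 1)) * ennreal (subord s \<tau> * exp (- a * \<tau>)) \<partial>lborel)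
    = ennreal (a powr (s / 2)) * (\<integral>\<^sup>+\<tau>. ennreal (subord s \<tau> * exp (- a * \<tau>)) \<partial>lborel)"
  proof -
    have "a * a powr (s / 2 - 1) = a powr (s / 2)" using assms by (simp add: powr_diff)
    then have "ennreal a * ennreal (a powr (s / 2 - 1)) = ennreal (a powr (s / 2))"
      using assms by (simp add: ennreal_mult[symmetric])
    then show ?thesis
      by (subst nn_integral_cmult) (simp_all only: mult.assoc[symmetric], measurable)
  qed
  finally have "ennreal (a powr (- (s / 2))) * ennreal (Gamma (s / 2)) = ennreal (a powr (- (s / 2)) * a powr
      (s / 2)) * (\<integral>\<^sup>+\<tau>. ennreal (subord s \<tau> * exp (- a * \<tau>)) \<partial>lborel)"
    by (simp add: ennreal_mult mult.assoc)
  also have "a powr (- (s / 2)) * a powr (s / 2) = 1" using assms by (simp flip: powr_add)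
  finally show ?thesis using assms by (simp add: ennreal_mult[symmetric] mult.commute)
qed

text \<open>The time integral is split at r: near 0 the weight is integrable against a bounded
  function, and at infinity decay of order p > s/2 is enough. The splitting time stays free so that
  it can be matched to the scale of each application.\<close>

lemma nn_integral_subord_powr_tail:
  assumes "0 < s" "s / 2 < p" "s \<le> 2"
  shows "\<exists>C>0. \<forall>r>0. \<forall>f::real \<Rightarrow> real. \<forall>A\<ge>0. \<forall>B\<ge>0. (\<forall>\<tau>>0. f \<tau> \<le> A) \<longrightarrow> (\<forall>\<tau>>0. f \<tau> \<le> B * \<tau> powr (- p)) \<longrightarrow>
    (\<integral>\<^sup>+\<tau>. ennreal (subord s \<tau> * f \<tau>) \<partial>lborel) \<le> ennreal (C * (A * r powr (s / 2) + B * r powr (s / 2 - p)))"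
proof -
  obtain C1 where C1: "C1 > 0" "\<And>r. r > 0 \<Longrightarrow>
      (\<integral>\<^sup>+x. ennreal (norm (x::real) powr (- (1 - s / 2)) * indicator {..<r} (norm x)) \<partial>lborel)
          \<le> ennreal (C1 * r powr (s / 2))"
    using nn_integral_norm_powr_ball[where 'a = real, of "1 - s / 2"] assms by auto
  obtain C2 where C2: "C2 > 0" "\<And>r. r > 0 \<Longrightarrow>
      (\<integral>\<^sup>+x. ennreal (norm (x::real) powr (- (1 + p - s / 2)) * indicator {r..} (norm x)) \<partial>lborel)
          \<le> ennreal (C2 * r powr (s / 2 - p))"
    using nn_integral_norm_powr_outside[where 'a = real, of "1 + p - s / 2"] assms by auto
  show ?thesis
  proof (intro exI conjI allI impI)
    fix r A B :: real and f :: "real \<Rightarrow> real"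
    assume r: "r > 0" and AB: "A \<ge> 0" "B \<ge> 0" and f: "\<forall>\<tau>>0. f \<tau> \<le> A" "\<forall>\<tau>>0. f \<tau> \<le> B * \<tau> powr (- p)"
    have "(\<integral>\<^sup>+\<tau>. ennreal (subord s \<tau> * f \<tau>) \<partial>lborel)
      \<le> (\<integral>\<^sup>+\<tau>. ennreal A * ennreal (norm (\<tau>::real) powr (- (1 - s / 2)) * indicator {..<r} (norm \<tau>))
         + ennreal B * ennreal (norm \<tau> powr (- (1 + p - s / 2)) * indicator {r..} (norm \<tau>)) \<partial>lborel)"
    proof (rule nn_integral_mono)
      fix \<tau> :: real
      show "ennreal (subord s \<tau> * f \<tau>) \<le> ennreal A * ennreal (norm \<tau> powr (- (1 - s / 2)) * indicator {..<r}
          (norm \<tau>))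
         + ennreal B * ennreal (norm \<tau> powr (- (1 + p - s / 2)) * indicator {r..} (norm \<tau>))"
      proof (cases "\<tau> > 0")
        case True
        show ?thesis
        proof (cases "\<tau> < r")
          case less: True
          have "\<tau> powr (s / 2 - 1) * f \<tau> \<le> \<tau> powr (s / 2 - 1) * A" using f(1) True
              by (intro mult_left_mono) auto
          then show ?thesis using True less AB by (simp add: subord_def ennreal_mult[symmetric] ennreal_leI
              mult.commute)
        next
          case False
          have "\<tau> powr (s / 2 - 1) * f \<tau> \<le> \<tau> powr (s / 2 - 1) * (B * \<tau> powr (- p))" using f(2) True
              by (intro mult_left_mono) auto
          also have "\<dots> = B * \<tau> powr (- (1 + p - s / 2))" by (simp add: algebra_simps flip: powr_add)
          finally show ?thesis using True False AB by (simp add: subord_def ennreal_mult[symmetric]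
              ennreal_leI)
        qed
      next
        case False
        then have "subord s \<tau> = 0" by (auto simp: subord_def indicator_def)
        then show ?thesis by simp
      qed
    qed
    also have "\<dots> = ennreal A * (\<integral>\<^sup>+\<tau>. ennreal (norm \<tau> powr (- (1 - s / 2)) * indicator {..<r} (norm
        (\<tau>::real))) \<partial>lborel)
      + ennreal B * (\<integral>\<^sup>+\<tau>. ennreal (norm \<tau> powr (- (1 + p - s / 2)) * indicator {r..} (norm (\<tau>::real)))
          \<partial>lborel)"
      by (simp add: nn_integral_add nn_integral_cmult del: real_norm_def)
    also have "\<dots> \<le> ennreal A * ennreal (C1 * r powr (s / 2)) + ennreal B * ennreal (C2 * r powr (s / 2 - p))"
      using C1(2)[OF r] C2(2)[OF r] by (intro add_mono mult_left_mono) auto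
    also have "\<dots> = ennreal (A * (C1 * r powr (s / 2)) + B * (C2 * r powr (s / 2 - p)))"
      using AB C1(1) C2(1) by (simp add: ennreal_mult ennreal_plus)
    also have "\<dots> \<le> ennreal (max C1 C2 * (A * r powr (s / 2) + B * r powr (s / 2 - p)))"
    proof (rule ennreal_leI)
      have "A * (C1 * r powr (s / 2)) \<le> A * (max C1 C2 * r powr (s / 2))"
        "B * (C2 * r powr (s / 2 - p)) \<le> B * (max C1 C2 * r powr (s / 2 - p))"
        using AB by (intro mult_left_mono mult_right_mono; simp)+
      then show "A * (C1 * r powr (s / 2)) + B * (C2 * r powr (s / 2 - p)) \<le> max C1 C2 * (A * r powr (s / 2)
          + B * r powr (s / 2 - p))"
        by (simp add: distrib_left mult.left_commute)
    qed
    finally show "(\<integral>\<^sup>+\<tau>. ennreal (subord s \<tau> * f \<tau>) \<partial>lborel) \<le> ennreal (max C1 C2 * (A * r powr (s / 2)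
        + B * r powr (s / 2 - p)))" .
  qed (use C1(1) in auto)
qed

lemma powr_exp_bound:
  fixes p w :: real
  assumes "0 < p" "0 \<le> w"
  shows "w powr p * exp (- w) \<le> p powr p"
proof (cases "w = 0")
  case False
  then have w: "w > 0" using assms by simp
  have "ln (w / p) \<le> w / p - 1" using w assms by (intro ln_le_minus_one) auto
  then have "p * ln (w / p) \<le> w - p" using assms by (simp add: field_simps)
  then have "exp (p * ln (w / p)) \<le> exp w" using assms by simp
  then have "(w / p) powr p \<le> exp w" using w assms by (simp add: powr_def mult.commute)
  then have "w powr p \<le> p powr p * exp w" using w assms by (simp add: powr_divide field_simps)
  then show ?thesis by (simp add: exp_minus field_simps)
qed simp

lemma heat_le_time:
  assumes "t > 0" shows "heat t (x::'a::euclidean_space) \<le> (4 * pi) powr (- real DIM('a) / 2) * t powr (- real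
      DIM('a) / 2)"
proof -
  have "heat t x \<le> (4 * pi * t) powr (- real DIM('a) / 2) * 1"
    unfolding heat_def using assms by (intro mult_left_mono) auto
  then show ?thesis by (simp add: powr_mult)
qed

text \<open>With w = |x|^2/(4t) the kernel is a constant times |x|^(-n) w^(n/2) exp(-w), and the
  function of w is bounded.\<close>

lemma heat_le_space:
  assumes "t > 0" "x \<noteq> 0"
  shows "heat t (x::'a::euclidean_space) \<le> pi powr (- real DIM('a) / 2) * (real DIM('a) / 2) powr (real
      DIM('a) / 2) * norm x powr (- real DIM('a))"
proof -
  let ?n = "real DIM('a)"
  define w where "w = (norm x)\<^sup>2 / (4 * t)"
  have w: "w > 0" using assms by (simp add: w_def)
  have "4 * pi * t = pi * ((norm x)\<^sup>2 / w)" using assms by (simp add: w_def)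
  then have "(4 * pi * t) powr (- ?n / 2) = pi powr (- ?n / 2) * ((norm x)\<^sup>2 / w) powr (- ?n / 2)"
    by (simp only: powr_mult)
  also have "((norm x)\<^sup>2 / w) powr (- ?n / 2) = norm x powr (- ?n) * w powr (?n / 2)"
  proof -
    have "((norm x)\<^sup>2 / w) powr (- ?n / 2) = (norm x powr 2) powr (- ?n / 2) / w powr (- ?n / 2)"
      using assms by (simp add: powr_divide powr_numeral)
    also have "\<dots> = norm x powr (- ?n) * w powr (?n / 2)"
      unfolding powr_powr using w by (simp add: powr_minus field_simps)
    finally show ?thesis .
  qed
  finally have "heat t x = pi powr (- ?n / 2) * norm x powr (- ?n) * (w powr (?n / 2) * exp (- w))"
    by (simp add: heat_def w_def)
  also have "\<dots> \<le> pi powr (- ?n / 2) * norm x powr (- ?n) * (?n / 2) powr (?n / 2)"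
    using w by (intro mult_left_mono powr_exp_bound) auto
  finally show ?thesis by (simp add: mult_ac)
qed

text \<open>The time mixture is a multiple of the Riesz kernel, of which only the upper bound is
  used. The natural splitting time is |x|^2: the bound |x|^(-n) serves before it, and \<tau>^(-n/2)
  after it.\<close>

lemma subord_heat_le_riesz:
  assumes s: "0 < s" "s \<le> 2" "s < real DIM('a::euclidean_space)"
  shows "\<exists>C>0. \<forall>x::'a. x \<noteq> 0 \<longrightarrow> (\<integral>\<^sup>+\<tau>. ennreal (subord s \<tau> * heat \<tau> x) \<partial>lborel)
      \<le> ennreal (C * norm x powr (s - real DIM('a)))"
proof -
  let ?n = "real DIM('a)"
  obtain C where C: "C > 0" "\<And>r (f::real \<Rightarrow> real) A B. r > 0 \<Longrightarrow> A \<ge> 0 \<Longrightarrow> B \<ge> 0 \<Longrightarrow> (\<forall>\<tau>>0. f \<tau> \<le> A) \<Longrightarrow> (\<forall>\<tau>>0. f \<tau>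
      \<le> B * \<tau> powr (- (?n / 2))) \<Longrightarrow>
    (\<integral>\<^sup>+\<tau>. ennreal (subord s \<tau> * f \<tau>) \<partial>lborel) \<le> ennreal (C * (A * r powr (s / 2)
        + B * r powr (s / 2 - ?n / 2)))"
    using nn_integral_subord_powr_tail[of s "?n / 2"] s by auto
  define K1 where "K1 = pi powr (- ?n / 2) * (?n / 2) powr (?n / 2)"
  define K2 where "K2 = (4 * pi) powr (- ?n / 2)"
  have K: "K1 > 0" "K2 > 0" by (simp_all add: K1_def K2_def)
  show ?thesis
  proof (intro exI conjI allI impI)
    fix x :: 'a assume x: "x \<noteq> 0"
    have "(\<integral>\<^sup>+\<tau>. ennreal (subord s \<tau> * heat \<tau> x) \<partial>lborel)
      \<le> ennreal (C * ((K1 * norm x powr (- ?n)) * ((norm x)\<^sup>2) powr (s / 2)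
          + K2 * ((norm x)\<^sup>2) powr (s / 2 - ?n / 2)))"
      using heat_le_space[OF _ x] heat_le_time[where x = x] x K
      by (intro C(2)) (auto simp: K1_def K2_def)
    also have "(K1 * norm x powr (- ?n)) * ((norm x)\<^sup>2) powr (s / 2) + K2 * ((norm x)\<^sup>2) powr (s / 2 - ?n / 2)
      = (K1 + K2) * norm x powr (s - ?n)"
    proof -
      have sq: "(norm x)\<^sup>2 = norm x powr 2" using x by (simp add: powr_numeral)
      have "norm x powr (- ?n) * norm x powr (2 * (s / 2)) = norm x powr (s - ?n)" by (simp flip: powr_add)
      moreover have "norm x powr (2 * (s / 2 - ?n / 2)) = norm x powr (s - ?n)" by (simp add: algebra_simps)
      ultimately show ?thesis unfolding sq powr_powr by (simp only: distrib_right mult.assoc)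
    qed
    finally show "(\<integral>\<^sup>+\<tau>. ennreal (subord s \<tau> * heat \<tau> x) \<partial>lborel) \<le> ennreal (C * (K1
        + K2) * norm x powr (s - ?n))"
      by (simp add: mult.assoc)
  qed (use C K in simp)
qed

lemma heat_L2_bound:
  fixes g :: "'a::euclidean_space \<Rightarrow> real"
  assumes [measurable]: "g \<in> borel_measurable borel" and t: "t > 0" and a: "a \<ge> 0"
    and g: "(\<integral>\<^sup>+z. ennreal ((g z)\<^sup>2) \<partial>lborel) \<le> ennreal (a\<^sup>2)"
  shows "(\<integral>\<^sup>+z. ennreal (heat t (y - z) * \<bar>g z\<bar>) \<partial>lborel) \<le> ennreal ((4 * pi) powr (- real DIM('a) / 4) * t
      powr (- real DIM('a) / 4) * a)"
proof (rule Cauchy_Schwarz_nn_integral_bound[OF _ _ _ _ _ g])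
  let ?K = "(4 * pi) powr (- real DIM('a) / 2) * t powr (- real DIM('a) / 2)"
  have "(\<integral>\<^sup>+z. ennreal ((heat t (y - z))\<^sup>2) \<partial>lborel) \<le> (\<integral>\<^sup>+z. ennreal ?K * ennreal (heat t (y - z)) \<partial>lborel)"
    using heat_le_time[OF t, where 'a = 'a]
    by (intro nn_integral_mono) (simp add: power2_eq_square ennreal_mult[symmetric] ennreal_leI
        mult_right_mono)
  also have "\<dots> = ennreal ?K" using t by (simp add: nn_integral_cmult nn_integral_heat)
  also have "?K = ((4 * pi) powr (- real DIM('a) / 4) * t powr (- real DIM('a) / 4))\<^sup>2"
    unfolding power_mult_distrib powr_square by simp
  finally show "(\<integral>\<^sup>+z. ennreal ((heat t (y - z))\<^sup>2) \<partial>lborel) \<le> ennreal (((4 * pi) powr (- real DIM('a) / 4) *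
      t powr (- real DIM('a) / 4))\<^sup>2)" .
qed (use a in auto)

text \<open>Near \<tau> = 0 the extra time t keeps the heat average bounded. For large \<tau> the
  L^2 bound decays like \<tau>^(-n/4), which is integrable against the weight because s/2 <
  n/4.\<close>

lemma subord_heat_finite:
  fixes g :: "'a::euclidean_space \<Rightarrow> real"
  assumes [measurable]: "g \<in> borel_measurable borel" and t: "t > 0" and a: "a \<ge> 0"
    and g: "(\<integral>\<^sup>+z. ennreal ((g z)\<^sup>2) \<partial>lborel) \<le> ennreal (a\<^sup>2)" and s: "0 < s" "s \<le> 2" "2 * s < real DIM('a)"
  shows "(\<integral>\<^sup>+\<tau>. ennreal (subord s \<tau>) * (\<integral>\<^sup>+z. ennreal (heat (t + \<tau>) (y - z) * \<bar>g z\<bar>) \<partial>lborel) \<partial>lborel) < \<infinity>"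
proof -
  let ?n = "real DIM('a)"
  let ?K = "(4 * pi) powr (- ?n / 4) * a"
  obtain C where C: "C > 0" "\<And>r (f::real \<Rightarrow> real) A B. r > 0 \<Longrightarrow> A \<ge> 0 \<Longrightarrow> B \<ge> 0 \<Longrightarrow> (\<forall>\<tau>>0. f \<tau> \<le> A) \<Longrightarrow> (\<forall>\<tau>>0. f \<tau>
      \<le> B * \<tau> powr (- (?n / 4))) \<Longrightarrow>
    (\<integral>\<^sup>+\<tau>. ennreal (subord s \<tau> * f \<tau>) \<partial>lborel) \<le> ennreal (C * (A * r powr (s / 2)
        + B * r powr (s / 2 - ?n / 4)))"
    using nn_integral_subord_powr_tail[of s "?n / 4"] s by auto
  have "(\<integral>\<^sup>+\<tau>. ennreal (subord s \<tau>) * (\<integral>\<^sup>+z. ennreal (heat (t + \<tau>) (y - z) * \<bar>g z\<bar>) \<partial>lborel) \<partial>lborel)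
    \<le> (\<integral>\<^sup>+\<tau>. ennreal (subord s \<tau> * (?K * (t + \<tau>) powr (- (?n / 4)))) \<partial>lborel)"
  proof (rule nn_integral_mono)
    fix \<tau>
    show "ennreal (subord s \<tau>) * (\<integral>\<^sup>+z. ennreal (heat (t + \<tau>) (y - z) * \<bar>g z\<bar>) \<partial>lborel)
        \<le> ennreal (subord s \<tau> * (?K * (t + \<tau>) powr (- (?n / 4))))"
    proof (cases "\<tau> \<ge> 0")
      case True
      then have "(\<integral>\<^sup>+z. ennreal (heat (t + \<tau>) (y - z) * \<bar>g z\<bar>) \<partial>lborel) \<le> ennreal (?K * (t
          + \<tau>) powr (- (?n / 4)))"
        using heat_L2_bound[OF _ _ a g, of "t + \<tau>" y] t by (simp add: mult_ac)
      then show ?thesis using a by (subst ennreal_mult) (auto intro: mult_left_mono)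
    qed (simp add: subord_def)
  qed
  also have "\<dots> \<le> ennreal (C * (?K * t powr (- (?n / 4)) * 1 powr (s / 2) + ?K * 1 powr (s / 2 - ?n / 4)))"
    using a t by (intro C(2)) (auto intro!: mult_left_mono powr_mono2')
  also have "\<dots> < \<infinity>" by simp
  finally show ?thesis .
qed

section \<open>The distributional Fourier transform\<close>

lemma borel_representative_complex:
  fixes f :: "'a::euclidean_space \<Rightarrow> complex"
  assumes f: "f \<in> borel_measurable lebesgue"
  shows "\<exists>f'\<in>borel_measurable borel. AE x in lborel. f x = f' x"
proof -
  have "(\<lambda>x. Re (f x)) \<in> borel_measurable lebesgue" "(\<lambda>x. Im (f x)) \<in> borel_measurable lebesgue"
    using f by auto
  from this[THEN completion_ex_borel_measurable_real] obtain r i where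
    [measurable]: "r \<in> borel_measurable lborel" "i \<in> borel_measurable lborel" and
    ae: "AE x in lborel. Re (f x) = r x" "AE x in lborel. Im (f x) = i x" by blast
  show ?thesis
  proof (intro bexI)
    show "AE x in lborel. f x = Complex (r x) (i x)" using ae by eventually_elim (simp add: complex_eq_iff)
    have "(\<lambda>x. complex_of_real (r x) + \<i> * complex_of_real (i x)) \<in> borel_measurable borel" by measurable
    then show "(\<lambda>x. Complex (r x) (i x)) \<in> borel_measurable borel" by (simp add: Complex_eq)
  qed
qed

lemma lebesgue_representative:
  fixes f f' :: "'a::euclidean_space \<Rightarrow> 'b::{banach, second_countable_topology}"
  assumes [measurable]: "f' \<in> borel_measurable borel" and f: "f \<in> borel_measurable lebesgue" and ae:
      "AE x in lborel. f x = f' x"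
  shows "integrable lebesgue f \<longleftrightarrow> integrable lborel f'" "integral\<^sup>L lebesgue f = integral\<^sup>L lborel f'"
proof -
  have ae': "AE x in lebesgue. f x = f' x" using ae by (rule AE_completion)
  have m: "f' \<in> borel_measurable lborel" by simp
  then have m': "f' \<in> borel_measurable lebesgue" by (rule measurable_completion)
  show "integrable lebesgue f \<longleftrightarrow> integrable lborel f'"
    using integrable_cong_AE[OF f m' ae'] integrable_completion[OF m] by simp
  show "integral\<^sup>L lebesgue f = integral\<^sup>L lborel f'"
    using integral_cong_AE[OF f m' ae'] integral_completion[OF m] by simp
qed

text \<open>Transfers the distributional identity to Borel representatives on \<open>lborel\<close>,
  where product measures and Fubini are at hand.\<close>

lemma has_fourier_lborel:
  fixes f v f' v' :: "real^'n \<Rightarrow> complex"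
  assumes h: "has_fourier f v" and [measurable]: "f' \<in> borel_measurable borel" "v' \<in> borel_measurable borel"
    and ae: "AE x in lborel. f x = f' x" "AE x in lborel. v x = v' x"
    and \<phi>: "schwartz \<phi>" and [measurable]: "\<phi> \<in> borel_measurable borel" and F: "fourier \<phi>
        = \<psi>" and [measurable]: "\<psi> \<in> borel_measurable borel"
  shows "integrable lborel (\<lambda>x. f' x * \<psi> x)" "integrable lborel (\<lambda>\<xi>. v' \<xi> * \<phi> \<xi>)"
    "(\<integral>x. f' x * \<psi> x \<partial>lborel) = (\<integral>\<xi>. v' \<xi> * \<phi> \<xi> \<partial>lborel)"
proof -
  have m: "f \<in> borel_measurable lebesgue" "v \<in> borel_measurable lebesgue"
    and i: "integrable lebesgue (\<lambda>x. f x * \<psi> x)" "integrable lebesgue (\<lambda>\<xi>. v \<xi> * \<phi> \<xi>)"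
      "(\<integral>x. f x * \<psi> x \<partial>lebesgue) = (\<integral>\<xi>. v \<xi> * \<phi> \<xi> \<partial>lebesgue)"
    using h \<phi> unfolding has_fourier_def F[symmetric] by auto
  have [measurable]: "\<phi> \<in> borel_measurable lebesgue" "\<psi> \<in> borel_measurable lebesgue"
    by (auto intro!: measurable_completion)
  note [measurable] = m
  have fm: "(\<lambda>x. f x * \<psi> x) \<in> borel_measurable lebesgue" and vm: "(\<lambda>x. v x * \<phi> x) \<in> borel_measurable lebesgue"
    by measurable
  have ae2: "AE x in lborel. f x * \<psi> x = f' x * \<psi> x" "AE x in lborel. v x * \<phi> x = v' x * \<phi> x"
    using ae by auto
  have bm: "(\<lambda>x. f' x * \<psi> x) \<in> borel_measurable borel" "(\<lambda>x. v' x * \<phi> x) \<in> borel_measurable borel"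
      by measurable
  note 1 = lebesgue_representative[OF bm(1) fm ae2(1)] and 2 = lebesgue_representative[OF bm(2) vm ae2(2)]
  show "integrable lborel (\<lambda>x. f' x * \<psi> x)" "integrable lborel (\<lambda>\<xi>. v' \<xi> * \<phi> \<xi>)"
    "(\<integral>x. f' x * \<psi> x \<partial>lborel) = (\<integral>\<xi>. v' \<xi> * \<phi> \<xi> \<partial>lborel)"
    using i 1 2 by simp_all
qed

lemma measurable_gaussian [measurable]: "gaussian t a b \<in> borel_measurable borel"
  unfolding gaussian_def[abs_def] by measurable

lemma gaussian_modulated: "gaussian t 0 b x = of_real (exp (- t * (norm x)\<^sup>2)) * cis (b \<bullet> x)"
  by (simp add: gaussian_alt)

lemma fourier_gaussian:
  fixes b :: "real^'n"
  assumes t: "t > 0"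
  shows "fourier (gaussian t 0 b) = (\<lambda>x. of_real ((2 * pi) powr (real CARD('n) / 2) * heat t (b - x)))"
proof
  fix x :: "real^'n"
  have "(\<integral>\<xi>. cis (- (\<xi> \<bullet> x)) * gaussian t 0 b \<xi> \<partial>lebesgue) = (\<integral>\<xi>. cis (- (\<xi> \<bullet> x)) * gaussian t 0 b \<xi> \<partial>lborel)"
    by (rule integral_completion) (simp add: cis_conv_exp)
  also have "\<dots> = (\<integral>\<xi>. of_real (exp (- t * (norm \<xi>)\<^sup>2)) * cis ((b - x) \<bullet> \<xi>) \<partial>lborel)"
  proof (rule Bochner_Integration.integral_cong)
    fix \<xi> :: "real^'n"
    have "cis ((b - x) \<bullet> \<xi>) = cis (- (\<xi> \<bullet> x)) * cis (b \<bullet> \<xi>)"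
      by (simp add: cis_mult inner_simps inner_commute)
    then show "cis (- (\<xi> \<bullet> x)) * gaussian t 0 b \<xi> = of_real (exp (- t * (norm \<xi>)\<^sup>2)) * cis ((b - x) \<bullet> \<xi>)"
      by (simp add: gaussian_modulated)
  qed simp
  also have "\<dots> = of_real ((2 * pi) powr real CARD('n) * heat t (b - x))"
    using integral_gaussian_cis[OF t, of "b - x"] by simp
  finally have "fourier (gaussian t 0 b) x = of_real ((2 * pi) powr (- (real CARD('n) / 2)) * ((2 * pi) powr
      real CARD('n) * heat t (b - x)))"
    unfolding fourier_def by simp
  also have "(2 * pi) powr (- (real CARD('n) / 2)) * ((2 * pi) powr real CARD('n) * heat t (b - x))
      = (2 * pi) powr (real CARD('n) / 2) * heat t (b - x)"
    unfolding mult.assoc[symmetric] powr_add[symmetric] by simp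
  finally show "fourier (gaussian t 0 b) x = of_real ((2 * pi) powr (real CARD('n) / 2) * heat t (b - x))" .
qed

text \<open>The test function is the modulated Gaussian: its frequency y becomes the centre of the
  heat kernel and its width parameter t becomes the time.\<close>

lemma has_fourier_heat:
  fixes f v f' v' :: "real^'n \<Rightarrow> complex"
  assumes h: "has_fourier f v" and m[measurable]: "f' \<in> borel_measurable borel" "v' \<in> borel_measurable borel"
    and ae: "AE x in lborel. f x = f' x" "AE x in lborel. v x = v' x" and t: "t > 0"
  shows "integrable lborel (\<lambda>x. f' x * of_real (heat t (y - x)))"
    and "integrable lborel (\<lambda>\<xi>. v' \<xi> * gaussian t 0 y \<xi>)"
    and "(\<integral>x. f' x * of_real (heat t (y - x)) \<partial>lborel) = of_real ((2 * pi) powr (- (real CARD('n) / 2))) *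
        (\<integral>\<xi>. v' \<xi> * gaussian t 0 y \<xi> \<partial>lborel)"
proof -
  let ?c = "(2 * pi) powr (real CARD('n) / 2)"
  have psi: "(\<lambda>x. complex_of_real (?c * heat t (y - x))) \<in> borel_measurable borel" by measurable
  note * = has_fourier_lborel[OF h m ae schwartz_gaussian[OF t] measurable_gaussian fourier_gaussian[OF t]
      psi]
  have eq: "f' x * of_real (?c * heat t (y - x)) = of_real ?c * (f' x * of_real (heat t (y - x)))" for x
      by simp
  show "integrable lborel (\<lambda>\<xi>. v' \<xi> * gaussian t 0 y \<xi>)" by (rule *(2))
  show "integrable lborel (\<lambda>x. f' x * of_real (heat t (y - x)))"
  proof -
    have "integrable lborel (\<lambda>x. (1 / of_real ?c) * (of_real ?c * (f' x * of_real (heat t (y - x)))))"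
      using *(1) unfolding eq by (rule integrable_mult_right)
    then show ?thesis by simp
  qed
  have "of_real ?c * (\<integral>x. f' x * of_real (heat t (y - x)) \<partial>lborel) = (\<integral>\<xi>. v' \<xi> * gaussian t 0 y \<xi> \<partial>lborel)"
    using *(3) unfolding eq integral_mult_right_zero .
  then have "of_real ((2 * pi) powr (- (real CARD('n) / 2))) * (of_real ?c * (\<integral>x. f' x * of_real (heat t (y -
      x)) \<partial>lborel))
    = of_real ((2 * pi) powr (- (real CARD('n) / 2))) * (\<integral>\<xi>. v' \<xi> * gaussian t 0 y \<xi> \<partial>lborel)"
    by (rule arg_cong)
  moreover have "complex_of_real ((2 * pi) powr (- (real CARD('n) / 2))) * of_real ?c = 1"
    unfolding of_real_mult[symmetric] powr_add[symmetric] by simp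
  ultimately show "(\<integral>x. f' x * of_real (heat t (y - x)) \<partial>lborel) = of_real ((2 * pi) powr (- (real CARD('n) /
      2))) * (\<integral>\<xi>. v' \<xi> * gaussian t 0 y \<xi> \<partial>lborel)"
    unfolding mult.assoc[symmetric] by simp
qed

text \<open>Expanding the square exhibits a translated heat kernel as a member of the
  \<open>gaussian\<close> family, hence as an admissible test function on the frequency
  side.\<close>

lemma heat_conv_gaussian:
  fixes \<eta> x :: "real^'n"
  assumes "t > 0"
  shows "complex_of_real (heat t (\<eta> - x)) = of_real ((4 * pi * t) powr (- real CARD('n) / 2) * exp (- (norm
      \<eta>)\<^sup>2 / (4 * t))) * gaussian (1 / (4 * t)) ((1 / (2 * t)) *\<^sub>R \<eta>) 0 x"
proof -
  have N: "(norm (\<eta> - x))\<^sup>2 = (norm \<eta>)\<^sup>2 - 2 * (\<eta> \<bullet> x) + (norm x)\<^sup>2"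
    unfolding power2_norm_eq_inner by (simp add: inner_simps inner_commute)
  have "- (norm (\<eta> - x))\<^sup>2 / (4 * t) = - (norm \<eta>)\<^sup>2 / (4 * t) + (- (1 / (4 * t)) * (norm x)\<^sup>2
      + ((1 / (2 * t)) *\<^sub>R \<eta>) \<bullet> x)"
    unfolding N using assms by (simp add: field_simps)
  then have "exp (- (norm (\<eta> - x))\<^sup>2 / (4 * t)) = exp (- (norm \<eta>)\<^sup>2 / (4 * t)) * exp (- (1 / (4 * t)) * (norm
      x)\<^sup>2 + ((1 / (2 * t)) *\<^sub>R \<eta>) \<bullet> x)"
    by (simp only: exp_add)
  then show ?thesis unfolding heat_def gaussian_alt by (simp only: of_real_mult DIM_cart) simp
qed

text \<open>Vanishing averages mean that the positive and negative parts of \<open>h\<close> have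
  equal heat averages, so \<open>heat_unique\<close> makes the two parts equal, and a real number
  with equal parts is 0.\<close>

lemma heat_unique_real:
  fixes h :: "'a::euclidean_space \<Rightarrow> real"
  assumes [measurable]: "h \<in> borel_measurable borel"
    and int: "\<And>t y. t > 0 \<Longrightarrow> integrable lborel (\<lambda>x. h x * heat t (y - x))"
    and zero: "\<And>t y. t > 0 \<Longrightarrow> (\<integral>x. h x * heat t (y - x) \<partial>lborel) = 0"
  shows "AE x in lborel. h x = 0"
proof -
  have pos: "(\<integral>\<^sup>+x. ennreal (k x) * ennreal (heat t (y - x)) \<partial>lborel) = (\<integral>\<^sup>+x. ennreal (k x * heat t (y - x))
      \<partial>lborel)" for k t y
    by (simp add: ennreal_mult'')
  have fin: "(\<integral>\<^sup>+x. ennreal (h x * heat t (y - x)) \<partial>lborel) < \<infinity>" "(\<integral>\<^sup>+x. ennreal (- h x * heat t (y - x))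
      \<partial>lborel) < \<infinity>" if "t > 0" for t y
    using int[OF that, of y] by (simp_all add: real_integrable_def less_top)
  have "AE x in lborel. ennreal (h x) = ennreal (- h x)"
  proof (rule heat_unique)
    fix t :: real and y :: 'a assume t: "t > 0"
    let ?A = "\<integral>\<^sup>+x. ennreal (h x * heat t (y - x)) \<partial>lborel" and ?B = "\<integral>\<^sup>+x. ennreal (- h x * heat t (y - x))
        \<partial>lborel"
    have "enn2real ?A = enn2real ?B"
      using zero[OF t, of y] real_lebesgue_integral_def[OF int[OF t, of y]] by simp
    moreover have "?A = ennreal (enn2real ?A)" "?B = ennreal (enn2real ?B)" using fin[OF t, of y] by simp_all
    ultimately have "?A = ?B" by simp
    then show "(\<integral>\<^sup>+x. ennreal (h x) * ennreal (heat t (y - x)) \<partial>lborel) = (\<integral>\<^sup>+x. ennreal (- h x) * ennreal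
        (heat t (y - x)) \<partial>lborel)"
      unfolding pos .
    show "(\<integral>\<^sup>+x. ennreal (h x) * ennreal (heat t (y - x)) \<partial>lborel) < \<infinity>" unfolding pos by (rule fin[OF t])
  qed auto
  then show ?thesis
  proof eventually_elim
    case (elim x)
    then show ?case by (cases "h x" "0::real" rule: linorder_cases) (auto simp: ennreal_neg)
  qed
qed

lemma heat_unique_complex:
  fixes f g :: "'a::euclidean_space \<Rightarrow> complex"
  assumes [measurable]: "f \<in> borel_measurable borel" "g \<in> borel_measurable borel"
    and int: "\<And>t y. t > 0 \<Longrightarrow> integrable lborel (\<lambda>x. f x * of_real (heat t (y - x)))"
       "\<And>t y. t > 0 \<Longrightarrow> integrable lborel (\<lambda>x. g x * of_real (heat t (y - x)))"
    and eq: "\<And>t y. t > 0 \<Longrightarrow> (\<integral>x. f x * of_real (heat t (y - x)) \<partial>lborel) = (\<integral>x. g x * of_real (heat t (y - x))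
        \<partial>lborel)"
  shows "AE x in lborel. f x = g x"
proof -
  have i: "integrable lborel (\<lambda>x. (f x - g x) * of_real (heat t (y - x)))" if "t > 0" for t y
    using Bochner_Integration.integrable_diff[OF int(1)[OF that, of y] int(2)[OF that, of y]]
        by (simp add: left_diff_distrib)
  have z: "(\<integral>x. (f x - g x) * of_real (heat t (y - x)) \<partial>lborel) = 0" if "t > 0" for t y
    using Bochner_Integration.integral_diff[OF int(1)[OF that, of y] int(2)[OF that, of y]] eq[OF that, of y]
        by (simp add: left_diff_distrib)
  have "AE x in lborel. Re (f x - g x) = 0"
  proof (rule heat_unique_real)
    fix t :: real and y :: 'a assume t: "t > 0"
    show "integrable lborel (\<lambda>x. Re (f x - g x) * heat t (y - x))" using integrable_Re[OF i[OF t, of y]]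
        by simp
    show "(\<integral>x. Re (f x - g x) * heat t (y - x) \<partial>lborel) = 0" using integral_Re[OF i[OF t, of y]] z[OF t, of y]
        by simp
  qed measurable
  moreover have "AE x in lborel. Im (f x - g x) = 0"
  proof (rule heat_unique_real)
    fix t :: real and y :: 'a assume t: "t > 0"
    show "integrable lborel (\<lambda>x. Im (f x - g x) * heat t (y - x))" using integrable_Im[OF i[OF t, of y]]
        by simp
    show "(\<integral>x. Im (f x - g x) * heat t (y - x) \<partial>lborel) = 0" using integral_Im[OF i[OF t, of y]] z[OF t, of y]
        by simp
  qed measurable
  ultimately show ?thesis by eventually_elim (simp add: complex_eq_iff)
qed

text \<open>The test function is a heat kernel in the frequency variable. Both averages equal the
  integral of \<open>f\<close> against its transform, which therefore enters only through its
  measurability.\<close>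

lemma has_fourier_unique_right:
  fixes f v w :: "real^'n \<Rightarrow> complex"
  assumes h: "has_fourier f v" "has_fourier f w"
  shows "AE x in lborel. v x = w x"
proof -
  have "f \<in> borel_measurable lebesgue" "v \<in> borel_measurable lebesgue" "w \<in> borel_measurable lebesgue"
    using h by (simp_all add: has_fourier_def)
  from this[THEN borel_representative_complex] obtain f' v' w' where
    [measurable]: "f' \<in> borel_measurable borel" "v' \<in> borel_measurable borel" "w' \<in> borel_measurable borel"
    and ae: "AE x in lborel. f x = f' x" "AE x in lborel. v x = v' x" "AE x in lborel. w x = w' x" by blast
  have "AE x in lborel. v' x = w' x"
  proof (rule heat_unique_complex)
    fix t :: real and y :: "real^'n" assume t: "t > 0"
    let ?G = "gaussian (1 / (4 * t)) ((1 / (2 * t)) *\<^sub>R y) 0"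
    let ?c = "complex_of_real ((4 * pi * t) powr (- real CARD('n) / 2) * exp (- (norm y)\<^sup>2 / (4 * t)))"
    have S: "schwartz ?G" using t by (intro schwartz_gaussian) simp
    have [measurable]: "fourier ?G \<in> borel_measurable borel"
    proof -
      have "fourier ?G = (\<lambda>\<xi>. of_real ((2 * pi) powr (- (real CARD('n) / 2))) * (\<integral>x. cis (- (x \<bullet> \<xi>)) * ?G x
          \<partial>lborel))"
        unfolding fourier_def by (intro ext arg_cong2[where f = "(*)"] refl integral_completion) (simp add:
            cis_conv_exp)
      also have "\<dots> \<in> borel_measurable borel"
        unfolding cis_conv_exp gaussian_def by measurable
      finally show ?thesis .
    qed
    have P: "f' \<in> borel_measurable borel" "v' \<in> borel_measurable borel" "w' \<in> borel_measurable borel"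
        "?G \<in> borel_measurable borel" "fourier ?G \<in> borel_measurable borel"
      by measurable
    note 1 = has_fourier_lborel[OF h(1) P(1,2) ae(1,2) S P(4) refl P(5)]
    note 2 = has_fourier_lborel[OF h(2) P(1,3) ae(1,3) S P(4) refl P(5)]
    have eq: "q x * complex_of_real (heat t (y - x)) = ?c * (q x * ?G x)" for x q
      unfolding heat_conv_gaussian[OF t] by (simp only: mult.left_commute)
    show "integrable lborel (\<lambda>x. v' x * of_real (heat t (y - x)))"
        "integrable lborel (\<lambda>x. w' x * of_real (heat t (y - x)))"
      unfolding eq by (intro integrable_mult_right 1(2) 2(2))+
    show "(\<integral>x. v' x * of_real (heat t (y - x)) \<partial>lborel) = (\<integral>x. w' x * of_real (heat t (y - x)) \<partial>lborel)"
      unfolding eq integral_mult_right_zero 1(3)[symmetric] 2(3)[symmetric] ..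
  qed measurable
  with ae show ?thesis by eventually_elim simp
qed

text \<open>Modulated Gaussians are the right tests here, because their transforms are heat kernels
  on the side of \<open>f\<close> and \<open>g\<close>.\<close>

lemma has_fourier_unique_left:
  fixes f g v w :: "real^'n \<Rightarrow> complex"
  assumes h: "has_fourier f v" "has_fourier g w" and vw: "AE x in lborel. v x = w x"
  shows "AE x in lborel. f x = g x"
proof -
  have "f \<in> borel_measurable lebesgue" "g \<in> borel_measurable lebesgue" "v \<in> borel_measurable lebesgue"
    using h by (simp_all add: has_fourier_def)
  from this[THEN borel_representative_complex] obtain f' g' v' where
    m[measurable]: "f' \<in> borel_measurable borel" "g' \<in> borel_measurable borel" "v' \<in> borel_measurable borel"
    and ae: "AE x in lborel. f x = f' x" "AE x in lborel. g x = g' x" "AE x in lborel. v x = v' x" by blast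
  have wv': "AE x in lborel. w x = v' x" using vw ae(3) by eventually_elim simp
  note 1 = has_fourier_heat[OF h(1) m(1,3) ae(1,3)] and 2 = has_fourier_heat[OF h(2) m(2,3) ae(2) wv']
  have "AE x in lborel. f' x = g' x"
    by (rule heat_unique_complex) (use 1 2 in simp_all)
  with ae show ?thesis by eventually_elim simp
qed

text \<open>Required because \<open>frac_laplacian\<close> is a \<open>SOME\<close> choice: whatever
  is chosen agrees almost everywhere with any explicit candidate.\<close>

lemma has_frac_laplacian_unique:
  fixes u g h :: "real^'n \<Rightarrow> real"
  assumes "has_frac_laplacian s u g" "has_frac_laplacian s u h"
  shows "AE x in lborel. g x = h x"
proof -
  obtain v w where v: "has_fourier (\<lambda>x. complex_of_real (u x)) v" "has_fourier (\<lambda>x. complex_of_real (g x))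
      (\<lambda>\<xi>. of_real (norm \<xi> powr s) * v \<xi>)"
    and w: "has_fourier (\<lambda>x. complex_of_real (u x)) w" "has_fourier (\<lambda>x. complex_of_real (h x)) (\<lambda>\<xi>. of_real
        (norm \<xi> powr s) * w \<xi>)"
    using assms unfolding has_frac_laplacian_def by blast
  have "AE x in lborel. complex_of_real (g x) = complex_of_real (h x)"
    by (rule has_fourier_unique_left[OF v(2) w(2)]) (use has_fourier_unique_right[OF v(1) w(1)] in auto)
  then show ?thesis by simp
qed

section \<open>Representation by Riesz potentials\<close>

lemma
  assumes "0 < s" "0 < a"
  shows integrable_subord_exp: "integrable lborel (\<lambda>\<tau>. subord s \<tau> * exp (- a * \<tau>))"
    and integral_subord_exp: "(\<integral>\<tau>. subord s \<tau> * exp (- a * \<tau>) \<partial>lborel) = Gamma (s / 2) * a powr (- (s / 2))"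
proof -
  have "has_bochner_integral lborel (\<lambda>\<tau>. subord s \<tau> * exp (- a * \<tau>)) (Gamma (s / 2) * a powr (- (s / 2)))"
    using nn_integral_subord_exp[OF assms] assms by (intro has_bochner_integral_nn_integral) (auto intro!:
        Gamma_real_nonneg)
  then show "integrable lborel (\<lambda>\<tau>. subord s \<tau> * exp (- a * \<tau>))"
    "(\<integral>\<tau>. subord s \<tau> * exp (- a * \<tau>) \<partial>lborel) = Gamma (s / 2) * a powr (- (s / 2))"
    by (auto simp: has_bochner_integral_iff)
qed

text \<open>Averaging the Gaussian regularisation of \<open>|\<xi>|\<^sup>s v\<close> over time with weight \<open>\<tau> powr (s/2 - 1)\<close> removes
  the factor \<open>|\<xi>|\<^sup>s\<close>; in physical space this inverts the fractional Laplacian.\<close>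

lemma subordination_identity:
  fixes u g :: "real^'n \<Rightarrow> real" and v :: "real^'n \<Rightarrow> complex"
  assumes s: "0 < s"
    and [measurable]: "v \<in> borel_measurable borel"
    and int: "\<And>t y. t > 0 \<Longrightarrow> integrable lborel (\<lambda>\<xi>. v \<xi> * gaussian t 0 y \<xi>)"
    and u: "\<And>t y. t > 0 \<Longrightarrow> of_real (\<integral>x. u x * heat t (y - x) \<partial>lborel)
        = \<kappa> * (\<integral>\<xi>. v \<xi> * gaussian t 0 y \<xi> \<partial>lborel)"
    and g: "\<And>t y. t > 0 \<Longrightarrow> of_real (\<integral>x. g x * heat t (y - x) \<partial>lborel) = \<kappa> * (\<integral>\<xi>. (of_real (norm \<xi> powr s) * v
        \<xi>) * gaussian t 0 y \<xi> \<partial>lborel)"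
    and t: "t > 0"
  shows "Gamma (s / 2) * (\<integral>x. u x * heat t (y - x) \<partial>lborel)
    = (\<integral>\<tau>. subord s \<tau> * (\<integral>x. g x * heat (t + \<tau>) (y - x) \<partial>lborel) \<partial>lborel)"
proof -
  \<comment> \<open>The joint integrand. Integrating over \<tau> first removes |\<xi>|^s, while
    integrating over \<xi> first leaves the Gaussian mean of |\<xi>|^s v at time t + \<tau>.\<close>
  define F where "F \<xi> \<tau> = of_real (norm \<xi> powr s) * (of_real (subord s \<tau> * exp (- ((norm \<xi>)\<^sup>2) * \<tau>)) * (v \<xi> *
      gaussian t 0 y \<xi>))" for \<xi> \<tau>
  have [measurable]: "case_prod F \<in> borel_measurable (lborel \<Otimes>\<^sub>M lborel)" unfolding F_def by measurable
  have a: "(norm \<xi>)\<^sup>2 > 0 \<and> ((norm \<xi>)\<^sup>2) powr (- (s / 2)) = norm \<xi> powr (- s)" if "\<xi> \<noteq> 0" for \<xi> :: "real^'n"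
  proof -
    have "((norm \<xi>)\<^sup>2) powr (- (s / 2)) = (norm \<xi> powr 2) powr (- (s / 2))" using that
        by (simp add: powr_numeral)
    then show ?thesis using that unfolding powr_powr by simp
  qed
  have inner_int: "integrable lborel (F \<xi>)" for \<xi>
  proof (cases "\<xi> = 0")
    case False
    have "integrable lborel (\<lambda>\<tau>. complex_of_real (subord s \<tau> * exp (- ((norm \<xi>)\<^sup>2) * \<tau>)))"
      by (intro integrable_of_real integrable_subord_exp) (use s a[OF False] in auto)
    then show ?thesis unfolding F_def[abs_def] by (intro integrable_mult_right integrable_mult_left)
  qed (simp add: F_def[abs_def])
  have inner: "(\<integral>\<tau>. F \<xi> \<tau> \<partial>lborel) = of_real (Gamma (s / 2)) * (v \<xi> * gaussian t 0 y \<xi>)" if "\<xi> \<noteq> 0" for \<xi>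
  proof -
    have "(\<integral>\<tau>. F \<xi> \<tau> \<partial>lborel) = of_real (norm \<xi> powr s) * (of_real (\<integral>\<tau>. subord s \<tau> * exp (- ((norm \<xi>)\<^sup>2) * \<tau>)
        \<partial>lborel) * (v \<xi> * gaussian t 0 y \<xi>))"
      unfolding F_def integral_mult_right_zero integral_mult_left_zero integral_complex_of_real ..
    also have "\<dots> = of_real (norm \<xi> powr s * norm \<xi> powr (- s)) * (of_real (Gamma (s / 2)) * (v \<xi> * gaussian t
        0 y \<xi>))"
      using integral_subord_exp[of s "(norm \<xi>)\<^sup>2"] s a[OF that] by simp
    also have "norm \<xi> powr s * norm \<xi> powr (- s) = 1" using that by (simp flip: powr_add)
    finally show ?thesis by simp
  qed
  have inner_norm: "(\<integral>\<tau>. norm (F \<xi> \<tau>) \<partial>lborel) = Gamma (s / 2) * norm (v \<xi> * gaussian t 0 y \<xi>)" if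
      "\<xi> \<noteq> 0" for \<xi>
  proof -
    have "(\<integral>\<tau>. norm (F \<xi> \<tau>) \<partial>lborel) = (\<integral>\<tau>. norm \<xi> powr s * ((subord s \<tau> * exp (- ((norm \<xi>)\<^sup>2) * \<tau>)) * norm (v
        \<xi> * gaussian t 0 y \<xi>)) \<partial>lborel)"
      by (intro Bochner_Integration.integral_cong) (simp_all add: F_def norm_mult abs_mult)
    also have "\<dots> = norm \<xi> powr s * ((\<integral>\<tau>. subord s \<tau> * exp (- ((norm \<xi>)\<^sup>2) * \<tau>) \<partial>lborel) * norm (v \<xi> * gaussian
        t 0 y \<xi>))"
      unfolding integral_mult_right_zero integral_mult_left_zero ..
    also have "\<dots> = (norm \<xi> powr s * norm \<xi> powr (- s)) * (Gamma (s / 2) * norm (v \<xi> * gaussian t 0 y \<xi>))"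
      using integral_subord_exp[of s "(norm \<xi>)\<^sup>2"] s a[OF that] by simp
    also have "norm \<xi> powr s * norm \<xi> powr (- s) = 1" using that by (simp flip: powr_add)
    finally show ?thesis by simp
  qed
  have AE0: "AE \<xi> in lborel. \<xi> \<noteq> (0::real^'n)" by (rule AE_lborel_neq)
  \<comment> \<open>The factor |\<xi>|^s cancels in the integral of the norm as well, so absolute
    integrability reduces to that of v times the Gaussian.\<close>
  have F_int: "integrable (lborel \<Otimes>\<^sub>M lborel) (case_prod F)"
  proof (rule lborel_pair.Fubini_integrable)
    have "integrable lborel (\<lambda>\<xi>. Gamma (s / 2) * norm (v \<xi> * gaussian t 0 y \<xi>))"
      by (intro integrable_mult_right integrable_norm int t)
    then show "integrable lborel (\<lambda>x. \<integral>\<tau>. norm (case_prod F (x, \<tau>)) \<partial>lborel)"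
      by (rule integrable_cong_AE[THEN iffD1, rotated -1]) (use AE0 inner_norm in auto)
    show "AE x in lborel. integrable lborel (\<lambda>y. case_prod F (x, y))" using inner_int by simp
  qed measurable
  have "of_real (Gamma (s / 2) * (\<integral>x. u x * heat t (y - x) \<partial>lborel)) = \<kappa> * (of_real (Gamma (s / 2)) * (\<integral>\<xi>. v \<xi>
      * gaussian t 0 y \<xi> \<partial>lborel))"
    using u[OF t, of y] by (simp add: mult_ac)
  also have "of_real (Gamma (s / 2)) * (\<integral>\<xi>. v \<xi> * gaussian t 0 y \<xi> \<partial>lborel)
      = (\<integral>\<xi>. of_real (Gamma (s / 2)) * (v \<xi> * gaussian t 0 y \<xi>) \<partial>lborel)"
    by simp
  also have "\<dots> = (\<integral>\<xi>. (\<integral>\<tau>. F \<xi> \<tau> \<partial>lborel) \<partial>lborel)"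
    by (rule integral_cong_AE) (use AE0 inner in \<open>auto\<close>)
  also have "\<dots> = (\<integral>\<tau>. (\<integral>\<xi>. F \<xi> \<tau> \<partial>lborel) \<partial>lborel)"
    by (rule lborel_pair.Fubini_integral[symmetric]) (rule F_int)
  also have "\<kappa> * \<dots> = (\<integral>\<tau>. \<kappa> * (\<integral>\<xi>. F \<xi> \<tau> \<partial>lborel) \<partial>lborel)" by simp
  also have "\<dots> = (\<integral>\<tau>. of_real (subord s \<tau> * (\<integral>x. g x * heat (t + \<tau>) (y - x) \<partial>lborel)) \<partial>lborel)"
  proof (rule Bochner_Integration.integral_cong)
    fix \<tau> :: real
    show "\<kappa> * (\<integral>\<xi>. F \<xi> \<tau> \<partial>lborel) = of_real (subord s \<tau> * (\<integral>x. g x * heat (t + \<tau>) (y - x) \<partial>lborel))"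
    proof (cases "\<tau> \<ge> 0")
      case True
      have "F \<xi> \<tau> = of_real (subord s \<tau>) * ((of_real (norm \<xi> powr s) * v \<xi>) * gaussian (t + \<tau>) 0 y \<xi>)" for \<xi>
      proof -
        have "exp (- (t + \<tau>) * (norm \<xi>)\<^sup>2) = exp (- ((norm \<xi>)\<^sup>2) * \<tau>) * exp (- t * (norm \<xi>)\<^sup>2)"
          unfolding exp_add[symmetric] by (simp add: algebra_simps)
        then show ?thesis unfolding F_def gaussian_modulated by (simp add: mult_ac)
      qed
      then have "\<kappa> * (\<integral>\<xi>. F \<xi> \<tau> \<partial>lborel) = of_real (subord s \<tau>) * (\<kappa> * (\<integral>\<xi>. (of_real (norm \<xi> powr s) * v \<xi>) *
          gaussian (t + \<tau>) 0 y \<xi> \<partial>lborel))"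
        by simp
      then show ?thesis using g[of "t + \<tau>" y] True t by simp
    next
      case False
      then have "subord s \<tau> = 0" by (simp add: subord_def)
      then show ?thesis by (simp add: F_def)
    qed
  qed simp
  also have "\<dots> = of_real (\<integral>\<tau>. subord s \<tau> * (\<integral>x. g x * heat (t + \<tau>) (y - x) \<partial>lborel) \<partial>lborel)"
    by (rule integral_complex_of_real)
  finally show ?thesis unfolding of_real_eq_iff .
qed

text \<open>\<Gamma>(s/2) times the inverse fractional Laplacian of the positive part of
  \<open>g\<close>: the coercion \<open>ennreal (g z)\<close> cuts off negative values. Applied to g
  and to -g it handles both parts.\<close>

definition heat_pot :: "real \<Rightarrow> ('a::euclidean_space \<Rightarrow> real) \<Rightarrow> 'a \<Rightarrow> ennreal" where
  "heat_pot s g x = (\<integral>\<^sup>+\<tau>. ennreal (subord s \<tau>) * (\<integral>\<^sup>+z. ennreal (g z) * ennreal (heat \<tau> (x - z)) \<partial>lborel)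
      \<partial>lborel)"

lemma measurable_heat_pot [measurable]:
  assumes [measurable]: "g \<in> borel_measurable borel"
  shows "heat_pot s g \<in> borel_measurable borel"
  unfolding heat_pot_def by measurable

text \<open>Tonelli reduces this to the bound on the mixed kernel. The comparison function
  \<open>h\<close> allows g and -g to be treated by one statement.\<close>

lemma heat_pot_le_riesz_pot:
  assumes s: "0 < s" "s \<le> 2" "s < real DIM('a::euclidean_space)"
  shows "\<exists>C>0. \<forall>g\<in>borel_measurable (borel :: 'a measure). \<forall>h\<in>borel_measurable borel. (\<forall>x. h x \<le> \<bar>g x\<bar>) \<longrightarrow>
      (\<forall>x. heat_pot s h x \<le> ennreal C * riesz_pot s g x)"
proof -
  obtain C where C: "C > 0" "\<And>x::'a. x \<noteq> 0 \<Longrightarrow> (\<integral>\<^sup>+\<tau>. ennreal (subord s \<tau> * heat \<tau> x) \<partial>lborel)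
      \<le> ennreal (C * norm x powr (s - real DIM('a)))"
    using subord_heat_le_riesz[OF s] by blast
  show ?thesis
  proof (intro exI conjI ballI allI impI)
    fix g h :: "'a \<Rightarrow> real" and x :: 'a
    assume [measurable]: "g \<in> borel_measurable borel" "h \<in> borel_measurable borel" and hg: "\<forall>x. h x \<le> \<bar>g x\<bar>"
    have "heat_pot s h x = (\<integral>\<^sup>+\<tau>. (\<integral>\<^sup>+z. ennreal (h z) * ennreal (subord s \<tau> * heat \<tau> (x - z)) \<partial>lborel)
        \<partial>lborel)"
      unfolding heat_pot_def by (subst nn_integral_cmult[symmetric]) (simp_all add: ennreal_mult mult_ac)
    also have "\<dots> = (\<integral>\<^sup>+z. (\<integral>\<^sup>+\<tau>. ennreal (h z) * ennreal (subord s \<tau> * heat \<tau> (x - z)) \<partial>lborel) \<partial>lborel)"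
      by (rule lborel_pair.Fubini') measurable
    also have "\<dots> = (\<integral>\<^sup>+z. ennreal (h z) * (\<integral>\<^sup>+\<tau>. ennreal (subord s \<tau> * heat \<tau> (x - z)) \<partial>lborel) \<partial>lborel)"
      by (simp add: nn_integral_cmult)
    also have "\<dots> \<le> (\<integral>\<^sup>+z. ennreal C * ennreal (norm (x - z) powr (s - real DIM('a)) * \<bar>g z\<bar>) \<partial>lborel)"
    proof (rule nn_integral_mono_AE)
      show "AE z in lborel. ennreal (h z) * (\<integral>\<^sup>+\<tau>. ennreal (subord s \<tau> * heat \<tau> (x - z)) \<partial>lborel)
          \<le> ennreal C * ennreal (norm (x - z) powr (s - real DIM('a)) * \<bar>g z\<bar>)"
        using AE_lborel_neq[of x]
      proof eventually_elim
        case (elim z)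
        have "ennreal (h z) * (\<integral>\<^sup>+\<tau>. ennreal (subord s \<tau> * heat \<tau> (x - z)) \<partial>lborel)
            \<le> ennreal \<bar>g z\<bar> * ennreal (C * norm (x - z) powr (s - real DIM('a)))"
          using hg elim by (intro mult_mono ennreal_leI C(2)) auto
        also have "\<dots> = ennreal C * ennreal (norm (x - z) powr (s - real DIM('a)) * \<bar>g z\<bar>)"
          using C by (simp add: ennreal_mult[symmetric] mult_ac)
        finally show ?case .
      qed
    qed
    also have "\<dots> = ennreal C * riesz_pot s g x" unfolding riesz_pot_def by (rule nn_integral_cmult) measurable
    finally show "heat_pot s h x \<le> ennreal C * riesz_pot s g x" .
  qed (use C in simp)
qed

text \<open>By the semigroup law one more heat convolution only shifts the time by t, which matches
  the right-hand side of \<open>subordination_identity\<close>.\<close>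

lemma heat_of_heat_pot:
  fixes g :: "'a::euclidean_space \<Rightarrow> real"
  assumes [measurable]: "g \<in> borel_measurable borel" and t: "t > 0"
  shows "(\<integral>\<^sup>+x. heat_pot s g x * ennreal (heat t (y - x)) \<partial>lborel)
    = (\<integral>\<^sup>+\<tau>. ennreal (subord s \<tau>) * (\<integral>\<^sup>+z. ennreal (g z) * ennreal (heat (t + \<tau>) (y - z)) \<partial>lborel) \<partial>lborel)"
proof -
  define H where "H \<tau> x = (\<integral>\<^sup>+z. ennreal (g z) * ennreal (heat \<tau> (x - z)) \<partial>lborel)" for \<tau> x
  have [measurable]: "(\<lambda>p. H (fst p) (snd p)) \<in> borel_measurable (borel \<Otimes>\<^sub>M borel)"
      "(\<lambda>p. H (snd p) (fst p)) \<in> borel_measurable (borel \<Otimes>\<^sub>M borel)"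
    "H \<tau> \<in> borel_measurable borel" "(\<lambda>\<tau>. H \<tau> x) \<in> borel_measurable borel" for \<tau> x
    unfolding H_def[abs_def] by measurable
  have "(\<integral>\<^sup>+x. heat_pot s g x * ennreal (heat t (y - x)) \<partial>lborel)
    = (\<integral>\<^sup>+x. (\<integral>\<^sup>+\<tau>. ennreal (subord s \<tau>) * H \<tau> x * ennreal (heat t (y - x)) \<partial>lborel) \<partial>lborel)"
    unfolding heat_pot_def H_def[symmetric] by (simp add: nn_integral_multc)
  also have "\<dots> = (\<integral>\<^sup>+\<tau>. (\<integral>\<^sup>+x. ennreal (subord s \<tau>) * H \<tau> x * ennreal (heat t (y - x)) \<partial>lborel) \<partial>lborel)"
    by (rule lborel_pair.Fubini') measurable
  also have "\<dots> = (\<integral>\<^sup>+\<tau>. ennreal (subord s \<tau>) * (\<integral>\<^sup>+x. H \<tau> x * ennreal (heat t (y - x)) \<partial>lborel) \<partial>lborel)"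
    by (subst nn_integral_cmult[symmetric]) (simp_all add: mult.assoc)
  also have "\<dots> = (\<integral>\<^sup>+\<tau>. ennreal (subord s \<tau>) * (\<integral>\<^sup>+z. ennreal (g z) * ennreal (heat (t
      + \<tau>) (y - z)) \<partial>lborel) \<partial>lborel)"
  proof (rule nn_integral_cong_AE)
    show "AE \<tau> in lborel. ennreal (subord s \<tau>) * (\<integral>\<^sup>+x. H \<tau> x * ennreal (heat t (y - x)) \<partial>lborel)
      = ennreal (subord s \<tau>) * (\<integral>\<^sup>+z. ennreal (g z) * ennreal (heat (t + \<tau>) (y - z)) \<partial>lborel)"
      using AE_lborel_neq[of "0::real"]
    proof eventually_elim
      case (elim \<tau>)
      show ?case
      proof (cases "\<tau> > 0")
        case True
        have "(\<integral>\<^sup>+x. H \<tau> x * ennreal (heat t (y - x)) \<partial>lborel) = (\<integral>\<^sup>+x. (\<integral>\<^sup>+z. ennreal (g z) * ennreal (heat t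
            (y - x) * heat \<tau> (x - z)) \<partial>lborel) \<partial>lborel)"
          unfolding H_def by (subst nn_integral_multc[symmetric]) (simp_all add: ennreal_mult mult_ac)
        also have "\<dots> = (\<integral>\<^sup>+z. (\<integral>\<^sup>+x. ennreal (g z) * ennreal (heat t (y - x) * heat \<tau> (x - z)) \<partial>lborel)
            \<partial>lborel)"
          by (rule lborel_pair.Fubini') measurable
        also have "\<dots> = (\<integral>\<^sup>+z. ennreal (g z) * ennreal (heat (t + \<tau>) (y - z)) \<partial>lborel)"
          by (simp add: nn_integral_cmult nn_integral_heat_conv[OF t True])
        finally show ?thesis by simp
      next
        case False
        then show ?thesis using elim by (simp add: subord_def)
      qed
    qed
  qed
  finally show ?thesis .
qed

lemma
  fixes X :: "'b \<Rightarrow> ennreal"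
  assumes [measurable]: "X \<in> borel_measurable M" and fin: "(\<integral>\<^sup>+x. X x \<partial>M) < \<infinity>"
  shows integrable_enn2real: "integrable M (\<lambda>x. enn2real (X x))"
    and integral_enn2real: "(\<integral>x. enn2real (X x) \<partial>M) = enn2real (\<integral>\<^sup>+x. X x \<partial>M)"
proof -
  have "AE x in M. X x \<noteq> \<infinity>" by (rule nn_integral_noteq_infinite) (use fin in auto)
  then have "(\<integral>\<^sup>+x. ennreal (enn2real (X x)) \<partial>M) = (\<integral>\<^sup>+x. X x \<partial>M)"
    by (intro nn_integral_cong_AE) (auto simp: less_top)
  also have "\<dots> = ennreal (enn2real (\<integral>\<^sup>+x. X x \<partial>M))" using fin by simp
  finally have "has_bochner_integral M (\<lambda>x. enn2real (X x)) (enn2real (\<integral>\<^sup>+x. X x \<partial>M))"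
    by (intro has_bochner_integral_nn_integral) auto
  then show "integrable M (\<lambda>x. enn2real (X x))" "(\<integral>x. enn2real (X x) \<partial>M) = enn2real (\<integral>\<^sup>+x. X x \<partial>M)"
    by (auto simp: has_bochner_integral_iff)
qed

lemma integral_mult_heat_parts:
  fixes f :: "'a::euclidean_space \<Rightarrow> real"
  assumes int: "integrable lborel (\<lambda>x. f x * heat t (y - x))"
  shows "(\<integral>\<^sup>+x. ennreal (f x) * ennreal (heat t (y - x)) \<partial>lborel) < \<infinity>"
    and "(\<integral>\<^sup>+x. ennreal (- f x) * ennreal (heat t (y - x)) \<partial>lborel) < \<infinity>"
    and "(\<integral>x. f x * heat t (y - x) \<partial>lborel) = enn2real (\<integral>\<^sup>+x. ennreal (f x) * ennreal (heat t (y - x))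
        \<partial>lborel)
      - enn2real (\<integral>\<^sup>+x. ennreal (- f x) * ennreal (heat t (y - x)) \<partial>lborel)"
proof -
  have e: "ennreal k * ennreal (heat t (y - x)) = ennreal (k * heat t (y - x))" for k x
    by (simp add: ennreal_mult'')
  show "(\<integral>\<^sup>+x. ennreal (f x) * ennreal (heat t (y - x)) \<partial>lborel) < \<infinity>"
    "(\<integral>\<^sup>+x. ennreal (- f x) * ennreal (heat t (y - x)) \<partial>lborel) < \<infinity>"
    unfolding e using int by (simp_all add: real_integrable_def less_top)
  show "(\<integral>x. f x * heat t (y - x) \<partial>lborel) = enn2real (\<integral>\<^sup>+x. ennreal (f x) * ennreal (heat t (y - x)) \<partial>lborel)
      - enn2real (\<integral>\<^sup>+x. ennreal (- f x) * ennreal (heat t (y - x)) \<partial>lborel)"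
    unfolding e using real_lebesgue_integral_def[OF int] by simp
qed

lemma frac_laplacian_le_riesz_pot:
  assumes s: "0 < s" "s \<le> 2" "2 * s < real CARD('n::finite)"
  shows "\<exists>c>0. \<forall>(u :: real^'n \<Rightarrow> real) g u' g' a. has_frac_laplacian s u g \<longrightarrow>
    u' \<in> borel_measurable borel \<longrightarrow> g' \<in> borel_measurable borel \<longrightarrow>
    (AE x in lborel. u x = u' x) \<longrightarrow> (AE x in lborel. g x = g' x) \<longrightarrow> 0 \<le> a \<longrightarrow>
    (\<integral>\<^sup>+z. ennreal ((g' z)\<^sup>2) \<partial>lborel) \<le> ennreal (a\<^sup>2) \<longrightarrow>
    (AE x in lborel. ennreal \<bar>u' x\<bar> \<le> ennreal c * riesz_pot s g' x)"
proof -
  let ?\<Gamma> = "Gamma (s / 2)"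
  have G: "?\<Gamma> > 0" using s by (intro Gamma_real_pos) auto
  obtain C where C: "C > 0" "\<And>g h x. g \<in> borel_measurable (borel :: (real^'n) measure) \<Longrightarrow>
      h \<in> borel_measurable borel \<Longrightarrow> (\<forall>x. h x \<le> \<bar>g x\<bar>) \<Longrightarrow> heat_pot s h x \<le> ennreal C * riesz_pot s g x"
    using heat_pot_le_riesz_pot[where 'a = "real^'n", of s] s by auto
  have main: "AE x in lborel. ennreal \<bar>u' x\<bar> \<le> ennreal (C / ?\<Gamma>) * riesz_pot s g' x"
    if h: "has_frac_laplacian s u g" and m[measurable]: "u' \<in> borel_measurable borel"
        "g' \<in> borel_measurable borel"
      and ae: "AE x in lborel. u x = u' x" "AE x in lborel. g x = g' x" and a: "0 \<le> a"
      and L2: "(\<integral>\<^sup>+z. ennreal ((g' z)\<^sup>2) \<partial>lborel) \<le> ennreal (a\<^sup>2)" for u g u' g' :: "real^'n \<Rightarrow> real" and a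
  proof -
    obtain v where v: "has_fourier (\<lambda>x. complex_of_real (u x)) v" "has_fourier (\<lambda>x. complex_of_real (g x))
        (\<lambda>\<xi>. of_real (norm \<xi> powr s) * v \<xi>)"
      using h unfolding has_frac_laplacian_def by blast
    then have "v \<in> borel_measurable lebesgue" by (simp add: has_fourier_def)
    then obtain v' where v'[measurable]: "v' \<in> borel_measurable borel" and vae: "AE x in lborel. v x = v' x"
      using borel_representative_complex by blast
    have P: "(\<lambda>x. complex_of_real (u' x)) \<in> borel_measurable borel"
        "(\<lambda>x. complex_of_real (g' x)) \<in> borel_measurable borel"
      "(\<lambda>\<xi>. of_real (norm \<xi> powr s) * v' \<xi>) \<in> borel_measurable borel" by measurable
    have AE1: "AE x in lborel. complex_of_real (u x) = complex_of_real (u' x)"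
        "AE x in lborel. complex_of_real (g x) = complex_of_real (g' x)"
      "AE \<xi> in lborel. of_real (norm \<xi> powr s) * v \<xi> = of_real (norm \<xi> powr s) * v' \<xi>"
      using ae vae by auto
    note hu = has_fourier_heat[OF v(1) P(1) v' AE1(1) vae] and hg = has_fourier_heat[OF v(2) P(2,3) AE1(2,3)]
    have iu: "integrable lborel (\<lambda>x. u' x * heat t (y - x))" and ig: "integrable lborel (\<lambda>x. g' x * heat t (y
        - x))" if "t > 0" for t y
      using hu(1)[OF that, of y] hg(1)[OF that, of y] by (simp_all only: of_real_mult[symmetric]
          complex_of_real_integrable_eq)
    define W where "W = heat_pot s g'"
    define V where "V = heat_pot s (\<lambda>x. - g' x)"
    have [measurable]: "W \<in> borel_measurable borel" "V \<in> borel_measurable borel"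
        by (simp_all add: W_def V_def)
    have key: "(\<integral>\<^sup>+x. (ennreal ?\<Gamma> * ennreal (u' x) + V x) * ennreal (heat t (y - x)) \<partial>lborel)
        = (\<integral>\<^sup>+x. (ennreal ?\<Gamma> * ennreal (- u' x) + W x) * ennreal (heat t (y - x)) \<partial>lborel)"
      and fin: "(\<integral>\<^sup>+x. (ennreal ?\<Gamma> * ennreal (u' x) + V x) * ennreal (heat t (y - x)) \<partial>lborel) < \<infinity>" if t:
          "t > 0" for t y
    proof -
      define U1 where "U1 = (\<integral>\<^sup>+x. ennreal (u' x) * ennreal (heat t (y - x)) \<partial>lborel)"
      define U2 where "U2 = (\<integral>\<^sup>+x. ennreal (- u' x) * ennreal (heat t (y - x)) \<partial>lborel)"
      note U = integral_mult_heat_parts[OF iu[OF t, of y], folded U1_def U2_def]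
      define A where "A \<sigma> \<tau> = (\<integral>\<^sup>+z. ennreal (\<sigma> * g' z) * ennreal (heat (t + \<tau>) (y - z)) \<partial>lborel)" for \<sigma> \<tau>
      have [measurable]: "A \<sigma> \<in> borel_measurable borel" for \<sigma> unfolding A_def[abs_def] by measurable
      define I where "I \<sigma> = (\<integral>\<^sup>+\<tau>. ennreal (subord s \<tau>) * A \<sigma> \<tau> \<partial>lborel)" for \<sigma>
      have Ifin: "I \<sigma> < \<infinity>" if "\<bar>\<sigma>\<bar> = 1" for \<sigma>
      proof -
        have "A \<sigma> \<tau> \<le> (\<integral>\<^sup>+z. ennreal (heat (t + \<tau>) (y - z) * \<bar>g' z\<bar>) \<partial>lborel)" for \<tau>
          unfolding A_def
        proof (intro nn_integral_mono)
          fix z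
          have "\<sigma> * g' z \<le> \<bar>g' z\<bar>" using that abs_ge_self[of "\<sigma> * g' z"] by (simp add: abs_mult)
          then show "ennreal (\<sigma> * g' z) * ennreal (heat (t + \<tau>) (y - z)) \<le> ennreal (heat (t
              + \<tau>) (y - z) * \<bar>g' z\<bar>)"
            by (simp add: ennreal_mult''[symmetric] mult.commute[of "heat _ _"] mult_right_mono ennreal_leI)
        qed
        then have "I \<sigma> \<le> (\<integral>\<^sup>+\<tau>. ennreal (subord s \<tau>) * (\<integral>\<^sup>+z. ennreal (heat (t
            + \<tau>) (y - z) * \<bar>g' z\<bar>) \<partial>lborel) \<partial>lborel)"
          unfolding I_def by (intro nn_integral_mono mult_left_mono) auto
        also have "\<dots> < \<infinity>" using s by (intro subord_heat_finite[OF _ t a L2]) auto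
        finally show ?thesis .
      qed
      have "?\<Gamma> * (\<integral>x. u' x * heat t (y - x) \<partial>lborel) = (\<integral>\<tau>. subord s \<tau> * (\<integral>x. g' x * heat (t
          + \<tau>) (y - x) \<partial>lborel) \<partial>lborel)"
      proof (rule subordination_identity[OF s(1) v' _ _ _ t])
        show "complex_of_real (\<integral>x. u' x * heat t (y - x) \<partial>lborel) = of_real ((2 * pi) powr (- (real CARD('n) /
            2))) * (\<integral>\<xi>. v' \<xi> * gaussian t 0 y \<xi> \<partial>lborel)"
          if "t > 0" for t y
          using hu(3)[OF that, of y] by (simp only: of_real_mult[symmetric] integral_complex_of_real)
        show "complex_of_real (\<integral>x. g' x * heat t (y - x) \<partial>lborel) = of_real ((2 * pi) powr (- (real CARD('n) /
            2))) * (\<integral>\<xi>. of_real (norm \<xi> powr s) * v' \<xi> * gaussian t 0 y \<xi> \<partial>lborel)"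
          if "t > 0" for t y
          using hg(3)[OF that, of y] by (simp only: of_real_mult[symmetric] integral_complex_of_real)
      qed (rule hu(2))
      also have "\<dots> = (\<integral>\<tau>. enn2real (ennreal (subord s \<tau>) * A 1 \<tau>) - enn2real (ennreal (subord s \<tau>) * A (- 1)
          \<tau>) \<partial>lborel)"
      proof (rule Bochner_Integration.integral_cong)
        fix \<tau>
        show "subord s \<tau> * (\<integral>x. g' x * heat (t + \<tau>) (y - x) \<partial>lborel) = enn2real (ennreal (subord s \<tau>) * A 1 \<tau>)
            - enn2real (ennreal (subord s \<tau>) * A (- 1) \<tau>)"
        proof (cases "\<tau> \<ge> 0")
          case True
          then have "t + \<tau> > 0" using t by simp
          from integral_mult_heat_parts(3)[OF ig[OF this, of y]] show ?thesis
            by (simp add: A_def enn2real_mult right_diff_distrib)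
        qed (simp add: subord_def)
      qed simp
      also have "\<dots> = enn2real (I 1) - enn2real (I (- 1))"
      proof -
        have m: "(\<lambda>\<tau>. ennreal (subord s \<tau>) * A \<sigma> \<tau>) \<in> borel_measurable lborel" for \<sigma> by measurable
        show ?thesis
          using Bochner_Integration.integral_diff[OF integrable_enn2real[OF m Ifin[of 1, unfolded I_def]]
              integrable_enn2real[OF m Ifin[of "-1", unfolded I_def]]]
            integral_enn2real[OF m Ifin[of 1, unfolded I_def]] integral_enn2real[OF m Ifin[of
                "-1", unfolded I_def]]
          by (simp add: I_def)
      qed
      finally have real_eq: "?\<Gamma> * enn2real U1 + enn2real (I (- 1)) = ?\<Gamma> * enn2real U2 + enn2real (I 1)"
        unfolding U(3) by (simp add: algebra_simps)
      have fins: "U1 = ennreal (enn2real U1)" "U2 = ennreal (enn2real U2)" "I 1 = ennreal (enn2real (I 1))"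
          "I (- 1) = ennreal (enn2real (I (- 1)))"
        using U(1,2) Ifin[of 1] Ifin[of "-1"] by simp_all
      \<comment> \<open>All four quantities are finite, so the real identity lifts back to
        \<open>ennreal\<close> without cancellation.\<close>
      have enn_eq: "ennreal ?\<Gamma> * U1 + I (- 1) = ennreal ?\<Gamma> * U2 + I 1"
      proof -
        have "ennreal ?\<Gamma> * ennreal (enn2real U1) + ennreal (enn2real (I (- 1)))
            = ennreal ?\<Gamma> * ennreal (enn2real U2) + ennreal (enn2real (I 1))"
          using real_eq G by (simp add: ennreal_mult[symmetric] ennreal_plus[symmetric] del: ennreal_plus)
        then show ?thesis by (simp only: fins[symmetric])
      qed
      have IW: "(\<integral>\<^sup>+x. W x * ennreal (heat t (y - x)) \<partial>lborel) = I 1"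
          "(\<integral>\<^sup>+x. V x * ennreal (heat t (y - x)) \<partial>lborel) = I (- 1)"
        unfolding W_def V_def I_def A_def by (simp_all add: heat_of_heat_pot[OF _ t])
      have 1: "(\<integral>\<^sup>+x. (ennreal ?\<Gamma> * ennreal (u' x) + V x) * ennreal (heat t (y - x)) \<partial>lborel)
          = ennreal ?\<Gamma> * U1 + I (- 1)"
        unfolding U1_def IW(2)[symmetric] distrib_right by (subst nn_integral_add) (simp_all add:
            nn_integral_cmult mult.assoc)
      have 2: "(\<integral>\<^sup>+x. (ennreal ?\<Gamma> * ennreal (- u' x) + W x) * ennreal (heat t (y - x)) \<partial>lborel)
          = ennreal ?\<Gamma> * U2 + I 1"
        unfolding U2_def IW(1)[symmetric] distrib_right by (subst nn_integral_add) (simp_all add: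
            nn_integral_cmult mult.assoc)
      show "(\<integral>\<^sup>+x. (ennreal ?\<Gamma> * ennreal (u' x) + V x) * ennreal (heat t (y - x)) \<partial>lborel)
        = (\<integral>\<^sup>+x. (ennreal ?\<Gamma> * ennreal (- u' x) + W x) * ennreal (heat t (y - x)) \<partial>lborel)"
        unfolding 1 2 by (rule enn_eq)
      show "(\<integral>\<^sup>+x. (ennreal ?\<Gamma> * ennreal (u' x) + V x) * ennreal (heat t (y - x)) \<partial>lborel) < \<infinity>"
        unfolding 1 using U(1) Ifin[of "-1"] by (simp add: ennreal_mult_less_top)
    qed
    have "AE x in lborel. ennreal ?\<Gamma> * ennreal (u' x) + V x = ennreal ?\<Gamma> * ennreal (- u' x) + W x"
      by (rule heat_unique[OF _ _ key fin]) auto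
    then show ?thesis
    proof eventually_elim
      case (elim x)
      have WV: "W x \<le> ennreal C * riesz_pot s g' x" "V x \<le> ennreal C * riesz_pot s g' x"
        unfolding W_def V_def using m by (auto intro!: C(2))
      have "ennreal ?\<Gamma> * ennreal \<bar>u' x\<bar> \<le> ennreal C * riesz_pot s g' x"
      proof (cases "u' x \<ge> 0")
        case True
        then have "ennreal ?\<Gamma> * ennreal \<bar>u' x\<bar> \<le> ennreal ?\<Gamma> * ennreal (u' x) + V x" by simp
        also have "\<dots> = W x" unfolding elim using True by (simp add: ennreal_neg)
        finally show ?thesis using WV(1) by simp
      next
        case False
        then have "ennreal ?\<Gamma> * ennreal \<bar>u' x\<bar> \<le> ennreal ?\<Gamma> * ennreal (- u' x) + W x" by simp
        also have "\<dots> = V x" unfolding elim[symmetric] using False by (simp add: ennreal_neg)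
        finally show ?thesis using WV(2) by simp
      qed
      then have "ennreal (1 / ?\<Gamma>) * (ennreal ?\<Gamma> * ennreal \<bar>u' x\<bar>) \<le> ennreal (1 / ?\<Gamma>) * (ennreal C * riesz_pot
          s g' x)"
        by (rule mult_left_mono) simp
      moreover have "ennreal (1 / ?\<Gamma>) * ennreal ?\<Gamma> = 1" using G by (simp add: ennreal_mult[symmetric])
      moreover have "ennreal (1 / ?\<Gamma>) * ennreal C = ennreal (C / ?\<Gamma>)" using G C
          by (simp add: ennreal_mult[symmetric])
      ultimately show ?case by (simp only: mult.assoc[symmetric] mult_1)
    qed
  qed
  show ?thesis
    by (intro exI[of _ "C / ?\<Gamma>"] conjI allI impI) (use C G in simp, rule main)
qed

section \<open>Borel representatives and norms\<close>

lemma borel_representative_real: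
  fixes f :: "'a::euclidean_space \<Rightarrow> real"
  assumes "f \<in> borel_measurable lebesgue"
  shows "\<exists>f'\<in>borel_measurable borel. AE x in lborel. f x = f' x"
  using completion_ex_borel_measurable_real[OF assms] by simp

text \<open>\<open>Lp_norm\<close> rests on the Bochner integral, which is 0 for a non-integrable
  function; finiteness ensures that it is the true norm.\<close>

lemma Lp_norm_powr:
  fixes f f' :: "real^'n \<Rightarrow> real"
  assumes [measurable]: "f' \<in> borel_measurable borel" and f: "f \<in> borel_measurable lebesgue" and ae:
      "AE x in lborel. f x = f' x"
    and p: "p > 0" and fin: "(\<integral>\<^sup>+x. ennreal (\<bar>f' x\<bar> powr p) \<partial>lborel) < \<infinity>"
  shows "(\<integral>\<^sup>+x. ennreal (\<bar>f' x\<bar> powr p) \<partial>lborel) = ennreal (Lp_norm p f powr p)"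
proof -
  have m: "(\<lambda>x. \<bar>f' x\<bar> powr p) \<in> borel_measurable borel" by measurable
  have ml: "(\<lambda>x. \<bar>f x\<bar> powr p) \<in> borel_measurable lebesgue" using f by measurable
  have "AE x in lborel. \<bar>f x\<bar> powr p = \<bar>f' x\<bar> powr p" using ae by auto
  from lebesgue_representative(2)[OF m ml this]
  have "Lp_norm p f = (\<integral>x. \<bar>f' x\<bar> powr p \<partial>lborel) powr (1 / p)" by (simp add: Lp_norm_def)
  then have "Lp_norm p f powr p = (\<integral>x. \<bar>f' x\<bar> powr p \<partial>lborel) powr 1"
    using p by (simp add: powr_powr)
  also have "\<dots> = (\<integral>x. \<bar>f' x\<bar> powr p \<partial>lborel)" by (simp add: powr_one Bochner_Integration.integral_nonneg)
  finally show ?thesis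
    using fin by (subst nn_integral_eq_integral) (auto intro!: integrableI_bounded)
qed

lemma Lp_norm_nonneg: "0 \<le> Lp_norm p f"
  by (simp add: Lp_norm_def)

text \<open>\<open>Ds\<close> provides some square-integrable fractional Laplacian, and
  \<open>SOME\<close> may pick another function; by uniqueness they agree almost everywhere, so the
  chosen one has the same finite norm.\<close>

lemma frac_laplacian_L2:
  fixes u :: "real^'n \<Rightarrow> real"
  assumes u: "u \<in> Ds s"
  shows "\<exists>g'\<in>borel_measurable borel. (AE x in lborel. frac_laplacian s u x = g' x)
      \<and> has_frac_laplacian s u (frac_laplacian s u) \<and>
    (\<integral>\<^sup>+x. ennreal ((g' x)\<^sup>2) \<partial>lborel) = ennreal ((Lp_norm 2 (frac_laplacian s u))\<^sup>2)"
proof -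
  obtain g where g: "g \<in> Lp 2" "has_frac_laplacian s u g" using u by (auto simp: Ds_def)
  let ?f = "frac_laplacian s u"
  have f: "has_frac_laplacian s u ?f" unfolding frac_laplacian_def by (rule someI[where P =
      "has_frac_laplacian s u", OF g(2)])
  then have "(\<lambda>x. complex_of_real (?f x)) \<in> borel_measurable lebesgue" by (auto simp: has_frac_laplacian_def
      has_fourier_def)
  then have "(\<lambda>x. Re (complex_of_real (?f x))) \<in> borel_measurable lebesgue" by measurable
  then have fm: "?f \<in> borel_measurable lebesgue" by simp
  have gm: "g \<in> borel_measurable lebesgue" and gi: "integrable lebesgue (\<lambda>x. \<bar>g x\<bar> powr 2)" using g(1)
      by (auto simp: Lp_def)
  obtain g' where g'[measurable]: "g' \<in> borel_measurable borel" and ae: "AE x in lborel. g x = g' x"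
    using borel_representative_real[OF gm] by blast
  have ae2: "AE x in lborel. ?f x = g' x" using has_frac_laplacian_unique[OF f g(2)] ae
      by eventually_elim simp
  have m: "(\<lambda>x. \<bar>g' x\<bar> powr 2) \<in> borel_measurable borel" and ml:
      "(\<lambda>x. \<bar>g x\<bar> powr 2) \<in> borel_measurable lebesgue"
    using gm by measurable
  have "AE x in lborel. \<bar>g x\<bar> powr 2 = \<bar>g' x\<bar> powr 2" using ae by auto
  from lebesgue_representative(1)[OF m ml this] gi have "integrable lborel (\<lambda>x. \<bar>g' x\<bar> powr 2)" by simp
  then have fin: "(\<integral>\<^sup>+x. ennreal (\<bar>g' x\<bar> powr 2) \<partial>lborel) < \<infinity>" by (simp add: integrable_iff_bounded)
  from Lp_norm_powr[OF g' fm ae2 _ fin]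
  have "(\<integral>\<^sup>+x. ennreal ((g' x)\<^sup>2) \<partial>lborel) = ennreal ((Lp_norm 2 ?f)\<^sup>2)"
    by (simp add: Lp_norm_nonneg powr_numeral)
  then show ?thesis using g' ae2 f by blast
qed

section \<open>The quotient on radial functions\<close>

lemma AE_zero_of_weighted_powr_integral_zero:
  fixes f' :: "'a::euclidean_space \<Rightarrow> real"
  assumes [measurable]: "f' \<in> borel_measurable borel" and "(\<integral>\<^sup>+x. ennreal (k x * \<bar>f' x\<bar> powr p) \<partial>lborel) = 0"
    and [measurable]: "k \<in> borel_measurable borel" and k: "\<And>x. x \<noteq> 0 \<Longrightarrow> k x > 0"
  shows "AE x in lborel. f' x = 0"
proof -
  have "AE x in lborel. ennreal (k x * \<bar>f' x\<bar> powr p) = 0"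
    using assms(2) by (subst (asm) nn_integral_0_iff_AE) auto
  then show ?thesis using AE_lborel_neq[of 0]
  proof eventually_elim
    case (elim x)
    then have "k x * \<bar>f' x\<bar> powr p \<le> 0" by (simp add: ennreal_eq_0_iff)
    then have "\<bar>f' x\<bar> powr p \<le> 0" using k[OF elim(2)] by (simp add: mult_le_0_iff)
    then show ?case by (metis abs_eq_0 powr_gt_zero not_less)
  qed
qed

text \<open>The potential bound feeds the interpolation inequality, used with \<Lambda> = lam. As
  \<open>J\<close> is built from norms that default to 0 and from a quotient, the Hardy term and the
  weighted q-norm must be shown finite, and both \<open>a\<close> and \<open>L\<close>
  positive.\<close>

lemma radial_J_lower_bound:
  assumes n: "CARD('n::finite) \<ge> 2" and s: "0 < s" "s < 1"
    and b: "real CARD('n) / q - b = real CARD('n) / 2 - s"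
    and r: "r = weak_exponent (real CARD('n)) s" and q: "2 < q" "q < r"
  shows "\<exists>c>0. \<forall>lam\<ge>1. \<forall>u :: real^'n \<Rightarrow> real. u \<in> Ds s \<longrightarrow> nonzero_ae u \<longrightarrow> radial u \<longrightarrow>
    c * lam powr (2 / q * ((r - q) / (r - 2))) \<le> J s b q lam u"
proof -
  let ?n = "real CARD('n)"
  define e where "e = (r - q) / (r - 2)"
  have n2: "2 * s < ?n" "2 \<le> DIM(real^'n)" using n s by auto
  obtain c where c: "c > 0" "\<And>(u :: real^'n \<Rightarrow> real) g u' g' a. has_frac_laplacian s u g \<Longrightarrow>
    u' \<in> borel_measurable borel \<Longrightarrow> g' \<in> borel_measurable borel \<Longrightarrow>
    (AE x in lborel. u x = u' x) \<Longrightarrow> (AE x in lborel. g x = g' x) \<Longrightarrow> 0 \<le> a \<Longrightarrow>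
    (\<integral>\<^sup>+z. ennreal ((g' z)\<^sup>2) \<partial>lborel) \<le> ennreal (a\<^sup>2) \<Longrightarrow>
    (AE x in lborel. ennreal \<bar>u' x\<bar> \<le> ennreal c * riesz_pot s g' x)"
    using frac_laplacian_le_riesz_pot[where 'n = 'n, of s] s n2 by auto
  obtain H where H: "H > 0" "\<And>g. g \<in> borel_measurable (borel :: (real^'n) measure) \<Longrightarrow>
    (\<integral>\<^sup>+y. ennreal (norm y powr (- 2 * s)) * (riesz_pot s g y)\<^sup>2 \<partial>lborel)
        \<le> ennreal H * (\<integral>\<^sup>+z. ennreal ((g z)\<^sup>2) \<partial>lborel)"
    using hardy_riesz[where 'a = "real^'n", of s] s n2 unfolding riesz_pot_def by auto
  have r': "r = weak_exponent (real DIM(real^'n)) s" using r by simp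
  obtain K where K: "K > 0" "\<forall>g\<in>borel_measurable (borel :: (real^'n) measure). \<forall>u\<in>borel_measurable borel.
      \<forall>a>0. \<forall>d\<ge>0. \<forall>\<Lambda>\<ge>1.
    (\<integral>\<^sup>+z. ennreal ((g z)\<^sup>2) \<partial>lborel) \<le> ennreal (a\<^sup>2) \<longrightarrow>
    (\<integral>\<^sup>+y. ennreal ((norm y powr (- s) * u y)\<^sup>2) \<partial>lborel) \<le> ennreal (d\<^sup>2) \<longrightarrow>
    (\<exists>f. AE y in lborel. u y = f (norm y)) \<longrightarrow>
    (AE y in lborel. ennreal \<bar>u y\<bar> \<le> ennreal c * riesz_pot s g y) \<longrightarrow>
    (\<integral>\<^sup>+y. ennreal (norm y powr ((real DIM(real^'n) / 2 - s) * q - real DIM(real^'n)) * \<bar>u y\<bar> powr q) \<partial>lborel)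
      \<le> ennreal (K * (a\<^sup>2 + \<Lambda> * d\<^sup>2) powr (q / 2) * \<Lambda> powr (- ((r - q) / (r - 2))))"
    using radial_interpolation[OF s n2(2) c(1) r' q] by (elim exE conjE) (rule that, assumption+)
  \<comment> \<open>The interpolation bound controls the q-th power of the denominator norm; passing
    to its square raises \<open>K\<close> to the power 2/q.\<close>
  define c0 where "c0 = 1 / K powr (2 / q)"
  have c0: "c0 > 0" using K(1) by (simp add: c0_def)
  have main: "c0 * lam powr (2 / q * e) \<le> J s b q lam u"
    if lam: "lam \<ge> 1" and u: "u \<in> Ds s" and nz: "nonzero_ae u" and rad: "radial u" for lam and u ::
        "real^'n \<Rightarrow> real"
  proof -
    have um: "u \<in> borel_measurable lebesgue" using u by (simp add: Ds_def Lp_def)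
    obtain u' where u'[measurable]: "u' \<in> borel_measurable borel" and uae: "AE x in lborel. u x = u' x"
      using borel_representative_real[OF um] by blast
    obtain g where g[measurable]: "g \<in> borel_measurable borel" and gae: "AE x in lborel. frac_laplacian s u x
        = g x"
      and frac: "has_frac_laplacian s u (frac_laplacian s u)"
      and g2: "(\<integral>\<^sup>+x. ennreal ((g x)\<^sup>2) \<partial>lborel) = ennreal ((Lp_norm 2 (frac_laplacian s u))\<^sup>2)"
      using frac_laplacian_L2[OF u] by blast
    define a where "a = Lp_norm 2 (frac_laplacian s u)"
    have g2': "(\<integral>\<^sup>+x. ennreal ((g x)\<^sup>2) \<partial>lborel) \<le> ennreal (a\<^sup>2)" by (simp add: g2 a_def)
    have a0: "0 \<le> a" by (simp add: a_def Lp_norm_nonneg)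
    have riesz: "AE x in lborel. ennreal \<bar>u' x\<bar> \<le> ennreal c * riesz_pot s g x"
      by (rule c(2)[OF frac u' g uae gae a0 g2'])
    have nz': "\<not> (AE x in lborel. u' x = 0)"
    proof
      assume "AE x in lborel. u' x = 0"
      then have "AE x in lborel. u x = 0" using uae by eventually_elim simp
      then have "AE x in lebesgue. u x = 0" by (rule AE_completion)
      with nz show False by (simp add: nonzero_ae_def)
    qed
    \<comment> \<open>If \<open>a\<close> were 0, then g, hence its Riesz potential, hence u would
      vanish almost everywhere.\<close>
    have a: "a > 0"
    proof (rule ccontr)
      assume "\<not> a > 0"
      then have "(\<integral>\<^sup>+x. ennreal ((g x)\<^sup>2) \<partial>lborel) = 0" using a0 g2 by (simp add: a_def)
      then have "AE x in lborel. ennreal ((g x)\<^sup>2) = 0" by (subst (asm) nn_integral_0_iff_AE) auto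
      then have g0: "AE x in lborel. g x = 0" by (rule eventually_mono) (simp add: ennreal_eq_0_iff)
      have "riesz_pot s g y = 0" for y
        unfolding riesz_pot_def by (subst nn_integral_0_iff_AE) (use g0 in auto)
      with riesz have "AE x in lborel. u' x = 0" by (auto elim!: eventually_mono)
      with nz' show False by simp
    qed
    have hardy: "(\<integral>\<^sup>+y. ennreal ((norm y powr (- s) * u' y)\<^sup>2) \<partial>lborel) < \<infinity>"
    proof -
      have "(\<integral>\<^sup>+y. ennreal ((norm y powr (- s) * u' y)\<^sup>2) \<partial>lborel) \<le> (\<integral>\<^sup>+y. ennreal (c\<^sup>2) * (ennreal (norm y
          powr (- 2 * s)) * (riesz_pot s g y)\<^sup>2) \<partial>lborel)"
      proof (rule nn_integral_mono_AE)
        show "AE y in lborel. ennreal ((norm y powr (- s) * u' y)\<^sup>2) \<le> ennreal (c\<^sup>2) * (ennreal (norm y powr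
            (- 2 * s)) * (riesz_pot s g y)\<^sup>2)"
          using riesz
        proof eventually_elim
          case (elim y)
          have "(ennreal \<bar>u' y\<bar>)\<^sup>2 \<le> (ennreal c * riesz_pot s g y)\<^sup>2" using elim by (rule power_mono) simp
          then have "ennreal ((u' y)\<^sup>2) \<le> ennreal (c\<^sup>2) * (riesz_pot s g y)\<^sup>2"
            using c(1) by (simp add: ennreal_power power_mult_distrib)
          then have "ennreal (norm y powr (- 2 * s)) * ennreal ((u' y)\<^sup>2) \<le> ennreal (norm y powr (- 2 * s)) *
              (ennreal (c\<^sup>2) * (riesz_pot s g y)\<^sup>2)"
            by (rule mult_left_mono) simp
          moreover have "(norm y powr (- s) * u' y)\<^sup>2 = norm y powr (- 2 * s) * (u' y)\<^sup>2"
            unfolding power_mult_distrib powr_square by simp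
          ultimately show ?case by (simp add: ennreal_mult mult_ac)
        qed
      qed
      also have "\<dots> = ennreal (c\<^sup>2) * (\<integral>\<^sup>+y. ennreal (norm y powr (- 2 * s)) * (riesz_pot s g y)\<^sup>2 \<partial>lborel)"
        by (rule nn_integral_cmult) measurable
      also have "\<dots> \<le> ennreal (c\<^sup>2) * (ennreal H * ennreal (a\<^sup>2))"
        using H(2)[OF g] g2 by (intro mult_left_mono) (auto simp: a_def)
      also have "\<dots> < \<infinity>" by (simp add: ennreal_mult_less_top)
      finally show ?thesis .
    qed
    define d where "d = Lp_norm 2 (\<lambda>x. norm x powr (- s) * u x)"
    have d0: "0 \<le> d" by (simp add: d_def Lp_norm_nonneg)
    have mw: "(\<lambda>x::real^'n. norm x powr t) \<in> borel_measurable lebesgue" for t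
    proof -
      have "(\<lambda>x::real^'n. norm x powr t) \<in> borel_measurable lborel" by simp
      then show ?thesis by (rule measurable_completion)
    qed
    have L2: "(\<integral>\<^sup>+y. ennreal ((norm y powr (- s) * u' y)\<^sup>2) \<partial>lborel) = ennreal (d\<^sup>2)"
    proof -
      have 1: "(\<lambda>x. norm x powr (- s) * u' x) \<in> borel_measurable borel" by measurable
      have 2: "(\<lambda>x. norm x powr (- s) * u x) \<in> borel_measurable lebesgue" using mw um by measurable
      have 3: "AE x in lborel. norm x powr (- s) * u x = norm x powr (- s) * u' x" using uae by auto
      have 4: "(\<integral>\<^sup>+x. ennreal (\<bar>norm x powr (- s) * u' x\<bar> powr 2) \<partial>lborel)
          = (\<integral>\<^sup>+y. ennreal ((norm y powr (- s) * u' y)\<^sup>2) \<partial>lborel)"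
        by (simp add: powr_numeral)
      show ?thesis using Lp_norm_powr[OF 1 2 3, of 2] hardy unfolding 4 d_def
        by (simp add: powr_numeral Lp_norm_nonneg)
    qed
    have rad': "\<exists>f. AE y in lborel. u' y = f (norm y)"
    proof -
      obtain f where "AE x in lebesgue. u x = f (norm x)" using rad by (auto simp: radial_def)
      then have "AE x in lborel. u x = f (norm x)" by (simp add: AE_completion_iff)
      then have "AE x in lborel. u' x = f (norm x)" using uae by eventually_elim simp
      then show ?thesis by (rule exI[of _ f])
    qed
    define D where "D = a\<^sup>2 + lam * d\<^sup>2"
    have D: "D > 0" using a lam by (simp add: D_def add_pos_nonneg)
    let ?k = "\<lambda>y::real^'n. norm y powr ((?n / 2 - s) * q - ?n)"
    have N: "(\<integral>\<^sup>+y. ennreal (?k y * \<bar>u' y\<bar> powr q) \<partial>lborel) \<le> ennreal (K * D powr (q / 2) * lam powr (- e))"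
      using K(2)[rule_format, OF g u' a d0 lam g2' _ rad' riesz] L2 unfolding D_def e_def by simp
    define L where "L = Lp_norm q (\<lambda>x. norm x powr (- b) * u x)"
    \<comment> \<open>The relation defining \<open>b\<close> says precisely that the weight of the
      q-norm is the one in the interpolation inequality.\<close>
    have bq: "(- b) * q = (?n / 2 - s) * q - ?n"
      using b q by (simp add: field_simps)
    have LN: "(\<integral>\<^sup>+y. ennreal (?k y * \<bar>u' y\<bar> powr q) \<partial>lborel) = ennreal (L powr q)"
    proof -
      have 1: "(\<lambda>x. norm x powr (- b) * u' x) \<in> borel_measurable borel" by measurable
      have 2: "(\<lambda>x. norm x powr (- b) * u x) \<in> borel_measurable lebesgue" using mw um by measurable
      have 3: "AE x in lborel. norm x powr (- b) * u x = norm x powr (- b) * u' x" using uae by auto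
      have 4: "(\<integral>\<^sup>+x. ennreal (\<bar>norm x powr (- b) * u' x\<bar> powr q) \<partial>lborel)
          = (\<integral>\<^sup>+y. ennreal (?k y * \<bar>u' y\<bar> powr q) \<partial>lborel)"
        unfolding abs_mult powr_mult bq[symmetric] by (simp add: powr_powr)
      have "(\<integral>\<^sup>+y. ennreal (?k y * \<bar>u' y\<bar> powr q) \<partial>lborel) < \<infinity>" using N by (rule le_less_trans) simp
      then show ?thesis using Lp_norm_powr[OF 1 2 3, of q] q unfolding 4 L_def by simp
    qed
    \<comment> \<open>With \<open>L\<close> = 0 the quotient would be 0 by convention and the lower
      bound would fail.\<close>
    have L0: "L > 0"
    proof (rule ccontr)
      assume "\<not> L > 0"
      then have "L = 0" using Lp_norm_nonneg[of q "\<lambda>x. norm x powr (- b) * u x"] by (simp add: L_def)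
      then have "(\<integral>\<^sup>+y. ennreal (?k y * \<bar>u' y\<bar> powr q) \<partial>lborel) = 0" using LN by simp
      then have "AE x in lborel. u' x = 0" by (rule AE_zero_of_weighted_powr_integral_zero[OF u']) auto
      with nz' show False by simp
    qed
    have "L powr q \<le> K * D powr (q / 2) * lam powr (- e)"
      using N K(1) unfolding LN by (subst (asm) ennreal_le_iff) auto
    then have "(L powr q) powr (2 / q) \<le> (K * D powr (q / 2) * lam powr (- e)) powr (2 / q)"
      using q by (intro powr_mono2) auto
    then have "L\<^sup>2 \<le> K powr (2 / q) * D * lam powr (- (2 / q * e))"
      unfolding powr_mult powr_powr using q L0 D by (simp add: powr_numeral mult.commute)
    then have "c0 * lam powr (2 / q * e) * L\<^sup>2 \<le> c0 * lam powr (2 / q * e) * (K powr (2 / q) * D * lam powr (-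
        (2 / q * e)))"
      using c0 by (intro mult_left_mono) auto
    also have "\<dots> = (c0 * K powr (2 / q)) * (lam powr (2 / q * e) * lam powr (- (2 / q * e))) * D"
        by (simp only: mult_ac)
    also have "\<dots> = D" using K(1) lam by (simp add: c0_def flip: powr_add)
    finally have "c0 * lam powr (2 / q * e) \<le> D / L\<^sup>2" using L0 by (simp add: field_simps)
    then show ?thesis by (simp add: J_def D_def L_def a_def d_def)
  qed
  show ?thesis
    by (intro exI[of _ c0] conjI allI impI c0, unfold e_def[symmetric], rule main)
qed

section \<open>A concentrated test function\<close>

text \<open>A constant bound serves on the unit ball and decay of order n + 1, the first integer
  order integrable at infinity, outside it.\<close>

lemma schwartz_integrable:
  fixes \<phi> :: "real^'n \<Rightarrow> complex"
  assumes "schwartz \<phi>"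
  shows "\<phi> \<in> borel_measurable borel" "integrable lborel \<phi>"
proof -
  let ?N = "CARD('n)"
  have d: "\<phi> differentiable (at x)" and bd: "bounded (range (\<lambda>x. norm x ^ k *\<^sub>R \<phi> x))" for x k
    using assms[unfolded schwartz_def, rule_format, of "[]"] by simp_all
  have "continuous_on UNIV \<phi>"
    using d by (auto simp: continuous_on_eq_continuous_within intro: differentiable_imp_continuous_within)
  then show [measurable]: "\<phi> \<in> borel_measurable borel" by (rule borel_measurable_continuous_onI)
  obtain A where A: "norm (\<phi> x) \<le> A" for x using bd[of 0] by (auto simp: bounded_iff)
  obtain B where B: "norm x ^ (?N + 1) * norm (\<phi> x) \<le> B" for x using bd[of "?N + 1"]
      by (auto simp: bounded_iff)
  have A0: "0 \<le> A" using A[of 0] norm_ge_zero order_trans by blast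
  have B0: "0 \<le> B" by (rule order_trans[OF _ B[of 0]]) simp
  obtain C where C: "\<And>r. r > 0 \<Longrightarrow> (\<integral>\<^sup>+x. ennreal (norm (x::real^'n) powr (- real (?N
      + 1)) * indicator {r..} (norm x)) \<partial>lborel)
      \<le> ennreal (C * r powr (real ?N - real (?N + 1)))"
    using nn_integral_norm_powr_outside[where 'a = "real^'n", of "real (?N + 1)"] by auto
  have "(\<integral>\<^sup>+x. ennreal (norm (\<phi> x)) \<partial>lborel)
    \<le> (\<integral>\<^sup>+x. ennreal A * indicator (ball 0 1) x + ennreal B * ennreal (norm (x::real^'n) powr (- real (?N
        + 1)) * indicator {1..} (norm x)) \<partial>lborel)"
  proof (rule nn_integral_mono)
    fix x :: "real^'n"
    show "ennreal (norm (\<phi> x)) \<le> ennreal A * indicator (ball 0 1) x + ennreal B * ennreal (norm x powr (- real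
        (?N + 1)) * indicator {1..} (norm x))"
    proof (cases "norm x < 1")
      case True
      then show ?thesis using A[of x] by (simp add: ennreal_leI)
    next
      case False
      then have x: "norm x > 0" by linarith
      have "norm (\<phi> x) \<le> B * norm x powr (- real (?N + 1))"
        using B[of x] x by (simp only: powr_minus powr_realpow) (simp add: field_simps)
      then show ?thesis using False B0 by (simp add: ennreal_mult[symmetric] ennreal_leI)
    qed
  qed
  also have "\<dots> = ennreal A * emeasure lborel (ball (0::real^'n) 1) + ennreal B * (\<integral>\<^sup>+x. ennreal (norm
      (x::real^'n) powr (- real (?N + 1)) * indicator {1..} (norm x)) \<partial>lborel)"
  proof -
    have [measurable]: "ball (0::real^'n) 1 \<in> sets lborel" by simp
    have "(\<lambda>x. ennreal A * indicator (ball (0::real^'n) 1) x) \<in> borel_measurable lborel" by measurable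
    then show ?thesis
      by (subst nn_integral_add) (simp_all add: nn_integral_cmult nn_integral_cmult_indicator)
  qed
  also have "\<dots> < \<infinity>"
  proof -
    have "(\<integral>\<^sup>+x. ennreal (norm (x::real^'n) powr (- real (?N + 1)) * indicator {1..} (norm x)) \<partial>lborel) < \<infinity>"
      by (rule le_less_trans[OF C[OF zero_less_one]]) simp
    then show ?thesis using emeasure_lborel_ball_finite[of "0::real^'n" 1]
        by (simp add: ennreal_mult_less_top)
  qed
  finally show "integrable lborel \<phi>" by (intro integrableI_bounded) auto
qed

text \<open>The multiplication formula: Fubini exchanges the roles of \<open>f\<close> and the test
  function, and the boundedness of transforms of integrable functions gives the integrability
  claims.\<close>

lemma has_fourier_integrable:
  fixes f :: "real^'n \<Rightarrow> complex"
  assumes [measurable]: "f \<in> borel_measurable borel" and int: "integrable lborel f"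
  shows "has_fourier f (fourier f)"
proof -
  let ?c = "complex_of_real ((2 * pi) powr (- (real CARD('n) / 2)))"
  have cis_m [measurable]: "cis \<in> borel_measurable borel" unfolding cis_conv_exp[abs_def] by measurable
  have four: "fourier \<phi> = (\<lambda>\<xi>. ?c * (\<integral>x. cis (- (x \<bullet> \<xi>)) * \<phi> x \<partial>lborel))" if [measurable]:
      "\<phi> \<in> borel_measurable borel" for \<phi> :: "real^'n \<Rightarrow> complex"
    unfolding fourier_def by (intro ext arg_cong2[where f = "(*)"] refl integral_completion) measurable
  have meas: "fourier \<phi> \<in> borel_measurable borel" if [measurable]: "\<phi> \<in> borel_measurable borel" for \<phi> ::
      "real^'n \<Rightarrow> complex"
    unfolding four[OF that] by measurable
  note [measurable] = meas[OF assms(1)]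
  have bdd: "cmod (fourier \<phi> \<xi>) \<le> cmod ?c * (\<integral>x. cmod (\<phi> x) \<partial>lborel)" if [measurable]:
      "\<phi> \<in> borel_measurable borel" for \<phi> :: "real^'n \<Rightarrow> complex" and \<xi>
  proof -
    have "cmod (\<integral>x. cis (- (x \<bullet> \<xi>)) * \<phi> x \<partial>lborel) \<le> (\<integral>x. cmod (cis (- (x \<bullet> \<xi>)) * \<phi> x) \<partial>lborel)"
        by (rule integral_norm_bound)
    then show ?thesis unfolding four[OF that] by (simp add: norm_mult mult_left_mono)
  qed
  show ?thesis unfolding has_fourier_def
  proof (intro conjI allI impI)
    show "f \<in> borel_measurable lebesgue" "fourier f \<in> borel_measurable lebesgue"
      by (auto intro!: measurable_completion)
    fix \<phi> :: "real^'n \<Rightarrow> complex" assume "schwartz \<phi>"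
    note [measurable] = schwartz_integrable(1)[OF this] and \<phi>i = schwartz_integrable(2)[OF this]
    note [measurable] = meas[OF schwartz_integrable(1)[OF \<open>schwartz \<phi>\<close>]]
    have 1: "integrable lborel (\<lambda>x. f x * fourier \<phi> x)"
    proof (rule Bochner_Integration.integrable_bound)
      show "integrable lborel (\<lambda>x. (cmod ?c * (\<integral>x. cmod (\<phi> x) \<partial>lborel)) * cmod (f x))" using int by simp
      show "AE x in lborel. cmod (f x * fourier \<phi> x) \<le> norm ((cmod ?c * (\<integral>x. cmod (\<phi> x) \<partial>lborel)) * cmod (f
          x))"
        using mult_left_mono[OF bdd[of \<phi>] norm_ge_zero] by (intro AE_I2) (simp add: norm_mult abs_mult
            mult.commute)
    qed measurable
    have 2: "integrable lborel (\<lambda>x. fourier f x * \<phi> x)"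
    proof (rule Bochner_Integration.integrable_bound)
      show "integrable lborel (\<lambda>x. (cmod ?c * (\<integral>x. cmod (f x) \<partial>lborel)) * cmod (\<phi> x))" using \<phi>i by simp
      show "AE x in lborel. cmod (fourier f x * \<phi> x) \<le> norm ((cmod ?c * (\<integral>x. cmod (f x) \<partial>lborel)) * cmod (\<phi>
          x))"
        using mult_right_mono[OF bdd[of f] norm_ge_zero] by (intro AE_I2) (simp add: norm_mult abs_mult)
    qed measurable
    have m1: "(\<lambda>x. f x * fourier \<phi> x) \<in> borel_measurable lborel" "(\<lambda>x. fourier f x * \<phi> x) \<in> borel_measurable
        lborel" by measurable
    show "integrable lebesgue (\<lambda>x. f x * fourier \<phi> x)" "integrable lebesgue (\<lambda>x. fourier f x * \<phi> x)"
      using 1 2 m1 by (simp_all add: integrable_completion)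
    define F where "F x \<xi> = ?c * (cis (- (x \<bullet> \<xi>)) * (f x * \<phi> \<xi>))" for x \<xi>
    have [measurable]: "case_prod F \<in> borel_measurable (lborel \<Otimes>\<^sub>M lborel)" unfolding F_def by measurable
    have Fi: "integrable (lborel \<Otimes>\<^sub>M lborel) (case_prod F)"
    proof (rule lborel_pair.Fubini_integrable)
      have "(\<lambda>x. \<integral>\<xi>. norm (case_prod F (x, \<xi>)) \<partial>lborel) = (\<lambda>x. cmod (f x) * (cmod ?c * (\<integral>\<xi>. cmod (\<phi> \<xi>)
          \<partial>lborel)))"
        by (simp add: F_def norm_mult mult_ac)
      then show "integrable lborel (\<lambda>x. \<integral>\<xi>. norm (case_prod F (x, \<xi>)) \<partial>lborel)" using int by simp
      show "AE x in lborel. integrable lborel (\<lambda>\<xi>. case_prod F (x, \<xi>))"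
      proof (intro AE_I2)
        fix x
        show "integrable lborel (\<lambda>\<xi>. case_prod F (x, \<xi>))"
          by (rule Bochner_Integration.integrable_bound[OF integrable_mult_right[OF integrable_norm[OF \<phi>i], of
              "cmod ?c * cmod (f x)"]])
            (auto simp: F_def norm_mult abs_mult)
      qed
    qed measurable
    have "(\<integral>x. f x * fourier \<phi> x \<partial>lborel) = (\<integral>x. (\<integral>\<xi>. F x \<xi> \<partial>lborel) \<partial>lborel)"
    proof (rule Bochner_Integration.integral_cong)
      fix x
      have "f x * fourier \<phi> x = (?c * f x) * (\<integral>\<xi>. cis (- (\<xi> \<bullet> x)) * \<phi> \<xi> \<partial>lborel)"
        by (subst four) simp_all
      also have "\<dots> = (\<integral>\<xi>. (?c * f x) * (cis (- (\<xi> \<bullet> x)) * \<phi> \<xi>) \<partial>lborel)"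
          by (simp only: integral_mult_right_zero)
      also have "\<dots> = (\<integral>\<xi>. F x \<xi> \<partial>lborel)"
        by (intro Bochner_Integration.integral_cong) (simp_all add: F_def inner_commute mult_ac)
      finally show "f x * fourier \<phi> x = (\<integral>\<xi>. F x \<xi> \<partial>lborel)" .
    qed simp
    also have "\<dots> = (\<integral>\<xi>. (\<integral>x. F x \<xi> \<partial>lborel) \<partial>lborel)" by (rule lborel_pair.Fubini_integral[OF Fi, symmetric])
    also have "\<dots> = (\<integral>\<xi>. fourier f \<xi> * \<phi> \<xi> \<partial>lborel)"
    proof (rule Bochner_Integration.integral_cong)
      fix \<xi>
      have "fourier f \<xi> * \<phi> \<xi> = (?c * \<phi> \<xi>) * (\<integral>x. cis (- (x \<bullet> \<xi>)) * f x \<partial>lborel)"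
        by (subst four) simp_all
      also have "\<dots> = (\<integral>x. (?c * \<phi> \<xi>) * (cis (- (x \<bullet> \<xi>)) * f x) \<partial>lborel)"
          by (simp only: integral_mult_right_zero)
      also have "\<dots> = (\<integral>x. F x \<xi> \<partial>lborel)"
        by (intro Bochner_Integration.integral_cong) (simp_all add: F_def mult_ac)
      finally show "(\<integral>x. F x \<xi> \<partial>lborel) = fourier f \<xi> * \<phi> \<xi>" by simp
    qed simp
    finally show "(\<integral>x. f x * fourier \<phi> x \<partial>lebesgue) = (\<integral>\<xi>. fourier f \<xi> * \<phi> \<xi> \<partial>lebesgue)"
      using m1 by (simp add: integral_completion)
  qed
qed

section \<open>Levy representation of the fractional Laplacian of a Gaussian\<close>

definition levy :: "real \<Rightarrow> real \<Rightarrow> real" where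
  "levy s \<tau> = indicator {0..} \<tau> * \<tau> powr (- 1 - s / 2)"

lemma measurable_levy [measurable]: "levy s \<in> borel_measurable borel"
  unfolding levy_def by measurable

lemma levy_nonneg [simp]: "0 \<le> levy s \<tau>"
  by (simp add: levy_def)

text \<open>Linear vanishing at 0 compensates the singularity because s < 2, and boundedness
  suffices at infinity because s > 0. As with \<open>subord\<close>, the splitting time is left
  free.\<close>

lemma nn_integral_levy_le:
  assumes "0 < s" "s < 2"
  shows "\<exists>C>0. \<forall>r>0. \<forall>f::real \<Rightarrow> ennreal. \<forall>A\<ge>0. \<forall>B\<ge>0. (\<forall>\<tau>>0. f \<tau> \<le> ennreal (A * \<tau>)) \<longrightarrow> (\<forall>\<tau>>0. f \<tau> \<le> ennreal B) \<longrightarrow>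
    (\<integral>\<^sup>+\<tau>. ennreal (levy s \<tau>) * f \<tau> \<partial>lborel) \<le> ennreal (C * (A * r powr (1 - s / 2)
        + B * r powr (- (s / 2))))"
proof -
  obtain C1 where C1: "C1 > 0" "\<And>r. r > 0 \<Longrightarrow>
      (\<integral>\<^sup>+x. ennreal (norm (x::real) powr (- (s / 2)) * indicator {..<r} (norm x)) \<partial>lborel)
          \<le> ennreal (C1 * r powr (1 - s / 2))"
    using nn_integral_norm_powr_ball[where 'a = real, of "s / 2"] assms by auto
  obtain C2 where C2: "C2 > 0" "\<And>r. r > 0 \<Longrightarrow>
      (\<integral>\<^sup>+x. ennreal (norm (x::real) powr (- (1 + s / 2)) * indicator {r..} (norm x)) \<partial>lborel)
          \<le> ennreal (C2 * r powr (- (s / 2)))"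
    using nn_integral_norm_powr_outside[where 'a = real, of "1 + s / 2"] assms by auto
  show ?thesis
  proof (intro exI conjI allI impI)
    fix r A B :: real and f :: "real \<Rightarrow> ennreal"
    assume r: "r > 0" and AB: "A \<ge> 0" "B \<ge> 0" and f: "\<forall>\<tau>>0. f \<tau> \<le> ennreal (A * \<tau>)" "\<forall>\<tau>>0. f \<tau> \<le> ennreal B"
    have "(\<integral>\<^sup>+\<tau>. ennreal (levy s \<tau>) * f \<tau> \<partial>lborel)
      \<le> (\<integral>\<^sup>+\<tau>. ennreal A * ennreal (norm (\<tau>::real) powr (- (s / 2)) * indicator {..<r} (norm \<tau>))
         + ennreal B * ennreal (norm \<tau> powr (- (1 + s / 2)) * indicator {r..} (norm \<tau>)) \<partial>lborel)"
    proof (rule nn_integral_mono)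
      fix \<tau> :: real
      show "ennreal (levy s \<tau>) * f \<tau> \<le> ennreal A * ennreal (norm \<tau> powr (- (s / 2)) * indicator {..<r} (norm
          \<tau>))
         + ennreal B * ennreal (norm \<tau> powr (- (1 + s / 2)) * indicator {r..} (norm \<tau>))"
      proof (cases "\<tau> > 0")
        case True
        show ?thesis
        proof (cases "\<tau> < r")
          case less: True
          have "ennreal (levy s \<tau>) * f \<tau> \<le> ennreal (levy s \<tau>) * ennreal (A * \<tau>)" using f(1) True
              by (intro mult_left_mono) auto
          also have "\<dots> = ennreal (A * (\<tau> powr (- 1 - s / 2) * \<tau> powr 1))"
            using True AB by (simp add: levy_def ennreal_mult[symmetric] mult_ac)
          also have "\<tau> powr (- 1 - s / 2) * \<tau> powr 1 = \<tau> powr (- (s / 2))" unfolding powr_add[symmetric]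
              by simp
          finally show ?thesis using True less AB by (simp add: ennreal_mult[symmetric])
        next
          case False
          have "ennreal (levy s \<tau>) * f \<tau> \<le> ennreal (levy s \<tau>) * ennreal B" using f(2) True
              by (intro mult_left_mono) auto
          also have "\<dots> = ennreal (B * \<tau> powr (- (1 + s / 2)))"
            using True AB by (simp add: levy_def ennreal_mult[symmetric] mult_ac)
          finally show ?thesis using True False AB by (simp add: ennreal_mult[symmetric])
        qed
      next
        case False
        then have "levy s \<tau> = 0" by (auto simp: levy_def indicator_def)
        then show ?thesis by simp
      qed
    qed
    also have "\<dots> = ennreal A * (\<integral>\<^sup>+\<tau>. ennreal (norm \<tau> powr (- (s / 2)) * indicator {..<r} (norm (\<tau>::real)))
        \<partial>lborel)
      + ennreal B * (\<integral>\<^sup>+\<tau>. ennreal (norm \<tau> powr (- (1 + s / 2)) * indicator {r..} (norm (\<tau>::real))) \<partial>lborel)"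
      by (simp add: nn_integral_add nn_integral_cmult del: real_norm_def)
    also have "\<dots> \<le> ennreal A * ennreal (C1 * r powr (1 - s / 2)) + ennreal B * ennreal (C2 * r powr (- (s /
        2)))"
      using C1(2)[OF r] C2(2)[OF r] by (intro add_mono mult_left_mono) auto
    also have "\<dots> = ennreal (A * (C1 * r powr (1 - s / 2)) + B * (C2 * r powr (- (s / 2))))"
      using AB C1(1) C2(1) by (simp add: ennreal_mult ennreal_plus)
    also have "\<dots> \<le> ennreal (max C1 C2 * (A * r powr (1 - s / 2) + B * r powr (- (s / 2))))"
    proof (rule ennreal_leI)
      have "A * (C1 * r powr (1 - s / 2)) \<le> A * (max C1 C2 * r powr (1 - s / 2))"
        "B * (C2 * r powr (- (s / 2))) \<le> B * (max C1 C2 * r powr (- (s / 2)))"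
        using AB by (intro mult_left_mono mult_right_mono; simp)+
      then show "A * (C1 * r powr (1 - s / 2)) + B * (C2 * r powr (- (s / 2)))
          \<le> max C1 C2 * (A * r powr (1 - s / 2) + B * r powr (- (s / 2)))"
        by (simp add: distrib_left mult.left_commute)
    qed
    finally show "(\<integral>\<^sup>+\<tau>. ennreal (levy s \<tau>) * f \<tau> \<partial>lborel) \<le> ennreal (max C1 C2 * (A * r powr (1 - s / 2)
        + B * r powr (- (s / 2))))" .
  qed (use C1(1) in auto)
qed

text \<open>The normalisation in the formula that writes |\<xi>|^s as the integral of 1 -
  exp(-\<tau>|\<xi>|^2) against \<open>levy s\<close>. It equals \<Gamma>(1 - s/2)/(s/2), but only
  its positivity is used.\<close>

definition levy_const :: "real \<Rightarrow> real" where
  "levy_const s = (\<integral>\<tau>. levy s \<tau> * (1 - exp (- \<tau>)) \<partial>lborel)"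

lemma integrable_levy_exp:
  assumes "0 < s" "s < 2" "0 \<le> A"
  shows "integrable lborel (\<lambda>\<tau>. levy s \<tau> * (1 - exp (- A * \<tau>)))"
proof -
  obtain C where C: "C > 0" "\<forall>r>0. \<forall>f::real \<Rightarrow> ennreal. \<forall>A\<ge>0. \<forall>B\<ge>0. (\<forall>\<tau>>0. f \<tau> \<le> ennreal (A * \<tau>)) \<longrightarrow> (\<forall>\<tau>>0. f \<tau>
      \<le> ennreal B) \<longrightarrow>
    (\<integral>\<^sup>+\<tau>. ennreal (levy s \<tau>) * f \<tau> \<partial>lborel) \<le> ennreal (C * (A * r powr (1 - s / 2)
        + B * r powr (- (s / 2))))"
    using nn_integral_levy_le[OF assms(1,2)] by (elim exE conjE) (rule that, assumption+)
  have le: "1 - exp (- A * \<tau>) \<le> A * \<tau>" for \<tau> using exp_ge_add_one_self[of "- A * \<tau>"] by simp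
  have "(\<integral>\<^sup>+\<tau>. ennreal (norm (levy s \<tau> * (1 - exp (- A * \<tau>)))) \<partial>lborel) = (\<integral>\<^sup>+\<tau>. ennreal (levy s \<tau>) * ennreal
      (1 - exp (- A * \<tau>)) \<partial>lborel)"
  proof (rule nn_integral_cong)
    fix \<tau>
    have "0 \<le> 1 - exp (- A * \<tau>)" if "\<tau> \<ge> 0" using that assms by simp
    then show "ennreal (norm (levy s \<tau> * (1 - exp (- A * \<tau>)))) = ennreal (levy s \<tau>) * ennreal (1 - exp (- A *
        \<tau>))"
      by (cases "\<tau> \<ge> 0") (simp_all add: ennreal_mult[symmetric] abs_mult levy_def)
  qed
  also have "\<dots> \<le> ennreal (C * (A * 1 powr (1 - s / 2) + 1 * 1 powr (- (s / 2))))"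
    using assms le by (intro C(2)[rule_format]) (auto intro: ennreal_leI)
  also have "\<dots> < \<infinity>" by simp
  finally show ?thesis by (intro integrableI_bounded) auto
qed

text \<open>Substituting A\<tau> for \<tau> extracts the power of A from the homogeneity of
  \<open>levy\<close>, leaving the constant unevaluated. The case of interest is A =
  |\<xi>|^2.\<close>

lemma integral_levy_exp:
  assumes "0 < s" "0 \<le> A"
  shows "(\<integral>\<tau>. levy s \<tau> * (1 - exp (- A * \<tau>)) \<partial>lborel) = A powr (s / 2) * levy_const s"
proof (cases "A = 0")
  case False
  then have A: "A > 0" using assms by simp
  have e: "levy s (0 + A * \<tau>) = A powr (- 1 - s / 2) * levy s \<tau>" for \<tau>
    using A by (auto simp: levy_def indicator_def zero_le_mult_iff powr_mult)
  have "levy_const s = \<bar>A\<bar> *\<^sub>R (\<integral>\<tau>. levy s (0 + A * \<tau>) * (1 - exp (- (0 + A * \<tau>))) \<partial>lborel)"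
    unfolding levy_const_def using A by (intro lborel_integral_real_affine) simp
  then have "levy_const s = A * (A powr (- 1 - s / 2) * (\<integral>\<tau>. levy s \<tau> * (1 - exp (- A * \<tau>)) \<partial>lborel))"
    using A unfolding e by (simp add: mult.assoc)
  then have "A powr (s / 2) * levy_const s = (A powr (s / 2) * (A powr 1 * A powr (- 1 - s / 2))) * (\<integral>\<tau>. levy
      s \<tau> * (1 - exp (- A * \<tau>)) \<partial>lborel)"
    using A by (simp add: mult.assoc)
  also have "A powr (s / 2) * (A powr 1 * A powr (- 1 - s / 2)) = 1"
    unfolding powr_add[symmetric] using A by simp
  finally show ?thesis by simp
qed simp

lemma levy_const_pos:
  assumes "0 < s" "s < 2"
  shows "levy_const s > 0"
proof -
  have int: "integrable lborel (\<lambda>\<tau>. levy s \<tau> * (1 - exp (- \<tau>)))" using integrable_levy_exp[OF assms, of 1]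
      by simp
  have nn: "0 \<le> levy s \<tau> * (1 - exp (- \<tau>))" for \<tau> by (cases "\<tau> \<ge> 0") (auto simp: levy_def)
  have "levy_const s \<noteq> 0"
  proof
    assume "levy_const s = 0"
    then have "AE \<tau> in lborel. levy s \<tau> * (1 - exp (- \<tau>)) = 0"
      unfolding levy_const_def using integral_nonneg_eq_0_iff_AE[OF int] nn by auto
    then have "AE \<tau> in lborel. \<tau> \<notin> {0<..<1::real}"
      by (rule eventually_mono) (auto simp: levy_def)
    then have "{0<..<1::real} \<in> null_sets lborel" by (subst AE_iff_null_sets) auto
    then show False by (simp add: null_sets_def)
  qed
  moreover have "levy_const s \<ge> 0" unfolding levy_const_def using nn
      by (rule Bochner_Integration.integral_nonneg)
  ultimately show ?thesis by simp
qed

lemma heat_has_derivative: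
  assumes "\<sigma> > 0"
  shows "((\<lambda>\<sigma>. heat \<sigma> (x::'a::euclidean_space)) has_real_derivative
    heat \<sigma> x * (- (real DIM('a) / 2) / \<sigma> + (norm x)\<^sup>2 / (4 * \<sigma>\<^sup>2))) (at \<sigma>)"
proof -
  let ?p = "- real DIM('a) / 2"
  have "((\<lambda>\<sigma>. (4 * pi) powr ?p * (\<sigma> powr ?p * exp (- (norm x)\<^sup>2 / (4 * \<sigma>)))) has_real_derivative
    (4 * pi) powr ?p * (\<sigma> powr ?p * exp (- (norm x)\<^sup>2 / (4 * \<sigma>)) * (?p / \<sigma> + (norm x)\<^sup>2 / (4 * \<sigma>\<^sup>2)))) (at \<sigma>)"
  proof -
    have d1: "((\<lambda>\<sigma>. \<sigma> powr ?p) has_real_derivative \<sigma> powr ?p * (?p / \<sigma>)) (at \<sigma>)"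
      using has_real_derivative_powr[OF assms, of ?p] assms by (simp add: powr_diff mult.commute)
    have d2: "((\<lambda>\<sigma>. exp (- (norm x)\<^sup>2 / (4 * \<sigma>))) has_real_derivative exp (- (norm x)\<^sup>2 / (4 * \<sigma>)) * ((norm
        x)\<^sup>2 / (4 * \<sigma>\<^sup>2))) (at \<sigma>)"
      using assms by (auto intro!: derivative_eq_intros simp: field_simps power2_eq_square)
    show ?thesis using DERIV_cmult[OF DERIV_mult[OF d1 d2], of "(4 * pi) powr ?p"]
        by (simp add: algebra_simps)
  qed
  then show ?thesis unfolding heat_def powr_mult by (simp add: mult.assoc)
qed

text \<open>Mean value theorem in time. The time derivative is the kernel times 1/z times an affine
  function of w = |x|^2/(8z). Half of the Gaussian exponent absorbs the factor w, and z <= 2a turns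
  the other half into the Gaussian of time 4a.\<close>

lemma heat_diff_le:
  assumes a: "0 < a" and \<tau>: "0 < \<tau>" "\<tau> \<le> a"
  shows "\<bar>heat a x - heat (a + \<tau>) (x::'a::euclidean_space)\<bar> \<le> (real DIM('a) / 2
      + 2) * 4 powr (real DIM('a) / 2) * (\<tau> / a) * heat (4 * a) x"
proof -
  let ?n = "real DIM('a)"
  have "\<exists>z. a < z \<and> z < a + \<tau> \<and> heat (a + \<tau>) x - heat a x = (a + \<tau> - a) * (heat z x * (- (?n / 2) / z
      + (norm x)\<^sup>2 / (4 * z\<^sup>2)))"
    using a \<tau> by (intro MVT2 heat_has_derivative) auto
  then obtain z where z: "a < z" "z < a + \<tau>" "heat (a + \<tau>) x - heat a x = \<tau> * (heat z x * (- (?n / 2) / z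
      + (norm x)\<^sup>2 / (4 * z\<^sup>2)))"
    by auto
  have z2: "z \<le> 2 * a" "0 < z" using z a \<tau> by auto
  define w where "w = (norm x)\<^sup>2 / (8 * z)"
  have w: "0 \<le> w" using z2 by (simp add: w_def)
  have "\<bar>- (?n / 2) / z + (norm x)\<^sup>2 / (4 * z\<^sup>2)\<bar> \<le> \<bar>- (?n / 2) / z\<bar> + \<bar>(norm x)\<^sup>2 / (4 * z\<^sup>2)\<bar>"
      by (rule abs_triangle_ineq)
  also have "\<dots> = (?n / 2 + 2 * w) / z" using z2 by (simp add: w_def power2_eq_square field_simps)
  finally have "\<bar>heat z x * (- (?n / 2) / z + (norm x)\<^sup>2 / (4 * z\<^sup>2))\<bar> \<le> heat z x * ((?n / 2 + 2 * w) / z)"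
    unfolding abs_mult abs_of_nonneg[OF heat_nonneg] by (rule mult_left_mono) simp
  also have "heat z x * ((?n / 2 + 2 * w) / z) = (4 * pi * z) powr (- ?n / 2) * (exp (- w) * exp (- w)) * ((?n
      / 2 + 2 * w) / z)"
    unfolding exp_add[symmetric] heat_def w_def by (simp add: field_simps)
  also have "\<dots> = (4 * pi * z) powr (- ?n / 2) * ((?n / 2 * exp (- w) + 2 * (w * exp (- w))) * exp (- w)) * (1
      / z)"
    by (simp add: field_simps)
  also have "\<dots> \<le> (4 * pi * a) powr (- ?n / 2) * ((?n / 2 * 1 + 2 * 1) * exp (- (norm x)\<^sup>2 / (16 * a))) * (1 /
      a)"
  proof -
    have "w \<le> exp w" using exp_ge_add_one_self[of w] by linarith
    then have we: "w * exp (- w) \<le> 1" by (simp add: exp_minus field_simps)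
    have "(norm x)\<^sup>2 / (16 * a) \<le> w" unfolding w_def using z2 a by (intro divide_left_mono) auto
    then have "exp (- w) \<le> exp (- (norm x)\<^sup>2 / (16 * a))" by simp
    moreover have "(4 * pi * z) powr (- ?n / 2) \<le> (4 * pi * a) powr (- ?n / 2)" using z a
        by (intro powr_mono2') auto
    moreover have "1 / z \<le> 1 / a" using z a by (simp add: field_simps)
    ultimately show ?thesis using we w z2 by (intro mult_mono add_mono) auto
  qed
  also have "\<dots> = (?n / 2 + 2) * 4 powr (?n / 2) * (1 / a) * heat (4 * a) x"
  proof -
    have "(4 * pi * (4 * a)) powr (- ?n / 2) = 4 powr (- ?n / 2) * (4 * pi * a) powr (- ?n / 2)"
      by (subst powr_mult[symmetric]) (simp add: mult_ac)
    then have "4 powr (?n / 2) * (4 * pi * (4 * a)) powr (- ?n / 2) = (4 powr (?n / 2) * 4 powr (- ?n / 2)) *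
        (4 * pi * a) powr (- ?n / 2)"
      by (simp only: mult.assoc)
    also have "4 powr (?n / 2) * 4 powr (- ?n / 2) = (1::real)" unfolding powr_add[symmetric] by simp
    finally have e: "(4 * pi * a) powr (- ?n / 2) = 4 powr (?n / 2) * (4 * pi * (4 * a)) powr (- ?n / 2)"
        by simp
    show ?thesis unfolding e heat_def by (simp add: mult_ac)
  qed
  finally have D: "\<bar>heat z x * (- (?n / 2) / z + (norm x)\<^sup>2 / (4 * z\<^sup>2))\<bar> \<le> (?n / 2
      + 2) * 4 powr (?n / 2) * (1 / a) * heat (4 * a) x" .
  have "\<bar>heat a x - heat (a + \<tau>) x\<bar> = \<tau> * \<bar>heat z x * (- (?n / 2) / z + (norm x)\<^sup>2 / (4 * z\<^sup>2))\<bar>"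
    using z(3) \<tau> by (subst abs_minus_commute) (simp add: abs_mult)
  also have "\<dots> \<le> \<tau> * ((?n / 2 + 2) * 4 powr (?n / 2) * (1 / a) * heat (4 * a) x)"
    using D \<tau> by (intro mult_left_mono) auto
  finally show ?thesis by (simp add: mult_ac)
qed

text \<open>Sup and L^1 estimates, each in a bounded and in a linear version, as
  \<open>nn_integral_levy_le\<close> requires. The mean value estimate covers \<tau> <= a; for
  larger \<tau> the trivial bound is below the linear one because \<tau>/a exceeds 1.\<close>

lemma heat_diff_bounds:
  "\<exists>C>0. \<forall>a>0. \<forall>\<tau>>0. \<forall>x0::'a::euclidean_space.
    (\<forall>x. \<bar>heat a (x - x0) - heat (a + \<tau>) (x - x0)\<bar> \<le> C * a powr (- real DIM('a) / 2)) \<and>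
    (\<forall>x. \<bar>heat a (x - x0) - heat (a + \<tau>) (x - x0)\<bar> \<le> C * a powr (- real DIM('a) / 2) / a * \<tau>) \<and>
    (\<integral>\<^sup>+x. ennreal \<bar>heat a (x - x0) - heat (a + \<tau>) (x - x0)\<bar> \<partial>lborel) \<le> ennreal C \<and>
    (\<integral>\<^sup>+x. ennreal \<bar>heat a (x - x0) - heat (a + \<tau>) (x - x0)\<bar> \<partial>lborel) \<le> ennreal (C / a * \<tau>)"
proof -
  let ?n = "real DIM('a)"
  define K where "K = (?n / 2 + 2) * 4 powr (?n / 2)"
  define C where "C = K + 2"
  have K: "K > 0" by (simp add: K_def add_nonneg_pos)
  have p1: "(4 * pi) powr (- ?n / 2) \<le> 1"
  proof -
    have "(4 * pi) powr (- ?n / 2) \<le> (4 * pi) powr 0" using pi_gt3 by (intro powr_mono) auto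
    then show ?thesis by simp
  qed
  have sup: "heat t x \<le> t powr (- ?n / 2)" if "t > 0" for t and x :: 'a
  proof -
    have "(4 * pi) powr (- ?n / 2) * t powr (- ?n / 2) \<le> 1 * t powr (- ?n / 2)" using p1
        by (rule mult_right_mono) simp
    then show ?thesis using heat_le_time[OF that, of x] by linarith
  qed
  have "(\<forall>x. \<bar>heat a (x - x0) - heat (a + \<tau>) (x - x0)\<bar> \<le> C * a powr (- ?n / 2)) \<and>
    (\<forall>x. \<bar>heat a (x - x0) - heat (a + \<tau>) (x - x0)\<bar> \<le> C * a powr (- ?n / 2) / a * \<tau>) \<and>
    (\<integral>\<^sup>+x. ennreal \<bar>heat a (x - x0) - heat (a + \<tau>) (x - x0)\<bar> \<partial>lborel) \<le> ennreal C \<and>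
    (\<integral>\<^sup>+x. ennreal \<bar>heat a (x - x0) - heat (a + \<tau>) (x - x0)\<bar> \<partial>lborel) \<le> ennreal (C / a * \<tau>)"
    if a: "a > 0" and \<tau>: "\<tau> > 0" for a \<tau> :: real and x0 :: 'a
  proof -
    define M where "M = a powr (- ?n / 2)"
    have M: "M \<ge> 0" by (simp add: M_def)
    have M2: "\<bar>heat a x - heat (a + \<tau>) x\<bar> \<le> 2 * M" for x :: 'a
    proof -
      have "(a + \<tau>) powr (- ?n / 2) \<le> M" unfolding M_def using a \<tau> by (intro powr_mono2') auto
      then have "heat (a + \<tau>) x \<le> M" "heat a x \<le> M" using sup[of a x] sup[of "a + \<tau>" x] a \<tau>
          by (auto simp: M_def)
      then show ?thesis using heat_nonneg[of a x] heat_nonneg[of "a + \<tau>" x] by linarith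
    qed
    have I2: "(\<integral>\<^sup>+x. ennreal \<bar>heat a (x - x0) - heat (a + \<tau>) (x - x0)\<bar> \<partial>lborel) \<le> 2"
    proof -
      have "(\<integral>\<^sup>+x. ennreal \<bar>heat a (x - x0) - heat (a + \<tau>) (x - x0)\<bar> \<partial>lborel)
          \<le> (\<integral>\<^sup>+x. ennreal (heat a (x - x0)) + ennreal (heat (a + \<tau>) (x - x0)) \<partial>lborel)"
      proof (intro nn_integral_mono)
        fix x
        have "\<bar>heat a (x - x0) - heat (a + \<tau>) (x - x0)\<bar> \<le> heat a (x - x0) + heat (a + \<tau>) (x - x0)"
          using heat_nonneg[of a "x - x0"] heat_nonneg[of "a + \<tau>" "x - x0"] by linarith
        then show "ennreal \<bar>heat a (x - x0) - heat (a + \<tau>) (x - x0)\<bar> \<le> ennreal (heat a (x - x0))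
            + ennreal (heat (a + \<tau>) (x - x0))"
          by (simp add: ennreal_leI flip: ennreal_plus)
      qed
      also have "\<dots> = 2" using a \<tau> by (simp add: nn_integral_add nn_integral_heat)
      finally show ?thesis .
    qed
    have small: "\<bar>heat a x - heat (a + \<tau>) x\<bar> \<le> K * (\<tau> / a) * heat (4 * a) x" if "\<tau> \<le> a" for x :: 'a
      unfolding K_def using heat_diff_le[OF a \<tau> that] .
    have 1: "\<bar>heat a x - heat (a + \<tau>) x\<bar> \<le> C * M" for x :: 'a
      using M2[of x] mult_right_mono[of 2 C M] K M by (simp add: C_def)
    have 2: "\<bar>heat a x - heat (a + \<tau>) x\<bar> \<le> C * M / a * \<tau>" for x :: 'a
    proof (cases "\<tau> \<le> a")
      case True
      have "heat (4 * a) x \<le> M" 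
      proof -
        have "(4 * a) powr (- ?n / 2) \<le> M" unfolding M_def using a by (intro powr_mono2') auto
        then show ?thesis using sup[of "4 * a" x] a by simp
      qed
      then have "K * (\<tau> / a) * heat (4 * a) x \<le> C * (\<tau> / a) * M"
        using K a \<tau> M by (intro mult_mono) (auto simp: C_def)
      then show ?thesis using small[OF True, of x] by (simp add: field_simps)
    next
      case False
      then have "2 * M * 1 \<le> C * M * (\<tau> / a)" using K M a by (intro mult_mono) (auto simp: C_def field_simps)
      then show ?thesis using M2[of x] by simp
    qed
    have 3: "(\<integral>\<^sup>+x. ennreal \<bar>heat a (x - x0) - heat (a + \<tau>) (x - x0)\<bar> \<partial>lborel) \<le> ennreal C"
    proof -
      have "(2::ennreal) = ennreal 2" by simp
      also have "\<dots> \<le> ennreal C" using K by (intro ennreal_leI) (simp add: C_def)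
      finally show ?thesis using I2 by (rule order_trans[rotated])
    qed
    have 4: "(\<integral>\<^sup>+x. ennreal \<bar>heat a (x - x0) - heat (a + \<tau>) (x - x0)\<bar> \<partial>lborel) \<le> ennreal (C / a * \<tau>)"
    proof (cases "\<tau> \<le> a")
      case True
      have "(\<integral>\<^sup>+x. ennreal \<bar>heat a (x - x0) - heat (a + \<tau>) (x - x0)\<bar> \<partial>lborel)
          \<le> (\<integral>\<^sup>+x. ennreal (K * (\<tau> / a)) * ennreal (heat (4 * a) (x - x0)) \<partial>lborel)"
        using small[OF True] K a \<tau> by (intro nn_integral_mono) (simp add: ennreal_mult[symmetric] ennreal_leI)
      also have "\<dots> = ennreal (K * (\<tau> / a))" using a by (simp add: nn_integral_cmult nn_integral_heat)
      also have "\<dots> \<le> ennreal (C / a * \<tau>)" using a \<tau> by (intro ennreal_leI) (simp add: C_def field_simps)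
      finally show ?thesis .
    next
      case False
      have "(2::ennreal) = ennreal 2" by simp
      also have "\<dots> \<le> ennreal (C / a * \<tau>)"
      proof (rule ennreal_leI)
        have "2 * 1 \<le> C * (\<tau> / a)" using K False a by (intro mult_mono) (auto simp: C_def field_simps)
        then show "2 \<le> C / a * \<tau>" by simp
      qed
      finally show ?thesis using I2 by (rule order_trans[rotated])
    qed
    show ?thesis using 1 2 3 4 by (auto simp: M_def)
  qed
  moreover have "C > 0" using K by (simp add: C_def)
  ultimately show ?thesis by (intro exI[of _ C]) blast
qed

text \<open>The Levy formula for (-\<Delta>)^(s/2) of a Gaussian bump, using that the heat semigroup
  takes \<open>heat a\<close> to \<open>heat (a + \<tau>)\<close>. A pointwise formula in physical
  space allows the L^2 norm to be estimated directly.\<close>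

definition bump_laplacian :: "real \<Rightarrow> real \<Rightarrow> 'a::euclidean_space \<Rightarrow> 'a \<Rightarrow> real" where
  "bump_laplacian s a x0 x = (\<integral>\<tau>. levy s \<tau> * (heat a (x - x0) - heat (a + \<tau>) (x - x0)) \<partial>lborel) / levy_const
      s"

lemma measurable_bump_laplacian [measurable]: "bump_laplacian s a x0 \<in> borel_measurable borel"
  unfolding bump_laplacian_def[abs_def] by measurable

text \<open>The time integral is split at r = a, the only scale present. The L^2 bound is the
  product of the sup and the L^1 bound, and the finiteness of the double integral serves for Fubini
  in the Fourier computation.\<close>

lemma bump_laplacian_bounds:
  assumes s: "0 < s" "s < 2"
  shows "\<exists>C>0. \<forall>a>0. \<forall>x0::'a::euclidean_space.
    (\<integral>\<^sup>+x. (\<integral>\<^sup>+\<tau>. ennreal (levy s \<tau>) * ennreal \<bar>heat a (x - x0) - heat (a + \<tau>) (x - x0)\<bar> \<partial>lborel) \<partial>lborel) < \<infinity>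
        \<and>
    (\<forall>x. (\<integral>\<^sup>+\<tau>. ennreal (levy s \<tau>) * ennreal \<bar>heat a (x - x0) - heat (a + \<tau>) (x - x0)\<bar> \<partial>lborel) < \<infinity>) \<and>
    (\<integral>\<^sup>+x. ennreal \<bar>bump_laplacian s a x0 x\<bar> \<partial>lborel) \<le> ennreal (C * a powr (- (s / 2))) \<and>
    (\<integral>\<^sup>+x. ennreal ((bump_laplacian s a x0 x)\<^sup>2) \<partial>lborel) \<le> ennreal (C * a powr (- s - real DIM('a) / 2))"
proof -
  let ?n = "real DIM('a)"
  obtain C1 where C1: "C1 > 0" "\<forall>r>0. \<forall>f::real \<Rightarrow> ennreal. \<forall>A\<ge>0. \<forall>B\<ge>0. (\<forall>\<tau>>0. f \<tau> \<le> ennreal (A * \<tau>)) \<longrightarrow>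
      (\<forall>\<tau>>0. f \<tau> \<le> ennreal B) \<longrightarrow>
    (\<integral>\<^sup>+\<tau>. ennreal (levy s \<tau>) * f \<tau> \<partial>lborel) \<le> ennreal (C1 * (A * r powr (1 - s / 2)
        + B * r powr (- (s / 2))))"
    using nn_integral_levy_le[OF assms] by (elim exE conjE) (rule that, assumption+)
  obtain C2 where C2: "C2 > 0" "\<forall>a>0. \<forall>\<tau>>0. \<forall>x0::'a.
    (\<forall>x. \<bar>heat a (x - x0) - heat (a + \<tau>) (x - x0)\<bar> \<le> C2 * a powr (- ?n / 2)) \<and>
    (\<forall>x. \<bar>heat a (x - x0) - heat (a + \<tau>) (x - x0)\<bar> \<le> C2 * a powr (- ?n / 2) / a * \<tau>) \<and>
    (\<integral>\<^sup>+x. ennreal \<bar>heat a (x - x0) - heat (a + \<tau>) (x - x0)\<bar> \<partial>lborel) \<le> ennreal C2 \<and>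
    (\<integral>\<^sup>+x. ennreal \<bar>heat a (x - x0) - heat (a + \<tau>) (x - x0)\<bar> \<partial>lborel) \<le> ennreal (C2 / a * \<tau>)"
    using heat_diff_bounds[where 'a = 'a] by (elim exE conjE) (rule that, assumption+)
  let ?c = "levy_const s"
  have c: "?c > 0" by (rule levy_const_pos[OF s])
  \<comment> \<open>The 2 appears because both pieces of the bound coincide once the splitting time
    is a.\<close>
  define K where "K = 2 * C1 * C2 / ?c"
  have K: "K > 0" using C1(1) C2(1) c by (simp add: K_def)
  define T where "T a x0 \<tau> x = \<bar>heat a (x - x0) - heat (a + \<tau>) (x - x0)\<bar>" for a \<tau> :: real and x0 x :: 'a
  note C2' = C2(2)[folded T_def]
  have [measurable]: "(\<lambda>p. T a x0 (fst p) (snd p)) \<in> borel_measurable (borel \<Otimes>\<^sub>M borel)"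
      "(\<lambda>p. T a x0 (snd p) (fst p)) \<in> borel_measurable (borel \<Otimes>\<^sub>M borel)"
    "(\<lambda>\<tau>. T a x0 \<tau> x) \<in> borel_measurable borel" "T a x0 \<tau> \<in> borel_measurable borel" for a x0 x \<tau>
    unfolding T_def[abs_def] by measurable
  have main: "(\<integral>\<^sup>+x. (\<integral>\<^sup>+\<tau>. ennreal (levy s \<tau>) * ennreal (T a x0 \<tau> x) \<partial>lborel) \<partial>lborel) < \<infinity> \<and>
    (\<forall>x. (\<integral>\<^sup>+\<tau>. ennreal (levy s \<tau>) * ennreal (T a x0 \<tau> x) \<partial>lborel) < \<infinity>) \<and>
    (\<integral>\<^sup>+x. ennreal \<bar>bump_laplacian s a x0 x\<bar> \<partial>lborel) \<le> ennreal (max K (K * K) * a powr (- (s / 2))) \<and>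
    (\<integral>\<^sup>+x. ennreal ((bump_laplacian s a x0 x)\<^sup>2) \<partial>lborel) \<le> ennreal (max K (K * K) * a powr (- s - ?n / 2))"
    if a: "a > 0" for a and x0 :: 'a
  proof -
    define I where "I x = (\<integral>\<^sup>+\<tau>. ennreal (levy s \<tau>) * ennreal (T a x0 \<tau> x) \<partial>lborel)" for x
    have [measurable]: "I \<in> borel_measurable borel" unfolding I_def by measurable
    define M where "M = C2 * a powr (- ?n / 2)"
    have M: "M \<ge> 0" using C2(1) by (simp add: M_def)
    have aa: "a powr (1 - s / 2) = a * a powr (- (s / 2))" using powr_add[of a 1 "- (s / 2)"] a by simp
    have Ix: "I x \<le> ennreal (C1 * (M / a * a powr (1 - s / 2) + M * a powr (- (s / 2))))" for x
      unfolding I_def using C2'[rule_format, OF a] M a by (intro C1(2)[rule_format]) (auto intro!: ennreal_leI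
          simp: M_def)
    have Ix': "I x \<le> ennreal (K * ?c * a powr (- (s / 2) - ?n / 2))" for x
    proof -
      have "C1 * (M / a * a powr (1 - s / 2) + M * a powr (- (s / 2))) = 2 * C1 * C2 * (a powr (- ?n / 2) * a
          powr (- (s / 2)))"
        unfolding aa using a by (simp add: M_def field_simps)
      also have "\<dots> = K * ?c * a powr (- (s / 2) - ?n / 2)"
        unfolding powr_add[symmetric] using c by (simp add: K_def algebra_simps)
      finally show ?thesis using Ix[of x] by simp
    qed
    have II: "(\<integral>\<^sup>+x. I x \<partial>lborel) \<le> ennreal (K * ?c * a powr (- (s / 2)))"
    proof -
      have "(\<integral>\<^sup>+x. I x \<partial>lborel) = (\<integral>\<^sup>+\<tau>. (\<integral>\<^sup>+x. ennreal (levy s \<tau>) * ennreal (T a x0 \<tau> x) \<partial>lborel) \<partial>lborel)"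
        unfolding I_def by (rule lborel_pair.Fubini') measurable
      also have "\<dots> = (\<integral>\<^sup>+\<tau>. ennreal (levy s \<tau>) * (\<integral>\<^sup>+x. ennreal (T a x0 \<tau> x) \<partial>lborel) \<partial>lborel)"
          by (simp add: nn_integral_cmult)
      also have "\<dots> \<le> ennreal (C1 * (C2 / a * a powr (1 - s / 2) + C2 * a powr (- (s / 2))))"
        using C2'[rule_format, OF a] C2(1) a by (intro C1(2)[rule_format]) auto
      also have "C1 * (C2 / a * a powr (1 - s / 2) + C2 * a powr (- (s / 2))) = K * ?c * a powr (- (s / 2))"
        unfolding aa using a c by (simp add: K_def field_simps)
      finally show ?thesis .
    qed
    have bI: "ennreal \<bar>bump_laplacian s a x0 x\<bar> \<le> ennreal (1 / ?c) * I x" for x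
    proof -
      have "ennreal (norm (\<integral>\<tau>. levy s \<tau> * (heat a (x - x0) - heat (a + \<tau>) (x - x0)) \<partial>lborel)) \<le> I x"
      \<comment> \<open>Without convergence the Bochner integral is 0 by convention and the bound is
        trivial.\<close>
      proof (cases "integrable lborel (\<lambda>\<tau>. levy s \<tau> * (heat a (x - x0) - heat (a + \<tau>) (x - x0)))")
        case True
        have "ennreal (norm (\<integral>\<tau>. levy s \<tau> * (heat a (x - x0) - heat (a + \<tau>) (x - x0)) \<partial>lborel))
            \<le> (\<integral>\<^sup>+\<tau>. ennreal (norm (levy s \<tau> * (heat a (x - x0) - heat (a + \<tau>) (x - x0)))) \<partial>lborel)"
          by (rule integral_norm_bound_ennreal[OF True])
        also have "\<dots> = I x" unfolding I_def T_def by (intro nn_integral_cong) (simp add: abs_mult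
            ennreal_mult)
        finally show ?thesis .
      qed (simp add: not_integrable_integral_eq)
      then have "ennreal (1 / ?c) * ennreal (norm (\<integral>\<tau>. levy s \<tau> * (heat a (x - x0) - heat (a
          + \<tau>) (x - x0)) \<partial>lborel)) \<le> ennreal (1 / ?c) * I x"
        by (rule mult_left_mono) simp
      then show ?thesis using c by (simp add: bump_laplacian_def ennreal_mult[symmetric])
    qed
    have L1: "(\<integral>\<^sup>+x. ennreal \<bar>bump_laplacian s a x0 x\<bar> \<partial>lborel) \<le> ennreal (K * a powr (- (s / 2)))"
    proof -
      have "(\<integral>\<^sup>+x. ennreal \<bar>bump_laplacian s a x0 x\<bar> \<partial>lborel) \<le> (\<integral>\<^sup>+x. ennreal (1 / ?c) * I x \<partial>lborel)"
          by (intro nn_integral_mono bI)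
      also have "\<dots> \<le> ennreal (1 / ?c) * ennreal (K * ?c * a powr (- (s / 2)))" using II
          by (simp add: nn_integral_cmult mult_left_mono)
      also have "\<dots> = ennreal (K * a powr (- (s / 2)))" using c K by (simp add: ennreal_mult[symmetric])
      finally show ?thesis .
    qed
    have sup: "\<bar>bump_laplacian s a x0 x\<bar> \<le> K * a powr (- (s / 2) - ?n / 2)" for x
    proof -
      have "ennreal \<bar>bump_laplacian s a x0 x\<bar> \<le> ennreal (1 / ?c) * ennreal (K * ?c * a powr (- (s / 2) - ?n /
          2))"
        using bI[of x] Ix'[of x] by (meson mult_left_mono order_trans zero_le)
      also have "\<dots> = ennreal (K * a powr (- (s / 2) - ?n / 2))" using c K
          by (simp add: ennreal_mult[symmetric])
      finally show ?thesis using K by simp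
    qed
    have L2: "(\<integral>\<^sup>+x. ennreal ((bump_laplacian s a x0 x)\<^sup>2) \<partial>lborel) \<le> ennreal (K * K * a powr (- s - ?n / 2))"
    proof -
      have "(\<integral>\<^sup>+x. ennreal ((bump_laplacian s a x0 x)\<^sup>2) \<partial>lborel) \<le> (\<integral>\<^sup>+x. ennreal (K * a powr (- (s / 2) - ?n
          / 2)) * ennreal \<bar>bump_laplacian s a x0 x\<bar> \<partial>lborel)"
      proof (rule nn_integral_mono)
        fix x
        have "(bump_laplacian s a x0 x)\<^sup>2 = \<bar>bump_laplacian s a x0 x\<bar> * \<bar>bump_laplacian s a x0 x\<bar>"
            by (simp add: power2_eq_square)
        also have "\<dots> \<le> (K * a powr (- (s / 2) - ?n / 2)) * \<bar>bump_laplacian s a x0 x\<bar>" using sup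
            by (rule mult_right_mono) simp
        finally show "ennreal ((bump_laplacian s a x0 x)\<^sup>2) \<le> ennreal (K * a powr (- (s / 2) - ?n / 2)) *
            ennreal \<bar>bump_laplacian s a x0 x\<bar>"
          using K by (simp add: ennreal_mult[symmetric] ennreal_leI)
      qed
      also have "\<dots> \<le> ennreal (K * a powr (- (s / 2) - ?n / 2)) * ennreal (K * a powr (- (s / 2)))"
        using L1 by (simp add: nn_integral_cmult mult_left_mono)
      also have "\<dots> = ennreal (K * K * (a powr (- (s / 2) - ?n / 2) * a powr (- (s / 2))))" using K
          by (simp add: ennreal_mult[symmetric] mult_ac)
      also have "a powr (- (s / 2) - ?n / 2) * a powr (- (s / 2)) = a powr (- s - ?n / 2)"
          unfolding powr_add[symmetric] by simp
      finally show ?thesis .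
    qed
    have "(\<integral>\<^sup>+x. I x \<partial>lborel) < \<infinity>" using II by (rule le_less_trans) simp
    moreover have "I x < \<infinity>" for x using Ix[of x] by (rule le_less_trans) simp
    moreover have "ennreal (K * a powr (- (s / 2))) \<le> ennreal (max K (K * K) * a powr (- (s / 2)))"
      "ennreal (K * K * a powr (- s - ?n / 2)) \<le> ennreal (max K (K * K) * a powr (- s - ?n / 2))"
      by (intro ennreal_leI mult_right_mono; simp)+
    ultimately show ?thesis using order_trans[OF L1] order_trans[OF L2] unfolding I_def by blast
  qed
  show ?thesis
    using main K unfolding T_def by (intro exI[of _ "max K (K * K)"] conjI allI impI) (auto simp:
        less_max_iff_disj)
qed

lemma integrable_heat:
  assumes "a > 0" shows "integrable lborel (\<lambda>x. heat a (x - x0 :: 'a::euclidean_space))"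
  using assms by (intro integrableI_nonneg) (auto simp: nn_integral_heat)

text \<open>The transform of \<open>heat a\<close> minus \<open>heat (a + \<tau>)\<close> is that of
  \<open>heat a\<close> times 1 - exp(-\<tau>|\<xi>|^2), up to the modulation by \<open>x0\<close>,
  which is common to both. Integrating against the Levy weight produces |\<xi>|^s. Both functions
  are integrable, so classical transforms may be used.\<close>

lemma bump_has_frac_laplacian:
  fixes x0 :: "real^'n"
  assumes s: "0 < s" "s < 2" and a: "a > 0"
  shows "has_frac_laplacian s (\<lambda>x. heat a (x - x0)) (bump_laplacian s a x0)"
proof -
  let ?u = "\<lambda>x. heat a (x - x0)" and ?g = "bump_laplacian s a x0"
  obtain C where "(\<integral>\<^sup>+x. (\<integral>\<^sup>+\<tau>. ennreal (levy s \<tau>) * ennreal \<bar>heat a (x - x0) - heat (a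
      + \<tau>) (x - x0)\<bar> \<partial>lborel) \<partial>lborel) < \<infinity> \<and>
    (\<integral>\<^sup>+x. ennreal \<bar>bump_laplacian s a x0 x\<bar> \<partial>lborel) \<le> ennreal (C * a powr (- (s / 2)))"
    using bump_laplacian_bounds[OF s, where 'a = "real^'n"] a by blast
  then have fin: "(\<integral>\<^sup>+x. (\<integral>\<^sup>+\<tau>. ennreal (levy s \<tau>) * ennreal \<bar>heat a (x - x0) - heat (a
      + \<tau>) (x - x0)\<bar> \<partial>lborel) \<partial>lborel) < \<infinity>"
    and fin1: "(\<integral>\<^sup>+x. ennreal (norm (?g x)) \<partial>lborel) < \<infinity>"
    by (auto intro: le_less_trans)
  have gi: "integrable lborel ?g" using fin1 by (intro integrableI_bounded) auto
  have cis_m [measurable]: "cis \<in> borel_measurable borel" unfolding cis_conv_exp[abs_def] by measurable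
  have four: "fourier \<phi> \<xi> = of_real ((2 * pi) powr (- (real CARD('n) / 2))) * (\<integral>x. cis (- (x \<bullet> \<xi>)) * \<phi> x
      \<partial>lborel)"
    if [measurable]: "\<phi> \<in> borel_measurable borel" for \<phi> :: "real^'n \<Rightarrow> complex" and \<xi>
    unfolding fourier_def by (intro arg_cong2[where f = "(*)"] refl integral_completion) measurable
  have fg: "fourier (\<lambda>x. complex_of_real (?g x)) = (\<lambda>\<xi>. of_real (norm \<xi> powr s) * fourier (\<lambda>x. complex_of_real
      (?u x)) \<xi>)"
  proof
    fix \<xi> :: "real^'n"
    let ?c = "complex_of_real (1 / levy_const s)" and ?A = "(norm \<xi>)\<^sup>2"
    define F where "F x \<tau> = cis (- (x \<bullet> \<xi>)) * of_real (levy s \<tau> * (heat a (x - x0) - heat (a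
        + \<tau>) (x - x0)))" for x \<tau>
    have [measurable]: "case_prod F \<in> borel_measurable (lborel \<Otimes>\<^sub>M lborel)" unfolding F_def by measurable
    have Fi: "integrable (lborel \<Otimes>\<^sub>M lborel) (case_prod F)"
    proof (rule integrableI_bounded)
      have "(\<integral>\<^sup>+p. ennreal (norm (case_prod F p)) \<partial>(lborel \<Otimes>\<^sub>M lborel)) = (\<integral>\<^sup>+x. (\<integral>\<^sup>+\<tau>. ennreal (norm (F x \<tau>))
          \<partial>lborel) \<partial>lborel)"
        by (subst lborel.nn_integral_fst[symmetric]) simp_all
      also have "\<dots> = (\<integral>\<^sup>+x. (\<integral>\<^sup>+\<tau>. ennreal (levy s \<tau>) * ennreal \<bar>heat a (x - x0) - heat (a
          + \<tau>) (x - x0)\<bar> \<partial>lborel) \<partial>lborel)"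
        unfolding F_def norm_mult norm_cis norm_of_real mult_1 abs_mult
        by (intro nn_integral_cong) (simp add: ennreal_mult)
      finally show "(\<integral>\<^sup>+p. ennreal (norm (case_prod F p)) \<partial>(lborel \<Otimes>\<^sub>M lborel)) < \<infinity>" using fin by simp
    qed measurable
    have "(\<integral>x. cis (- (x \<bullet> \<xi>)) * complex_of_real (?g x) \<partial>lborel) = (\<integral>x. ?c * (\<integral>\<tau>. F x \<tau> \<partial>lborel) \<partial>lborel)"
    proof (rule Bochner_Integration.integral_cong)
      fix x
      have "(\<integral>\<tau>. F x \<tau> \<partial>lborel) = cis (- (x \<bullet> \<xi>)) * of_real (\<integral>\<tau>. levy s \<tau> * (heat a (x - x0) - heat (a
          + \<tau>) (x - x0)) \<partial>lborel)"
        unfolding F_def integral_mult_right_zero integral_complex_of_real ..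
      then show "cis (- (x \<bullet> \<xi>)) * complex_of_real (?g x) = ?c * (\<integral>\<tau>. F x \<tau> \<partial>lborel)"
        by (simp add: bump_laplacian_def)
    qed simp
    also have "\<dots> = ?c * (\<integral>\<tau>. (\<integral>x. F x \<tau> \<partial>lborel) \<partial>lborel)"
      by (simp only: integral_mult_right_zero lborel_pair.Fubini_integral[OF Fi])
    also have "(\<integral>\<tau>. (\<integral>x. F x \<tau> \<partial>lborel) \<partial>lborel) = (\<integral>\<tau>. of_real (levy s \<tau> * (1 - exp (- ?A * \<tau>))) * (of_real
        (exp (- a * ?A)) * cis (- (x0 \<bullet> \<xi>))) \<partial>lborel)"
    proof (rule Bochner_Integration.integral_cong)
      fix \<tau> :: real
      show "(\<integral>x. F x \<tau> \<partial>lborel) = of_real (levy s \<tau> * (1 - exp (- ?A * \<tau>))) * (of_real (exp (- a * ?A)) * cis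
          (- (x0 \<bullet> \<xi>)))"
      proof (cases "\<tau> \<ge> 0")
        case True
        then have at: "a + \<tau> > 0" using a by simp
        have "F x \<tau> = of_real (levy s \<tau>) * (cis (- (x \<bullet> \<xi>)) * of_real (heat a (x - x0)) - cis (- (x \<bullet> \<xi>)) *
            of_real (heat (a + \<tau>) (x - x0)))" for x
          by (simp add: F_def algebra_simps)
        then have "(\<integral>x. F x \<tau> \<partial>lborel) = of_real (levy s \<tau>) * ((\<integral>x. cis (- (x \<bullet> \<xi>)) * of_real (heat a (x -
            x0)) \<partial>lborel) - (\<integral>x. cis (- (x \<bullet> \<xi>)) * of_real (heat (a + \<tau>) (x - x0)) \<partial>lborel))"
          by (simp only: integral_mult_right_zero Bochner_Integration.integral_diff[OF integrable_cis_heat[OF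
              a] integrable_cis_heat[OF at]])
        also have "\<dots> = of_real (levy s \<tau>) * ((of_real (exp (- a * ?A)) - of_real (exp (- (a
            + \<tau>) * ?A))) * cis (- (x0 \<bullet> \<xi>)))"
          unfolding integral_cis_heat[OF a] integral_cis_heat[OF at] by (simp only: left_diff_distrib)
        also have "exp (- (a + \<tau>) * ?A) = exp (- a * ?A) * exp (- ?A * \<tau>)"
          unfolding exp_add[symmetric] by (simp add: algebra_simps)
        finally show ?thesis by (simp add: algebra_simps)
      qed (simp add: F_def levy_def)
    qed simp
    also have "\<dots> = of_real (?A powr (s / 2) * levy_const s) * (of_real (exp (- a * ?A)) * cis (- (x0 \<bullet> \<xi>)))"
      using integral_levy_exp[of s ?A] s by (simp only: integral_mult_left_zero integral_complex_of_real) simp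
    also have "?A powr (s / 2) = norm \<xi> powr s"
    proof (cases "\<xi> = 0")
      case False
      then have "?A powr (s / 2) = (norm \<xi> powr 2) powr (s / 2)" by (simp add: powr_numeral)
      then show ?thesis unfolding powr_powr by simp
    qed simp
    finally have "(\<integral>x. cis (- (x \<bullet> \<xi>)) * complex_of_real (?g x) \<partial>lborel) = of_real (norm \<xi> powr s) * (\<integral>x. cis
        (- (x \<bullet> \<xi>)) * complex_of_real (?u x) \<partial>lborel)"
      unfolding integral_cis_heat[OF a] using levy_const_pos[OF s] by simp
    then show "fourier (\<lambda>x. complex_of_real (?g x)) \<xi> = of_real (norm \<xi> powr s) * fourier (\<lambda>x. complex_of_real
        (?u x)) \<xi>"
      by (subst (1 2) four) simp_all
  qed
  show ?thesis unfolding has_frac_laplacian_def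
  proof (intro exI conjI)
    show "has_fourier (\<lambda>x. complex_of_real (?u x)) (fourier (\<lambda>x. complex_of_real (?u x)))"
      by (intro has_fourier_integrable integrable_of_real integrable_heat a) measurable
    show "has_fourier (\<lambda>x. complex_of_real (?g x)) (\<lambda>\<xi>. of_real (norm \<xi> powr s) * fourier (\<lambda>x. complex_of_real
        (?u x)) \<xi>)"
      unfolding fg[symmetric] by (intro has_fourier_integrable integrable_of_real gi) measurable
  qed
qed

section \<open>Norms of the Gaussian bump\<close>

lemma Lp_norm_2_le:
  fixes f :: "real^'n \<Rightarrow> real"
  assumes [measurable]: "f \<in> borel_measurable borel" and le: "(\<integral>\<^sup>+x. ennreal ((f x)\<^sup>2) \<partial>lborel)
      \<le> ennreal K" and K: "0 \<le> K"
  shows "(Lp_norm 2 f)\<^sup>2 \<le> K"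
proof -
  have f: "f \<in> borel_measurable lebesgue" using assms(1) by (intro measurable_completion) simp
  have e: "(\<integral>\<^sup>+x. ennreal (\<bar>f x\<bar> powr 2) \<partial>lborel) = (\<integral>\<^sup>+x. ennreal ((f x)\<^sup>2) \<partial>lborel)"
      by (simp add: powr_numeral)
  have "(\<integral>\<^sup>+x. ennreal ((f x)\<^sup>2) \<partial>lborel) < \<infinity>" using le by (rule le_less_trans) simp
  then have "ennreal (Lp_norm 2 f powr 2) \<le> ennreal K"
    using Lp_norm_powr[OF assms(1) f, of 2] le unfolding e by simp
  then show ?thesis using K by (simp add: powr_numeral Lp_norm_nonneg)
qed

text \<open>A bounded integrable function lies in L^p for every p > 1, in particular for the Sobolev
  exponent.\<close>

lemma bump_in_Ds:
  fixes x0 :: "real^'n"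
  assumes s: "0 < s" "s < 2" "2 * s < real CARD('n)" and a: "a > 0"
  shows "(\<lambda>x. heat a (x - x0)) \<in> Ds s"
proof -
  let ?u = "\<lambda>x. heat a (x - x0)"
  let ?p = "2 * real CARD('n) / (real CARD('n) - 2 * s)"
  have p: "?p > 1" using s by (simp add: field_simps)
  define M where "M = (4 * pi) powr (- real CARD('n) / 2) * a powr (- real CARD('n) / 2)"
  have M: "0 \<le> M" by (simp add: M_def)
  have le: "?u x \<le> M" for x using heat_le_time[OF a, of "x - x0"] by (simp add: M_def)
  have pw: "\<bar>?u x\<bar> powr ?p \<le> M powr (?p - 1) * ?u x" for x
  proof -
    have "\<bar>?u x\<bar> powr ?p = ?u x powr (?p - 1) * ?u x powr 1"
      unfolding powr_add[symmetric] by simp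
    also have "\<dots> \<le> M powr (?p - 1) * ?u x"
      using p le[of x] by (simp add: mult_right_mono powr_mono2 powr_one)
    finally show ?thesis .
  qed
  have "integrable lborel (\<lambda>x. \<bar>?u x\<bar> powr ?p)"
  proof (rule Bochner_Integration.integrable_bound[OF integrable_mult_right[OF integrable_heat[OF a, of x0],
      of "M powr (?p - 1)"]])
    show "AE x in lborel. norm (\<bar>?u x\<bar> powr ?p) \<le> norm (M powr (?p - 1) * ?u x)"
      using pw by (intro AE_I2) (simp add: abs_mult)
  qed measurable
  then have i: "integrable lebesgue (\<lambda>x. \<bar>?u x\<bar> powr ?p)" by (subst integrable_completion) auto
  have um: "?u \<in> borel_measurable lebesgue" by (intro measurable_completion) simp
  have gm: "bump_laplacian s a x0 \<in> borel_measurable lebesgue" by (intro measurable_completion) simp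
  obtain C where C: "(\<integral>\<^sup>+x. ennreal ((bump_laplacian s a x0 x)\<^sup>2) \<partial>lborel)
      \<le> ennreal (C * a powr (- s - real DIM(real^'n) / 2))"
    using bump_laplacian_bounds[OF s(1,2), where 'a = "real^'n"] a by blast
  have "integrable lborel (\<lambda>x. \<bar>bump_laplacian s a x0 x\<bar> powr 2)"
    using C by (intro integrableI_bounded) (auto simp: powr_numeral intro: le_less_trans)
  then have "integrable lebesgue (\<lambda>x. \<bar>bump_laplacian s a x0 x\<bar> powr 2)" by (subst integrable_completion) auto
  then have "bump_laplacian s a x0 \<in> Lp 2" using gm by (simp add: Lp_def)
  then show ?thesis unfolding Ds_def Lp_def using i um bump_has_frac_laplacian[OF s(1,2) a, of x0] by auto
qed

text \<open>The bound is uniform in the width: for |x| < 1/2 the centre is at distance at least 1/2,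
  so the kernel is bounded independently of a while the weight is integrable; elsewhere the weight
  is bounded and the kernel has mass one.\<close>

lemma nn_integral_weight_heat:
  assumes s: "0 \<le> s" "2 * s < real DIM('a::euclidean_space)"
  shows "\<exists>C>0. \<forall>a>0. \<forall>x0::'a. norm x0 = 1 \<longrightarrow> (\<integral>\<^sup>+x. ennreal (norm x powr (- 2 * s) * heat a (x - x0)) \<partial>lborel)
      \<le> ennreal C"
proof -
  let ?n = "real DIM('a)"
  obtain C where C: "C > 0" "\<And>r. r > 0 \<Longrightarrow> (\<integral>\<^sup>+x. ennreal (norm (x::'a) powr (- (2 * s)) * indicator {..<r}
      (norm x)) \<partial>lborel) \<le> ennreal (C * r powr (?n - 2 * s))"
    using nn_integral_norm_powr_ball[where 'a = 'a, of "2 * s"] s by auto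
  define K where "K = pi powr (- ?n / 2) * (?n / 2) powr (?n / 2) * (1/2) powr (- ?n)"
  have K: "K > 0" by (simp add: K_def)
  show ?thesis
  proof (intro exI conjI allI impI)
    fix a :: real and x0 :: 'a assume a: "a > 0" and x0: "norm x0 = 1"
    have "(\<integral>\<^sup>+x. ennreal (norm x powr (- 2 * s) * heat a (x - x0)) \<partial>lborel)
      \<le> (\<integral>\<^sup>+x. ennreal K * ennreal (norm x powr (- (2 * s)) * indicator {..<1/2} (norm x))
          + ennreal ((1/2) powr (- (2 * s))) * ennreal (heat a (x - x0)) \<partial>lborel)"
    proof (rule nn_integral_mono)
      fix x :: 'a
      show "ennreal (norm x powr (- 2 * s) * heat a (x - x0)) \<le> ennreal K * ennreal (norm x powr (- (2 * s)) *
          indicator {..<1/2} (norm x)) + ennreal ((1/2) powr (- (2 * s))) * ennreal (heat a (x - x0))"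
      proof (cases "norm x < 1/2")
        case True
        have "norm x0 \<le> norm x + norm (x - x0)" by norm
        then have far: "1/2 \<le> norm (x - x0)" using True x0 by simp
        then have "x - x0 \<noteq> 0" by auto
        have "heat a (x - x0) \<le> pi powr (- ?n / 2) * (?n / 2) powr (?n / 2) * norm (x - x0) powr (- ?n)"
          by (rule heat_le_space[OF a \<open>x - x0 \<noteq> 0\<close>])
        also have "\<dots> \<le> K" unfolding K_def using far by (intro mult_left_mono powr_mono2') auto
        finally have "norm x powr (- (2 * s)) * heat a (x - x0) \<le> norm x powr (- (2 * s)) * K"
            by (intro mult_left_mono) auto
        then have "ennreal (norm x powr (- 2 * s) * heat a (x - x0)) \<le> ennreal K * ennreal (norm x powr (- (2
            * s)) * indicator {..<1/2} (norm x))"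
          using True K by (simp add: ennreal_mult[symmetric] ennreal_leI mult.commute)
        then show ?thesis by (rule order_trans) simp
      next
        case False
        then have "norm x powr (- (2 * s)) \<le> (1/2) powr (- (2 * s))" using s by (intro powr_mono2') auto
        then have "norm x powr (- (2 * s)) * heat a (x - x0) \<le> (1/2) powr (- (2 * s)) * heat a (x - x0)"
            by (rule mult_right_mono) simp
        then show ?thesis using False by (simp add: ennreal_mult[symmetric] ennreal_leI)
      qed
    qed
    also have "\<dots> = ennreal K * (\<integral>\<^sup>+x. ennreal (norm x powr (- (2 * s)) * indicator {..<1/2} (norm (x::'a)))
        \<partial>lborel) + ennreal ((1/2) powr (- (2 * s)))"
      using a by (simp add: nn_integral_add nn_integral_cmult nn_integral_heat)
    also have "\<dots> \<le> ennreal K * ennreal (C * (1/2) powr (?n - 2 * s)) + ennreal ((1/2) powr (- (2 * s)))"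
      using C(2)[of "1/2"] by (intro add_mono mult_left_mono) auto
    also have "\<dots> = ennreal (K * (C * (1/2) powr (?n - 2 * s)) + (1/2) powr (- (2 * s)))"
      using K C(1) by (simp add: ennreal_mult ennreal_plus)
    finally show "(\<integral>\<^sup>+x. ennreal (norm x powr (- 2 * s) * heat a (x - x0)) \<partial>lborel)
        \<le> ennreal (K * (C * (1/2) powr (?n - 2 * s)) + (1/2) powr (- (2 * s)))" .
  qed (use K C(1) in \<open>simp add: add_pos_pos\<close>)
qed

text \<open>Both signs of the exponent are covered, because the estimate that uses it fixes no sign
  for \<open>b\<close>.\<close>

lemma powr_ge_two_powr:
  assumes "1/2 \<le> (x::real)" "x \<le> 2"
  shows "2 powr (- \<bar>p\<bar>) \<le> x powr p"
proof (cases "p \<ge> 0")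
  case True
  have "2 powr (- \<bar>p\<bar>) = (1/2) powr p" using True by (simp add: powr_minus powr_divide field_simps)
  also have "\<dots> \<le> x powr p" using assms True by (intro powr_mono2) auto
  finally show ?thesis .
next
  case False
  then have "2 powr (- \<bar>p\<bar>) = 2 powr p" by simp
  also have "\<dots> \<le> x powr p" using assms False by (intro powr_mono2') auto
  finally show ?thesis .
qed

text \<open>On the ball of radius sqrt a about \<open>x0\<close> the Gaussian is comparable to its
  maximum, of order a^(-n/2). The condition a <= 1/4 keeps this ball away from the origin, so the
  weight is of order one there, and the volume contributes a^(n/2).\<close>

lemma nn_integral_weight_heat_ge:
  assumes q: "q > 0"
  shows "\<exists>c>0. \<forall>a>0. \<forall>x0::'a::euclidean_space. a \<le> 1/4 \<longrightarrow> norm x0 = 1 \<longrightarrow>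
    ennreal (c * a powr (- real DIM('a) * q / 2 + real DIM('a) / 2)) \<le> (\<integral>\<^sup>+x. ennreal (\<bar>norm x powr (- b) *
        heat a (x - x0)\<bar> powr q) \<partial>lborel)"
proof -
  let ?n = "real DIM('a)" and ?V = "unit_ball_vol (real DIM('a))"
  define k where "k = 2 powr (- \<bar>- b * q\<bar>) * ((4 * pi) powr (- ?n / 2) * exp (- (1/4))) powr q"
  have k: "k > 0" by (simp add: k_def)
  show ?thesis
  proof (intro exI conjI allI impI)
    show "k * ?V > 0" using k by simp
    fix a :: real and x0 :: 'a assume a: "a > 0" "a \<le> 1/4" and x0: "norm x0 = 1"
    have sq: "sqrt a \<le> 1/2" using a by (intro real_le_lsqrt) (auto simp: power2_eq_square)
    have pt: "k * a powr (- ?n * q / 2) \<le> \<bar>norm x powr (- b) * heat a (x - x0)\<bar> powr q" if x: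
        "x \<in> ball x0 (sqrt a)" for x
    proof -
      have d: "norm (x - x0) < sqrt a" using x by (simp add: dist_norm norm_minus_commute)
      have "norm x0 \<le> norm x + norm (x - x0)" "norm x \<le> norm x0 + norm (x - x0)" by norm+
      then have nx: "1/2 \<le> norm x" "norm x \<le> 2" using d sq x0 by auto
      have "(norm (x - x0))\<^sup>2 \<le> (sqrt a)\<^sup>2" using d by (intro power_mono) auto
      then have "exp (- (1/4)) \<le> exp (- (norm (x - x0))\<^sup>2 / (4 * a))" using a by (simp add: field_simps)
      note ex = this
      have "(4 * pi) powr (- ?n / 2) * exp (- (1/4)) * a powr (- ?n / 2) \<le> heat a (x - x0)"
      proof -
        from ex have "((4 * pi) powr (- ?n / 2) * a powr (- ?n / 2)) * exp (- (1/4))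
            \<le> ((4 * pi) powr (- ?n / 2) * a powr (- ?n / 2)) * exp (- (norm (x - x0))\<^sup>2 / (4 * a))"
          by (rule mult_left_mono) simp
        also have "\<dots> = heat a (x - x0)" by (simp add: heat_def powr_mult)
        finally show ?thesis by (simp only: mult_ac)
      qed
      then have "((4 * pi) powr (- ?n / 2) * exp (- (1/4)) * a powr (- ?n / 2)) powr q
          \<le> heat a (x - x0) powr q"
        using q by (intro powr_mono2) auto
      moreover have "2 powr (- \<bar>- b * q\<bar>) \<le> norm x powr (- b * q)" by (rule powr_ge_two_powr[OF nx])
      ultimately have "2 powr (- \<bar>- b * q\<bar>) * ((4 * pi) powr (- ?n / 2) * exp (- (1/4)) * a powr (- ?n / 2))
          powr q \<le> norm x powr (- b * q) * heat a (x - x0) powr q"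
        by (intro mult_mono) auto
      moreover have "2 powr (- \<bar>- b * q\<bar>) * ((4 * pi) powr (- ?n / 2) * exp (- (1/4)) * a powr (- ?n / 2))
          powr q = k * a powr (- ?n * q / 2)"
        unfolding powr_mult[of _ "a powr (- ?n / 2)"] powr_powr k_def by simp
      moreover have "\<bar>norm x powr (- b) * heat a (x - x0)\<bar> powr q = norm x powr (- b * q) * heat a (x - x0)
          powr q"
        unfolding abs_mult powr_mult by (simp add: powr_powr)
      ultimately show ?thesis by simp
    qed
    have "ennreal (k * ?V * a powr (- ?n * q / 2 + ?n / 2)) = ennreal (k * a powr (- ?n * q / 2)) * emeasure
        lborel (ball x0 (sqrt a))"
    proof -
      have "sqrt a ^ DIM('a) = a powr (?n / 2)"
      proof -
        have "sqrt a ^ DIM('a) = (a powr (1/2)) powr ?n" using a by (subst powr_realpow) (auto simp: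
            powr_half_sqrt)
        then show ?thesis unfolding powr_powr by simp
      qed
      then have "emeasure lborel (ball x0 (sqrt a)) = ennreal (?V * a powr (?n / 2))" using a
          by (simp add: emeasure_ball)
      then have "ennreal (k * a powr (- ?n * q / 2)) * emeasure lborel (ball x0 (sqrt a))
          = ennreal (k * a powr (- ?n * q / 2) * (?V * a powr (?n / 2)))"
        using k by (simp add: ennreal_mult)
      also have "k * a powr (- ?n * q / 2) * (?V * a powr (?n / 2)) = k * ?V * a powr (- ?n * q / 2 + ?n / 2)"
        unfolding powr_add by simp
      finally show ?thesis by simp
    qed
    also have "\<dots> = (\<integral>\<^sup>+x. ennreal (k * a powr (- ?n * q / 2)) * indicator (ball x0 (sqrt a)) x \<partial>lborel)"
      by (rule nn_integral_cmult_indicator[symmetric]) simp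
    also have "\<dots> \<le> (\<integral>\<^sup>+x. ennreal (\<bar>norm x powr (- b) * heat a (x - x0)\<bar> powr q) \<partial>lborel)"
      using pt by (intro nn_integral_mono) (auto simp: indicator_def intro: ennreal_leI)
    finally show "ennreal (k * ?V * a powr (- ?n * q / 2 + ?n / 2)) \<le> (\<integral>\<^sup>+x. ennreal (\<bar>norm x powr (- b) *
        heat a (x - x0)\<bar> powr q) \<partial>lborel)" .
  qed
qed

text \<open>For a = lam^(-1/s) one has a^(-s) = lam, so both terms of the numerator are of order
  a^(-s-n/2), against a^(-n+n/q) for the denominator.\<close>

lemma J_bump_upper_bound:
  assumes n: "CARD('n::finite) \<ge> 2" and s: "0 < s" "s < 1" and q: "2 < q"
  shows "\<exists>C>0. \<forall>lam\<ge>4. \<exists>u :: real^'n \<Rightarrow> real. u \<in> Ds s \<and> nonzero_ae u \<and>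
    J s b q lam u \<le> C * lam powr (1 - real CARD('n) / s * (1 / 2 - 1 / q))"
proof -
  let ?n = "real CARD('n)"
  have n2: "2 * s < ?n" using n s by auto
  obtain A where A: "A > 0" "\<And>a (x0::real^'n). a > 0 \<Longrightarrow> (\<integral>\<^sup>+x. ennreal ((bump_laplacian s a x0 x)\<^sup>2) \<partial>lborel)
      \<le> ennreal (A * a powr (- s - ?n / 2))"
    using bump_laplacian_bounds[where 'a = "real^'n", of s] s by auto
  obtain B where B: "B > 0" "\<And>a (x0::real^'n). a > 0 \<Longrightarrow> norm x0 = 1 \<Longrightarrow> (\<integral>\<^sup>+x. ennreal (norm x powr (- 2 * s) *
      heat a (x - x0)) \<partial>lborel) \<le> ennreal B"
    using nn_integral_weight_heat[where 'a = "real^'n", of s] s n2 by auto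
  obtain k where k: "k > 0" "\<And>a (x0::real^'n). a > 0 \<Longrightarrow> a \<le> 1/4 \<Longrightarrow> norm x0 = 1 \<Longrightarrow>
    ennreal (k * a powr (- ?n * q / 2 + ?n / 2)) \<le> (\<integral>\<^sup>+x. ennreal (\<bar>norm x powr (- b) * heat a (x - x0)\<bar> powr
        q) \<partial>lborel)"
    using nn_integral_weight_heat_ge[where 'a = "real^'n", of q b] q by auto
  define C where "C = (A + B) / k powr (2 / q)"
  have C: "C > 0" using A B k by (simp add: C_def)
  have "\<exists>u :: real^'n \<Rightarrow> real. u \<in> Ds s \<and> nonzero_ae u \<and> J s b q lam u \<le> C * lam powr (1 - ?n / s * (1 / 2 - 1
      / q))"
    if lam: "lam \<ge> 4" for lam
  proof -
    define x0 :: "real^'n" where "x0 = axis undefined 1"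
    have x0: "norm x0 = 1" by (simp add: x0_def)
    define a where "a = lam powr (- (1 / s))"
    have a0: "a > 0" using lam by (simp add: a_def)
    have as: "a powr (- s) = lam" unfolding a_def powr_powr using s lam by simp
    \<comment> \<open>This is where lam >= 4 comes from: with 1/s >= 1 it places the width in the
      range of the lower bound for the denominator.\<close>
    have a1: "a \<le> 1/4"
    proof -
      have "1 \<le> 1 / s" using s by simp
      then have "a \<le> lam powr (- 1)" unfolding a_def using lam by (intro powr_mono) auto
      also have "\<dots> \<le> 4 powr (- 1)" using lam by (intro powr_mono2') auto
      finally show ?thesis by (simp add: powr_minus)
    qed
    let ?u = "\<lambda>x. heat a (x - x0)"
    have u: "?u \<in> Ds s" using s n2 a0 by (intro bump_in_Ds) auto
    have nz: "nonzero_ae ?u" unfolding nonzero_ae_def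
    proof
      assume "AE x in lebesgue. ?u x = 0"
      then have "AE x in lborel. ?u x = 0" by (simp add: AE_completion_iff)
      then have "(\<integral>\<^sup>+x. ennreal (?u x) \<partial>lborel) = 0" by (subst nn_integral_0_iff_AE) auto
      then show False using a0 by (simp add: nn_integral_heat)
    qed
    have lap: "(Lp_norm 2 (frac_laplacian s ?u))\<^sup>2 \<le> A * a powr (- s - ?n / 2)"
    proof -
      obtain g where g: "AE x in lborel. frac_laplacian s ?u x = g x" "has_frac_laplacian s ?u (frac_laplacian
          s ?u)"
        "(\<integral>\<^sup>+x. ennreal ((g x)\<^sup>2) \<partial>lborel) = ennreal ((Lp_norm 2 (frac_laplacian s ?u))\<^sup>2)"
        using frac_laplacian_L2[OF u] by blast
      have "AE x in lborel. frac_laplacian s ?u x = bump_laplacian s a x0 x"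
        using s a0 by (intro has_frac_laplacian_unique[OF g(2)] bump_has_frac_laplacian) auto
      with g(1) have "AE x in lborel. ennreal ((g x)\<^sup>2) = ennreal ((bump_laplacian s a x0 x)\<^sup>2)"
          by eventually_elim simp
      then have "(\<integral>\<^sup>+x. ennreal ((g x)\<^sup>2) \<partial>lborel) = (\<integral>\<^sup>+x. ennreal ((bump_laplacian s a x0 x)\<^sup>2) \<partial>lborel)"
          by (rule nn_integral_cong_AE)
      then have "ennreal ((Lp_norm 2 (frac_laplacian s ?u))\<^sup>2) \<le> ennreal (A * a powr (- s - ?n / 2))"
        using g(3) A(2)[OF a0, of x0] by simp
      then show ?thesis using A(1) by (subst (asm) ennreal_le_iff) auto
    qed
    have hardy: "(Lp_norm 2 (\<lambda>x. norm x powr (- s) * ?u x))\<^sup>2 \<le> B * a powr (- ?n / 2)"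
    proof (rule Lp_norm_2_le)
      have "(\<integral>\<^sup>+x. ennreal ((norm x powr (- s) * ?u x)\<^sup>2) \<partial>lborel) \<le> (\<integral>\<^sup>+x. ennreal (a powr (- ?n / 2)) *
          ennreal (norm x powr (- 2 * s) * ?u x) \<partial>lborel)"
      proof (rule nn_integral_mono)
        fix x
        have "(4 * pi) powr (- ?n / 2) \<le> (4 * pi) powr 0" using pi_gt3 by (intro powr_mono) auto
        then have "(4 * pi) powr (- ?n / 2) * a powr (- ?n / 2) \<le> 1 * a powr (- ?n / 2)"
            by (intro mult_right_mono) auto
        then have h: "?u x \<le> a powr (- ?n / 2)" using heat_le_time[OF a0, of "x - x0"] by simp
        have "(norm x powr (- s) * ?u x)\<^sup>2 = norm x powr (- 2 * s) * ?u x * ?u x"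
          unfolding power_mult_distrib powr_square by (simp add: power2_eq_square)
        also have "\<dots> \<le> norm x powr (- 2 * s) * ?u x * a powr (- ?n / 2)" using h by (rule mult_left_mono) simp
        finally show "ennreal ((norm x powr (- s) * ?u x)\<^sup>2) \<le> ennreal (a powr (- ?n / 2)) * ennreal (norm x
            powr (- 2 * s) * ?u x)"
          by (simp add: ennreal_mult[symmetric] ennreal_leI mult.commute)
      qed
      also have "\<dots> \<le> ennreal (a powr (- ?n / 2)) * ennreal B"
        using B(2)[OF a0 x0] by (simp add: nn_integral_cmult mult_left_mono)
      also have "\<dots> = ennreal (B * a powr (- ?n / 2))" using B(1) by (simp add: ennreal_mult[symmetric]
          mult.commute)
      finally show "(\<integral>\<^sup>+x. ennreal ((norm x powr (- s) * ?u x)\<^sup>2) \<partial>lborel) \<le> ennreal (B * a powr (- ?n / 2))"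
          .
    qed (use B in auto)
    define L where "L = Lp_norm q (\<lambda>x. norm x powr (- b) * ?u x)"
    define D where "D = (Lp_norm 2 (frac_laplacian s ?u))\<^sup>2 + lam * (Lp_norm 2 (\<lambda>x. norm x powr (- s) * ?u
        x))\<^sup>2"
    have D: "D \<le> (A + B) * a powr (- s - ?n / 2)"
    proof -
      have "D \<le> A * a powr (- s - ?n / 2) + lam * (B * a powr (- ?n / 2))"
        unfolding D_def using lap hardy lam by (intro add_mono mult_left_mono) auto
      also have "lam * (B * a powr (- ?n / 2)) = B * (a powr (- s) * a powr (- ?n / 2))" unfolding as by simp
      also have "a powr (- s) * a powr (- ?n / 2) = a powr (- s - ?n / 2)" unfolding powr_add[symmetric]
          by simp
      finally show ?thesis by (simp add: distrib_right)
    qed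
    have JL: "J s b q lam ?u = D / L\<^sup>2" by (simp add: J_def D_def L_def)
    have "J s b q lam ?u \<le> C * lam powr (1 - ?n / s * (1 / 2 - 1 / q))"
    proof (cases "(\<integral>\<^sup>+x. ennreal (\<bar>norm x powr (- b) * ?u x\<bar> powr q) \<partial>lborel) < \<infinity>")
      case True
      have fm: "(\<lambda>x. norm x powr (- b) * ?u x) \<in> borel_measurable borel" by measurable
      then have fl: "(\<lambda>x. norm x powr (- b) * ?u x) \<in> borel_measurable lebesgue"
          by (intro measurable_completion) simp
      have "ennreal (k * a powr (- ?n * q / 2 + ?n / 2)) \<le> ennreal (L powr q)"
        using k(2)[OF a0 a1 x0] Lp_norm_powr[OF fm fl _ _ True] q by (simp add: L_def)
      then have "k * a powr (- ?n * q / 2 + ?n / 2) \<le> L powr q" by (subst (asm) ennreal_le_iff) auto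
      then have "(k * a powr (- ?n * q / 2 + ?n / 2)) powr (2 / q) \<le> (L powr q) powr (2 / q)"
        using q k by (intro powr_mono2) auto
      moreover have "(L powr q) powr (2 / q) = L\<^sup>2"
        unfolding powr_powr using q by (simp add: powr_numeral L_def Lp_norm_nonneg)
      moreover have "(- ?n * q / 2 + ?n / 2) * (2 / q) = - ?n + ?n / q" using q by (simp add: field_simps)
      ultimately have L2: "k powr (2 / q) * a powr (- ?n + ?n / q) \<le> L\<^sup>2" unfolding powr_mult powr_powr
          by simp
      have "D / L\<^sup>2 \<le> (A + B) * a powr (- s - ?n / 2) / (k powr (2 / q) * a powr (- ?n + ?n / q))"
        using D L2 A B k a0 by (intro frac_le) auto
      also have "\<dots> = C * (a powr (- s - ?n / 2) / a powr (- ?n + ?n / q))" by (simp add: C_def)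
      also have "a powr (- s - ?n / 2) / a powr (- ?n + ?n / q) = lam powr (1 - ?n / s * (1 / 2 - 1 / q))"
        unfolding powr_diff[symmetric] a_def powr_powr using s q by (intro arg_cong[where f =
            "\<lambda>t. lam powr t"]) (simp add: field_simps)
      finally show ?thesis by (simp add: JL)
    next
      \<comment> \<open>If the q-integral diverges, \<open>L\<close> is 0 by the convention for the
        Bochner integral and the quotient is 0 by that for division, so the upper bound holds
        trivially.\<close>
      case False
      have "\<not> integrable lborel (\<lambda>x. \<bar>norm x powr (- b) * ?u x\<bar> powr q)"
        using False by (simp add: integrable_iff_bounded)
      then have "L = 0"
        unfolding L_def Lp_norm_def
        by (subst integral_completion) (auto simp: not_integrable_integral_eq)
      then show ?thesis using C by (simp add: JL)
    qed
    then show ?thesis using u nz by blast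
  qed
  then show ?thesis using C by blast
qed

section \<open>Comparison of the two powers of lam\<close>

lemma J_nonneg: "0 \<le> lam \<Longrightarrow> 0 \<le> J s b q lam u"
  by (simp add: J_def)

text \<open>A real \<open>INF\<close> is a lower bound only for a set bounded below; nonnegativity
  of \<open>J\<close> provides this.\<close>

lemma best_const_le:
  fixes u :: "real^'n \<Rightarrow> real"
  assumes "0 \<le> lam" "u \<in> Ds s" "nonzero_ae u"
  shows "best_const TYPE('n) s b q lam \<le> J s b q lam u"
  unfolding best_const_def
proof (rule cINF_lower)
  show "bdd_below (J s b q lam ` {u :: real^'n \<Rightarrow> real. u \<in> Ds s \<and> nonzero_ae u})"
    using J_nonneg[OF assms(1)] by (intro bdd_belowI2[of _ 0]) auto
qed (use assms in auto)

text \<open>Writing the Sobolev exponent as 2 + 4s/(n-2s), the first claim is the comparison of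
  n-1-s with n-2s. The two powers of lam differ by (q-2)(1-s)/(2sq), which does not depend on n and
  is positive because 2 < q and s < 1.\<close>

lemma exponent_gap:
  assumes "0 < s" "s < 1" "2 \<le> n" "2 < q" and r: "r = weak_exponent n s" and "2 * s < n" and q:
      "q < 2 * n / (n - 2 * s)"
  shows "q < r" "1 - n / s * (1 / 2 - 1 / q) < 2 / q * ((r - q) / (r - 2))"
proof -
  define m where "m = n - 1 - s"
  have m: "m > 0" using assms by (simp add: m_def)
  have rm: "r = 2 + 4 * s / m" by (simp add: r weak_exponent_def m_def)
  have "2 * n / (n - 2 * s) = 2 + 4 * s / (n - 2 * s)" using assms by (simp add: field_simps)
  also have "\<dots> \<le> r" unfolding rm m_def using assms by (intro add_left_mono divide_left_mono) auto
  finally show "q < r" using q by simp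
  have "2 / q * ((r - q) / (r - 2)) - (1 - n / s * (1 / 2 - 1 / q)) = (q - 2) * (1 - s) / (2 * s * q)"
    unfolding rm using m assms by (simp add: field_simps) (simp add: m_def algebra_simps)
  also have "\<dots> > 0" using assms by simp
  finally show "1 - n / s * (1 / 2 - 1 / q) < 2 / q * ((r - q) / (r - 2))" by simp
qed

theorem theorem1p1:
  fixes s q b :: real
  assumes "CARD('n::finite) \<ge> 2"
    and "0 < s" and "s < 1"
    and "2 < q" and "q < 2 * real CARD('n) / (real CARD('n) - 2 * s)"
    and "real CARD('n) / q - b = real CARD('n) / 2 - s"
  shows "\<exists>lam0 > 0. \<forall>lam > lam0. \<forall>u :: real^'n \<Rightarrow> real. extremal s b q lam u \<longrightarrow> \<not> radial u"
proof -
  let ?n = "real CARD('n)"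
  define r where "r = weak_exponent ?n s"
  define E1 where "E1 = 2 / q * ((r - q) / (r - 2))"
  define E2 where "E2 = 1 - ?n / s * (1 / 2 - 1 / q)"
  have n: "2 \<le> ?n" "2 * s < ?n" using assms by auto
  note gap = exponent_gap[OF assms(2,3) n(1) assms(4) r_def n(2) assms(5)]
  have E: "E2 < E1" using gap(2) by (simp add: E1_def E2_def)
  obtain c where c: "c > 0" "\<And>lam (u :: real^'n \<Rightarrow> real). lam \<ge> 1 \<Longrightarrow> u \<in> Ds s \<Longrightarrow> nonzero_ae u \<Longrightarrow> radial u \<Longrightarrow>
      c * lam powr E1 \<le> J s b q lam u"
    using radial_J_lower_bound[OF assms(1-3,6) r_def assms(4) gap(1)] unfolding E1_def by blast
  obtain C where C: "C > 0" "\<And>lam. lam \<ge> 4 \<Longrightarrow> \<exists>u :: real^'n \<Rightarrow> real. u \<in> Ds s \<and> nonzero_ae u \<and> J s b q lam u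
      \<le> C * lam powr E2"
    using J_bump_upper_bound[OF assms(1-4), of b] unfolding E2_def by blast
  \<comment> \<open>4 is the threshold of the test-function bound; the second entry is the value at
    which lam^(E1-E2) reaches C/c.\<close>
  define lam0 where "lam0 = max 4 ((C / c) powr (1 / (E1 - E2)))"
  show ?thesis
  proof (intro exI[of _ lam0] conjI allI impI notI)
    show "0 < lam0" by (simp add: lam0_def)
    fix lam and u :: "real^'n \<Rightarrow> real"
    assume lam: "lam0 < lam" and ext: "extremal s b q lam u" and rad: "radial u"
    have lam4: "lam \<ge> 4" and big: "(C / c) powr (1 / (E1 - E2)) < lam" using lam by (auto simp: lam0_def)
    obtain w :: "real^'n \<Rightarrow> real" where w: "w \<in> Ds s" "nonzero_ae w" "J s b q lam w \<le> C * lam powr E2"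
      using C(2)[OF lam4] by blast
    have "c * lam powr E1 \<le> J s b q lam u"
      using ext rad lam4 by (intro c(2)) (auto simp: extremal_def)
    also have "\<dots> = best_const TYPE('n) s b q lam" using ext by (simp add: extremal_def)
    also have "\<dots> \<le> J s b q lam w" using lam4 w by (intro best_const_le) auto
    also have "\<dots> \<le> C * lam powr E2" by (rule w)
    finally have "lam powr E1 / lam powr E2 \<le> C / c" using c(1) lam4 by (simp add: field_simps)
    then have "lam powr (E1 - E2) \<le> C / c" by (simp add: powr_diff)
    moreover have "C / c < lam powr (E1 - E2)"
    proof -
      have "C / c = ((C / c) powr (1 / (E1 - E2))) powr (E1 - E2)"
        unfolding powr_powr using E C(1) c(1) by simp
      also have "\<dots> < lam powr (E1 - E2)" using big E by (intro powr_less_mono2) auto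
      finally show ?thesis .
    qed
    ultimately show False by simp
  qed
qed

end
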